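(* Let $0<\tau\le1$ and suppose $$1>\sigma\ge\frac{\sqrt{4+\tau^2}-2}{2-\sqrt{4-\tau^2}}.$$ Then there exists a $C^1$ convex curve $C_T$ in the half-plane $\{x\ge0\}$ of the $xz$-plane, starting orthogonally to the $z$-axis at its tip and curving upward, consisting successively of: a circular arc of radius $\sigma$ and angle $\arcsin\frac\tau2$; a line segment of length $\frac{\tau(1-\sigma)}{\sqrt{4-\tau^2}}$; a circular arc of radius $1$ and angle $\arcsin\tau-\arcsin\frac\tau2$ (the shoulder); and a straight ray attached to the other end of the shoulder (cut off at the constraining plane). Moreover, the corresponding $2{*}2$-symmetric curve $\tilde C_T$, placed so that the tip of its second component lies at the center of the shoulder of the first, is a critical curve for the $(\tau,\sigma)$-clasp problem.
   Context: Symmetry. The group $2{*}2\subset O(3)$ (order 8) is generated by $(x,y,z)\mapsto(-x,y,z)$, $(x,y,z)\mapsto(x,-y,z)$ and $(x,y,z)\mapsto(-y,x,-z)$. A curve $C$ in $\{y=0,x\ge0\}$ starting orthogonally to the $z$-axis at its tip $(0,0,z_0)$ determines the $2{*}2$-symmetric curve $\tilde C$, the union of its images: one component in the $xz$-plane and a congruent one in the $yz$-plane with tip $(0,0,-z_0)$. The vertical position of $C$ is a free parameter, here fixed by requiring that the shoulder of $C$ be centered at $(0,0,-z_0)$. Clasp problem. Fix $h$ large. The $(\tau,\sigma)$-clasp problem concerns links $L$ of two arcs, the first with one endpoint on each of the planes $\pm\sqrt{1-\tau^2}\,x+\tau z=h$, the second with one endpoint on each of the planes $\pm\sqrt{1-\tau^2}\,y-\tau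 z=h$ (faces of a large tetrahedron), tangents at endpoints free, and hooked through each other (giving a Hopf link if each component is closed up by segments in its own boundary faces); one minimizes length subject to $\mathrm{Thi}_\sigma(L)\ge1$. Thickness. For a $C^{1,1}$ link $L$ (compact embedded 1-manifold with boundary, $C^{1,1}$ in arclength) and $\sigma\ge\frac12$, $\mathrm{Thi}_\sigma(L)=\min\{2\,\mathrm{reach}(L),\ \frac1\sigma\min_L\rho\}$, where $\mathrm{reach}(L)$ is the supremal $r$ such that every point within distance less than $r$ of $L$ has a unique nearest point on $L$, and $\rho(x)=\bigl(\limsup_{y\to x}|\kappa(y)|\bigr)^{-1}$, the limsup being over points $y$ where $L$ is twice differentiable ($\kappa$ the curvature vector). Critical for the $(\tau,\sigma)$-clasp problem: $L$ satisfies the endpoint constraints, $\mathrm{Thi}_\sigma(L)=1$, and for every $\xi\in C^2(\mathbb{R}^3,\mathbb{R}^3)$ tangent at each endpoint of $L$ to its constraining plane, $\delta_\xi\mathrm{len}(L)<0$ implies $\delta_\xi\mathrm{Thi}_\sigma(L)<0$. Here $\delta_\xi\mathrm{len}(L)=\int_L\langle\xi',T\rangle ds$ and $\delta_\xi\mathrm{Thi}_\sigma(L)$ is the right derivative at $t=0$ of $\mathrm{Thi}_\sigma(\phi^t(L))$ for any $C^1$ family of $C^2$ diffeomorphisms $\phi^t$ with $\phi^0=\mathrm{Id}$ and initial velocity $\xi$. *)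

theory Defs
  imports "HOL-Analysis.Analysis"
begin

section \<open>Curves parametrized by arclength\<close>

definition C1_arclength :: "(real \<Rightarrow> real^3) \<Rightarrow> real set \<Rightarrow> (real \<Rightarrow> real^3) \<Rightarrow> bool" where
  "C1_arclength c I T \<longleftrightarrow>
     (\<forall>s\<in>I. (c has_vector_derivative T s) (at s within I) \<and> norm (T s) = 1) \<and>
     continuous_on I T"

definition C11_arclength :: "(real \<Rightarrow> real^3) \<Rightarrow> real set \<Rightarrow> (real \<Rightarrow> real^3) \<Rightarrow> bool" where
  "C11_arclength c I T \<longleftrightarrow> C1_arclength c I T \<and> (\<exists>K. K-lipschitz_on I T)"


section \<open>Thickness\<close>

text \<open>All of the following depend only on the point set \<open>L\<close>.  A chart of \<open>L\<close> at \<open>x\<close> is an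
  arclength parametrization, by an interval \<open>I\<close> containing 0, of a relatively open part of \<open>L\<close>;
  at a boundary point of \<open>L\<close> the number 0 is an end point of \<open>I\<close>.\<close>

definition C11_chart_at ::
    "(real^3) set \<Rightarrow> real^3 \<Rightarrow> (real \<Rightarrow> real^3) \<Rightarrow> real set \<Rightarrow> (real \<Rightarrow> real^3) \<Rightarrow> bool" where
  "C11_chart_at L x c I T \<longleftrightarrow>
     is_interval I \<and> 0 \<in> I \<and> I \<noteq> {0} \<and> c 0 = x \<and>
     (\<exists>g. homeomorphism I (c ` I) c g) \<and> openin (top_of_set L) (c ` I) \<and>
     C11_arclength c I T"

text \<open>Reversing a chart leaves the curvature vector unchanged, so there is at most one.\<close>

definition has_curvature_vector :: "(real^3) set \<Rightarrow> real^3 \<Rightarrow> real^3 \<Rightarrow> bool" where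
  "has_curvature_vector L x k \<longleftrightarrow>
     (\<exists>c I T. C11_chart_at L x c I T \<and> (T has_vector_derivative k) (at 0 within I))"

definition twice_diff_points :: "(real^3) set \<Rightarrow> (real^3) set" where
  "twice_diff_points L = {x \<in> L. \<exists>k. has_curvature_vector L x k}"

definition curvature_vector :: "(real^3) set \<Rightarrow> real^3 \<Rightarrow> real^3" where
  "curvature_vector L x = (THE k. has_curvature_vector L x k)"

text \<open>In \<^typ>\<open>ereal\<close>, \<open>inverse 0 = \<infinity>\<close>: straight pieces have infinite radius of curvature.\<close>

definition rho :: "(real^3) set \<Rightarrow> real^3 \<Rightarrow> ereal" where
  "rho L x = inverse (Limsup (at x within twice_diff_points L)
                             (\<lambda>y. ereal (norm (curvature_vector L y))))"

text \<open>All \<open>r \<le> 0\<close> qualify vacuously, so the supremum is over a nonempty set.\<close>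

definition reach :: "(real^3) set \<Rightarrow> ereal" where
  "reach L = Sup {ereal r | r.
     \<forall>p. infdist p L < r \<longrightarrow> (\<exists>!q. q \<in> L \<and> dist p q = infdist p L)}"

text \<open>For a \<open>C\<^sup>1\<^sup>,\<^sup>1\<close> link the function \<^const>\<open>rho\<close> is lower semicontinuous and \<open>L\<close> is compact,
  so the infimum below is the minimum of \<^const>\<open>rho\<close> on \<open>L\<close>.\<close>

definition Thi :: "real \<Rightarrow> (real^3) set \<Rightarrow> ereal" where
  "Thi \<sigma> L = min (2 * reach L) ((INF x\<in>L. rho L x) / ereal \<sigma>)"


section \<open>Variations\<close>

definition C2_with ::
    "(real^3 \<Rightarrow> real^3) \<Rightarrow> (real^3 \<Rightarrow> (real^3) \<Rightarrow>\<^sub>L (real^3)) \<Rightarrow>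
     (real^3 \<Rightarrow> (real^3) \<Rightarrow>\<^sub>L ((real^3) \<Rightarrow>\<^sub>L (real^3))) \<Rightarrow> bool" where
  "C2_with f f' f'' \<longleftrightarrow>
     (\<forall>x. (f has_derivative blinfun_apply (f' x)) (at x)) \<and>
     (\<forall>x. (f' has_derivative blinfun_apply (f'' x)) (at x)) \<and>
     continuous_on UNIV f''"

definition C2 :: "(real^3 \<Rightarrow> real^3) \<Rightarrow> bool" where
  "C2 f \<longleftrightarrow> (\<exists>f' f''. C2_with f f' f'')"

text \<open>A family of \<open>C\<^sup>2\<close> diffeomorphisms \<open>\<phi> t\<close>, \<open>\<bar>t\<bar> < \<epsilon>\<close>, that is continuously differentiable in
  \<open>t\<close> as a curve in the space of \<open>C\<^sup>2\<close> maps (with uniform convergence of the derivatives up to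
  order two on compact sets): the map and its first two spatial derivatives are differentiable in
  \<open>t\<close>, and their \<open>t\<close>-derivatives \<open>V0\<close>, \<open>V1\<close>, \<open>V2\<close> are jointly continuous in \<open>(t, x)\<close>.\<close>

definition C1_family_of_C2_diffeos ::
    "real \<Rightarrow> (real \<Rightarrow> real^3 \<Rightarrow> real^3) \<Rightarrow> (real^3 \<Rightarrow> real^3) \<Rightarrow> bool" where
  "C1_family_of_C2_diffeos \<epsilon> \<phi> \<xi> \<longleftrightarrow>
     \<epsilon> > 0 \<and>
     (\<exists>D1 D2 V0 V1 V2.
        (\<forall>t\<in>{-\<epsilon><..<\<epsilon>}. bij (\<phi> t) \<and> C2_with (\<phi> t) (D1 t) (D2 t) \<and> C2 (inv (\<phi> t))) \<and>
        (\<forall>t\<in>{-\<epsilon><..<\<epsilon>}. \<forall>x.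
           ((\<lambda>u. \<phi> u x) has_vector_derivative V0 (t, x)) (at t) \<and>
           ((\<lambda>u. D1 u x) has_vector_derivative V1 (t, x)) (at t) \<and>
           ((\<lambda>u. D2 u x) has_vector_derivative V2 (t, x)) (at t)) \<and>
        continuous_on ({-\<epsilon><..<\<epsilon>} \<times> UNIV) V0 \<and>
        continuous_on ({-\<epsilon><..<\<epsilon>} \<times> UNIV) V1 \<and>
        continuous_on ({-\<epsilon><..<\<epsilon>} \<times> UNIV) V2 \<and>
        (\<forall>x. \<phi> 0 x = x \<and> V0 (0, x) = \<xi> x))"

definition has_Thi_variation ::
    "real \<Rightarrow> (real^3) set \<Rightarrow> (real^3 \<Rightarrow> real^3) \<Rightarrow> real \<Rightarrow> bool" where
  "has_Thi_variation \<sigma> L \<xi> d \<longleftrightarrow>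
     (\<forall>\<epsilon> \<phi>. C1_family_of_C2_diffeos \<epsilon> \<phi> \<xi> \<longrightarrow>
        ((\<lambda>t. real_of_ereal (Thi \<sigma> (\<phi> t ` L))) has_real_derivative d) (at_right 0))"

definition len_variation :: "(real \<Rightarrow> real^3) \<Rightarrow> real \<Rightarrow> (real^3 \<Rightarrow> real^3) \<Rightarrow> real" where
  "len_variation c l \<xi> =
     integral {0..l} (\<lambda>s. vector_derivative (\<xi> \<circ> c) (at s within {0..l}) \<bullet>
                          vector_derivative c (at s within {0..l}))"


section \<open>The clasp problem\<close>

text \<open>The signs \<open>i = 1\<close> and \<open>i = -1\<close> select the two constraining planes of each arc, given by
  \<open>conormal i \<bullet> p = h\<close>.  The four normals are unit vectors.\<close>

definition conormal1 :: "real \<Rightarrow> real \<Rightarrow> real^3" where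
  "conormal1 \<tau> i = vector [i * sqrt (1 - \<tau>\<^sup>2), 0, \<tau>]"

definition conormal2 :: "real \<Rightarrow> real \<Rightarrow> real^3" where
  "conormal2 \<tau> i = vector [0, i * sqrt (1 - \<tau>\<^sup>2), - \<tau>]"

definition clasp_body :: "real \<Rightarrow> real \<Rightarrow> (real^3) set" where
  "clasp_body \<tau> h =
     {p. \<forall>i\<in>{1, -1}. conormal1 \<tau> i \<bullet> p \<le> h \<and> conormal2 \<tau> i \<bullet> p \<le> h}"

definition clasp_face :: "real \<Rightarrow> real \<Rightarrow> real^3 \<Rightarrow> (real^3) set" where
  "clasp_face \<tau> h n = {p \<in> clasp_body \<tau> h. n \<bullet> p = h}"

text \<open>The standard Hopf link consists of two perpendicular unit circles, each passing through the
  center of the other.  Since the unoriented Hopf link is isotopic to its mirror image, a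
  homeomorphism of pairs need not be required to preserve orientation.\<close>

definition is_Hopf_link :: "(real^3) set \<Rightarrow> (real^3) set \<Rightarrow> bool" where
  "is_Hopf_link A B \<longleftrightarrow>
     (\<exists>(f :: real^3 \<Rightarrow> real^3) g. homeomorphism UNIV UNIV f g \<and>
        f ` A = {p. p $ 3 = 0 \<and> norm p = 1} \<and>
        f ` B = {p. p $ 2 = 0 \<and> norm (p - vector [1, 0, 0]) = 1})"

text \<open>Each arc is closed up by two segments, one in each of its boundary faces, meeting on the
  common edge of these faces.  (For \<open>\<tau> = 1\<close> the two faces of an arc coincide.)\<close>

definition hooked ::
    "real \<Rightarrow> real \<Rightarrow> (real \<Rightarrow> real^3) \<Rightarrow> real \<Rightarrow> (real \<Rightarrow> real^3) \<Rightarrow> real \<Rightarrow> bool" where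
  "hooked \<tau> h c1 l1 c2 l2 \<longleftrightarrow>
     (\<exists>p q.
        closed_segment (c1 l1) p \<subseteq> clasp_face \<tau> h (conormal1 \<tau> 1) \<and>
        closed_segment p (c1 0) \<subseteq> clasp_face \<tau> h (conormal1 \<tau> (-1)) \<and>
        closed_segment (c2 l2) q \<subseteq> clasp_face \<tau> h (conormal2 \<tau> 1) \<and>
        closed_segment q (c2 0) \<subseteq> clasp_face \<tau> h (conormal2 \<tau> (-1)) \<and>
        is_Hopf_link
          (c1 ` {0..l1} \<union> closed_segment (c1 l1) p \<union> closed_segment p (c1 0))
          (c2 ` {0..l2} \<union> closed_segment (c2 l2) q \<union> closed_segment q (c2 0)))"

definition C11_arc :: "(real \<Rightarrow> real^3) \<Rightarrow> real \<Rightarrow> bool" where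
  "C11_arc c l \<longleftrightarrow> l > 0 \<and> inj_on c {0..l} \<and> (\<exists>T. C11_arclength c {0..l} T)"

definition clasp_link ::
    "real \<Rightarrow> real \<Rightarrow> (real \<Rightarrow> real^3) \<Rightarrow> real \<Rightarrow> (real \<Rightarrow> real^3) \<Rightarrow> real \<Rightarrow> bool" where
  "clasp_link \<tau> h c1 l1 c2 l2 \<longleftrightarrow>
     C11_arc c1 l1 \<and> C11_arc c2 l2 \<and> c1 ` {0..l1} \<inter> c2 ` {0..l2} = {} \<and>
     conormal1 \<tau> (-1) \<bullet> c1 0 = h \<and> conormal1 \<tau> 1 \<bullet> c1 l1 = h \<and>
     conormal2 \<tau> (-1) \<bullet> c2 0 = h \<and> conormal2 \<tau> 1 \<bullet> c2 l2 = h \<and>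
     hooked \<tau> h c1 l1 c2 l2"

definition clasp_critical :: "real \<Rightarrow> real \<Rightarrow> real \<Rightarrow> (real^3) set \<Rightarrow> bool" where
  "clasp_critical \<tau> \<sigma> h L \<longleftrightarrow>
     (\<exists>c1 l1 c2 l2.
        L = c1 ` {0..l1} \<union> c2 ` {0..l2} \<and>
        clasp_link \<tau> h c1 l1 c2 l2 \<and>
        Thi \<sigma> L = 1 \<and>
        (\<forall>\<xi>. C2 \<xi> \<and>
             conormal1 \<tau> (-1) \<bullet> \<xi> (c1 0) = 0 \<and> conormal1 \<tau> 1 \<bullet> \<xi> (c1 l1) = 0 \<and>
             conormal2 \<tau> (-1) \<bullet> \<xi> (c2 0) = 0 \<and> conormal2 \<tau> 1 \<bullet> \<xi> (c2 l2) = 0 \<and>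
             len_variation c1 l1 \<xi> + len_variation c2 l2 \<xi> < 0 \<longrightarrow>
             (\<exists>d<0. has_Thi_variation \<sigma> L \<xi> d)))"


section \<open>The symmetry group\<close>

text \<open>The generators have finite order, so closing under composition yields a group.\<close>

inductive_set group_2star2 :: "(real^3 \<Rightarrow> real^3) set" where
  "id \<in> group_2star2"
| "g \<in> group_2star2 \<Longrightarrow> (\<lambda>p. vector [- p $ 1, p $ 2, p $ 3]) \<circ> g \<in> group_2star2"
| "g \<in> group_2star2 \<Longrightarrow> (\<lambda>p. vector [p $ 1, - p $ 2, p $ 3]) \<circ> g \<in> group_2star2"
| "g \<in> group_2star2 \<Longrightarrow> (\<lambda>p. vector [- p $ 2, p $ 1, - p $ 3]) \<circ> g \<in> group_2star2"

definition sym_2star2 :: "(real^3) set \<Rightarrow> (real^3) set" where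
  "sym_2star2 C = (\<Union>g\<in>group_2star2. g ` C)"


section \<open>The curve \<open>C\<^sub>T\<close>\<close>

definition circular_arc ::
    "(real \<Rightarrow> real^3) \<Rightarrow> real \<Rightarrow> real \<Rightarrow> real^3 \<Rightarrow> real \<Rightarrow> real \<Rightarrow> bool" where
  "circular_arc c a b m r \<theta> \<longleftrightarrow>
     b - a = r * \<theta> \<and>
     (\<exists>u v. norm u = 1 \<and> norm v = 1 \<and> u \<bullet> v = 0 \<and>
        (\<forall>s\<in>{a..b}. c s = m + r *\<^sub>R (cos ((s - a) / r) *\<^sub>R u + sin ((s - a) / r) *\<^sub>R v)))"

definition straight_piece :: "(real \<Rightarrow> real^3) \<Rightarrow> real \<Rightarrow> real \<Rightarrow> bool" where
  "straight_piece c a b \<longleftrightarrow>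
     (\<exists>v. norm v = 1 \<and> (\<forall>s\<in>{a..b}. c s = c a + (s - a) *\<^sub>R v))"

text \<open>A curve in the \<open>xz\<close>-plane is convex if it lies on one side of each of its tangent lines.\<close>

definition convex_curve_xz :: "(real \<Rightarrow> real^3) \<Rightarrow> real set \<Rightarrow> (real \<Rightarrow> real^3) \<Rightarrow> bool" where
  "convex_curve_xz c I T \<longleftrightarrow>
     (\<forall>s\<in>I. (\<forall>u\<in>I. vector [- T s $ 3, 0, T s $ 1] \<bullet> (c u - c s) \<ge> 0) \<or>
            (\<forall>u\<in>I. vector [- T s $ 3, 0, T s $ 1] \<bullet> (c u - c s) \<le> 0))"

text \<open>\<open>z0\<close> is the height of the tip and \<open>m\<close> the center of the shoulder; the ray is cut off where it
  meets the plane \<open>conormal1 \<tau> 1 \<bullet> p = h\<close>.\<close>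

definition transition_curve ::
    "real \<Rightarrow> real \<Rightarrow> real \<Rightarrow> (real \<Rightarrow> real^3) \<Rightarrow> real \<Rightarrow> real \<Rightarrow> real^3 \<Rightarrow> bool" where
  "transition_curve \<tau> \<sigma> h c l z0 m \<longleftrightarrow>
     (\<exists>T. C1_arclength c {0..l} T \<and> convex_curve_xz c {0..l} T \<and> T 0 $ 3 = 0) \<and>
     c 0 = vector [0, 0, z0] \<and>
     (\<forall>s\<in>{0..l}. c s $ 2 = 0 \<and> c s $ 1 \<ge> 0 \<and> c s $ 3 \<ge> z0) \<and>
     (\<exists>s1 s2 s3 m1.
        circular_arc c 0 s1 m1 \<sigma> (arcsin (\<tau> / 2)) \<and>
        straight_piece c s1 s2 \<and> s2 - s1 = \<tau> * (1 - \<sigma>) / sqrt (4 - \<tau>\<^sup>2) \<and>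
        circular_arc c s2 s3 m 1 (arcsin \<tau> - arcsin (\<tau> / 2)) \<and>
        straight_piece c s3 l \<and> s3 < l \<and>
        conormal1 \<tau> 1 \<bullet> c l = h)"

end

theory Submission
  imports Defs
begin

text \<open>Near time 0 the thickness of the transported link is the minimum of the distance between its two
  components and of the smallest radius of curvature divided by \<open>\<sigma>\<close>: each component alone keeps reach
  greater than \<open>1/2\<close>, because the ball of radius \<open>\<sigma>\<close> rolls freely on the concave side of a convex
  curve that turns by at most \<open>\<pi>\<close>.  By Danskin's theorem the right derivative of the
  thickness is the minimum of the first variations over the struts (pairs at distance 1) and the kinks
  (points of curvature \<open>1/\<sigma>\<close>).  If no strut shortens and no curvature increases, integration by parts
  along the components shows that the length does not decrease to first order: the shoulders, loaded
  uniformly by the struts to the opposite tip, push that tip with total force \<open>\<tau>\<close>, and this force is carried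
  by the tip arc, whose curvature is loaded with the weight \<open>\<sigma> (1 - cos (\<theta>\<^sub>1 - \<bar>\<alpha>\<bar>))\<close>,
  \<open>\<alpha>\<close> being the tangent angle.  The lower
  bound on \<open>\<sigma>\<close> is what keeps the line segments of the two components at distance at least 1.\<close>

section \<open>Parametrized families and one-sided derivatives of minima\<close>

text \<open>Two obstacles shape the proof. Thickness is defined from the point set alone, by
  \<open>THE\<close> curvature vector and a \<open>Limsup\<close>, while the curvature of the link
  jumps at the junctions. So curvature is computed on closed pieces with one-sided values; the
  disjoint union of these pieces is compact, and curvature is continuous on it. Secondly, reach is
  global and has to be controlled for every transported link. Uniqueness of nearest points on one
  component is proved for the original curve at distances up to and including 1/2 and passed on by a
  compactness argument; a quantitative estimate keeps two nearest points from merging in the limit.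
  It requires curvature little above 1: the hypothesis on \<sigma> implies \<sigma> > cos (arcsin
  (\<tau>/2)) > 0.86, hence curvature at most 117/100. Distances and curvatures are squared before
  differentiating, because the norm of the curvature vector is not differentiable along straight
  pieces. Finally, one number must serve all families with the same velocity \<xi>: an exchange of
  time and space derivatives expresses the variation of curvature by the first two derivatives of
  \<xi>.\<close>

definition C1_param ::
  "real \<Rightarrow> 'k::topological_space set \<Rightarrow> (real \<Rightarrow> 'k \<Rightarrow> 'b::real_normed_vector) \<Rightarrow> (real \<times> 'k \<Rightarrow> 'b) \<Rightarrow> bool" where
  "C1_param \<epsilon> K G V \<longleftrightarrow> 0 < \<epsilon> \<and>
     (\<forall>t\<in>{-\<epsilon><..<\<epsilon>}. \<forall>k\<in>K. ((\<lambda>u. G u k) has_vector_derivative V (t, k)) (at t)) \<and>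
     continuous_on ({-\<epsilon><..<\<epsilon>} \<times> K) V \<and> continuous_on ({-\<epsilon><..<\<epsilon>} \<times> K) (\<lambda>p. G (fst p) (snd p))"

lemma C1_paramD:
  assumes "C1_param \<epsilon> K G V"
  shows "0 < \<epsilon>" "\<And>t k. \<bar>t\<bar> < \<epsilon> \<Longrightarrow> k \<in> K \<Longrightarrow> ((\<lambda>u. G u k) has_vector_derivative V (t, k)) (at t)"
    "continuous_on ({-\<epsilon><..<\<epsilon>} \<times> K) V" "continuous_on ({-\<epsilon><..<\<epsilon>} \<times> K) (\<lambda>p. G (fst p) (snd p))"
  using assms by (auto simp: C1_param_def abs_less_iff)

text \<open>Joint continuity of \<open>G\<close> comes for free: \<open>G t k\<close> is
  \<open>G 0 k\<close> plus the integral of \<open>t *\<^sub>R V (t * r, k)\<close> over r from 0 to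
  1. The rescaling to a fixed interval puts t and k into the integrand, where a continuous parameter
  gives a continuous integral.\<close>

lemma C1_paramI:
  fixes G :: "real \<Rightarrow> 'k::metric_space \<Rightarrow> 'b::banach"
  assumes "0 < \<epsilon>"
    and d: "\<And>t k. t \<in> {-\<epsilon><..<\<epsilon>} \<Longrightarrow> k \<in> K \<Longrightarrow> ((\<lambda>u. G u k) has_vector_derivative V (t, k)) (at t)"
    and V: "continuous_on ({-\<epsilon><..<\<epsilon>} \<times> K) V" and G0: "continuous_on K (G 0)"
  shows "C1_param \<epsilon> K G V"
proof -
  let ?U = "{-\<epsilon><..<\<epsilon>} \<times> K"
  have small: "t * r \<in> {-\<epsilon><..<\<epsilon>}" if "t \<in> {-\<epsilon><..<\<epsilon>}" "r \<in> {0..1}" for t r :: real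
  proof -
    have "\<bar>t * r\<bar> \<le> \<bar>t\<bar> * 1"
      unfolding abs_mult using that by (intro mult_left_mono) auto
    then show ?thesis using that by auto
  qed
  have eq: "G t k = G 0 k + integral (cbox 0 1) (\<lambda>r. t *\<^sub>R V (t * r, k))"
    if "(t, k) \<in> ?U" for t k
  proof -
    have "((\<lambda>r. t *\<^sub>R V (t * r, k)) has_integral (G (t * 1) k - G (t * 0) k)) {0..1}"
    proof (rule fundamental_theorem_of_calculus)
      fix r :: real assume r: "r \<in> {0..1}"
      have 1: "((\<lambda>r. t * r) has_vector_derivative t) (at r within {0..1})"
        by (auto intro!: derivative_eq_intros)
      have "((\<lambda>u. G u k) has_vector_derivative V (t * r, k)) (at (t * r) within (\<lambda>r. t * r) ` {0..1})"
        using small[of t r] that r by (auto intro: has_vector_derivative_at_within[OF d])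
      from vector_diff_chain_within[OF 1 this]
      show "((\<lambda>r. G (t * r) k) has_vector_derivative t *\<^sub>R V (t * r, k)) (at r within {0..1})"
        by (simp add: o_def)
    qed simp
    from integral_unique[OF this]
    have "integral (cbox 0 1) (\<lambda>r. t *\<^sub>R V (t * r, k)) = G t k - G 0 k" by (simp only: mult_1_right mult_zero_right cbox_interval)
    then show ?thesis by (simp only: add_diff_cancel_left' add_diff_eq)
  qed
  have "continuous_on ?U (\<lambda>p. G 0 (snd p) + integral (cbox 0 1) (\<lambda>r. fst p *\<^sub>R V (fst p * r, snd p)))"
  proof (intro continuous_on_add integral_continuous_on_param)
    show "continuous_on ?U (\<lambda>p. G 0 (snd p))"
      by (rule continuous_on_compose2[OF G0]) (auto intro!: continuous_intros)
    have "continuous_on (?U \<times> cbox 0 1) (\<lambda>q. V (fst (fst q) * snd q, snd (fst q)))"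
      using small by (intro continuous_on_compose2[OF V]) (auto intro!: continuous_intros)
    then show "continuous_on (?U \<times> cbox 0 1) (\<lambda>(p, r). fst p *\<^sub>R V (fst p * r, snd p))"
      unfolding split_beta by (intro continuous_intros)
  qed
  then have "continuous_on ?U (\<lambda>p. G (fst p) (snd p))"
  proof (rule continuous_on_eq)
    fix p assume "p \<in> ?U"
    then show "G 0 (snd p) + integral (cbox 0 1) (\<lambda>r. fst p *\<^sub>R V (fst p * r, snd p)) = G (fst p) (snd p)"
      using eq[of "fst p" "snd p"] by simp
  qed
  then show ?thesis using assms by (auto simp: C1_param_def)
qed

lemma C1_param_subst:
  assumes "C1_param \<epsilon> K G V" "continuous_on J c" "c ` J \<subseteq> K"
  shows "C1_param \<epsilon> J (\<lambda>t s. G t (c s)) (\<lambda>p. V (fst p, c (snd p)))"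
proof -
  note D = C1_paramD[OF assms(1)]
  have c: "continuous_on ({-\<epsilon><..<\<epsilon>} \<times> J) (\<lambda>p. (fst p, c (snd p)))"
    by (intro continuous_intros continuous_on_compose2[OF assms(2)]) auto
  have sub: "(\<lambda>p. (fst p, c (snd p))) ` ({-\<epsilon><..<\<epsilon>} \<times> J) \<subseteq> {-\<epsilon><..<\<epsilon>} \<times> K"
    using assms(3) by auto
  show ?thesis
    unfolding C1_param_def using D(1,2) assms(3)
      continuous_on_compose2[OF D(3) c sub] continuous_on_compose2[OF D(4) c sub]
    by (auto simp: abs_less_iff)
qed

text \<open>One product rule for scalar products, real products and applications of linear maps.
  Squared distances and squared curvatures of the transported link are assembled from the flow by
  such products.\<close>

lemma (in bounded_bilinear) C1_param:
  assumes F: "C1_param \<epsilon> K F V" and G: "C1_param \<epsilon> K G W"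
  shows "C1_param \<epsilon> K (\<lambda>t k. prod (F t k) (G t k))
    (\<lambda>p. prod (F (fst p) (snd p)) (W p) + prod (V p) (G (fst p) (snd p)))"
  unfolding C1_param_def
proof (intro conjI ballI)
  fix t k assume "t \<in> {-\<epsilon><..<\<epsilon>}" "k \<in> K"
  then have "\<bar>t\<bar> < \<epsilon>" by auto
  from has_vector_derivative[OF C1_paramD(2)[OF F this \<open>k \<in> K\<close>] C1_paramD(2)[OF G this \<open>k \<in> K\<close>]]
  show "((\<lambda>u. prod (F u k) (G u k)) has_vector_derivative
      prod (F (fst (t, k)) (snd (t, k))) (W (t, k)) + prod (V (t, k)) (G (fst (t, k)) (snd (t, k)))) (at t)"
    by simp
next
  show "continuous_on ({-\<epsilon><..<\<epsilon>} \<times> K) (\<lambda>p. prod (F (fst p) (snd p)) (W p) + prod (V p) (G (fst p) (snd p)))"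
    by (intro continuous_on_add continuous_on C1_paramD(3)[OF F] C1_paramD(3)[OF G] C1_paramD(4)[OF F] C1_paramD(4)[OF G])
  show "continuous_on ({-\<epsilon><..<\<epsilon>} \<times> K) (\<lambda>p. prod (F (fst p) (snd p)) (G (fst p) (snd p)))"
    by (intro continuous_on C1_paramD(4)[OF F] C1_paramD(4)[OF G])
qed (rule C1_paramD(1)[OF F])

lemma C1_param_const:
  assumes "0 < \<epsilon>" "continuous_on K c"
  shows "C1_param \<epsilon> K (\<lambda>t. c) (\<lambda>p. 0)"
proof -
  have "continuous_on ({-\<epsilon><..<\<epsilon>} \<times> K) (\<lambda>p. c (snd p))"
    by (rule continuous_on_compose2[OF assms(2) continuous_on_snd[OF continuous_on_id]]) auto
  then show ?thesis
    unfolding C1_param_def using assms(1) by auto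
qed

lemma C1_param_linear:
  assumes F: "C1_param \<epsilon> K F V" and L: "bounded_linear L"
  shows "C1_param \<epsilon> K (\<lambda>t k. L (F t k)) (\<lambda>p. L (V p))"
  unfolding C1_param_def
proof (intro conjI ballI)
  fix t k assume "t \<in> {-\<epsilon><..<\<epsilon>}" "k \<in> K"
  then show "((\<lambda>u. L (F u k)) has_vector_derivative L (V (t, k))) (at t)"
    by (intro bounded_linear.has_vector_derivative[OF L] C1_paramD(2)[OF F]) auto
qed (rule C1_paramD(1)[OF F] bounded_linear.continuous_on[OF L] C1_paramD(3)[OF F] C1_paramD(4)[OF F])+

lemma C1_param_add:
  assumes F: "C1_param \<epsilon> K F V" and G: "C1_param \<epsilon> K G W"
  shows "C1_param \<epsilon> K (\<lambda>t k. F t k + G t k) (\<lambda>p. V p + W p)"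
  unfolding C1_param_def using C1_paramD[OF F] C1_paramD[OF G]
  by (simp add: abs_less_iff has_vector_derivative_add continuous_on_add)

lemma C1_param_diff:
  assumes F: "C1_param \<epsilon> K F V" and G: "C1_param \<epsilon> K G W"
  shows "C1_param \<epsilon> K (\<lambda>t k. F t k - G t k) (\<lambda>p. V p - W p)"
  unfolding C1_param_def using C1_paramD[OF F] C1_paramD[OF G]
  by (simp add: abs_less_iff has_vector_derivative_diff continuous_on_diff)

section \<open>Uniform expansion over a compact parameter set and Danskin's theorem\<close>

lemma continuous_param_uniform:
  fixes H :: "real \<times> 'k::metric_space \<Rightarrow> 'b::metric_space"
  assumes "0 < \<epsilon>" "continuous_on ({-\<epsilon><..<\<epsilon>} \<times> K) H" "compact K" "0 < e"
  shows "\<exists>\<delta>>0. \<delta> < \<epsilon> \<and> (\<forall>t k. \<bar>t\<bar> \<le> \<delta> \<longrightarrow> k \<in> K \<longrightarrow> dist (H (t, k)) (H (0, k)) < e)"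
proof -
  let ?C = "{-\<epsilon>/2..\<epsilon>/2} \<times> K"
  have "uniformly_continuous_on ?C H"
    using assms(1) by (intro compact_uniformly_continuous continuous_on_subset[OF assms(2)] compact_Times assms(3)) auto
  then obtain \<delta> where \<delta>: "\<delta> > 0" "\<And>x x'. x \<in> ?C \<Longrightarrow> x' \<in> ?C \<Longrightarrow> dist x' x < \<delta> \<Longrightarrow> dist (H x') (H x) < e"
    unfolding uniformly_continuous_on_def using assms(4) by metis
  show ?thesis
  proof (intro exI[of _ "min (\<delta>/2) (\<epsilon>/2)"] conjI allI impI)
    fix t k assume "\<bar>t\<bar> \<le> min (\<delta>/2) (\<epsilon>/2)" "k \<in> K"
    then show "dist (H (t, k)) (H (0, k)) < e"
      using \<delta>(1) assms(1) by (intro \<delta>(2)) (auto simp: dist_Pair_Pair dist_real_def)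
  qed (use \<delta>(1) assms(1) in auto)
qed

text \<open>Mean value inequality for \<open>G u k - u *\<^sub>R V (0, k)\<close>, whose derivative
  \<open>V (u, k) - V (0, k)\<close> is below \<open>e\<close> uniformly in
  \<open>k\<close>.\<close>

lemma C1_param_taylor:
  fixes G :: "real \<Rightarrow> 'k::metric_space \<Rightarrow> 'b::real_normed_vector"
  assumes G: "C1_param \<epsilon> K G V" and "compact K" "0 < e"
  shows "\<exists>\<delta>>0. \<delta> < \<epsilon> \<and> (\<forall>t k. \<bar>t\<bar> \<le> \<delta> \<longrightarrow> k \<in> K \<longrightarrow> norm (G t k - G 0 k - t *\<^sub>R V (0, k)) \<le> e * \<bar>t\<bar>)"
proof -
  note D = C1_paramD[OF G]
  obtain \<delta> where \<delta>: "\<delta> > 0" "\<delta> < \<epsilon>" "\<And>t k. \<bar>t\<bar> \<le> \<delta> \<Longrightarrow> k \<in> K \<Longrightarrow> dist (V (t, k)) (V (0, k)) < e"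
    using continuous_param_uniform[OF D(1,3) assms(2,3)] by blast
  show ?thesis
  proof (intro exI[of _ \<delta>] conjI allI impI \<delta>(1,2))
    fix t k assume t: "\<bar>t\<bar> \<le> \<delta>" and k: "k \<in> K"
    have "norm ((G t k - t *\<^sub>R V (0, k)) - (G 0 k - 0 *\<^sub>R V (0, k))) \<le> e * norm (t - 0)"
    proof (rule differentiable_bound[where S="{-\<delta>..\<delta>}" and f="\<lambda>u. G u k - u *\<^sub>R V (0, k)" and f'="\<lambda>u h. h *\<^sub>R (V (u, k) - V (0, k))"])
      fix u assume u: "u \<in> {-\<delta>..\<delta>}"
      have "((\<lambda>u. G u k - u *\<^sub>R V (0, k)) has_vector_derivative V (u, k) - V (0, k)) (at u within {-\<delta>..\<delta>})"
        using u \<delta> k by (auto intro!: derivative_eq_intros has_vector_derivative_at_within[OF D(2)])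
      then show "((\<lambda>u. G u k - u *\<^sub>R V (0, k)) has_derivative (\<lambda>h. h *\<^sub>R (V (u, k) - V (0, k)))) (at u within {-\<delta>..\<delta>})"
        by (simp add: has_vector_derivative_def)
      show "onorm (\<lambda>h. h *\<^sub>R (V (u, k) - V (0, k))) \<le> e"
        proof (rule onorm_le)
        have "norm (V (u, k) - V (0, k)) \<le> e" using \<delta>(3)[of u k] u k by (simp add: dist_norm abs_le_iff)
        then show "norm (h *\<^sub>R (V (u, k) - V (0, k))) \<le> e * norm h" for h
          by (simp add: mult.commute[of e] mult_left_mono)
      qed
    qed (use t in auto)
    then show "norm (G t k - G 0 k - t *\<^sub>R V (0, k)) \<le> e * \<bar>t\<bar>"
      by (simp add: algebra_simps)
  qed
qed

text \<open>Danskin's theorem. The minimizers at time 0 form a compact set, and the slowest of them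
  decides: points slower by a margin stay away from the minimizers and cannot compete for small
  positive times, while all others obey the uniform expansion. The minimizer is returned together
  with its minimality, so that the derivatives for two families with the same velocity can be
  compared.\<close>

lemma C1_param_INF_derivative:
  fixes F :: "real \<Rightarrow> 'k::metric_space \<Rightarrow> real"
  assumes F: "C1_param \<epsilon> K F V" and K: "compact K" "K \<noteq> {}"
  defines "M \<equiv> \<lambda>t. INF k\<in>K. F t k"
  obtains k where "k \<in> K" "F 0 k = M 0" "\<And>k'. k' \<in> K \<Longrightarrow> F 0 k' = M 0 \<Longrightarrow> V (0, k) \<le> V (0, k')"
    "(M has_real_derivative V (0, k)) (at_right 0)"
proof -
  note D = C1_paramD[OF F]
  have slice: "continuous_on K (F t)" if "\<bar>t\<bar> < \<epsilon>" for t
  proof -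
    have "continuous_on K (\<lambda>k. (t, k))" by (rule continuous_on_Pair[OF continuous_on_const continuous_on_id])
    from continuous_on_compose2[OF D(4) this] show ?thesis using that by (auto simp: abs_less_iff image_subset_iff)
  qed
  have contV: "continuous_on K (\<lambda>k. V (0, k))"
  proof -
    have "continuous_on K (\<lambda>k. (0::real, k))" by (rule continuous_on_Pair[OF continuous_on_const continuous_on_id])
    from continuous_on_compose2[OF D(3) this] show ?thesis using D(1) by (simp add: image_subset_iff)
  qed
  have Mle: "M t \<le> F t k" if "\<bar>t\<bar> < \<epsilon>" "k \<in> K" for t k
    unfolding M_def using that slice[OF that(1)] K(1)
    by (intro cINF_lower bounded_imp_bdd_below compact_imp_bounded compact_continuous_image)
  have M0: "\<exists>k\<in>K. F 0 k = M 0"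
  proof -
    obtain k where k: "k \<in> K" "\<And>k'. k' \<in> K \<Longrightarrow> F 0 k \<le> F 0 k'"
      using continuous_attains_inf[OF K slice[of 0]] D(1) by auto
    have "F 0 k \<le> M 0" unfolding M_def using K k by (intro cINF_greatest) auto
    then show ?thesis using Mle[of 0 k] k D(1) by force
  qed
  define A where "A = {k \<in> K. F 0 k = M 0}"
  have "A = K \<inter> F 0 -` {M 0}" by (auto simp: A_def)
  moreover have "closed (K \<inter> F 0 -` {M 0})"
    using slice[of 0] D(1) compact_imp_closed[OF K(1)] by (intro continuous_closed_preimage) auto
  ultimately have "compact A" using K(1) compact_Int_closed[of K A] by (metis Int_left_absorb)
  moreover have "A \<noteq> {}" using M0 by (auto simp: A_def)
  moreover have "continuous_on A (\<lambda>k. V (0, k))" using contV by (rule continuous_on_subset) (auto simp: A_def)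
  ultimately obtain k where k: "k \<in> A" "\<And>k'. k' \<in> A \<Longrightarrow> V (0, k) \<le> V (0, k')"
    using continuous_attains_inf by metis
  let ?d = "V (0, k)"
  have est: "\<exists>\<delta>>0. \<forall>t. 0 < t \<and> t < \<delta> \<longrightarrow> \<bar>M t - M 0 - t * ?d\<bar> \<le> e * t" if e: "e > 0" for e
  proof -
    obtain \<delta>1 where \<delta>1: "\<delta>1 > 0" "\<delta>1 < \<epsilon>"
      and T: "\<And>t k. \<bar>t\<bar> \<le> \<delta>1 \<Longrightarrow> k \<in> K \<Longrightarrow> norm (F t k - F 0 k - t *\<^sub>R V (0, k)) \<le> e/2 * \<bar>t\<bar>"
      using C1_param_taylor[OF F K(1), of "e/2"] e by auto
    \<comment> \<open>\<open>B\<close> holds the points whose velocity undercuts \<open>?d\<close>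
      by at least \<open>e/2\<close>. It is compact and contains no minimizer, so \<open>F 0\<close>
      exceeds the minimum on it by a fixed gap \<open>\<eta>\<close>.\<close>
    define B where "B = K \<inter> (\<lambda>k. V (0, k)) -` {..?d - e/2}"
    have "closed B" unfolding B_def using contV compact_imp_closed[OF K(1)] by (intro continuous_closed_preimage) auto
    then have "compact B" using K(1) compact_Int_closed[of K B] by (simp add: B_def Int_absorb1 Int_absorb2 flip: Int_assoc)
    have "\<exists>\<eta>>0. \<forall>k\<in>B. F 0 k \<ge> M 0 + \<eta>"
    proof (cases "B = {}")
      case False
      have "continuous_on B (F 0)" using slice[of 0] D(1) by (auto intro: continuous_on_subset simp: B_def)
      then obtain b where b: "b \<in> B" "\<And>k'. k' \<in> B \<Longrightarrow> F 0 b \<le> F 0 k'"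
        using continuous_attains_inf[OF \<open>compact B\<close> False] by metis
      have "b \<notin> A" using k(2)[of b] b e by (auto simp: B_def)
      then have "F 0 b > M 0" using b Mle[of 0 b] D(1) by (auto simp: B_def A_def)
      then show ?thesis using b(2) by (intro exI[of _ "F 0 b - M 0"]) auto
    qed (auto intro: exI[of _ 1])
    then obtain \<eta> where \<eta>: "\<eta> > 0" "\<And>k. k \<in> B \<Longrightarrow> F 0 k \<ge> M 0 + \<eta>" by auto
    have "continuous_on ({-\<epsilon><..<\<epsilon>} \<times> K) (\<lambda>p. F (fst p) (snd p))" by (rule D)
    from continuous_param_uniform[OF D(1) this K(1), of "\<eta>/2"] \<eta>(1)
    obtain \<delta>2 where \<delta>2: "\<delta>2 > 0" "\<And>t k. \<bar>t\<bar> \<le> \<delta>2 \<Longrightarrow> k \<in> K \<Longrightarrow> dist (F t k) (F 0 k) < \<eta>/2"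
      by auto
    \<comment> \<open>The last entry keeps \<open>t * ?d\<close> below half of the gap
      \<open>\<eta>\<close>; the other half absorbs the motion of \<open>F\<close> on
      \<open>B\<close>.\<close>
    define \<delta> where "\<delta> = min (min \<delta>1 \<delta>2) (\<eta> / (2 * (1 + \<bar>?d\<bar>)))"
    have "\<delta> > 0" using \<delta>1 \<delta>2 \<eta> by (auto simp: \<delta>_def)
    moreover have "\<bar>M t - M 0 - t * ?d\<bar> \<le> e * t" if t: "0 < t" "t < \<delta>" for t
    proof -
      have tt: "\<bar>t\<bar> \<le> \<delta>1" "\<bar>t\<bar> \<le> \<delta>2" "\<bar>t\<bar> < \<epsilon>" using t \<delta>1 by (auto simp: \<delta>_def)
      have kK: "k \<in> K" "F 0 k = M 0" using k by (auto simp: A_def)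
      have "M t \<le> F t k" using Mle tt kK by auto
      have "F t k - F 0 k - t * ?d \<le> norm (F t k - F 0 k - t *\<^sub>R ?d)" by simp
      also have "\<dots> \<le> e/2 * t" using T[OF tt(1) kK(1)] t by simp
      finally have "F t k - F 0 k - t * ?d \<le> e/2 * t" .
      moreover have "M t \<le> F t k" using Mle tt kK by auto
      moreover have "e/2 * t \<le> e * t" using e t by simp
      ultimately have up: "M t - M 0 - t * ?d \<le> e * t" using kK(2) by linarith
      have "M 0 + t * ?d - e * t \<le> (INF k\<in>K. F t k)"
      proof (rule cINF_greatest[OF K(2)])
        fix k' assume k': "k' \<in> K"
        show "M 0 + t * ?d - e * t \<le> F t k'"
        proof (cases "k' \<in> B")
          case True
          have "t * (1 + \<bar>?d\<bar>) \<le> \<eta> / 2"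
            using t by (auto simp: \<delta>_def field_simps)
          moreover have "t * ?d \<le> t * (1 + \<bar>?d\<bar>)" using t by (intro mult_left_mono) auto
          moreover have "0 < e * t" using e t by simp
          moreover have "F 0 k' - F t k' < \<eta> / 2"
            using \<delta>2(2)[OF tt(2) k'] unfolding dist_real_def abs_less_iff by linarith
          ultimately show ?thesis using \<eta>(2)[OF True] by linarith
        next
          case False
          then have "V (0, k') \<ge> ?d - e/2" using k' by (auto simp: B_def)
          then have "t * V (0, k') \<ge> t * (?d - e/2)" using t by (intro mult_left_mono) auto
          moreover have "F 0 k' \<ge> M 0" using Mle[of 0 k'] k' D(1) by auto
          moreover have "- (F t k' - F 0 k' - t * V (0, k')) \<le> e/2 * t"
            using T[OF tt(1) k'] t by (simp only: real_norm_def real_scaleR_def abs_le_iff) simp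
          ultimately show ?thesis by (simp add: algebra_simps)
        qed
      qed
      then show ?thesis using up by (simp add: M_def abs_le_iff)
    qed
    ultimately show ?thesis by blast
  qed
  have "((\<lambda>t. (M t - M 0) / (t - 0)) \<longlongrightarrow> ?d) (at_right 0)"
  proof (rule tendstoI)
    fix e :: real assume "e > 0"
    then obtain \<delta> where \<delta>: "\<delta> > 0" "\<And>t. 0 < t \<Longrightarrow> t < \<delta> \<Longrightarrow> \<bar>M t - M 0 - t * ?d\<bar> \<le> e/2 * t"
      using est[of "e/2"] by auto
    have "dist ((M t - M 0) / (t - 0)) ?d < e" if "0 < t" "t < \<delta>" for t
    proof -
      have "(M t - M 0) / (t - 0) - ?d = (M t - M 0 - t * ?d) / t" using that by (simp add: field_simps)
      also have "\<bar>\<dots>\<bar> \<le> e/2" using \<delta>(2)[OF that] that by (simp add: field_simps)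
      finally show ?thesis using \<open>e > 0\<close> by (simp add: dist_real_def)
    qed
    then show "\<forall>\<^sub>F t in at_right 0. dist ((M t - M 0) / (t - 0)) ?d < e"
      unfolding eventually_at_right_field using \<delta>(1) by (intro exI[of _ \<delta>]) auto
  qed
  then have "(M has_real_derivative ?d) (at_right 0)" by (simp add: has_field_derivative_iff)
  then show thesis using k that by (auto simp: A_def)
qed

section \<open>Curvature vectors of a point set\<close>

text \<open>\<open>T\<close> is differentiable only at 0, so the second-order expansion is obtained
  from the first-order expansion of \<open>T\<close> by the mean value inequality along the segment
  from 0 to r. Limits within \<open>I\<close> admit end points and junctions, where the curvature is
  one-sided.\<close>

lemma arclength_taylor:
  assumes c: "C1_arclength c I T" and I: "is_interval I" "0 \<in> I"
    and k: "(T has_vector_derivative k) (at 0 within I)"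
  shows "((\<lambda>r. (c r - c 0 - r *\<^sub>R T 0) /\<^sub>R r\<^sup>2) \<longlongrightarrow> k /\<^sub>R 2) (at 0 within I)"
proof (rule tendstoI)
  fix e :: real assume e: "e > 0"
  obtain d where d: "d > 0" and T: "\<And>r. r \<in> I \<Longrightarrow> \<bar>r\<bar> < d \<Longrightarrow> norm (T r - T 0 - r *\<^sub>R k) \<le> e/2 * \<bar>r\<bar>"
  proof -
    have "\<forall>e>0. \<exists>d>0. \<forall>y\<in>I. norm (y - 0) < d \<longrightarrow> norm (T y - T 0 - (y - 0) *\<^sub>R k) \<le> e * norm (y - 0)"
      using k unfolding has_vector_derivative_def has_derivative_within_alt by blast
    then have "\<exists>d>0. \<forall>y\<in>I. norm (y - 0) < d \<longrightarrow> norm (T y - T 0 - (y - 0) *\<^sub>R k) \<le> e/2 * norm (y - 0)"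
      using half_gt_zero[OF e] by blast
    then show ?thesis using that by (metis diff_zero real_norm_def)
  qed
  have bound: "norm (c r - c 0 - r *\<^sub>R T 0 - (r\<^sup>2/2) *\<^sub>R k) \<le> e/2 * r\<^sup>2" if r: "r \<in> I" "\<bar>r\<bar> < d" for r
  proof -
    let ?S = "closed_segment 0 r"
    have S: "?S \<subseteq> I" by (rule closed_segment_subset[OF I(2) r(1) is_interval_convex[OF I(1)]])
    have Sr: "\<bar>u\<bar> \<le> \<bar>r\<bar>" if "u \<in> ?S" for u using that by (auto simp: closed_segment_eq_real_ivl split: if_splits)
    have "norm ((c r - r *\<^sub>R T 0 - (r\<^sup>2/2) *\<^sub>R k) - (c 0 - 0 *\<^sub>R T 0 - (0\<^sup>2/2) *\<^sub>R k)) \<le> (e/2 * \<bar>r\<bar>) * norm (r - 0)"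
    proof (rule differentiable_bound[where S="?S" and f'="\<lambda>u h. h *\<^sub>R (T u - T 0 - u *\<^sub>R k)"])
      fix u assume u: "u \<in> ?S"
      have "(c has_vector_derivative T u) (at u within ?S)"
        using c u S unfolding C1_arclength_def by (blast intro: has_vector_derivative_within_subset)
      moreover have "((\<lambda>r. r *\<^sub>R T 0) has_vector_derivative 1 *\<^sub>R T 0) (at u within ?S)"
        using has_vector_derivative_scaleR[OF DERIV_ident has_vector_derivative_const] by simp
      moreover have "((\<lambda>r. (r\<^sup>2/2) *\<^sub>R k) has_vector_derivative u *\<^sub>R k) (at u within ?S)"
      proof -
        have "((\<lambda>r. r\<^sup>2/2) has_real_derivative u) (at u within ?S)" by (auto intro!: derivative_eq_intros)
        from has_vector_derivative_scaleR[OF this has_vector_derivative_const] show ?thesis by simp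
      qed
      ultimately have "((\<lambda>r. c r - r *\<^sub>R T 0 - (r\<^sup>2/2) *\<^sub>R k) has_vector_derivative (T u - 1 *\<^sub>R T 0 - u *\<^sub>R k)) (at u within ?S)"
        by (intro has_vector_derivative_diff)
      then have "((\<lambda>r. c r - r *\<^sub>R T 0 - (r\<^sup>2/2) *\<^sub>R k) has_vector_derivative (T u - T 0 - u *\<^sub>R k)) (at u within ?S)"
        by simp
      then show "((\<lambda>r. c r - r *\<^sub>R T 0 - (r\<^sup>2/2) *\<^sub>R k) has_derivative (\<lambda>h. h *\<^sub>R (T u - T 0 - u *\<^sub>R k))) (at u within ?S)"
        by (simp add: has_vector_derivative_def)
      have "norm (T u - T 0 - u *\<^sub>R k) \<le> e/2 * \<bar>u\<bar>" using u S Sr[OF u] r by (intro T) auto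
      also have "\<dots> \<le> e/2 * \<bar>r\<bar>" using Sr[OF u] e by (intro mult_left_mono) auto
      finally have *: "norm (T u - T 0 - u *\<^sub>R k) \<le> e/2 * \<bar>r\<bar>" .
      show "onorm (\<lambda>h. h *\<^sub>R (T u - T 0 - u *\<^sub>R k)) \<le> e/2 * \<bar>r\<bar>"
      proof (rule onorm_le)
        fix h :: real
        show "norm (h *\<^sub>R (T u - T 0 - u *\<^sub>R k)) \<le> e/2 * \<bar>r\<bar> * norm h"
          using mult_right_mono[OF *, of "\<bar>h\<bar>"] by (simp add: mult.commute)
      qed
    qed auto
    then show ?thesis by (simp add: algebra_simps power2_eq_square)
  qed
  have "dist ((c r - c 0 - r *\<^sub>R T 0) /\<^sub>R r\<^sup>2) (k /\<^sub>R 2) < e" if r: "r \<in> I" "\<bar>r\<bar> < d" "r \<noteq> 0" for r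
  proof -
    have "(c r - c 0 - r *\<^sub>R T 0) /\<^sub>R r\<^sup>2 - k /\<^sub>R 2 = (c r - c 0 - r *\<^sub>R T 0 - (r\<^sup>2/2) *\<^sub>R k) /\<^sub>R r\<^sup>2"
    proof -
      have "((r\<^sup>2/2) *\<^sub>R k) /\<^sub>R r\<^sup>2 = k /\<^sub>R 2" using r(3) by simp
      then show ?thesis by (simp only: scaleR_diff_right[of _ _ "(r\<^sup>2/2) *\<^sub>R k"])
    qed
    also have "norm \<dots> = norm (c r - c 0 - r *\<^sub>R T 0 - (r\<^sup>2/2) *\<^sub>R k) / r\<^sup>2"
      by (simp only: norm_scaleR abs_inverse abs_power2 divide_inverse_commute)
    also have "\<dots> \<le> e/2" using bound[OF r(1,2)] r(3) by (simp add: pos_divide_le_eq)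
    finally show ?thesis using e by (simp add: dist_norm)
  qed
  then show "\<forall>\<^sub>F r in at 0 within I. dist ((c r - c 0 - r *\<^sub>R T 0) /\<^sub>R r\<^sup>2) (k /\<^sub>R 2) < e"
    unfolding eventually_at using d by (auto simp: dist_real_def)
qed

text \<open>Differentiate \<open>T s \<bullet> T s = 1\<close>; a derivative within \<open>I\<close>
  is unique because an interval other than \<open>{0}\<close> accumulates at 0.\<close>

lemma arclength_curvature_orthogonal:
  assumes c: "C1_arclength c I T" and I: "is_interval I" "0 \<in> I" "I \<noteq> {0}"
    and k: "(T has_vector_derivative k) (at 0 within I)"
  shows "T 0 \<bullet> k = 0"
proof -
  obtain r0 where r0: "r0 \<in> I" "r0 \<noteq> 0" using I by auto
  have nb: "at 0 within I \<noteq> bot"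
  proof -
    have "connected I" using I(1) is_interval_connected_1 by blast
    then have "0 islimpt I" by (rule connected_imp_perfect) (use I in auto)
    then show ?thesis by (simp add: trivial_limit_within)
  qed
  have "((\<lambda>s. T s \<bullet> T s) has_vector_derivative (T 0 \<bullet> k + k \<bullet> T 0)) (at 0 within I)"
    by (rule bounded_bilinear.has_vector_derivative[OF bounded_bilinear_inner k k])
  moreover have "((\<lambda>s. T s \<bullet> T s) has_vector_derivative 0) (at 0 within I)"
    by (rule has_vector_derivative_transform[OF _ _ has_vector_derivative_const[of 1]])
      (use c I in \<open>auto simp: C1_arclength_def dot_square_norm\<close>)
  ultimately have "T 0 \<bullet> k + k \<bullet> T 0 = 0"
    using vector_derivative_unique_within nb by blast
  then show ?thesis by (simp add: inner_commute)
qed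

text \<open>Both Taylor expansions are compared along points common to the two curves; the parameters
  of such points agree up to sign to second order, because both are arclengths.\<close>

lemma curvature_unique:
  assumes c: "C1_arclength c I T" and I: "is_interval I" "0 \<in> I" "I \<noteq> {0}"
    and sub: "c ` I \<subseteq> L" and k: "(T has_vector_derivative k) (at 0 within I)"
    and ch: "C11_chart_at L (c 0) c' I' T'" and k': "(T' has_vector_derivative k') (at 0 within I')"
  shows "k = k'"
proof -
  have c': "C1_arclength c' I' T'" and I': "is_interval I'" "0 \<in> I'" "I' \<noteq> {0}" and c0: "c' 0 = c 0"
    and op: "openin (top_of_set L) (c' ` I')"
    using ch by (auto simp: C11_chart_at_def C11_arclength_def)
  obtain g where g: "homeomorphism I' (c' ` I') c' g" using ch by (auto simp: C11_chart_at_def)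
  obtain r0 where r0: "r0 \<in> I" "r0 \<noteq> 0" using I by auto
  \<comment> \<open>The points \<open>c (r n)\<close> lie on \<open>L\<close> and tend to
    \<open>c 0\<close>, so they eventually enter the relatively open image of the chart;
    \<open>r'\<close> below are their parameters there.\<close>
  define r where "r = (\<lambda>n. r0 * inverse (real (Suc n)))"
  have "r \<longlonglongrightarrow> r0 * 0" unfolding r_def by (intro tendsto_mult tendsto_const LIMSEQ_inverse_real_of_nat)
  then have r_lim: "r \<longlonglongrightarrow> 0" by simp
  have rI: "r n \<in> I" for n
  proof -
    have "r n = (1 - inverse (real (Suc n))) *\<^sub>R 0 + inverse (real (Suc n)) *\<^sub>R r0" by (simp add: r_def)
    moreover have "inverse (real (Suc n)) \<le> 1" by (simp add: field_simps)
    ultimately show ?thesis using I r0 is_interval_convex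
      by (metis convex_alt inverse_nonnegative_iff_nonnegative of_nat_0_le_iff)
  qed
  have rn0: "r n \<noteq> 0" for n using r0 by (simp add: r_def)
  have r_at: "filterlim r (at 0 within I) sequentially"
    using r_lim rI rn0 by (auto simp: filterlim_at)
  define q where "q = (\<lambda>n. c (r n))"
  define r' where "r' = (\<lambda>n. g (q n))"
  have "(c has_vector_derivative T 0) (at 0 within I)" using c I by (auto simp: C1_arclength_def)
  then have "(c \<longlongrightarrow> c 0) (at 0 within I)"
    using has_vector_derivative_continuous continuous_within by blast
  then have q_lim: "q \<longlonglongrightarrow> c 0" unfolding q_def using r_at by (rule filterlim_compose)
  obtain U where U: "open U" "c' ` I' = L \<inter> U" using op by (auto simp: openin_open)
  have "c 0 \<in> U" using U c0 I'(2) by (metis IntD2 imageI)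
  then have "\<forall>\<^sub>F n in sequentially. q n \<in> U" using q_lim U(1) by (auto dest: topological_tendstoD)
  then have ev: "\<forall>\<^sub>F n in sequentially. q n \<in> c' ` I'"
    by eventually_elim (use U sub rI in \<open>auto simp: q_def\<close>)
  have A: "(\<lambda>n. (q n - c 0 - r n *\<^sub>R T 0) /\<^sub>R (r n)\<^sup>2) \<longlonglongrightarrow> k /\<^sub>R 2"
    unfolding q_def by (rule filterlim_compose[OF arclength_taylor[OF c I(1,2) k] r_at])
  have expand: "t + a *\<^sub>R ((v - a *\<^sub>R t) /\<^sub>R a\<^sup>2) = v /\<^sub>R a" if "a \<noteq> 0" for a and t v :: "real^3"
  proof -
    have "a * inverse (a\<^sup>2) = inverse a" "a * (inverse (a\<^sup>2) * a) = 1"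
      using that by (simp_all add: power2_eq_square field_simps)
    then show ?thesis by (simp add: scaleR_diff_right)
  qed
  let ?A = "\<lambda>n. (q n - c 0 - r n *\<^sub>R T 0) /\<^sub>R (r n)\<^sup>2"
  have "(\<lambda>n. T 0 + r n *\<^sub>R ?A n) \<longlonglongrightarrow> T 0 + 0 *\<^sub>R (k /\<^sub>R 2)"
    by (intro tendsto_intros r_lim A)
  moreover have "T 0 + r n *\<^sub>R ?A n = (q n - c 0) /\<^sub>R r n" for n
    by (rule expand[OF rn0])
  ultimately have A1: "(\<lambda>n. (q n - c 0) /\<^sub>R r n) \<longlonglongrightarrow> T 0" by simp
  have T0: "norm (T 0) = 1" "norm (T' 0) = 1" using c c' I I' by (auto simp: C1_arclength_def)
  have "\<forall>\<^sub>F n in sequentially. (q n - c 0) /\<^sub>R r n \<noteq> 0"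
    by (rule tendsto_imp_eventually_ne[OF A1]) (use T0 in auto)
  then have ev': "\<forall>\<^sub>F n in sequentially. r' n \<in> I' \<and> r' n \<noteq> 0 \<and> q n = c' (r' n)"
    using ev
  proof eventually_elim
    case (elim n)
    then obtain v where v: "v \<in> I'" "q n = c' v" by auto
    then have "r' n = v" using g by (simp add: r'_def homeomorphism_def)
    moreover have "v \<noteq> 0" using elim v c0 by auto
    ultimately show ?case using v by simp
  qed
  have "continuous_on (c' ` I') g" using g by (simp add: homeomorphism_def)
  then have "(g \<longlongrightarrow> g (c 0)) (at (c 0) within c' ` I')"
    using c0 I'(2) unfolding continuous_on_def by (metis imageI)
  moreover have g0: "g (c 0) = 0" using g c0 I'(2) by (metis homeomorphism_def)
  moreover have "filterlim q (at (c 0) within c' ` I') sequentially"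
    unfolding filterlim_at
  proof (intro conjI q_lim)
    show "\<forall>\<^sub>F n in sequentially. q n \<in> c' ` I' \<and> q n \<noteq> c 0"
      using ev' by eventually_elim (metis g0 g homeomorphism_def imageI)
  qed
  ultimately have r'_lim: "r' \<longlonglongrightarrow> 0" unfolding r'_def using filterlim_compose by fastforce
  have r'_at: "filterlim r' (at 0 within I') sequentially"
    unfolding filterlim_at using r'_lim ev' by (auto elim: eventually_mono)
  let ?B = "\<lambda>n. (q n - c 0 - r' n *\<^sub>R T' 0) /\<^sub>R (r' n)\<^sup>2"
  have "(\<lambda>n. (c' (r' n) - c' 0 - r' n *\<^sub>R T' 0) /\<^sub>R (r' n)\<^sup>2) \<longlonglongrightarrow> k' /\<^sub>R 2"
    by (rule filterlim_compose[OF arclength_taylor[OF c' I'(1,2) k'] r'_at])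
  then have B: "?B \<longlonglongrightarrow> k' /\<^sub>R 2"
    by (rule Lim_transform_eventually) (use ev' in \<open>eventually_elim; simp add: c0\<close>)
  have "(\<lambda>n. T' 0 + r' n *\<^sub>R ?B n) \<longlonglongrightarrow> T' 0 + 0 *\<^sub>R (k' /\<^sub>R 2)"
    by (intro tendsto_intros r'_lim B)
  then have "(\<lambda>n. T' 0 + r' n *\<^sub>R ?B n) \<longlonglongrightarrow> T' 0" by simp
  moreover have "\<forall>\<^sub>F n in sequentially. T' 0 + r' n *\<^sub>R ?B n = (q n - c 0) /\<^sub>R r' n"
    using ev' by eventually_elim (use expand in blast)
  ultimately have B1: "(\<lambda>n. (q n - c 0) /\<^sub>R r' n) \<longlonglongrightarrow> T' 0"
    by (rule Lim_transform_eventually)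
  have quot: "inverse a * x / (inverse b * x) = b / a" if "x \<noteq> 0" "a \<noteq> 0" "b \<noteq> 0" for a b x :: real
    using that by (simp add: field_simps)
  \<comment> \<open>The chord \<open>q n - c 0\<close>, divided by either parameter, tends to either
    tangent. Taking scalar products with \<open>T' 0\<close> gives the limit
    \<open>\<epsilon>\<close> for the ratio of the parameters, taking norms gives the limit 1 for
    its modulus. Hence the tangents agree up to sign.\<close>
  define \<rho> where "\<rho> = (\<lambda>n. r' n / r n)"
  define \<epsilon> where "\<epsilon> = T 0 \<bullet> T' 0"
  have "(\<lambda>n. (((q n - c 0) /\<^sub>R r n) \<bullet> T' 0) / (((q n - c 0) /\<^sub>R r' n) \<bullet> T' 0)) \<longlonglongrightarrow> \<epsilon> / (T' 0 \<bullet> T' 0)"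
    unfolding \<epsilon>_def using T0 by (intro tendsto_intros A1 B1) (auto simp: dot_square_norm)
  moreover have B2: "\<forall>\<^sub>F n in sequentially. ((q n - c 0) /\<^sub>R r' n) \<bullet> T' 0 \<noteq> 0"
    using tendsto_imp_eventually_ne[OF tendsto_inner[OF B1 tendsto_const[of "T' 0"]], of 0] T0 by (simp add: dot_square_norm)
  have "\<forall>\<^sub>F n in sequentially. (((q n - c 0) /\<^sub>R r n) \<bullet> T' 0) / (((q n - c 0) /\<^sub>R r' n) \<bullet> T' 0) = \<rho> n"
    using ev' B2
  proof eventually_elim
    case (elim n)
    then have "(q n - c 0) \<bullet> T' 0 \<noteq> 0" by auto
    then show ?case using elim rn0[of n] unfolding inner_scaleR_left \<rho>_def by (intro quot) auto
  qed
  ultimately have \<rho>: "\<rho> \<longlonglongrightarrow> \<epsilon>" using T0 by (auto simp: dot_square_norm intro: Lim_transform_eventually)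
  have "(\<lambda>n. norm ((q n - c 0) /\<^sub>R r n) / norm ((q n - c 0) /\<^sub>R r' n)) \<longlonglongrightarrow> norm (T 0) / norm (T' 0)"
    using T0 by (intro tendsto_intros A1 B1) auto
  moreover have "\<forall>\<^sub>F n in sequentially. norm ((q n - c 0) /\<^sub>R r n) / norm ((q n - c 0) /\<^sub>R r' n) = \<bar>\<rho> n\<bar>"
    using ev' B2
  proof eventually_elim
    case (elim n)
    then have "norm (q n - c 0) \<noteq> 0" by auto
    then show ?case using elim rn0[of n] unfolding norm_scaleR real_norm_def \<rho>_def abs_divide abs_inverse by (intro quot) auto
  qed
  ultimately have "(\<lambda>n. \<bar>\<rho> n\<bar>) \<longlonglongrightarrow> 1" using T0 by (auto intro: Lim_transform_eventually)
  moreover have "(\<lambda>n. \<bar>\<rho> n\<bar>) \<longlonglongrightarrow> \<bar>\<epsilon>\<bar>" using \<rho> by (rule tendsto_rabs)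
  ultimately have "\<bar>\<epsilon>\<bar> = 1" using LIMSEQ_unique by blast
  then have \<epsilon>2: "\<epsilon> * \<epsilon> = 1" by (metis abs_mult_self_eq mult_1)
  have "(T' 0 - \<epsilon> *\<^sub>R T 0) \<bullet> (T' 0 - \<epsilon> *\<^sub>R T 0) = T' 0 \<bullet> T' 0 - 2 * \<epsilon> * (T 0 \<bullet> T' 0) + \<epsilon> * \<epsilon> * (T 0 \<bullet> T 0)"
    by (simp add: inner_diff_left inner_diff_right inner_commute algebra_simps)
  also have "\<dots> = 0" using \<epsilon>2 T0 by (simp add: \<epsilon>_def[symmetric] dot_square_norm)
  finally have T'T: "T' 0 = \<epsilon> *\<^sub>R T 0" by simp
  \<comment> \<open>The projection orthogonal to \<open>T 0\<close> kills the linear terms of both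
    expansions. Only the squared ratio of the parameters is left, and its limit is 1.\<close>
  let ?P = "\<lambda>v. v - (v \<bullet> T 0) *\<^sub>R T 0"
  have PT: "?P (a *\<^sub>R T 0) = 0" for a using T0 by (simp add: dot_square_norm)
  have lin: "?P (a *\<^sub>R v) = a *\<^sub>R ?P v" "?P (v - w) = ?P v - ?P w" for a v w
    by (simp_all add: algebra_simps inner_diff_left)
  have eqP: "\<forall>\<^sub>F n in sequentially. ?P (?A n) = (\<rho> n)\<^sup>2 *\<^sub>R ?P (?B n)"
    using ev'
  proof eventually_elim
    case (elim n)
    have "?P (?A n) = inverse ((r n)\<^sup>2) *\<^sub>R ?P (q n - c 0)"
      unfolding lin using T0 by (simp add: dot_square_norm)
    moreover have "?P (?B n) = inverse ((r' n)\<^sup>2) *\<^sub>R ?P (q n - c 0)"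
      unfolding lin T'T scaleR_scaleR using T0 by (simp add: dot_square_norm)
    moreover have "inverse ((r n)\<^sup>2) = (\<rho> n)\<^sup>2 * inverse ((r' n)\<^sup>2)"
      using elim rn0[of n] by (simp add: \<rho>_def power_divide field_simps)
    ultimately show ?case by (simp only: scaleR_scaleR)
  qed
  have "(\<lambda>n. ?P (?A n)) \<longlonglongrightarrow> ?P (k /\<^sub>R 2)" by (intro tendsto_intros A)
  then have L1: "(\<lambda>n. (\<rho> n)\<^sup>2 *\<^sub>R ?P (?B n)) \<longlonglongrightarrow> ?P (k /\<^sub>R 2)" by (rule Lim_transform_eventually[OF _ eqP])
  have "(\<lambda>n. (\<rho> n)\<^sup>2 *\<^sub>R ?P (?B n)) \<longlonglongrightarrow> \<epsilon>\<^sup>2 *\<^sub>R ?P (k' /\<^sub>R 2)" by (intro tendsto_intros B \<rho>)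
  then have "?P (k /\<^sub>R 2) = ?P (k' /\<^sub>R 2)" using L1 LIMSEQ_unique \<epsilon>2 by (fastforce simp: power2_eq_square)
  moreover have "T 0 \<bullet> k = 0" "T' 0 \<bullet> k' = 0"
    using arclength_curvature_orthogonal c c' I I' k k' by blast+
  moreover have "\<epsilon> \<noteq> 0" using \<epsilon>2 by auto
  ultimately show ?thesis by (simp add: T'T inner_commute)
qed

section \<open>Arclength reparametrization and the curvature of regular arcs\<close>

lemma positive_antiderivative_inverse:
  fixes f :: "real \<Rightarrow> real"
  assumes f: "continuous_on UNIV f" and pos: "\<And>s. f s > 0"
  obtains S \<sigma> where "\<And>s. (S has_real_derivative f s) (at s)" "strict_mono S" "\<And>s. \<sigma> (S s) = s"
    "\<And>s. (\<sigma> has_real_derivative inverse (f s)) (at (S s))"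
proof -
  obtain S where S: "\<And>s. (S has_vector_derivative f s) (at s)"
  proof -
    obtain F where "\<forall>x. -\<infinity> < ereal x \<longrightarrow> ereal x < \<infinity> \<longrightarrow> (F has_vector_derivative f x) (at x)"
    proof -
      have "\<exists>F. \<forall>x. -\<infinity> < ereal x \<longrightarrow> ereal x < \<infinity> \<longrightarrow> (F has_vector_derivative f x) (at x)"
        using f by (intro einterval_antiderivative) (simp_all add: continuous_on_eq_continuous_at)
      then show ?thesis using that by blast
    qed
    then have "(F has_vector_derivative f s) (at s)" for s by simp
    then show ?thesis by (rule that)
  qed
  have S': "(S has_real_derivative f s) (at s)" for s
    using S by (simp add: has_real_derivative_iff_has_vector_derivative)
  have mono: "strict_mono S"
  proof (rule strict_monoI)
    fix x y :: real assume "x < y"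
    then show "S x < S y" by (rule DERIV_pos_imp_increasing) (use S' pos in blast)
  qed
  define \<sigma> where "\<sigma> = inv S"
  have inv: "\<sigma> (S s) = s" for s
    unfolding \<sigma>_def by (rule inv_f_f[OF strict_mono_imp_inj_on[OF mono]])
  have "(\<sigma> has_real_derivative inverse (f s)) (at (S s))" for s
  proof -
    have "(\<sigma> has_derivative (\<lambda>h. inverse (f s) * h)) (at (S s))"
    proof (rule has_derivative_inverse_strong[where S=UNIV and f=S and x=s])
      show "continuous_on UNIV S"
        using S' by (auto intro!: DERIV_isCont continuous_at_imp_continuous_on)
      show "(S has_derivative (*) (f s)) (at s)" using S'[of s] by (simp add: has_field_derivative_def)
      show "(*) (f s) \<circ> (\<lambda>h. inverse (f s) * h) = id" using pos[of s] by (auto simp: fun_eq_iff)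
    qed (use inv in auto)
    then show ?thesis by (simp add: has_field_derivative_def)
  qed
  then show thesis using that[of S \<sigma>] S' mono inv by blast
qed

text \<open>Curvature vector of a curve with velocity \<open>u\<close> and acceleration
  \<open>v\<close>: the part of \<open>v\<close> orthogonal to \<open>u\<close>, divided by the
  squared speed. It applies to transported curves, which are not parametrized by arclength.\<close>

definition curvature_of :: "real^3 \<Rightarrow> real^3 \<Rightarrow> real^3" where
  "curvature_of u v = (1 / (norm u)\<^sup>2) *\<^sub>R v - ((u \<bullet> v) / (norm u)^4) *\<^sub>R u"

text \<open>The derivative is two-sided on the whole line, so the arclength function and its inverse
  are differentiable even at \<open>a\<close> and \<open>b\<close>. A merely Lipschitz velocity
  leaves room for the jumps of curvature.\<close>

definition regular_arc :: "(real \<Rightarrow> real^3) \<Rightarrow> (real \<Rightarrow> real^3) \<Rightarrow> real \<Rightarrow> real \<Rightarrow> bool" where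
  "regular_arc \<gamma> \<gamma>' a b \<longleftrightarrow> a < b \<and> (\<forall>s. (\<gamma> has_vector_derivative \<gamma>' s) (at s)) \<and>
     continuous_on UNIV \<gamma>' \<and> (\<forall>s. \<gamma>' s \<noteq> 0) \<and> (\<exists>K. K-lipschitz_on {a..b} \<gamma>') \<and> inj_on \<gamma> {a..b}"

text \<open>With \<open>S\<close> the antiderivative of the speed and \<open>\<sigma>\<close> its
  inverse, \<open>c s\<close> is the arclength parametrization based at \<open>s\<close>, and
  \<open>I s J\<close> is the image of the parameter set \<open>J\<close>. For \<open>J\<close> the
  whole arc this yields a chart; for \<open>J\<close> a closed piece with end point \<open>s\<close>
  it yields a one-sided arc, on which the curvature at a junction still makes sense.\<close>

lemma regular_arc_arclength:
  assumes "regular_arc \<gamma> \<gamma>' a b"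
  obtains c I T where
    "\<And>s J. s \<in> J \<Longrightarrow> is_interval J \<Longrightarrow> is_interval (I s J)" 
    "\<And>s J. s \<in> J \<Longrightarrow> is_interval J \<Longrightarrow> J \<noteq> {s} \<Longrightarrow> I s J \<noteq> {0}"
    "\<And>s J. s \<in> J \<Longrightarrow> 0 \<in> I s J" "\<And>s. c s (0::real) = \<gamma> s" "\<And>s J. c s ` I s J = \<gamma> ` J"
    "\<And>s J. C1_arclength (c s) (I s J) (T s)"
    "\<And>s J v. s \<in> J \<Longrightarrow> (\<gamma>' has_vector_derivative v) (at s within J) \<Longrightarrow>
       (T s has_vector_derivative curvature_of (\<gamma>' s) v) (at 0 within I s J)"
    "\<And>s. s \<in> {a..b} \<Longrightarrow> \<exists>K. K-lipschitz_on (I s {a..b}) (T s)"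
    "\<And>s. s \<in> {a..b} \<Longrightarrow> \<exists>g. homeomorphism (I s {a..b}) (\<gamma> ` {a..b}) (c s) g"
proof -
  have g: "a < b" "\<And>s. (\<gamma> has_vector_derivative \<gamma>' s) (at s)" "continuous_on UNIV \<gamma>'" "\<And>s. \<gamma>' s \<noteq> 0"
    "inj_on \<gamma> {a..b}" and lip: "\<exists>K. K-lipschitz_on {a..b} \<gamma>'"
    using assms by (auto simp: regular_arc_def)
  obtain S \<sigma> where S: "\<And>s. (S has_real_derivative norm (\<gamma>' s)) (at s)" "strict_mono S" "\<And>s. \<sigma> (S s) = s"
    "\<And>s. (\<sigma> has_real_derivative inverse (norm (\<gamma>' s))) (at (S s))"
    using positive_antiderivative_inverse[of "\<lambda>s. norm (\<gamma>' s)"] g(3,4) by (auto intro: continuous_on_norm)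
  define c where "c = (\<lambda>s r. \<gamma> (\<sigma> (S s + r)))"
  define I where "I = (\<lambda>s J. (\<lambda>u. S u - S s) ` J)"
  define T where "T = (\<lambda>s r. sgn (\<gamma>' (\<sigma> (S s + r))))"
  have contS: "continuous_on X S" for X
    using S(1) by (auto intro!: DERIV_isCont continuous_at_imp_continuous_on)
  have \<sigma>r: "(\<lambda>r. \<sigma> (S s + r)) ` I s J = J" for s J
    by (simp add: I_def image_image S(3))
  have d\<sigma>: "((\<lambda>r. \<sigma> (S s + r)) has_real_derivative inverse (norm (\<gamma>' u))) (at (S u - S s) within X)" for s u X
  proof -
    have "(\<sigma> has_real_derivative inverse (norm (\<gamma>' u))) (at ((S u - S s) + S s))" using S(4) by simp
    then have "((\<lambda>r. \<sigma> (r + S s)) has_real_derivative inverse (norm (\<gamma>' u))) (at (S u - S s))"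
      using DERIV_shift[of \<sigma> _ "S u - S s" "S s"] by blast
    then show ?thesis by (simp add: add.commute has_field_derivative_at_within)
  qed
  have I_int: "is_interval (I s J)" if "is_interval J" for s J
    unfolding I_def using that
    by (intro is_interval_connected_1[THEN iffD2] connected_continuous_image)
      (auto intro!: continuous_intros contS simp: is_interval_connected_1)
  have I0: "0 \<in> I s J" if "s \<in> J" for s J using that by (auto simp: I_def image_iff)
  have I_ne: "I s J \<noteq> {0}" if sJ: "s \<in> J" "J \<noteq> {s}" for s J
  proof -
    obtain u where u: "u \<in> J" "u \<noteq> s" using sJ by blast
    then have "S u \<noteq> S s" using strict_mono_eq[OF S(2)] by auto
    moreover have "S u - S s \<in> I s J" unfolding I_def using u by blast
    ultimately show ?thesis by (metis singletonD right_minus_eq)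
  qed
  have cI: "c s ` I s J = \<gamma> ` J" for s J by (simp add: I_def c_def image_image S(3))
  have c0: "c s 0 = \<gamma> s" for s by (simp add: c_def S(3))
  have contT: "continuous_on (I s J) (T s)" for s J
  proof -
    have "continuous_on (I s J) (\<lambda>r. \<sigma> (S s + r))"
      unfolding continuous_on_eq_continuous_within
    proof
      fix r assume "r \<in> I s J"
      then obtain u where "r = S u - S s" by (auto simp: I_def)
      then show "continuous (at r within I s J) (\<lambda>r. \<sigma> (S s + r))"
        using d\<sigma> DERIV_continuous by blast
    qed
    then have "continuous_on (I s J) (\<lambda>r. \<gamma>' (\<sigma> (S s + r)))"
      by (rule continuous_on_compose2[OF g(3)]) auto
    then show ?thesis unfolding T_def using g(4) by (intro continuous_on_sgn) auto
  qed
  have arc: "C1_arclength (c s) (I s J) (T s)" for s J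
    unfolding C1_arclength_def
  proof (intro conjI ballI contT)
    fix r assume "r \<in> I s J"
    then obtain u where u: "r = S u - S s" by (auto simp: I_def)
    show "norm (T s r) = 1" using g(4) by (simp add: T_def norm_sgn)
    have 1: "((\<lambda>r. \<sigma> (S s + r)) has_vector_derivative inverse (norm (\<gamma>' u))) (at r within I s J)"
      using d\<sigma> u by (simp add: has_real_derivative_iff_has_vector_derivative)
    have 2: "(\<gamma> has_vector_derivative \<gamma>' u) (at (\<sigma> (S s + r)) within (\<lambda>r. \<sigma> (S s + r)) ` I s J)"
      using g(2)[of u] u S(3) by (auto intro: has_vector_derivative_at_within)
    from vector_diff_chain_within[OF 1 2]
    show "(c s has_vector_derivative T s r) (at r within I s J)"
      using u S(3) by (simp add: o_def c_def[abs_def] T_def sgn_div_norm)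
  qed
  have T': "(T s has_vector_derivative curvature_of (\<gamma>' s) v) (at 0 within I s J)"
    if s: "s \<in> J" and v: "(\<gamma>' has_vector_derivative v) (at s within J)" for s J v
  proof -
    have 1: "((\<lambda>r. \<sigma> (S s + r)) has_vector_derivative inverse (norm (\<gamma>' s))) (at 0 within I s J)"
      using d\<sigma>[of s s] by (simp add: has_real_derivative_iff_has_vector_derivative)
    have n: "norm (\<gamma>' s) \<noteq> 0" using g(4) by simp
    have "((\<lambda>u. norm (\<gamma>' u)) has_derivative (\<lambda>h. (h *\<^sub>R v) \<bullet> sgn (\<gamma>' s))) (at s within J)"
      using has_derivative_compose[OF v[unfolded has_vector_derivative_def] has_derivative_norm[OF g(4)]] .
    then have nd: "((\<lambda>u. norm (\<gamma>' u)) has_real_derivative (v \<bullet> sgn (\<gamma>' s))) (at s within J)"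
    proof -
      have "(\<lambda>h. (h *\<^sub>R v) \<bullet> sgn (\<gamma>' s)) = (*) (v \<bullet> sgn (\<gamma>' s))" by (auto simp: fun_eq_iff)
      then show ?thesis using \<open>((\<lambda>u. norm (\<gamma>' u)) has_derivative _) _\<close> by (simp add: has_field_derivative_def)
    qed
    have "((\<lambda>u. inverse (norm (\<gamma>' u))) has_real_derivative - ((v \<bullet> sgn (\<gamma>' s)) * inverse ((norm (\<gamma>' s))\<^sup>2))) (at s within J)"
      using DERIV_inverse_fun[OF nd n] by (simp add: power2_eq_square mult.assoc)
    from has_vector_derivative_scaleR[OF this v]
    have 2: "((\<lambda>u. sgn (\<gamma>' u)) has_vector_derivative
      inverse (norm (\<gamma>' s)) *\<^sub>R v + - ((v \<bullet> sgn (\<gamma>' s)) * inverse ((norm (\<gamma>' s))\<^sup>2)) *\<^sub>R \<gamma>' s) (at s within J)"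
      by (simp add: sgn_div_norm)
    have "((\<lambda>u. sgn (\<gamma>' u)) \<circ> (\<lambda>r. \<sigma> (S s + r)) has_vector_derivative inverse (norm (\<gamma>' s)) *\<^sub>R
      (inverse (norm (\<gamma>' s)) *\<^sub>R v + - ((v \<bullet> sgn (\<gamma>' s)) * inverse ((norm (\<gamma>' s))\<^sup>2)) *\<^sub>R \<gamma>' s)) (at 0 within I s J)"
      by (rule vector_diff_chain_within[OF 1]) (use 2 in \<open>simp add: \<sigma>r S(3)\<close>)
    moreover have "inverse (norm (\<gamma>' s)) *\<^sub>R
      (inverse (norm (\<gamma>' s)) *\<^sub>R v + - ((v \<bullet> sgn (\<gamma>' s)) * inverse ((norm (\<gamma>' s))\<^sup>2)) *\<^sub>R \<gamma>' s)
      = curvature_of (\<gamma>' s) v"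
    proof -
      have "inverse (norm (\<gamma>' s)) * inverse (norm (\<gamma>' s)) = 1 / (norm (\<gamma>' s))\<^sup>2"
        by (simp add: power2_eq_square divide_inverse)
      moreover have "inverse (norm (\<gamma>' s)) * (- ((v \<bullet> sgn (\<gamma>' s)) * inverse ((norm (\<gamma>' s))\<^sup>2))) = - ((\<gamma>' s \<bullet> v) / (norm (\<gamma>' s))^4)"
        using n by (simp add: sgn_div_norm inner_commute power2_eq_square power4_eq_xxxx field_simps)
      ultimately show ?thesis
        unfolding scaleR_add_right scaleR_scaleR curvature_of_def by (simp only: scaleR_minus_left) simp
    qed
    ultimately show ?thesis by (simp add: T_def o_def)
  qed
  \<comment> \<open>A positive lower bound of the speed makes both the inverse of arclength and the
    normalization of the velocity Lipschitz.\<close>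
  obtain m where m: "m > 0" "\<And>s. s \<in> {a..b} \<Longrightarrow> m \<le> norm (\<gamma>' s)"
  proof -
    have "continuous_on {a..b} (\<lambda>s. norm (\<gamma>' s))" using g(3) by (auto intro: continuous_on_subset continuous_on_norm)
    then obtain s0 where "s0 \<in> {a..b}" "\<And>s. s \<in> {a..b} \<Longrightarrow> norm (\<gamma>' s0) \<le> norm (\<gamma>' s)"
      using continuous_attains_inf[OF compact_Icc, of a b] g(1) by (metis atLeastAtMost_iff empty_iff less_eq_real_def)
    then show thesis using that[of "norm (\<gamma>' s0)"] g(4) by auto
  qed
  have S_lower: "m * \<bar>u - w\<bar> \<le> \<bar>S u - S w\<bar>" if "u \<in> {a..b}" "w \<in> {a..b}" for u w
  proof -
    have *: "m * (y - x) \<le> S y - S x" if xy: "x \<in> {a..b}" "y \<in> {a..b}" "x < y" for x y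
    proof -
      obtain z where "x < z" "z < y" "S y - S x = (y - x) * norm (\<gamma>' z)"
        using MVT2[of x y S "\<lambda>s. norm (\<gamma>' s)"] xy S(1) by blast
      then show ?thesis using m(2)[of z] xy by (auto simp: mult.commute intro: mult_left_mono)
    qed
    show ?thesis using *[of u w] *[of w u] that strict_mono_less[OF S(2), of u w] strict_mono_less[OF S(2), of w u]
      by (cases u w rule: linorder_cases) (auto simp: abs_real_def)
  qed
  have lipT: "\<exists>K. K-lipschitz_on (I s {a..b}) (T s)" for s
  proof -
    obtain K where K: "K-lipschitz_on {a..b} \<gamma>'" using lip by blast
    have K0: "K \<ge> 0" using K by (simp add: lipschitz_on_def)
    have "(2 * K / (m * m))-lipschitz_on (I s {a..b}) (T s)"
    proof (rule lipschitz_onI)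
      fix x y assume "x \<in> I s {a..b}" "y \<in> I s {a..b}"
      then obtain u w where uw: "u \<in> {a..b}" "w \<in> {a..b}" "x = S u - S s" "y = S w - S s" by (auto simp: I_def)
      have nz: "norm (\<gamma>' u) > 0" "norm (\<gamma>' w) > 0" using g(4) by auto
      have "sgn (\<gamma>' u) - sgn (\<gamma>' w) = (1 / norm (\<gamma>' u)) *\<^sub>R ((\<gamma>' u - \<gamma>' w) + (norm (\<gamma>' w) - norm (\<gamma>' u)) *\<^sub>R sgn (\<gamma>' w))"
        using nz by (simp add: sgn_div_norm algebra_simps divide_inverse)
      then have "norm (sgn (\<gamma>' u) - sgn (\<gamma>' w)) = norm ((\<gamma>' u - \<gamma>' w) + (norm (\<gamma>' w) - norm (\<gamma>' u)) *\<^sub>R sgn (\<gamma>' w)) / norm (\<gamma>' u)"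
        by simp
      also have "\<dots> \<le> (2 * norm (\<gamma>' u - \<gamma>' w)) / norm (\<gamma>' u)"
      proof (rule divide_right_mono)
        have "norm ((norm (\<gamma>' w) - norm (\<gamma>' u)) *\<^sub>R sgn (\<gamma>' w)) \<le> norm (\<gamma>' u - \<gamma>' w)"
          using g(4) norm_triangle_ineq3[of "\<gamma>' u" "\<gamma>' w"] by (simp add: norm_sgn abs_minus_commute)
        then show "norm ((\<gamma>' u - \<gamma>' w) + (norm (\<gamma>' w) - norm (\<gamma>' u)) *\<^sub>R sgn (\<gamma>' w)) \<le> 2 * norm (\<gamma>' u - \<gamma>' w)"
          using norm_triangle_ineq[of "\<gamma>' u - \<gamma>' w" "(norm (\<gamma>' w) - norm (\<gamma>' u)) *\<^sub>R sgn (\<gamma>' w)"] by linarith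
      qed simp
      also have "\<dots> \<le> (2 * (K * \<bar>u - w\<bar>)) / m"
        using lipschitz_onD[OF K uw(1,2)] m(1) m(2)[OF uw(1)] K0
        by (intro frac_le) (auto simp: dist_norm)
      also have "\<dots> \<le> (2 * (K * (\<bar>S u - S w\<bar> / m))) / m"
        using S_lower[OF uw(1,2)] m(1) K0
        by (intro divide_right_mono mult_left_mono) (auto simp: field_simps)
      finally show "dist (T s x) (T s y) \<le> 2 * K / (m * m) * dist x y"
        using uw S(3) by (simp add: T_def dist_norm)
    qed (use K0 m in simp)
    then show ?thesis by blast
  qed
  have hom: "\<exists>g. homeomorphism (I s {a..b}) (\<gamma> ` {a..b}) (c s) g" if "s \<in> {a..b}" for s
  proof (rule homeomorphism_compact)
    show "compact (I s {a..b})" unfolding I_def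
      by (intro compact_continuous_image) (auto intro!: continuous_intros contS)
    show "continuous_on (I s {a..b}) (c s)"
      using arc[of s "{a..b}"] unfolding C1_arclength_def
      by (auto simp: continuous_on_eq_continuous_within intro: has_vector_derivative_continuous)
    show "c s ` I s {a..b} = \<gamma> ` {a..b}" by (rule cI)
    show "inj_on (c s) (I s {a..b})"
      using g(5) by (auto simp: inj_on_def I_def c_def S(3))
  qed
  show thesis
  proof (rule that)
    show "\<And>s J. s \<in> J \<Longrightarrow> is_interval J \<Longrightarrow> is_interval (I s J)" by (rule I_int)
    show "\<And>s J. s \<in> J \<Longrightarrow> is_interval J \<Longrightarrow> J \<noteq> {s} \<Longrightarrow> I s J \<noteq> {0}" by (rule I_ne)
    show "\<And>s. s \<in> {a..b} \<Longrightarrow> \<exists>K. K-lipschitz_on (I s {a..b}) (T s)" by (rule lipT)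
  qed (fact I0 c0 cI arc T' hom)+
qed

text \<open>By \<open>curvature_unique\<close> every arc inside \<open>L\<close> through the point,
  even a one-sided one, dictates the value. Membership in \<open>twice_diff_points\<close> supplies
  the existence behind \<open>THE\<close>.\<close>

lemma curvature_vector_eq:
  assumes "C1_arclength c I T" "is_interval I" "0 \<in> I" "I \<noteq> {0}" "c ` I \<subseteq> L"
    "(T has_vector_derivative k) (at 0 within I)" "c 0 \<in> twice_diff_points L"
  shows "curvature_vector L (c 0) = k"
proof -
  have uniq: "has_curvature_vector L (c 0) k' \<Longrightarrow> k' = k" for k'
    using curvature_unique[OF assms(1-6)] unfolding has_curvature_vector_def by metis
  obtain k' where "has_curvature_vector L (c 0) k'" using assms(7) by (auto simp: twice_diff_points_def)
  then show ?thesis unfolding curvature_vector_def using uniq by (metis the_equality)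
qed

text \<open>The piece \<open>{p..q}\<close> gives an arc that determines the curvature vector
  wherever there is one. In its interior the second derivative is two-sided, and there the whole arc
  serves as a twice differentiable chart.\<close>

lemma regular_arc_curvature:
  assumes reg: "regular_arc \<gamma> \<gamma>' a b" and op: "openin (top_of_set L) (\<gamma> ` {a..b})"
    and pq: "p < q" "{p..q} \<subseteq> {a..b}" and s: "s \<in> {p..q}"
    and v: "(\<gamma>' has_vector_derivative v) (at s within {p..q})"
  shows "\<gamma> s \<in> twice_diff_points L \<Longrightarrow> curvature_vector L (\<gamma> s) = curvature_of (\<gamma>' s) v"
    and "s \<in> {p<..<q} \<Longrightarrow> \<gamma> s \<in> twice_diff_points L"
proof -
  obtain c I T where *:
    "\<And>s J. s \<in> J \<Longrightarrow> is_interval J \<Longrightarrow> is_interval (I s J)" 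
    "\<And>s J. s \<in> J \<Longrightarrow> is_interval J \<Longrightarrow> J \<noteq> {s} \<Longrightarrow> I s J \<noteq> {0}"
    "\<And>s J. s \<in> J \<Longrightarrow> 0 \<in> I s J" "\<And>s. c s (0::real) = \<gamma> s" "\<And>s J. c s ` I s J = \<gamma> ` J"
    "\<And>s J. C1_arclength (c s) (I s J) (T s)"
    "\<And>s J v. s \<in> J \<Longrightarrow> (\<gamma>' has_vector_derivative v) (at s within J) \<Longrightarrow>
       (T s has_vector_derivative curvature_of (\<gamma>' s) v) (at 0 within I s J)"
    "\<And>s. s \<in> {a..b} \<Longrightarrow> \<exists>K. K-lipschitz_on (I s {a..b}) (T s)"
    "\<And>s. s \<in> {a..b} \<Longrightarrow> \<exists>g. homeomorphism (I s {a..b}) (\<gamma> ` {a..b}) (c s) g"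
    by (rule regular_arc_arclength[OF reg], rule that)
  have iv: "is_interval {x..y::real}" for x y by (rule is_interval_cc)
  have ne: "{p..q} \<noteq> {s}" "{a..b} \<noteq> {s}"
    using pq(1) subsetD[OF pq(2), of p] subsetD[OF pq(2), of q] by (auto simp: atLeastAtMost_singleton_iff)
  have sub: "\<gamma> ` {a..b} \<subseteq> L" using op by (simp add: openin_imp_subset)
  have sab: "s \<in> {a..b}" using s pq by blast
  show "curvature_vector L (\<gamma> s) = curvature_of (\<gamma>' s) v" if tw: "\<gamma> s \<in> twice_diff_points L"
  proof -
    have "curvature_vector L (c s 0) = curvature_of (\<gamma>' s) v"
    proof (rule curvature_vector_eq)
      show "C1_arclength (c s) (I s {p..q}) (T s)" by (rule *)
      show "c s ` I s {p..q} \<subseteq> L" using sub pq *(5) by (metis image_mono order.trans)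
      show "c s 0 \<in> twice_diff_points L" using tw *(4) by simp
    qed (use * s iv ne v in simp_all)
    then show ?thesis using *(4) by simp
  qed
  show "\<gamma> s \<in> twice_diff_points L" if int: "s \<in> {p<..<q}"
  proof -
    have "at s within {p..q} = at s"
      using at_within_interior[of s "{p..q}"] int by simp
    then have v': "(\<gamma>' has_vector_derivative v) (at s within {a..b})"
      using v has_vector_derivative_at_within by simp
    have "C11_chart_at L (\<gamma> s) (c s) (I s {a..b}) (T s)"
      unfolding C11_chart_at_def C11_arclength_def
      using * sab iv ne op by simp
    then have "has_curvature_vector L (\<gamma> s) (curvature_of (\<gamma>' s) v)"
      unfolding has_curvature_vector_def using *(7)[OF sab v'] by blast
    then show ?thesis using sub sab by (auto simp: twice_diff_points_def)
  qed
qed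

text \<open>\<open>A\<close> indexes the components and \<open>P\<close> the closed pieces. No twice
  differentiable point has curvature above \<open>M\<close>, and the value \<open>M\<close> at
  \<open>s0\<close> is approached by interior points of its piece, even if \<open>s0\<close> itself
  is a junction. So the punctured \<open>Limsup\<close> equals \<open>M\<close> there.\<close>

lemma INF_rho:
  fixes P :: "'i set" and p q :: "'i \<Rightarrow> real" and \<gamma> \<gamma>' :: "'j \<Rightarrow> real \<Rightarrow> real^3"
  assumes reg: "\<And>j. j \<in> A \<Longrightarrow> regular_arc (\<gamma> j) (\<gamma>' j) a b"
    and op: "\<And>j. j \<in> A \<Longrightarrow> openin (top_of_set L) (\<gamma> j ` {a..b})"
    and L: "L = (\<Union>j\<in>A. \<gamma> j ` {a..b})"
    and pq: "\<And>i. i \<in> P \<Longrightarrow> p i < q i" and cover: "(\<Union>i\<in>P. {p i..q i}) = {a..b}"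
    and d2: "\<And>i j s. i \<in> P \<Longrightarrow> j \<in> A \<Longrightarrow> s \<in> {p i..q i} \<Longrightarrow> (\<gamma>' j has_vector_derivative \<gamma>'' i j s) (at s within {p i..q i})"
    and c2: "\<And>i j. i \<in> P \<Longrightarrow> j \<in> A \<Longrightarrow> continuous_on {p i..q i} (\<gamma>'' i j)"
    and le: "\<And>i j s. i \<in> P \<Longrightarrow> j \<in> A \<Longrightarrow> s \<in> {p i..q i} \<Longrightarrow> norm (curvature_of (\<gamma>' j s) (\<gamma>'' i j s)) \<le> M"
    and att: "i0 \<in> P" "j0 \<in> A" "s0 \<in> {p i0..q i0}" "norm (curvature_of (\<gamma>' j0 s0) (\<gamma>'' i0 j0 s0)) = M"
    and M: "M > 0"
  shows "(INF x\<in>L. rho L x) = ereal (1 / M)"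
proof -
  let ?k = "\<lambda>y. ereal (norm (curvature_vector L y))"
  let ?F = "\<lambda>x. at x within twice_diff_points L"
  have sub: "{p i..q i} \<subseteq> {a..b}" if "i \<in> P" for i using cover that by blast
  have key: "curvature_vector L (\<gamma> j s) = curvature_of (\<gamma>' j s) (\<gamma>'' i j s)"
    if "i \<in> P" "j \<in> A" "s \<in> {p i..q i}" "\<gamma> j s \<in> twice_diff_points L" for i j s
    by (rule regular_arc_curvature(1)[OF reg op pq sub _ d2]) (use that in auto)
  have key2: "\<gamma> j s \<in> twice_diff_points L" if "i \<in> P" "j \<in> A" "s \<in> {p i<..<q i}" for i j s
    by (rule regular_arc_curvature(2)[OF reg op pq sub _ d2]) (use that in auto)
  have loc: "\<exists>i\<in>P. \<exists>j\<in>A. \<exists>s\<in>{p i..q i}. x = \<gamma> j s" if x: "x \<in> L" for x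
  proof -
    obtain j s where js: "j \<in> A" "s \<in> {a..b}" "x = \<gamma> j s" using x L by blast
    moreover obtain i where "i \<in> P" "s \<in> {p i..q i}" using js(2) cover by blast
    ultimately show ?thesis by blast
  qed
  have fl: "filterlim (\<gamma> j) (?F (\<gamma> j s)) (at s within {p i<..<q i})" 
    and nb: "at s within {p i<..<q i} \<noteq> bot"
    if ijs: "i \<in> P" "j \<in> A" "s \<in> {p i..q i}" for i j s
  proof -
    have "(\<gamma> j has_vector_derivative \<gamma>' j s) (at s)" using reg[OF ijs(2)] by (simp add: regular_arc_def)
    then have "isCont (\<gamma> j) s" by (rule has_vector_derivative_continuous)
    then have lim: "(\<gamma> j \<longlongrightarrow> \<gamma> j s) (at s within {p i<..<q i})"
      by (simp add: isCont_def tendsto_within_subset[of _ _ _ UNIV])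
    have inj: "inj_on (\<gamma> j) {a..b}" using reg[OF ijs(2)] by (simp add: regular_arc_def)
    show "filterlim (\<gamma> j) (?F (\<gamma> j s)) (at s within {p i<..<q i})"
      unfolding filterlim_at
    proof (intro conjI lim)
      have "\<gamma> j u \<in> twice_diff_points L \<and> \<gamma> j u \<noteq> \<gamma> j s" if u: "u \<in> {p i<..<q i}" "u \<noteq> s" for u
      proof
        show "\<gamma> j u \<in> twice_diff_points L" using key2 ijs u by blast
        have "u \<in> {a..b}" "s \<in> {a..b}" using sub[OF ijs(1)] u(1) ijs(3) by auto
        then show "\<gamma> j u \<noteq> \<gamma> j s" using inj u(2) by (meson inj_onD)
      qed
      then show "\<forall>\<^sub>F u in at s within {p i<..<q i}. \<gamma> j u \<in> twice_diff_points L \<and> \<gamma> j u \<noteq> \<gamma> j s"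
        unfolding eventually_at_filter by (intro always_eventually) blast
    qed
    have "s islimpt {p i<..<q i}"
    proof (cases "s = p i")
      case True
      then show ?thesis using islimpt_greaterThanLessThan1[OF pq[OF ijs(1)]] by simp
    next
      case False
      then have "s islimpt {p i<..<s}" using ijs(3) by (intro islimpt_greaterThanLessThan2) simp
      then show ?thesis by (rule islimpt_subset) (use ijs(3) in auto)
    qed
    then show "at s within {p i<..<q i} \<noteq> bot" by (simp add: trivial_limit_within)
  qed
  \<comment> \<open>Over the trivial filter \<open>Limsup\<close> would be minus infinity.
    Nontriviality gives \<open>0 \<le> Limsup\<close>, without which \<open>inverse\<close> is not
    antitone on \<open>ereal\<close>.\<close>
  have nontriv: "?F x \<noteq> bot" if x: "x \<in> L" for x
  proof -
    obtain i j s where ijs: "i \<in> P" "j \<in> A" "s \<in> {p i..q i}" "x = \<gamma> j s" using loc[OF x] by blast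
    show ?thesis using filterlim_mono_eventually fl[OF ijs(1-3)] nb[OF ijs(1-3)] unfolding ijs(4)
      by (metis filterlim_def filtermap_bot_iff bot.extremum_uniqueI)
  qed
  have k_le: "?k y \<le> ereal M" if "y \<in> twice_diff_points L" for y
  proof -
    have "y \<in> L" using that by (simp add: twice_diff_points_def)
    then obtain i j s where "i \<in> P" "j \<in> A" "s \<in> {p i..q i}" "y = \<gamma> j s" using loc by blast
    then show ?thesis using key le that by simp
  qed
  have Ls: "0 \<le> Limsup (?F x) ?k" "Limsup (?F x) ?k \<le> ereal M" if "x \<in> L" for x
  proof -
    show "Limsup (?F x) ?k \<le> ereal M"
      by (rule Limsup_bounded) (use k_le in \<open>auto simp: eventually_at_filter\<close>)
    show "0 \<le> Limsup (?F x) ?k"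
      by (rule le_Limsup[OF nontriv[OF that]]) (auto intro: always_eventually)
  qed
  let ?x0 = "\<gamma> j0 s0"
  have x0: "?x0 \<in> L" using att L sub by blast
  have "ereal M \<le> Limsup (?F ?x0) ?k"
    unfolding Limsup_def
  proof (rule INF_greatest)
    fix Q assume "Q \<in> {Q. eventually Q (?F ?x0)}"
    then have "\<forall>\<^sub>F u in at s0 within {p i0<..<q i0}. Q (\<gamma> j0 u)"
      using fl[OF att(1-3)] by (simp add: filterlim_iff)
    moreover have "\<forall>\<^sub>F u in at s0 within {p i0<..<q i0}. u \<in> {p i0<..<q i0}"
      by (simp add: eventually_at_filter)
    ultimately have ev: "\<forall>\<^sub>F u in at s0 within {p i0<..<q i0}.
        ereal (norm (curvature_of (\<gamma>' j0 u) (\<gamma>'' i0 j0 u))) \<le> (SUP y\<in>Collect Q. ?k y)"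
    proof eventually_elim
      case (elim u)
      then have "curvature_vector L (\<gamma> j0 u) = curvature_of (\<gamma>' j0 u) (\<gamma>'' i0 j0 u)"
        using key[OF att(1,2)] key2[OF att(1,2)] by auto
      then have "ereal (norm (curvature_of (\<gamma>' j0 u) (\<gamma>'' i0 j0 u))) = ?k (\<gamma> j0 u)" by simp
      also have "\<dots> \<le> (SUP y\<in>Collect Q. ?k y)" using elim by (intro SUP_upper) auto
      finally show ?case .
    qed
    have "continuous_on UNIV (\<gamma>' j0)" using reg[OF att(2)] by (simp add: regular_arc_def)
    then have cg: "continuous_on {p i0..q i0} (\<gamma>' j0)" by (rule continuous_on_subset) simp
    have nz: "\<gamma>' j0 s \<noteq> 0" for s using reg[OF att(2)] by (simp add: regular_arc_def)
    have "continuous_on {p i0..q i0} (\<lambda>s. norm (curvature_of (\<gamma>' j0 s) (\<gamma>'' i0 j0 s)))"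
      unfolding curvature_of_def using nz
      by (intro continuous_intros cg c2 att) auto
    then have "((\<lambda>s. norm (curvature_of (\<gamma>' j0 s) (\<gamma>'' i0 j0 s))) \<longlongrightarrow> M) (at s0 within {p i0..q i0})"
      using att(3,4) by (auto simp: continuous_on_def)
    then have "((\<lambda>s. norm (curvature_of (\<gamma>' j0 s) (\<gamma>'' i0 j0 s))) \<longlongrightarrow> M) (at s0 within {p i0<..<q i0})"
      by (rule tendsto_within_subset) auto
    then show "ereal M \<le> (SUP y\<in>Collect Q. ?k y)"
      by (intro tendsto_upperbound[OF _ ev nb[OF att(1-3)]]) simp
  qed
  then have eq: "Limsup (?F ?x0) ?k = ereal M" using Ls(2)[OF x0] by simp
  have M': "inverse (ereal M) = ereal (1 / M)" using M by (simp add: inverse_eq_divide)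
  show ?thesis
  proof (rule antisym)
    have "rho L ?x0 = ereal (1/M)" unfolding rho_def eq M' ..
    then show "(INF x\<in>L. rho L x) \<le> ereal (1 / M)" using INF_lower[OF x0, of "rho L"] by simp
    show "ereal (1 / M) \<le> (INF x\<in>L. rho L x)"
    proof (rule INF_greatest)
      fix x assume x: "x \<in> L"
      show "ereal (1 / M) \<le> rho L x"
        unfolding rho_def M'[symmetric] using Ls[OF x] by (rule ereal_inverse_antimono)
    qed
  qed
qed

section \<open>Flows\<close>

text \<open>Two mean value inequalities: in time,
  \<open>D t z - D 0 z - t *\<^sub>R W (0, x)\<close> is at most \<open>e * \<bar>t\<bar>\<close>;
  in space, this bounds the difference of \<open>f t - f 0 - t *\<^sub>R W (0, x)\<close> between
  two points. Division by t and the limit t to 0 replace \<open>f\<close> by its velocity.\<close>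

lemma mixed_partial:
  fixes f :: "real \<Rightarrow> 'a::real_normed_vector \<Rightarrow> 'b::real_normed_vector" and D :: "real \<Rightarrow> 'a \<Rightarrow> 'a \<Rightarrow>\<^sub>L 'b"
  assumes \<epsilon>: "0 < \<epsilon>"
    and D: "\<And>t x. \<bar>t\<bar> < \<epsilon> \<Longrightarrow> (f t has_derivative D t x) (at x)"
    and V: "\<And>x. ((\<lambda>u. f u x) has_vector_derivative V x) (at 0)"
    and W: "\<And>t x. \<bar>t\<bar> < \<epsilon> \<Longrightarrow> ((\<lambda>u. D u x) has_vector_derivative W (t, x)) (at t)"
    and cont: "continuous_on ({-\<epsilon><..<\<epsilon>} \<times> UNIV) W"
  shows "(V has_derivative W (0, x)) (at x)"
  unfolding has_derivative_within_alt
proof (intro conjI allI impI blinfun.bounded_linear_right)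
  fix e :: real assume e: "0 < e"
  have "open ({-\<epsilon><..<\<epsilon>} \<times> (UNIV :: 'a set))" by (simp add: open_Times)
  then have "isCont W (0, x)" using cont \<epsilon> by (simp add: continuous_on_eq_continuous_at)
  then obtain d0 where d0: "d0 > 0" "\<And>z. dist z (0, x) < d0 \<Longrightarrow> dist (W z) (W (0, x)) < e"
    using e unfolding continuous_at_eps_delta by blast
  define d where "d = min (d0 / 2) (\<epsilon> / 2)"
  have d: "d > 0" "d < \<epsilon>" using d0 \<epsilon> by (auto simp: d_def)
  have W_near: "norm (W (t, y) - W (0, x)) \<le> e" if "\<bar>t\<bar> < d" "norm (y - x) < d" for t y
  proof -
    have "dist (t, y) (0, x) \<le> dist t 0 + dist y x"
      unfolding dist_Pair_Pair by (rule sqrt_sum_squares_le_sum) auto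
    also have "\<dots> < d0" using that by (auto simp: d_def dist_norm)
    finally show ?thesis using d0(2)[of "(t, y)"] by (simp add: dist_norm less_imp_le)
  qed
  have "norm (V y - V x - W (0, x) (y - x)) \<le> e * norm (y - x)" if y: "norm (y - x) < d" for y
  proof -
    have *: "norm ((f t y - f 0 y - t *\<^sub>R W (0, x) y) - (f t x - f 0 x - t *\<^sub>R W (0, x) x)) \<le> e * \<bar>t\<bar> * norm (y - x)"
      if t: "\<bar>t\<bar> < d" for t
    proof (rule differentiable_bound[where S="ball x d" and f'="\<lambda>z. blinfun_apply (D t z - D 0 z - t *\<^sub>R W (0, x))"])
      fix z assume z: "z \<in> ball x d"
      show "((\<lambda>y. f t y - f 0 y - t *\<^sub>R W (0, x) y) has_derivative blinfun_apply (D t z - D 0 z - t *\<^sub>R W (0, x))) (at z within ball x d)"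
        unfolding blinfun.diff_left blinfun.scaleR_left
        using t d \<epsilon>
        by (intro has_derivative_diff has_derivative_scaleR_right has_derivative_at_withinI[OF D]
            bounded_linear_imp_has_derivative blinfun.bounded_linear_right) simp_all
      have "norm ((D t z - t *\<^sub>R W (0, x)) - (D 0 z - 0 *\<^sub>R W (0, x))) \<le> e * norm (t - 0)"
      proof (rule differentiable_bound[where S="closed_segment 0 t" and f'="\<lambda>u h. h *\<^sub>R (W (u, z) - W (0, x))"])
        fix u assume "u \<in> closed_segment 0 t"
        then have u: "\<bar>u\<bar> < d" using t by (auto simp: closed_segment_eq_real_ivl split: if_splits)
        have "((\<lambda>u. u *\<^sub>R W (0, x)) has_vector_derivative 1 *\<^sub>R W (0, x)) (at u)"
          using has_vector_derivative_scaleR[OF DERIV_ident has_vector_derivative_const] by simp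
        then have "((\<lambda>u. D u z - u *\<^sub>R W (0, x)) has_vector_derivative W (u, z) - 1 *\<^sub>R W (0, x)) (at u)"
          using u d by (intro has_vector_derivative_diff W) auto
        then show "((\<lambda>u. D u z - u *\<^sub>R W (0, x)) has_derivative (\<lambda>h. h *\<^sub>R (W (u, z) - W (0, x)))) (at u within closed_segment 0 t)"
          by (simp add: has_vector_derivative_def has_derivative_at_withinI)
        have "norm (W (u, z) - W (0, x)) \<le> e" using u z by (intro W_near) (auto simp: dist_norm norm_minus_commute)
        then show "onorm (\<lambda>h. h *\<^sub>R (W (u, z) - W (0, x))) \<le> e"
          by (intro onorm_le) (simp add: mult.commute[of e] mult_left_mono)
      qed auto
      then have "norm (D t z - D 0 z - t *\<^sub>R W (0, x)) \<le> e * \<bar>t\<bar>" by (simp add: algebra_simps)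
      then show "onorm (blinfun_apply (D t z - D 0 z - t *\<^sub>R W (0, x))) \<le> e * \<bar>t\<bar>"
        by (simp only: norm_blinfun.rep_eq)
    qed (use y d in \<open>auto simp: dist_norm norm_minus_commute\<close>)
    have lim: "((\<lambda>t. (f t z - f 0 z) /\<^sub>R t) \<longlongrightarrow> V z) (at 0)" for z
    proof -
      have "((\<lambda>t. (1 / norm (t - 0)) *\<^sub>R (f t z - (f 0 z + (t - 0) *\<^sub>R V z))) \<longlongrightarrow> 0) (at 0)"
        using V[of z] unfolding has_vector_derivative_def has_derivative_within by blast
      then have "((\<lambda>t. norm ((1 / norm (t - 0)) *\<^sub>R (f t z - (f 0 z + (t - 0) *\<^sub>R V z)))) \<longlongrightarrow> 0) (at 0)"
        by (rule tendsto_norm_zero)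
      moreover have "\<forall>\<^sub>F t in at 0. norm ((1 / norm (t - 0)) *\<^sub>R (f t z - (f 0 z + (t - 0) *\<^sub>R V z)))
          = norm ((f t z - f 0 z) /\<^sub>R t - V z)"
        unfolding eventually_at_filter
      proof (intro always_eventually allI impI)
        fix t :: real assume "t \<noteq> 0"
        then have "(f t z - f 0 z) /\<^sub>R t - V z = (f t z - (f 0 z + (t - 0) *\<^sub>R V z)) /\<^sub>R t"
          by (simp add: scaleR_diff_right scaleR_add_right)
        then show "norm ((1 / norm (t - 0)) *\<^sub>R (f t z - (f 0 z + (t - 0) *\<^sub>R V z))) = norm ((f t z - f 0 z) /\<^sub>R t - V z)"
          by (simp add: inverse_eq_divide)
      qed
      ultimately have "((\<lambda>t. norm ((f t z - f 0 z) /\<^sub>R t - V z)) \<longlongrightarrow> 0) (at 0)" by (rule Lim_transform_eventually)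
      then show ?thesis by (rule LIM_zero_cancel[OF tendsto_norm_zero_cancel])
    qed
    have "((\<lambda>t. norm ((f t y - f 0 y) /\<^sub>R t - (f t x - f 0 x) /\<^sub>R t - W (0, x) (y - x))) \<longlongrightarrow> norm (V y - V x - W (0, x) (y - x))) (at 0)"
      by (intro tendsto_intros lim)
    moreover have "\<forall>\<^sub>F t in at 0. norm ((f t y - f 0 y) /\<^sub>R t - (f t x - f 0 x) /\<^sub>R t - W (0, x) (y - x)) \<le> e * norm (y - x)"
      unfolding eventually_at
    proof (intro exI[of _ d] conjI ballI impI d(1))
      fix t :: real assume "t \<noteq> 0 \<and> dist t 0 < d"
      then have t: "t \<noteq> 0" "\<bar>t\<bar> < d" by auto
      have "(f t y - f 0 y) /\<^sub>R t - (f t x - f 0 x) /\<^sub>R t - W (0, x) (y - x)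
        = ((f t y - f 0 y - t *\<^sub>R W (0, x) y) - (f t x - f 0 x - t *\<^sub>R W (0, x) x)) /\<^sub>R t"
        using t(1) by (simp add: scaleR_diff_right blinfun.diff_right)
      also have "norm \<dots> = norm ((f t y - f 0 y - t *\<^sub>R W (0, x) y) - (f t x - f 0 x - t *\<^sub>R W (0, x) x)) / \<bar>t\<bar>"
        by (simp only: norm_scaleR abs_inverse divide_inverse_commute)
      also have "\<dots> \<le> e * norm (y - x)"
        using *[OF t(2)] t(1) by (simp add: pos_divide_le_eq mult.assoc mult.commute[of "\<bar>t\<bar>"])
      finally show "norm ((f t y - f 0 y) /\<^sub>R t - (f t x - f 0 x) /\<^sub>R t - W (0, x) (y - x)) \<le> e * norm (y - x)" .
    qed
    ultimately show ?thesis by (intro tendsto_upperbound[where F="at (0::real)"]) auto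
  qed
  then show "\<exists>d>0. \<forall>y\<in>UNIV. norm (y - x) < d \<longrightarrow> norm (V y - V x - blinfun_apply (W (0, x)) (y - x)) \<le> e * norm (y - x)"
    using d(1) by blast
qed

lemma blinfun_eqI_has_derivative:
  assumes "(f has_derivative blinfun_apply A) (at x)" "(f has_derivative blinfun_apply B) (at x)"
  shows "A = B"
  using has_derivative_unique[OF assms] by (simp add: blinfun_apply_inject)

text \<open>Turns the existential witnesses of \<open>C1_family_of_C2_diffeos\<close> into
  parameters; the velocity field is read off as \<open>V0 (0, x)\<close>.\<close>

locale flow =
  fixes \<epsilon> :: real and \<phi> :: "real \<Rightarrow> real^3 \<Rightarrow> real^3" and D1 D2 V0 V1 V2
  assumes eps: "0 < \<epsilon>"
    and diffeo: "\<And>t. \<bar>t\<bar> < \<epsilon> \<Longrightarrow> bij (\<phi> t) \<and> C2_with (\<phi> t) (D1 t) (D2 t) \<and> C2 (inv (\<phi> t))"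
    and V0: "\<And>t x. \<bar>t\<bar> < \<epsilon> \<Longrightarrow> ((\<lambda>u. \<phi> u x) has_vector_derivative V0 (t, x)) (at t)"
    and V1: "\<And>t x. \<bar>t\<bar> < \<epsilon> \<Longrightarrow> ((\<lambda>u. D1 u x) has_vector_derivative V1 (t, x)) (at t)"
    and V2: "\<And>t x. \<bar>t\<bar> < \<epsilon> \<Longrightarrow> ((\<lambda>u. D2 u x) has_vector_derivative V2 (t, x)) (at t)"
    and cV0: "continuous_on ({-\<epsilon><..<\<epsilon>} \<times> UNIV) V0"
    and cV1: "continuous_on ({-\<epsilon><..<\<epsilon>} \<times> UNIV) V1"
    and cV2: "continuous_on ({-\<epsilon><..<\<epsilon>} \<times> UNIV) V2"
    and phi0: "\<And>x. \<phi> 0 x = x"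
begin

lemma phi_derivative: "\<bar>t\<bar> < \<epsilon> \<Longrightarrow> (\<phi> t has_derivative D1 t x) (at x)"
  and D1_derivative: "\<bar>t\<bar> < \<epsilon> \<Longrightarrow> (D1 t has_derivative D2 t x) (at x)"
  and D2_continuous: "\<bar>t\<bar> < \<epsilon> \<Longrightarrow> continuous_on UNIV (D2 t)"
  using diffeo by (auto simp: C2_with_def)

lemma D1_0: "D1 0 x = id_blinfun"
proof (rule blinfun_eqI_has_derivative)
  show "(\<phi> 0 has_derivative D1 0 x) (at x)" using phi_derivative eps by simp
  have "\<phi> 0 = (\<lambda>x. x)" using phi0 by auto
  then show "(\<phi> 0 has_derivative blinfun_apply id_blinfun) (at x)" by simp
qed

lemma D2_0: "D2 0 x = 0"
proof (rule blinfun_eqI_has_derivative)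
  show "(D1 0 has_derivative D2 0 x) (at x)" using D1_derivative eps by simp
  have "D1 0 = (\<lambda>x. id_blinfun)" using D1_0 by auto
  then show "(D1 0 has_derivative blinfun_apply 0) (at x)"
    by (metis blinfun.zero_left has_derivative_const has_derivative_eq_rhs ext)
qed

lemma C1_param_phi: "C1_param \<epsilon> UNIV \<phi> V0"
  using phi0 by (intro C1_paramI eps cV0 V0) (auto intro: continuous_on_eq[OF continuous_on_id])

lemma C1_param_D1: "C1_param \<epsilon> UNIV D1 V1"
proof (intro C1_paramI eps cV1 V1)
  show "continuous_on UNIV (D1 0)" by (rule continuous_on_eq[OF continuous_on_const[of _ id_blinfun]]) (simp add: D1_0)
qed auto

lemma C1_param_D2: "C1_param \<epsilon> UNIV D2 V2"
proof (intro C1_paramI eps cV2 V2)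
  show "continuous_on UNIV (D2 0)" by (rule continuous_on_eq[OF continuous_on_const[of _ 0]]) (simp add: D2_0)
qed auto

text \<open>The variation of curvature contains \<open>V1\<close> and \<open>V2\<close> at time 0.
  By \<open>mixed_partial\<close> these are the derivatives of the velocity field, so the variation
  depends on the family only through \<open>\<xi>\<close>.\<close>

lemma velocity_derivatives:
  assumes "C2_with \<xi> \<xi>' \<xi>''" "\<And>x. V0 (0, x) = \<xi> x"
  shows "V1 (0, x) = \<xi>' x" "V2 (0, x) = \<xi>'' x"
proof -
  have 1: "V1 (0, x) = \<xi>' x" for x
  proof (rule blinfun_eqI_has_derivative)
    show "(\<xi> has_derivative blinfun_apply (\<xi>' x)) (at x)" using assms by (simp add: C2_with_def)
    show "(\<xi> has_derivative blinfun_apply (V1 (0, x))) (at x)"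
      using V0[of 0] eps assms(2) by (intro mixed_partial[OF eps phi_derivative _ V1 cV1]) auto
  qed
  show "V1 (0, x) = \<xi>' x" by (rule 1)
  show "V2 (0, x) = \<xi>'' x"
  proof (rule blinfun_eqI_has_derivative)
    show "(\<xi>' has_derivative blinfun_apply (\<xi>'' x)) (at x)" using assms by (simp add: C2_with_def)
    show "(\<xi>' has_derivative blinfun_apply (V2 (0, x))) (at x)"
      using V1[of 0] eps 1 by (intro mixed_partial[OF eps D1_derivative _ V2 cV2]) auto
  qed
qed

text \<open>Chain rule for the differentiable inverse of \<open>\<phi> t\<close>. It keeps the
  transported curves regular for all times, not only for small ones.\<close>

lemma D1_nonzero:
  assumes t: "\<bar>t\<bar> < \<epsilon>" and v: "v \<noteq> 0"
  shows "D1 t x v \<noteq> 0"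
proof
  assume 0: "D1 t x v = 0"
  obtain f' where f': "\<And>y. (inv (\<phi> t) has_derivative blinfun_apply (f' y)) (at y)"
    using diffeo[OF t] unfolding C2_def C2_with_def by blast
  have "((\<lambda>x. inv (\<phi> t) (\<phi> t x)) has_derivative (\<lambda>h. f' (\<phi> t x) (D1 t x h))) (at x)"
    by (rule has_derivative_compose[OF phi_derivative[OF t] f'])
  moreover have "(\<lambda>x. inv (\<phi> t) (\<phi> t x)) = (\<lambda>x. x)"
    using diffeo[OF t] by (simp add: bij_is_inj inv_f_f)
  ultimately have "(\<lambda>h. f' (\<phi> t x) (D1 t x h)) = (\<lambda>h. h)"
    using has_derivative_unique has_derivative_ident by metis
  then have "v = f' (\<phi> t x) (D1 t x v)" by metis
  then show False using 0 v by (simp add: blinfun.zero_right)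
qed

lemma near_identity:
  assumes "0 < e"
  obtains \<delta> where "0 < \<delta>" "\<delta> < \<epsilon>"
    "\<And>t x. \<bar>t\<bar> \<le> \<delta> \<Longrightarrow> norm x \<le> R \<Longrightarrow> norm (\<phi> t x - x) < e \<and> norm (D1 t x - id_blinfun) < e \<and> norm (D2 t x) < e"
proof -
  let ?K = "cball (0::real^3) R"
  have *: "\<exists>\<delta>>0. \<delta> < \<epsilon> \<and> (\<forall>t x. \<bar>t\<bar> \<le> \<delta> \<longrightarrow> x \<in> ?K \<longrightarrow> dist (G t x) (G 0 x) < e)"
    if "C1_param \<epsilon> UNIV G V" for G :: "real \<Rightarrow> real^3 \<Rightarrow> 'c::real_normed_vector" and V
  proof -
    have "continuous_on ({-\<epsilon><..<\<epsilon>} \<times> ?K) (\<lambda>p. G (fst p) (snd p))"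
      by (rule continuous_on_subset[OF C1_paramD(4)[OF that]]) auto
    from continuous_param_uniform[OF eps this compact_cball assms] show ?thesis by simp
  qed
  obtain d1 where d1: "d1 > 0" "d1 < \<epsilon>" "\<And>t x. \<bar>t\<bar> \<le> d1 \<Longrightarrow> x \<in> ?K \<Longrightarrow> dist (\<phi> t x) (\<phi> 0 x) < e"
    using *[OF C1_param_phi] by blast
  obtain d2 where d2: "d2 > 0" "d2 < \<epsilon>" "\<And>t x. \<bar>t\<bar> \<le> d2 \<Longrightarrow> x \<in> ?K \<Longrightarrow> dist (D1 t x) (D1 0 x) < e"
    using *[OF C1_param_D1] by blast
  obtain d3 where d3: "d3 > 0" "d3 < \<epsilon>" "\<And>t x. \<bar>t\<bar> \<le> d3 \<Longrightarrow> x \<in> ?K \<Longrightarrow> dist (D2 t x) (D2 0 x) < e"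
    using *[OF C1_param_D2] by blast
  show thesis
  proof (rule that[of "min d1 (min d2 d3)"])
    fix t x assume "\<bar>t\<bar> \<le> min d1 (min d2 d3)" "norm (x::real^3) \<le> R"
    then show "norm (\<phi> t x - x) < e \<and> norm (D1 t x - id_blinfun) < e \<and> norm (D2 t x) < e"
      using d1(3)[of t x] d2(3)[of t x] d3(3)[of t x] by (auto simp: phi0 D1_0 D2_0 dist_norm)
  qed (use d1 d2 d3 in auto)
qed

lemma transported_derivative:
  assumes "\<bar>t\<bar> < \<epsilon>" "(c has_vector_derivative T) (at s within S)"
  shows "((\<lambda>s. \<phi> t (c s)) has_vector_derivative D1 t (c s) T) (at s within S)"
proof -
  have "((\<lambda>s. \<phi> t (c s)) has_derivative (\<lambda>h. D1 t (c s) (h *\<^sub>R T))) (at s within S)"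
    using has_derivative_compose[OF assms(2)[unfolded has_vector_derivative_def] phi_derivative[OF assms(1)]] .
  then show ?thesis by (simp add: has_vector_derivative_def blinfun.scaleR_right)
qed

lemma transported_derivative2:
  assumes t: "\<bar>t\<bar> < \<epsilon>" and c: "(c has_vector_derivative T s) (at s within S)"
    and T: "(T has_vector_derivative T') (at s within S)"
  shows "((\<lambda>s. D1 t (c s) (T s)) has_vector_derivative D2 t (c s) (T s) (T s) + D1 t (c s) T') (at s within S)"
proof -
  have "((\<lambda>s. D1 t (c s)) has_derivative (\<lambda>h. D2 t (c s) (h *\<^sub>R T s))) (at s within S)"
    using has_derivative_compose[OF c[unfolded has_vector_derivative_def] D1_derivative[OF t]] .
  then have "((\<lambda>s. D1 t (c s)) has_vector_derivative D2 t (c s) (T s)) (at s within S)"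
    by (simp add: has_vector_derivative_def blinfun.scaleR_right)
  from bounded_bilinear.has_vector_derivative[OF bounded_bilinear_blinfun_apply this T]
  show ?thesis by (simp add: add.commute)
qed

end

section \<open>Reach of two transported arcs\<close>

text \<open>The midpoint of a shortest connection has two nearest points, which bounds the reach
  from above. Conversely, nearest points on both components of a point closer than
  \<open>D / 2\<close> would be less than \<open>D\<close> apart, so uniqueness is a matter of each
  component alone.\<close>

lemma reach_two_components:
  assumes comp: "compact A" "compact B" and D: "0 < D"
    and le: "\<And>a b. a \<in> A \<Longrightarrow> b \<in> B \<Longrightarrow> D \<le> dist a b"
    and att: "a0 \<in> A" "b0 \<in> B" "dist a0 b0 = D"
    and uniq: "\<And>S p q q'. S = A \<or> S = B \<Longrightarrow> q \<in> S \<Longrightarrow> q' \<in> S \<Longrightarrow> dist p q < D / 2 \<Longrightarrow>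
      (\<And>v. v \<in> S \<Longrightarrow> dist p q \<le> dist p v) \<Longrightarrow> dist p q' = dist p q \<Longrightarrow> q = q'"
  shows "reach (A \<union> B) = ereal (D / 2)"
  unfolding reach_def
proof (rule antisym)
  let ?P = "\<lambda>r. \<forall>p. infdist p (A \<union> B) < r \<longrightarrow> (\<exists>!q. q \<in> A \<union> B \<and> dist p q = infdist p (A \<union> B))"
  have L: "closed (A \<union> B)" "A \<union> B \<noteq> {}" using comp att by (auto intro: compact_imp_closed)
  show "Sup {ereal r |r. ?P r} \<le> ereal (D / 2)"
  proof (rule Sup_least)
    fix x assume "x \<in> {ereal r |r. ?P r}"
    then obtain r where r: "x = ereal r" "?P r" by blast
    define p where "p = midpoint a0 b0"
    have p: "dist p a0 = D / 2" "dist p b0 = D / 2"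
      using att(3) by (auto simp: p_def dist_midpoint)
    have ge: "D / 2 \<le> dist p q" if "q \<in> A \<union> B" for q
    proof (cases "q \<in> A")
      case True
      then show ?thesis using le[OF True att(2)] dist_triangle[of q b0 p] p by (simp add: dist_commute)
    next
      case False
      then have "D \<le> dist a0 q" using le[OF att(1)] that by blast
      then show ?thesis using dist_triangle[of a0 q p] p by (simp add: dist_commute)
    qed
    have "infdist p (A \<union> B) \<le> D / 2" using infdist_le[of a0 "A \<union> B" p] att p by simp
    moreover have "D / 2 \<le> infdist p (A \<union> B)"
      using infdist_attains_inf[OF L, of p] ge by metis
    ultimately have inf: "infdist p (A \<union> B) = D / 2" by simp
    have "a0 \<noteq> b0" using att(3) D by auto
    then have "\<not> (\<exists>!q. q \<in> A \<union> B \<and> dist p q = infdist p (A \<union> B))"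
      using att p inf by (metis UnI1 UnI2)
    then have "\<not> infdist p (A \<union> B) < r" using r(2) by blast
    then show "x \<le> ereal (D / 2)" using r(1) inf by simp
  qed
  have "?P (D / 2)"
  proof (intro allI impI)
    fix p assume inf: "infdist p (A \<union> B) < D / 2"
    obtain q where q: "q \<in> A \<union> B" "infdist p (A \<union> B) = dist p q" using infdist_attains_inf[OF L] by blast
    have min: "dist p q \<le> dist p v" if "v \<in> A \<union> B" for v using infdist_le[OF that, of p] q by simp
    have "q' = q" if q': "q' \<in> A \<union> B" "dist p q' = infdist p (A \<union> B)" for q'
    proof -
      have "dist q q' < D" using dist_triangle[of q q' p] q q' inf by (simp add: dist_commute)
      then have "\<not> (q \<in> A \<and> q' \<in> B)" "\<not> (q' \<in> A \<and> q \<in> B)"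
        using le[of q q'] le[of q' q] by (auto simp: dist_commute)
      then consider "q \<in> A" "q' \<in> A" | "q \<in> B" "q' \<in> B" using q(1) q'(1) by blast
      then show ?thesis
      proof cases
        case 1
        show ?thesis by (rule sym, rule uniq[of A _ _ p]) (use 1 q q' inf min in simp_all)
      next
        case 2
        show ?thesis by (rule sym, rule uniq[of B _ _ p]) (use 2 q q' inf min in simp_all)
      qed
    qed
    then show "\<exists>!q. q \<in> A \<union> B \<and> dist p q = infdist p (A \<union> B)" using q by metis
  qed
  then show "ereal (D / 2) \<le> Sup {ereal r |r. ?P r}" by (intro Sup_upper) blast
qed

text \<open>The squared distance cannot decrease on entering \<open>{s..u}\<close> from either side.
  Only the inner side is used, so \<open>s\<close> and \<open>u\<close> may also be the ends of the
  arc.\<close>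

lemma nearest_first_order:
  fixes \<gamma> :: "real \<Rightarrow> 'a::real_inner"
  assumes \<gamma>: "\<And>s. (\<gamma> has_vector_derivative \<gamma>' s) (at s)" and su: "s < u"
    and min: "\<And>v. v \<in> {s..u} \<Longrightarrow> dist p (\<gamma> s) \<le> dist p (\<gamma> v)" "\<And>v. v \<in> {s..u} \<Longrightarrow> dist p (\<gamma> u) \<le> dist p (\<gamma> v)"
  shows "0 \<le> (\<gamma> s - p) \<bullet> \<gamma>' s" "(\<gamma> u - p) \<bullet> \<gamma>' u \<le> 0"
proof -
  let ?f = "\<lambda>v. (\<gamma> v - p) \<bullet> (\<gamma> v - p)"
  have f: "?f v = (dist p (\<gamma> v))\<^sup>2" for v by (simp add: dist_norm norm_minus_commute dot_square_norm)
  have d: "(?f has_real_derivative 2 * ((\<gamma> v - p) \<bullet> \<gamma>' v)) (at v)" for v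
  proof -
    have "((\<lambda>v. \<gamma> v - p) has_vector_derivative \<gamma>' v - 0) (at v)" by (intro derivative_intros \<gamma>)
    from bounded_bilinear.has_vector_derivative[OF bounded_bilinear_inner this this]
    show ?thesis by (simp add: has_real_derivative_iff_has_vector_derivative inner_commute)
  qed
  show "0 \<le> (\<gamma> s - p) \<bullet> \<gamma>' s"
  proof (rule ccontr)
    assume "\<not> ?thesis"
    then obtain \<eta> where \<eta>: "\<eta> > 0" "\<And>h. h > 0 \<Longrightarrow> h < \<eta> \<Longrightarrow> ?f (s + h) < ?f s"
      using DERIV_neg_dec_right[OF d[of s]] by auto
    have "?f (s + min (\<eta>/2) (u - s)) < ?f s" using \<eta>(1) su by (intro \<eta>(2)) auto
    moreover have "(dist p (\<gamma> s))\<^sup>2 \<le> (dist p (\<gamma> (s + min (\<eta>/2) (u - s))))\<^sup>2"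
      using \<eta>(1) su by (intro power_mono min) auto
    ultimately show False unfolding f by simp
  qed
  show "(\<gamma> u - p) \<bullet> \<gamma>' u \<le> 0"
  proof (rule ccontr)
    assume "\<not> ?thesis"
    then obtain \<eta> where \<eta>: "\<eta> > 0" "\<And>h. h > 0 \<Longrightarrow> h < \<eta> \<Longrightarrow> ?f (u - h) < ?f u"
      using DERIV_pos_inc_left[OF d[of u]] by auto
    have "?f (u - min (\<eta>/2) (u - s)) < ?f u" using \<eta>(1) su by (intro \<eta>(2)) auto
    moreover have "(dist p (\<gamma> u))\<^sup>2 \<le> (dist p (\<gamma> (u - min (\<eta>/2) (u - s))))\<^sup>2"
      using \<eta>(1) su by (intro power_mono min) auto
    ultimately show False unfolding f by simp
  qed
qed

context flow begin

text \<open>The change of the transported tangent splits into the turning of \<open>T\<close>, the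
  change of \<open>D1 t\<close> along the curve, and the deviation of \<open>D1 t\<close> from the
  identity acting on the turning of \<open>T\<close>.\<close>

lemma transported_lipschitz:
  assumes t: "\<bar>t\<bar> < \<epsilon>" and c: "\<And>s. (c has_vector_derivative T s) (at s)" and T1: "\<And>s. norm (T s) = 1"
    and lip: "\<And>s u. norm (T u - T s) \<le> \<kappa> * \<bar>u - s\<bar>" and \<kappa>: "0 \<le> \<kappa>" and e: "0 \<le> e"
    and near: "\<And>x. norm x \<le> R \<Longrightarrow> norm (D1 t x - id_blinfun) \<le> e \<and> norm (D2 t x) \<le> e"
    and R: "norm (c s) \<le> R" "norm (c u) \<le> R"
  shows "norm (D1 t (c u) (T u) - D1 t (c s) (T s)) \<le> (\<kappa> * (1 + e) + e) * \<bar>u - s\<bar>"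
proof -
  have cus: "norm (c u - c s) \<le> 1 * norm (u - s)"
  proof (rule differentiable_bound[where S=UNIV and f'="\<lambda>s h. h *\<^sub>R T s"])
    show "(c has_derivative (\<lambda>h. h *\<^sub>R T s)) (at s within UNIV)" for s using c[of s] by (simp add: has_vector_derivative_def)
    show "onorm (\<lambda>h. h *\<^sub>R T s) \<le> 1" for s by (rule onorm_le) (simp add: T1)
  qed auto
  have "norm (D1 t (c u) - D1 t (c s)) \<le> e * norm (c u - c s)"
  proof (rule differentiable_bound[where S="cball 0 R" and f'="\<lambda>x. blinfun_apply (D2 t x)"])
    show "(D1 t has_derivative D2 t x) (at x within cball 0 R)" for x
      by (rule has_derivative_at_withinI[OF D1_derivative[OF t]])
    show "onorm (D2 t x) \<le> e" if "x \<in> cball 0 R" for x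
      using near[of x] that by (simp add: norm_blinfun.rep_eq)
  qed (use R in auto)
  also have "\<dots> \<le> e * \<bar>u - s\<bar>" using cus e by (intro mult_left_mono) auto
  finally have 1: "norm ((D1 t (c u) - D1 t (c s)) (T s)) \<le> e * \<bar>u - s\<bar>"
    using norm_blinfun[of "D1 t (c u) - D1 t (c s)" "T s"] T1[of s] by simp
  have "norm ((D1 t (c u) - id_blinfun) (T u - T s)) \<le> norm (D1 t (c u) - id_blinfun) * norm (T u - T s)"
    by (rule norm_blinfun)
  also have "\<dots> \<le> e * (\<kappa> * \<bar>u - s\<bar>)" using near[OF R(2)] lip[of u s] e by (intro mult_mono) auto
  finally have 2: "norm ((D1 t (c u) - id_blinfun) (T u - T s)) \<le> e * (\<kappa> * \<bar>u - s\<bar>)" .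
  have "D1 t (c u) (T u) - D1 t (c s) (T s) = (D1 t (c u) - id_blinfun) (T u - T s) + ((T u - T s) + (D1 t (c u) - D1 t (c s)) (T s))"
    by (simp add: blinfun.diff_left blinfun.diff_right)
  also have "norm \<dots> \<le> e * (\<kappa> * \<bar>u - s\<bar>) + (\<kappa> * \<bar>u - s\<bar> + e * \<bar>u - s\<bar>)"
    by (intro norm_triangle_mono 1 2 lip)
  finally show ?thesis by (simp add: algebra_simps)
qed

text \<open>Subtracting the two first-order conditions, the chord times the tangent must be
  outweighed by the turning of the tangent times the distance to \<open>p\<close>. But the former is
  nearly \<open>u - s\<close>, and the latter at most \<open>(51/100) * L * (u - s)\<close> with
  \<open>L\<close> about 1.19. Here 117/100 bounds \<open>1 / \<sigma>\<close>, 51/100 leaves room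
  above 1/2, 1/100 is the tolerated deviation from the identity, and 1/4 keeps the chord close to
  the tangent.\<close>

lemma no_close_double_nearest:
  assumes t: "\<bar>t\<bar> < \<epsilon>" and c: "\<And>s. (c has_vector_derivative T s) (at s)" and T1: "\<And>s. norm (T s) = 1"
    and lip: "\<And>s u. norm (T u - T s) \<le> (117/100) * \<bar>u - s\<bar>"
    and near: "\<And>x. norm x \<le> R \<Longrightarrow> norm (D1 t x - id_blinfun) \<le> (1/100) \<and> norm (D2 t x) \<le> (1/100)"
    and R: "\<And>v. v \<in> {s..u} \<Longrightarrow> norm (c v) \<le> R"
    and su: "s < u" "u - s \<le> 1/4" and d: "dist p (\<phi> t (c s)) \<le> (51/100)"
    and min: "\<And>v. v \<in> {s..u} \<Longrightarrow> dist p (\<phi> t (c s)) \<le> dist p (\<phi> t (c v))" "\<And>v. v \<in> {s..u} \<Longrightarrow> dist p (\<phi> t (c u)) \<le> dist p (\<phi> t (c v))"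
  shows False
proof -
  let ?\<gamma> = "\<lambda>s. \<phi> t (c s)" and ?g = "\<lambda>s. D1 t (c s) (T s)"
  define L :: real where "L = (117/100) * (1 + (1/100)) + (1/100)"
  have g: "(?\<gamma> has_vector_derivative ?g s) (at s)" for s by (rule transported_derivative[OF t c])
  have Lip: "norm (?g v - ?g w) \<le> L * \<bar>v - w\<bar>" if "v \<in> {s..u}" "w \<in> {s..u}" for v w
    unfolding L_def by (rule transported_lipschitz[OF t c T1 lip _ _ near]) (use R that in auto)
  have N: "(99/100) \<le> norm (?g u)" "norm (?g u) \<le> (101/100)"
  proof -
    have "norm ((D1 t (c u) - id_blinfun) (T u)) \<le> norm (D1 t (c u) - id_blinfun) * norm (T u)" by (rule norm_blinfun)
    then have "norm (?g u - T u) \<le> (1/100)" using near[OF R[of u]] su T1[of u] by (simp add: blinfun.diff_left)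
    then show "(99/100) \<le> norm (?g u)" "norm (?g u) \<le> (101/100)"
      using norm_triangle_ineq2[of "T u" "?g u"] norm_triangle_ineq2[of "?g u" "T u"] T1[of u] by (auto simp: norm_minus_commute)
  qed
  \<comment> \<open>Second-order estimate: the chord differs from \<open>(u - s)\<close> times the
    tangent at \<open>u\<close> by at most \<open>L * (u - s)\<^sup>2\<close>.\<close>
  have "norm ((?\<gamma> u - u *\<^sub>R ?g u) - (?\<gamma> s - s *\<^sub>R ?g u)) \<le> (L * (u - s)) * norm (u - s)"
  proof (rule differentiable_bound[where S="{s..u}" and f'="\<lambda>v h. h *\<^sub>R (?g v - ?g u)"])
    fix v assume v: "v \<in> {s..u}"
    have "((\<lambda>v. v *\<^sub>R ?g u) has_vector_derivative 1 *\<^sub>R ?g u) (at v)"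
      using has_vector_derivative_scaleR[OF DERIV_ident has_vector_derivative_const] by simp
    then have "((\<lambda>v. ?\<gamma> v - v *\<^sub>R ?g u) has_vector_derivative ?g v - 1 *\<^sub>R ?g u) (at v)"
      by (intro has_vector_derivative_diff g)
    then show "((\<lambda>v. ?\<gamma> v - v *\<^sub>R ?g u) has_derivative (\<lambda>h. h *\<^sub>R (?g v - ?g u))) (at v within {s..u})"
      by (simp add: has_vector_derivative_def has_derivative_at_withinI)
    have "norm (?g v - ?g u) \<le> L * \<bar>v - u\<bar>" using v su by (intro Lip) auto
    also have "\<dots> \<le> L * (u - s)" using v by (intro mult_left_mono) (auto simp: L_def)
    finally show "onorm (\<lambda>h. h *\<^sub>R (?g v - ?g u)) \<le> L * (u - s)"
      by (intro onorm_le) (simp add: mult.commute[of "L * (u - s)"] mult_left_mono)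
  qed (use su in auto)
  then have err: "norm ((?\<gamma> u - ?\<gamma> s) - (u - s) *\<^sub>R ?g u) \<le> L * (u - s) * (u - s)"
    using su by (simp add: algebra_simps)
  have "((u - s) *\<^sub>R ?g u - (?\<gamma> u - ?\<gamma> s)) \<bullet> ?g u \<le> (L * (u - s) * (u - s)) * (101/100)"
    using norm_cauchy_schwarz[of "(u - s) *\<^sub>R ?g u - (?\<gamma> u - ?\<gamma> s)" "?g u"] err N su
      mult_mono[OF err N(2)] by (simp add: norm_minus_commute L_def)
  then have 1: "(u - s) * (norm (?g u))\<^sup>2 - (L * (u - s) * (u - s)) * (101/100) \<le> (?\<gamma> u - ?\<gamma> s) \<bullet> ?g u"
    by (simp add: inner_diff_left dot_square_norm)
  have 2: "- ((51/100) * (L * (u - s))) \<le> (?\<gamma> s - p) \<bullet> (?g u - ?g s)"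
  proof -
    have "- ((?\<gamma> s - p) \<bullet> (?g u - ?g s)) \<le> norm (?\<gamma> s - p) * norm (?g u - ?g s)"
      using norm_cauchy_schwarz[of "- (?\<gamma> s - p)" "?g u - ?g s"] by (simp only: inner_minus_left norm_minus_cancel)
    also have "\<dots> \<le> (51/100) * (L * (u - s))"
      using d Lip[of u s] su by (intro mult_mono) (auto simp: dist_norm norm_minus_commute)
    finally show ?thesis by linarith
  qed
  have "(?\<gamma> u - ?\<gamma> s) \<bullet> ?g u + (?\<gamma> s - p) \<bullet> (?g u - ?g s) = (?\<gamma> u - p) \<bullet> ?g u - (?\<gamma> s - p) \<bullet> ?g s"
    by (simp add: algebra_simps inner_diff_left inner_diff_right)
  also have "\<dots> \<le> 0" using nearest_first_order[of ?\<gamma> ?g, OF g su(1) min] by simp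
  finally have "(u - s) * (norm (?g u))\<^sup>2 - (L * (u - s) * (u - s)) * (101/100) - (51/100) * (L * (u - s)) \<le> 0"
    using 1 2 by linarith
  moreover have "x * (y - L * x * (101/100) - (51/100) * L) = x * y - (L * x * x) * (101/100) - (51/100) * (L * x)" for x y :: real
    by (simp add: field_simps)
  ultimately have "(u - s) * ((norm (?g u))\<^sup>2 - L * (u - s) * (101/100) - (51/100) * L) \<le> 0"
    by (simp only:)
  \<comment> \<open>With \<open>L = 1.1917\<close> and \<open>u - s \<le> 1/4\<close> the subtracted
    terms stay below 0.91, against \<open>(99/100)\<^sup>2 = 0.9801\<close>.\<close>
  moreover have "0 < (norm (?g u))\<^sup>2 - L * (u - s) * (101/100) - (51/100) * L"
  proof -
    have "((99/100)::real)\<^sup>2 \<le> (norm (?g u))\<^sup>2" by (intro power_mono N) auto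
    moreover have "L * (u - s) \<le> L * (1/4)" using su by (intro mult_left_mono) (auto simp: L_def)
    moreover have "L * (1/4) * (101/100) + (51/100) * L < (99/100)\<^sup>2" by (simp add: L_def power2_eq_square)
    ultimately show ?thesis by linarith
  qed
  ultimately show False using su(1) by (simp add: mult_le_0_iff)
qed

text \<open>If it failed for tolerances tending to 0, the double nearest points would have
  parameters at least 1/4 apart and subconverge to a double nearest point of the original arc. The
  limit distance is only known to be at most 1/2, which is why \<open>U\<close> includes
  equality.\<close>

lemma nearest_unique_stable:
  assumes c: "\<And>s. (c has_vector_derivative T s) (at s)" and T1: "\<And>s. norm (T s) = 1"
    and lip: "\<And>s u. norm (T u - T s) \<le> (117/100) * \<bar>u - s\<bar>"
    and U: "\<And>p s u. s \<in> {a..b} \<Longrightarrow> u \<in> {a..b} \<Longrightarrow> dist p (c s) \<le> 1/2 \<Longrightarrow>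
      (\<And>v. v \<in> {a..b} \<Longrightarrow> dist p (c s) \<le> dist p (c v)) \<Longrightarrow> dist p (c u) = dist p (c s) \<Longrightarrow> s = u"
  obtains \<delta> where "0 < \<delta>" "\<delta> < \<epsilon>" "\<And>t p s u. \<bar>t\<bar> \<le> \<delta> \<Longrightarrow> s \<in> {a..b} \<Longrightarrow> u \<in> {a..b} \<Longrightarrow> dist p (\<phi> t (c s)) \<le> 1/2 + \<delta> \<Longrightarrow>
      (\<And>v. v \<in> {a..b} \<Longrightarrow> dist p (\<phi> t (c s)) \<le> dist p (\<phi> t (c v))) \<Longrightarrow> dist p (\<phi> t (c u)) = dist p (\<phi> t (c s)) \<Longrightarrow> s = u"
proof -
  have cc: "isCont c s" for s using c has_vector_derivative_continuous by blast
  have "compact (c ` {a..b})" using cc by (intro compact_continuous_image continuous_at_imp_continuous_on) auto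
  then obtain R where R: "\<And>v. v \<in> {a..b} \<Longrightarrow> norm (c v) \<le> R"
    using compact_imp_bounded bounded_iff by (metis imageI)
  obtain \<delta>0 where \<delta>0: "0 < \<delta>0" "\<delta>0 < \<epsilon>"
    "\<And>t x. \<bar>t\<bar> \<le> \<delta>0 \<Longrightarrow> norm x \<le> R \<Longrightarrow> norm (\<phi> t x - x) < (1/100) \<and> norm (D1 t x - id_blinfun) < (1/100) \<and> norm (D2 t x) < (1/100)"
    using near_identity[of "1/100" R] by auto
  define bad where "bad = (\<lambda>\<delta> t p s u. \<bar>t\<bar> \<le> \<delta> \<and> s \<in> {a..b} \<and> u \<in> {a..b} \<and> s < u \<and> dist p (\<phi> t (c s)) \<le> 1/2 + \<delta> \<and>
      (\<forall>v\<in>{a..b}. dist p (\<phi> t (c s)) \<le> dist p (\<phi> t (c v))) \<and> dist p (\<phi> t (c u)) = dist p (\<phi> t (c s)))"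
  \<comment> \<open>The cap 1/100 makes \<open>1/2 + d n\<close> at most 51/100, the bound of
    \<open>no_close_double_nearest\<close>.\<close>
  define d where "d = (\<lambda>n. min \<delta>0 (1/100) * inverse (real (Suc n)))"
  have d_pos: "0 < d n" for n using \<delta>0 by (simp add: d_def)
  have d_le: "d n \<le> \<delta>0" "d n \<le> 1/100" for n
  proof -
    have "d n \<le> min \<delta>0 (1/100) * 1" unfolding d_def using \<delta>0 by (intro mult_left_mono) (auto simp: field_simps)
    then show "d n \<le> \<delta>0" "d n \<le> 1/100" by auto
  qed
  have "d \<longlonglongrightarrow> min \<delta>0 (1/100) * 0" unfolding d_def by (intro tendsto_mult tendsto_const LIMSEQ_inverse_real_of_nat)
  then have d_lim: "d \<longlonglongrightarrow> 0" by simp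
  have "\<exists>n. \<forall>t p s u. \<not> bad (d n) t p s u"
  proof (rule ccontr)
    assume "\<not> ?thesis"
    then have "\<forall>n. \<exists>t p s u. bad (d n) t p s u" by blast
    then obtain t p s u where bad: "\<And>n. bad (d n) (t n) (p n) (s n) (u n)" by metis
    have tn: "\<bar>t n\<bar> \<le> \<delta>0" "\<bar>t n\<bar> < \<epsilon>" for n using bad[of n] d_le(1)[of n] \<delta>0 by (auto simp: bad_def)
    have sn: "s n \<in> {a..b}" "u n \<in> {a..b}" "s n < u n" for n using bad[of n] by (auto simp: bad_def)
    have pn: "dist (p n) (\<phi> (t n) (c (s n))) \<le> (51/100)" for n using bad[of n] d_le(2)[of n] by (auto simp: bad_def)
    have far: "1/4 \<le> u n - s n" for n
    proof (rule ccontr)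
      assume close: "\<not> 1/4 \<le> u n - s n"
      show False
      proof (rule no_close_double_nearest[OF tn(2) c T1 lip _ _ sn(3) _ pn])
        show "norm x \<le> R \<Longrightarrow> norm (D1 (t n) x - id_blinfun) \<le> (1/100) \<and> norm (D2 (t n) x) \<le> (1/100)" for x
          using \<delta>0(3)[OF tn(1), of x] by (simp add: less_imp_le)
        show "u n - s n \<le> 1/4" using close by simp
        show "v \<in> {s n..u n} \<Longrightarrow> norm (c v) \<le> R" for v using sn[of n] by (intro R) auto
      qed (use bad[of n] in \<open>auto simp: bad_def\<close>)
    qed
    have "norm (p n) \<le> R + 1" for n
    proof -
      have "norm (p n) \<le> norm (c (s n)) + norm (\<phi> (t n) (c (s n)) - c (s n)) + norm (p n - \<phi> (t n) (c (s n)))"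
        using norm_triangle_ineq[of "c (s n) + (\<phi> (t n) (c (s n)) - c (s n))" "p n - \<phi> (t n) (c (s n))"]
          norm_triangle_ineq[of "c (s n)" "\<phi> (t n) (c (s n)) - c (s n)"] by simp
      then show ?thesis using R[OF sn(1)[of n]] \<delta>0(3)[OF tn(1) R[OF sn(1)], of n n] pn[of n] by (simp add: dist_norm)
    qed
    then have memb: "\<forall>n. (p n, s n, u n) \<in> cball 0 (R + 1) \<times> {a..b} \<times> {a..b}" using sn by simp
    have sc: "seq_compact (cball (0::real^3) (R + 1) \<times> {a..b} \<times> {a..b})"
      by (intro compact_imp_seq_compact compact_Times compact_cball compact_Icc)
    obtain l r where l: "l \<in> cball 0 (R + 1) \<times> {a..b} \<times> {a..b}" "strict_mono r" "((\<lambda>n. (p n, s n, u n)) \<circ> r) \<longlonglongrightarrow> l"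
      by (rule seq_compactE[OF sc memb]) (rule that)
    obtain p0 s0 u0 where [simp]: "l = (p0, s0, u0)" by (cases l) auto
    have s0: "s0 \<in> {a..b}" "u0 \<in> {a..b}" using l(1) by auto
    have lims: "(\<lambda>n. p (r n)) \<longlonglongrightarrow> p0" "(\<lambda>n. s (r n)) \<longlonglongrightarrow> s0" "(\<lambda>n. u (r n)) \<longlonglongrightarrow> u0"
      using tendsto_fst[OF l(3)] tendsto_fst[OF tendsto_snd[OF l(3)]] tendsto_snd[OF tendsto_snd[OF l(3)]] by (simp_all add: o_def)
    have dr: "(\<lambda>n. d (r n)) \<longlonglongrightarrow> 0" using LIMSEQ_subseq_LIMSEQ[OF d_lim l(2)] by (simp add: o_def)
    have tr: "(\<lambda>n. t (r n)) \<longlonglongrightarrow> 0"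
      by (rule tendsto_rabs_zero_cancel, rule tendsto_sandwich[OF _ _ tendsto_const dr])
        (use bad in \<open>auto simp: bad_def intro!: always_eventually\<close>)
    have "open ({-\<epsilon><..<\<epsilon>} \<times> (UNIV :: (real^3) set))" by (simp add: open_Times)
    then have "isCont (\<lambda>q. \<phi> (fst q) (snd q)) (0, x)" for x
      using C1_paramD(4)[OF C1_param_phi] eps by (simp add: continuous_on_eq_continuous_at)
    then have phi_lim: "(\<lambda>n. \<phi> (t (r n)) (y n)) \<longlonglongrightarrow> x" if "y \<longlonglongrightarrow> x" for y x
      using isCont_tendsto_compose[OF _ tendsto_Pair[OF tr that], of "\<lambda>q. \<phi> (fst q) (snd q)"] by (simp add: phi0)
    have c_lim: "(\<lambda>n. c (y n)) \<longlonglongrightarrow> c x" if "y \<longlonglongrightarrow> x" for y x by (rule isCont_tendsto_compose[OF cc that])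
    have D: "(\<lambda>n. dist (p (r n)) (\<phi> (t (r n)) (c (y n)))) \<longlonglongrightarrow> dist p0 (c x)" if "y \<longlonglongrightarrow> x" for y x
      by (intro tendsto_dist lims(1) phi_lim c_lim that)
    have "s0 = u0"
    proof (rule U[OF s0])
      show "dist p0 (c s0) \<le> 1/2"
      proof (rule LIMSEQ_le[OF D[OF lims(2)]])
        show "(\<lambda>n. 1/2 + d (r n)) \<longlonglongrightarrow> 1/2" using tendsto_add[OF tendsto_const dr, of "1/2"] by simp
      qed (use bad in \<open>auto simp: bad_def\<close>)
      show "dist p0 (c s0) \<le> dist p0 (c v)" if "v \<in> {a..b}" for v
        by (rule LIMSEQ_le[OF D[OF lims(2)] D[OF tendsto_const]]) (use bad that in \<open>auto simp: bad_def\<close>)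
      have "dist (p n) (\<phi> (t n) (c (u n))) = dist (p n) (\<phi> (t n) (c (s n)))" for n
        using bad[of n] unfolding bad_def by blast
      then have "(\<lambda>n. dist (p (r n)) (\<phi> (t (r n)) (c (s (r n))))) \<longlonglongrightarrow> dist p0 (c u0)"
        using D[OF lims(3)] by (simp only:)
      then show "dist p0 (c u0) = dist p0 (c s0)"
        using D[OF lims(2)] by (rule LIMSEQ_unique)
    qed
    moreover have "1/4 \<le> u0 - s0"
      by (rule LIMSEQ_le_const[OF tendsto_diff[OF lims(3,2)]]) (use far in auto)
    ultimately show False by simp
  qed
  then obtain n where n: "\<And>t p s u. \<not> bad (d n) t p s u" by blast
  show thesis
  proof (rule that[of "d n"])
    fix t p s u
    assume *: "\<bar>t\<bar> \<le> d n" "s \<in> {a..b}" "u \<in> {a..b}" "dist p (\<phi> t (c s)) \<le> 1/2 + d n"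
      "\<And>v. v \<in> {a..b} \<Longrightarrow> dist p (\<phi> t (c s)) \<le> dist p (\<phi> t (c v))" "dist p (\<phi> t (c u)) = dist p (\<phi> t (c s))"
    show "s = u"
    proof (rule ccontr)
      assume "s \<noteq> u"
      then consider "s < u" | "u < s" by linarith
      then have "bad (d n) t p s u \<or> bad (d n) t p u s"
        unfolding bad_def using *(1-4,6) *(5) by cases simp_all
      then show False using n by blast
    qed
  next
    show "d n < \<epsilon>" using d_le(1)[of n] \<delta>0(2) by simp
  qed (rule d_pos)
qed

end

section \<open>The plane curve\<close>

text \<open>The tangent angle has corners at the six junctions, so functions built from it are
  differentiable off a finite set only; the fundamental theorem of calculus tolerates this for
  continuous functions.\<close>

lemma mono_except_finite:
  fixes f :: "real \<Rightarrow> real"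
  assumes ab: "a \<le> b" and fin: "finite S" and cont: "continuous_on {a..b} f"
    and d: "\<And>x. x \<in> {a<..<b} - S \<Longrightarrow> \<exists>d\<ge>0. (f has_real_derivative d) (at x)"
  shows "f a \<le> f b"
proof -
  have "\<exists>f'. \<forall>x\<in>{a<..<b} - S. f' x \<ge> 0 \<and> (f has_real_derivative f' x) (at x)"
    using d by (intro bchoice) blast
  then obtain f' where f': "\<And>x. x \<in> {a<..<b} - S \<Longrightarrow> f' x \<ge> 0 \<and> (f has_real_derivative f' x) (at x)" by blast
  define g where "g x = (if x \<in> {a<..<b} - S then f' x else 0)" for x
  have "(g has_integral (f b - f a)) {a..b}"
  proof (rule fundamental_theorem_of_calculus_interior_strong[OF fin ab _ cont])
    fix x assume x: "x \<in> {a<..<b} - S"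
    then show "(f has_vector_derivative g x) (at x)"
      using f'[OF x] by (simp add: g_def has_real_derivative_iff_has_vector_derivative)
  qed
  then have "0 \<le> f b - f a" by (rule has_integral_nonneg) (use f' in \<open>auto simp: g_def\<close>)
  then show ?thesis by simp
qed

lemma real_antiderivative_exists:
  fixes f :: "real \<Rightarrow> real"
  assumes "continuous_on UNIV f"
  shows "\<exists>F. F 0 = c \<and> (\<forall>s. (F has_real_derivative f s) (at s))"
proof -
  have "\<exists>F. \<forall>x. -\<infinity> < ereal x \<longrightarrow> ereal x < \<infinity> \<longrightarrow> (F has_vector_derivative f x) (at x)"
    using assms by (intro einterval_antiderivative) (simp_all add: continuous_on_eq_continuous_at)
  then obtain F where F: "\<And>x. (F has_real_derivative f x) (at x)"
    by (auto simp: has_real_derivative_iff_has_vector_derivative)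
  have "((\<lambda>s. F s - F 0 + c) has_real_derivative f s) (at s)" for s
    using F[of s] by (auto intro!: derivative_eq_intros)
  then show ?thesis by (intro exI[of _ "\<lambda>s. F s - F 0 + c"]) simp
qed

lemma eq_on_interval_if_DERIV_eq:
  fixes f g :: "real \<Rightarrow> real"
  assumes "\<And>x. x \<in> {a..b} \<Longrightarrow> (f has_real_derivative h x) (at x within {a..b})"
    and "\<And>x. x \<in> {a..b} \<Longrightarrow> (g has_real_derivative h x) (at x within {a..b})"
    and "f a = g a" and x: "x \<in> {a..b}"
  shows "f x = g x"
proof -
  have "\<exists>c. \<forall>x\<in>{a..b}. f x - g x = c"
    by (rule has_field_derivative_zero_constant) (auto intro!: derivative_eq_intros assms)
  then obtain c where c: "\<And>x. x \<in> {a..b} \<Longrightarrow> f x - g x = c" by blast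
  have "c = 0" using c[of a] assms(3) x by simp
  then show ?thesis using c[OF x] by simp
qed

section \<open>Constants and the tangent angle\<close>

locale clasp_curve =
  fixes \<tau> \<sigma> :: real
  assumes tau: "0 < \<tau>" "\<tau> \<le> 1" and sigma1: "\<sigma> < 1"
    and sigma: "(sqrt (4 + \<tau>\<^sup>2) - 2) / (2 - sqrt (4 - \<tau>\<^sup>2)) \<le> \<sigma>"
begin

text \<open>\<open>\<theta>1\<close> is the tangent angle along the line segment,
  \<open>\<theta>2\<close> the one along the ray, and \<open>C\<close> the cosine of
  \<open>\<theta>1\<close>.\<close>

definition \<theta>1 where "\<theta>1 = arcsin (\<tau> / 2)"
definition \<theta>2 where "\<theta>2 = arcsin \<tau>"
definition C where "C = sqrt (4 - \<tau>\<^sup>2) / 2"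

lemma sin1: "sin \<theta>1 = \<tau> / 2" and sin2: "sin \<theta>2 = \<tau>"
  using tau by (auto simp: \<theta>1_def \<theta>2_def)

lemma tau2: "0 < \<tau>\<^sup>2" "\<tau>\<^sup>2 \<le> 1"
  using tau by (auto simp: power_le_one)

lemma cos1: "cos \<theta>1 = C"
proof -
  have "cos \<theta>1 = sqrt (1 - (\<tau>/2)\<^sup>2)" using tau by (simp add: \<theta>1_def cos_arcsin)
  also have "1 - (\<tau>/2)\<^sup>2 = (4 - \<tau>\<^sup>2) / 4" by (simp add: power_divide field_simps)
  also have "sqrt \<dots> = C" by (simp add: C_def real_sqrt_divide)
  finally show ?thesis .
qed

lemma cos2: "cos \<theta>2 = sqrt (1 - \<tau>\<^sup>2)"
  using tau by (simp add: \<theta>2_def cos_arcsin)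

lemma C_sq: "C\<^sup>2 = 1 - (\<tau>/2)\<^sup>2"
  using tau2 by (simp add: C_def power_divide field_simps)

lemma C_pos: "0 < C" and C_less: "C < 1" and C_lower: "0.86 < C"
proof -
  show "0 < C" using tau2 by (simp add: C_def)
  have "C\<^sup>2 < 1\<^sup>2" using C_sq tau by simp
  then show "C < 1" using power2_less_imp_less by fastforce
  have "0.86\<^sup>2 < C\<^sup>2" using C_sq tau2 by (simp add: power_divide power2_eq_square)
  then show "0.86 < C" using \<open>0 < C\<close> power2_less_imp_less[of "0.86" C] by simp
qed

lemma theta: "0 < \<theta>1" "\<theta>1 < \<theta>2" "\<theta>2 \<le> pi / 2"
proof -
  show "0 < \<theta>1" using tau arcsin_less_mono[of 0 "\<tau>/2"] by (simp add: \<theta>1_def)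
  show "\<theta>1 < \<theta>2" using tau arcsin_less_mono[of "\<tau>/2" \<tau>] by (simp add: \<theta>1_def \<theta>2_def)
  show "\<theta>2 \<le> pi/2" using tau arcsin_ubound[of \<tau>] by (simp add: \<theta>2_def)
qed

text \<open>Since \<open>sqrt (4 + \<tau>\<^sup>2) / 2 = sqrt (2 - C\<^sup>2)\<close>, the bound on \<open>\<sigma>\<close> reads \<open>1 + \<sigma> (1 - C) \<ge> sqrt (2 - C\<^sup>2)\<close>.\<close>

lemma sigma_bound: "(1 + \<sigma> * (1 - C))\<^sup>2 \<ge> 2 - C\<^sup>2"
proof -
  have eq: "(sqrt (4 + \<tau>\<^sup>2) / 2)\<^sup>2 = 2 - C\<^sup>2" using tau2 by (simp add: C_sq power_divide)
  have "2 - sqrt (4 - \<tau>\<^sup>2) = 2 * (1 - C)" by (simp add: C_def)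
  then have "sqrt (4 + \<tau>\<^sup>2) - 2 \<le> \<sigma> * (2 * (1 - C))"
    using sigma C_less by (simp add: pos_divide_le_eq)
  then have "sqrt (4 + \<tau>\<^sup>2) / 2 \<le> 1 + \<sigma> * (1 - C)" by (simp add: algebra_simps)
  then have "(sqrt (4 + \<tau>\<^sup>2) / 2)\<^sup>2 \<le> (1 + \<sigma> * (1 - C))\<^sup>2"
    by (rule power_mono) simp
  then show ?thesis using eq by simp
qed

text \<open>At \<open>\<sigma> = C\<close> the inequality \<open>sigma_bound\<close> already fails,
  by the positive defect \<open>(1 - C)^3 * (1 + C)\<close>. The bound \<open>C < \<sigma>\<close>
  limits the curvature and shows that points beyond the segment are far in the sense of
  \<open>dist2_far\<close>.\<close>

lemma sigma_gt_C: "C < \<sigma>"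
proof (rule ccontr)
  assume "\<not> C < \<sigma>"
  have "sqrt (4 + \<tau>\<^sup>2) \<ge> 2" by (rule real_le_rsqrt) simp
  then have "0 \<le> \<sigma>" using sigma C_less by (auto simp: C_def intro: order.trans[rotated])
  then have "1 + \<sigma> * (1 - C) \<ge> 0" "1 + \<sigma> * (1 - C) \<le> 1 + C * (1 - C)"
    using \<open>\<not> C < \<sigma>\<close> C_less by (auto intro: mult_right_mono)
  then have "(1 + \<sigma> * (1 - C))\<^sup>2 \<le> (1 + C * (1 - C))\<^sup>2" by (intro power_mono)
  moreover have "2 - C\<^sup>2 - (1 + C * (1 - C))\<^sup>2 = (1 - C)^3 * (1 + C)"
    by (simp add: power2_eq_square power3_eq_cube algebra_simps)
  moreover have "(1 - C)^3 * (1 + C) > 0" using C_less C_pos by simp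
  ultimately show False using sigma_bound by linarith
qed

lemma sigma_lower: "0.86 < \<sigma>" and sigma_pos: "0 < \<sigma>"
  using C_lower sigma_gt_C by auto

definition s1 where "s1 = \<sigma> * \<theta>1"
definition s2 where "s2 = s1 + \<tau> * (1 - \<sigma>) / sqrt (4 - \<tau>\<^sup>2)"
definition s3 where "s3 = s2 + (\<theta>2 - \<theta>1)"

lemma s2_eq: "s2 = s1 + (1 - \<sigma>) * (\<tau> / 2) / C"
  by (simp add: s2_def C_def)

lemma s123: "0 < s1" "s1 < s2" "s2 < s3"
  using theta sigma_pos sigma1 tau C_pos by (auto simp: s1_def s2_eq s3_def)

text \<open>Clamped ramps: \<open>angA\<close> climbs along the tip arc, \<open>angB\<close> along
  the right shoulder. The resulting angle is odd and defined on the whole line, so one formula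
  covers both halves of a component and its extension beyond the ends.\<close>

definition angA where "angA s = max (- s1) (min s s1)"
definition angB where "angB s = max 0 (min s s3 - s2)"
definition ang where "ang s = angA s / \<sigma> + angB s - angB (- s)"

lemma ang_minus: "ang (- s) = - ang s"
proof -
  have "angA (- s) = - angA s" using s123(1) by (auto simp: angA_def max_def min_def)
  then show ?thesis by (simp add: ang_def)
qed

lemma ang_continuous: "continuous_on X ang"
  unfolding ang_def angA_def angB_def using sigma_pos by (intro continuous_intros) auto

lemma ang_values: 
  "s \<in> {-s1..s1} \<Longrightarrow> ang s = s / \<sigma>" "s \<in> {s1..s2} \<Longrightarrow> ang s = \<theta>1"
  "s \<in> {s2..s3} \<Longrightarrow> ang s = \<theta>1 + (s - s2)" "s \<ge> s3 \<Longrightarrow> ang s = \<theta>2"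
proof -
  have q: "s1 / \<sigma> = \<theta>1" using sigma_pos by (simp add: s1_def)
  show "s \<in> {-s1..s1} \<Longrightarrow> ang s = s / \<sigma>"
    using s123 by (simp add: ang_def angA_def angB_def max_def min_def)
  show "s \<in> {s1..s2} \<Longrightarrow> ang s = \<theta>1"
    using s123 q by (auto simp: ang_def angA_def angB_def max_def min_def)
  show "s \<in> {s2..s3} \<Longrightarrow> ang s = \<theta>1 + (s - s2)"
    using s123 q by (auto simp: ang_def angA_def angB_def max_def min_def)
  show "s \<ge> s3 \<Longrightarrow> ang s = \<theta>2"
    using s123 q by (auto simp: ang_def angA_def angB_def max_def min_def s3_def)
qed

text \<open>The ramps climb on disjoint intervals, so their increments together are at most
  \<open>s - u\<close>; their slopes are \<open>1 / \<sigma>\<close> and 1, of which the first is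
  larger.\<close>

lemma ang_lipschitz: "u \<le> s \<Longrightarrow> 0 \<le> ang s - ang u \<and> ang s - ang u \<le> (s - u) / \<sigma>"
proof -
  assume us: "u \<le> s"
  have A: "0 \<le> angA s - angA u" and B: "0 \<le> angB s - angB u" "0 \<le> angB (-u) - angB (-s)"
    using us by (auto simp: angA_def angB_def)
  have sum: "(angA s - angA u) + ((angB s - angB u) + (angB (-u) - angB (-s))) \<le> s - u"
    using us s123 by (auto simp: angA_def angB_def max_def min_def)
  have eq: "ang s - ang u = (angA s - angA u) / \<sigma> + ((angB s - angB u) + (angB (-u) - angB (-s)))"
    by (simp add: ang_def diff_divide_distrib)
  have "((angB s - angB u) + (angB (-u) - angB (-s))) * \<sigma> \<le> ((angB s - angB u) + (angB (-u) - angB (-s))) * 1"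
    using B sigma1 by (intro mult_left_mono) auto
  then have "(angB s - angB u) + (angB (-u) - angB (-s)) \<le> ((angB s - angB u) + (angB (-u) - angB (-s))) / \<sigma>"
    using sigma_pos by (simp add: pos_le_divide_eq)
  then have "ang s - ang u \<le> ((angA s - angA u) + ((angB s - angB u) + (angB (-u) - angB (-s)))) / \<sigma>"
    using eq by (simp add: add_divide_distrib)
  also have "\<dots> \<le> (s - u) / \<sigma>" using sum sigma_pos by (simp add: divide_right_mono)
  finally show ?thesis using eq A B sigma_pos by simp
qed

lemma ang_mono: "u \<le> s \<Longrightarrow> ang u \<le> ang s"
  using ang_lipschitz[of u s] by simp

lemma ang_0: "ang 0 = 0" using ang_values(1)[of 0] s123 by simp

lemma ang_range: "- \<theta>2 \<le> ang s" "ang s \<le> \<theta>2" "- (pi/2) \<le> ang s" "ang s \<le> pi/2"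
proof -
  have *: "ang s \<le> \<theta>2" for s
    using ang_mono[of s "max s s3"] ang_values(4)[of "max s s3"] by simp
  show "ang s \<le> \<theta>2" by (rule *)
  show "- \<theta>2 \<le> ang s" using *[of "-s"] ang_minus[of s] by simp
  then show "- (pi/2) \<le> ang s" using theta by simp
  show "ang s \<le> pi/2" using *[of s] theta by simp
qed

lemma ang_nonneg: "0 \<le> s \<Longrightarrow> 0 \<le> ang s" using ang_mono[of 0 s] ang_0 by simp

text \<open>A triple \<open>(p, q, k)\<close> stands for the parameter interval \<open>{p..q}\<close>, on which the curvature is \<open>k\<close>.\<close>

definition pieces :: "real \<Rightarrow> (real \<times> real \<times> real) set" where
  "pieces l = {(-l, -s3, 0), (-s3, -s2, 1), (-s2, -s1, 0), (-s1, s1, 1/\<sigma>), (s1, s2, 0), (s2, s3, 1), (s3, l, 0)}"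

lemma ang_piece:
  assumes "(p, q, k) \<in> pieces l" "s \<in> {p..q}"
  shows "ang s = ang p + k * (s - p)"
proof -
  have neg: "ang s = - ang (- s)" for s using ang_minus[of s] by simp
  show ?thesis
    using assms s123 ang_values(1)[of s] ang_values(1)[of p] ang_values(2)[of s] ang_values(2)[of p]
      ang_values(3)[of s] ang_values(3)[of p] ang_values(4)[of s] ang_values(4)[of p]
      ang_values(2)[of "-s"] ang_values(2)[of "-p"]
      ang_values(3)[of "-s"] ang_values(3)[of "-p"] ang_values(4)[of "-s"] ang_values(4)[of "-p"]
      ang_minus[of s] ang_minus[of p]
    unfolding pieces_def by (elim insertE emptyE) (auto simp: diff_divide_distrib add_divide_distrib)
qed

lemma ang_DERIV:
  assumes "s \<notin> {-s3, -s2, -s1, s1, s2, s3}"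
  shows "\<exists>k\<ge>0. k * \<sigma> \<le> 1 \<and> (ang has_real_derivative k) (at s)"
proof -
  define l where "l = \<bar>s\<bar> + s3 + 1"
  obtain p q k where P: "(p, q, k) \<in> pieces l" and s: "s \<in> {p<..<q}"
  proof -
    consider "s < -s3" | "-s3 < s" "s < -s2" | "-s2 < s" "s < -s1" | "-s1 < s" "s < s1"
      | "s1 < s" "s < s2" | "s2 < s" "s < s3" | "s3 < s"
      using assms by fastforce
    then show thesis
    proof cases
      case 1 then show ?thesis using s123 by (intro that[of "-l" "-s3" 0]) (auto simp: pieces_def l_def)
    next
      case 2 then show ?thesis by (intro that[of "-s3" "-s2" 1]) (auto simp: pieces_def)
    next
      case 3 then show ?thesis by (intro that[of "-s2" "-s1" 0]) (auto simp: pieces_def)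
    next
      case 4 then show ?thesis by (intro that[of "-s1" s1 "1/\<sigma>"]) (auto simp: pieces_def)
    next
      case 5 then show ?thesis by (intro that[of s1 s2 0]) (auto simp: pieces_def)
    next
      case 6 then show ?thesis by (intro that[of s2 s3 1]) (auto simp: pieces_def)
    next
      case 7 then show ?thesis using s123 by (intro that[of s3 l 0]) (auto simp: pieces_def l_def)
    qed
  qed
  have "((\<lambda>s. ang p + k * (s - p)) has_real_derivative k) (at s)"
    by (auto intro!: derivative_eq_intros)
  then have "(ang has_real_derivative k) (at s)"
  proof (rule has_field_derivative_transform_within_open[where S="{p<..<q}"])
    show "ang p + k * (x - p) = ang x" if "x \<in> {p<..<q}" for x
      by (rule ang_piece[OF P, symmetric]) (use that in auto)
  qed (use s in auto)
  moreover have "k \<ge> 0" "k * \<sigma> \<le> 1" using P sigma_pos sigma1 by (auto simp: pieces_def)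
  ultimately show ?thesis by blast
qed

text \<open>Solves the requirement that the shoulder, a unit arc beginning at \<open>s2\<close> with
  tangent angle \<open>\<theta>1\<close>, be centred at height \<open>- z0\<close>: the climb from
  the tip to \<open>s2\<close> has to be \<open>- 2 * z0 - C\<close>.\<close>

definition z0 where "z0 = - (\<sigma> + (1 - \<sigma>) / C) / 2"
definition X where "X = (SOME F. F 0 = 0 \<and> (\<forall>s. (F has_real_derivative cos (ang s)) (at s)))"
definition Y where "Y = (SOME F. F 0 = z0 \<and> (\<forall>s. (F has_real_derivative sin (ang s)) (at s)))"

lemma X0: "X 0 = 0" and X_DERIV: "(X has_real_derivative cos (ang s)) (at s)"
proof -
  have "\<exists>F. F 0 = 0 \<and> (\<forall>s. (F has_real_derivative cos (ang s)) (at s))"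
    by (rule real_antiderivative_exists) (intro continuous_intros ang_continuous)
  from someI_ex[OF this] show "X 0 = 0" "(X has_real_derivative cos (ang s)) (at s)"
    unfolding X_def by auto
qed

lemma Y0: "Y 0 = z0" and Y_DERIV: "(Y has_real_derivative sin (ang s)) (at s)"
proof -
  have "\<exists>F. F 0 = z0 \<and> (\<forall>s. (F has_real_derivative sin (ang s)) (at s))"
    by (rule real_antiderivative_exists) (intro continuous_intros ang_continuous)
  from someI_ex[OF this] show "Y 0 = z0" "(Y has_real_derivative sin (ang s)) (at s)"
    unfolding Y_def by auto
qed

lemma X_continuous: "continuous_on A X" and Y_continuous: "continuous_on A Y"
  using X_DERIV Y_DERIV by (auto intro!: DERIV_isCont continuous_at_imp_continuous_on)

lemma X_minus: "X (- s) = - X s"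
proof -
  have "((\<lambda>s. X (- s) + X s) has_real_derivative 0) (at s)" for s
    using DERIV_chain'[OF DERIV_minus[OF DERIV_ident] X_DERIV, of s UNIV] X_DERIV[of s]
    by (auto intro!: derivative_eq_intros simp: ang_minus)
  then have "X (- s) + X s = X (- 0) + X 0"
    using DERIV_isconst_all[of "\<lambda>s. X (- s) + X s" s 0] by blast
  then show ?thesis using X0 by simp
qed

lemma Y_minus: "Y (- s) = Y s"
proof -
  have "((\<lambda>s. Y (- s) - Y s) has_real_derivative 0) (at s)" for s
    using DERIV_chain'[OF DERIV_minus[OF DERIV_ident] Y_DERIV, of s UNIV] Y_DERIV[of s]
    by (auto intro!: derivative_eq_intros simp: ang_minus)
  then have "Y (- s) - Y s = Y (- 0) - Y 0"
    using DERIV_isconst_all[of "\<lambda>s. Y (- s) - Y s" s 0] by blast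
  then show ?thesis by simp
qed

lemma cos_ang: "0 \<le> cos (ang s)"
  by (rule cos_ge_zero[OF ang_range(3,4)])

lemma X_mono: "s \<le> t \<Longrightarrow> X s \<le> X t"
  by (rule DERIV_nonneg_imp_nondecreasing) (use X_DERIV cos_ang in blast)+

lemma Y_mono:
  assumes "0 \<le> s" "s \<le> t"
  shows "Y s \<le> Y t"
proof (rule DERIV_nonneg_imp_nondecreasing[OF assms(2)])
  fix x assume "s \<le> x"
  then have x: "0 \<le> s" "s \<le> x" using assms by auto
  have "0 \<le> sin (ang x)" using ang_nonneg[of x] ang_range(4)[of x] x by (intro sin_ge_zero) auto
  then show "\<exists>y. (Y has_real_derivative y) (at x) \<and> 0 \<le> y" using Y_DERIV by blast
qed

lemma X_eqI:
  assumes "\<And>x. x \<in> {a..b} \<Longrightarrow> (g has_real_derivative cos (ang x)) (at x within {a..b})" "X a = g a" "s \<in> {a..b}"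
  shows "X s = g s"
  by (rule eq_on_interval_if_DERIV_eq[where f=X and h="\<lambda>x. cos (ang x)"])
    (use assms in \<open>auto intro: has_field_derivative_at_within[OF X_DERIV]\<close>)

lemma Y_eqI:
  assumes "\<And>x. x \<in> {a..b} \<Longrightarrow> (g has_real_derivative sin (ang x)) (at x within {a..b})" "Y a = g a" "s \<in> {a..b}"
  shows "Y s = g s"
  by (rule eq_on_interval_if_DERIV_eq[where f=Y and h="\<lambda>x. sin (ang x)"])
    (use assms in \<open>auto intro: has_field_derivative_at_within[OF Y_DERIV]\<close>)

section \<open>Closed forms of the pieces\<close>

lemma curve_arc:
  assumes "s \<in> {-s1..s1}"
  shows "X s = \<sigma> * sin (s / \<sigma>)" "Y s = z0 + \<sigma> - \<sigma> * cos (s / \<sigma>)"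
proof -
  have *: "X s = \<sigma> * sin (s / \<sigma>) \<and> Y s = z0 + \<sigma> - \<sigma> * cos (s / \<sigma>)" if s: "s \<in> {0..s1}" for s
  proof
    show "X s = \<sigma> * sin (s / \<sigma>)"
      by (rule X_eqI[where g="\<lambda>s. \<sigma> * sin (s / \<sigma>)" and a=0 and b=s1])
        (use s sigma_pos in \<open>auto intro!: derivative_eq_intros simp: X0 ang_values(1)\<close>)
    show "Y s = z0 + \<sigma> - \<sigma> * cos (s / \<sigma>)"
      by (rule Y_eqI[where g="\<lambda>s. z0 + \<sigma> - \<sigma> * cos (s / \<sigma>)" and a=0 and b=s1])
        (use s sigma_pos in \<open>auto intro!: derivative_eq_intros simp: Y0 ang_values(1)\<close>)
  qed
  show "X s = \<sigma> * sin (s / \<sigma>)" "Y s = z0 + \<sigma> - \<sigma> * cos (s / \<sigma>)"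
    using *[of s] *[of "-s"] assms X_minus[of s] Y_minus[of s] by (cases "s \<ge> 0"; simp)+
qed

lemma curve_segment:
  assumes "s \<in> {s1..s2}"
  shows "X s = \<sigma> * (\<tau>/2) + (s - s1) * C" "Y s = z0 + \<sigma> - \<sigma> * C + (s - s1) * (\<tau>/2)"
proof -
  have q: "s1 / \<sigma> = \<theta>1" using sigma_pos by (simp add: s1_def)
  have at: "X s1 = \<sigma> * (\<tau>/2)" "Y s1 = z0 + \<sigma> - \<sigma> * C"
    using curve_arc[of s1] s123 q sin1 cos1 by auto
  show "X s = \<sigma> * (\<tau>/2) + (s - s1) * C"
    by (rule X_eqI[where g="\<lambda>s. \<sigma> * (\<tau>/2) + (s - s1) * C" and a=s1 and b=s2])
      (use assms at in \<open>auto intro!: derivative_eq_intros simp: ang_values(2) cos1\<close>)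
  show "Y s = z0 + \<sigma> - \<sigma> * C + (s - s1) * (\<tau>/2)"
    by (rule Y_eqI[where g="\<lambda>s. z0 + \<sigma> - \<sigma> * C + (s - s1) * (\<tau>/2)" and a=s1 and b=s2])
      (use assms at in \<open>auto intro!: derivative_eq_intros simp: ang_values(2) sin1\<close>)
qed

text \<open>The length of the segment is made for this: the abscissa at its end becomes
  \<open>sin \<theta>1\<close>, so the unit circle touching the segment there is centred on the
  z-axis, and \<open>z0\<close> moves this centre to the opposite tip.\<close>

lemma curve_s2: "X s2 = \<tau>/2" "Y s2 = - z0 - C"
proof -
  have "X s2 = \<sigma> * (\<tau>/2) + (1 - \<sigma>) * (\<tau> / 2)"
    using curve_segment(1)[of s2] s123 C_pos by (simp add: s2_eq)
  then show "X s2 = \<tau>/2" by (simp add: field_simps)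
  have "Y s2 = z0 + \<sigma> - \<sigma> * C + (1 - \<sigma>) * (\<tau>/2)\<^sup>2 / C"
    using curve_segment(2)[of s2] s123 by (simp add: s2_eq power2_eq_square)
  also have "(\<tau>/2)\<^sup>2 = 1 - C\<^sup>2" using C_sq by simp
  also have "(1 - \<sigma>) * (1 - C\<^sup>2) / C = (1 - \<sigma>) / C - (1 - \<sigma>) * C"
    using C_pos by (simp add: field_simps power2_eq_square)
  finally have "Y s2 = z0 + \<sigma> - \<sigma> * C + ((1 - \<sigma>) / C - (1 - \<sigma>) * C)" .
  moreover have "(1 - \<sigma>) * C = C - \<sigma> * C" by (simp add: algebra_simps)
  moreover have "2 * z0 = - \<sigma> - (1 - \<sigma>) / C" by (simp only: z0_def) simp
  ultimately show "Y s2 = - z0 - C" by linarith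
qed

lemma curve_shoulder:
  assumes "s \<in> {s2..s3}"
  shows "X s = sin (ang s)" "Y s = - z0 - cos (ang s)"
proof -
  have at: "ang s2 = \<theta>1" using ang_values(2)[of s2] s123 by simp
  have X: "X s = sin (\<theta>1 + (s - s2))"
    by (rule X_eqI[where g="\<lambda>s. sin (\<theta>1 + (s - s2))" and a=s2 and b=s3])
      (use assms in \<open>auto intro!: derivative_eq_intros simp: ang_values(3) curve_s2 sin1\<close>)
  have Y: "Y s = - z0 - cos (\<theta>1 + (s - s2))"
    by (rule Y_eqI[where g="\<lambda>s. - z0 - cos (\<theta>1 + (s - s2))" and a=s2 and b=s3])
      (use assms in \<open>auto intro!: derivative_eq_intros simp: ang_values(3) curve_s2 cos1\<close>)
  show "X s = sin (ang s)" "Y s = - z0 - cos (ang s)"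
    using X Y assms by (simp_all add: ang_values(3))
qed

lemma curve_ray:
  assumes "s3 \<le> s"
  shows "X s = \<tau> + (s - s3) * cos \<theta>2" "Y s = - z0 - cos \<theta>2 + (s - s3) * \<tau>"
proof -
  have "ang s3 = \<theta>2" using ang_values(4)[of s3] by simp
  then have at: "X s3 = \<tau>" "Y s3 = - z0 - cos \<theta>2" using curve_shoulder[of s3] s123 sin2 by auto
  show "X s = \<tau> + (s - s3) * cos \<theta>2"
    by (rule X_eqI[where g="\<lambda>s. \<tau> + (s - s3) * cos \<theta>2" and a=s3 and b=s])
      (use assms in \<open>auto intro!: derivative_eq_intros simp: ang_values(4) at\<close>)
  show "Y s = - z0 - cos \<theta>2 + (s - s3) * \<tau>"
    by (rule Y_eqI[where g="\<lambda>s. - z0 - cos \<theta>2 + (s - s3) * \<tau>" and a=s3 and b=s])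
      (use assms in \<open>auto intro!: derivative_eq_intros simp: ang_values(4) at sin2\<close>)
qed

text \<open>Segment and ray are tangent to the unit circle of the shoulder, so from
  \<open>s1\<close> on every tangent line has signed distance 1 from the centre
  \<open>(0, - z0)\<close>, which is the opposite tip.\<close>

lemma support:
  assumes "s1 \<le> s"
  shows "X s * sin (ang s) - (Y s + z0) * cos (ang s) = 1"
proof -
  consider "s \<in> {s1..s2}" | "s \<in> {s2..s3}" | "s \<ge> s3" using assms by fastforce
  then show ?thesis
  proof cases
    case 1
    have "2 * z0 * C = - \<sigma> * C - (1 - \<sigma>)" using C_pos by (simp add: z0_def field_simps)
    moreover have "X s * (\<tau>/2) - (Y s + z0) * C = \<sigma> * ((\<tau>/2)\<^sup>2 + C\<^sup>2) - (2 * z0 * C + \<sigma> * C)"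
      unfolding curve_segment[OF 1] by (simp add: field_simps power2_eq_square)
    ultimately have "X s * (\<tau>/2) - (Y s + z0) * C = \<sigma> * ((\<tau>/2)\<^sup>2 + C\<^sup>2) + (1 - \<sigma>)" by simp
    then show ?thesis using 1 by (simp add: ang_values(2) sin1 cos1 C_sq)
  next
    case 2
    have "sin (ang s) * sin (ang s) + cos (ang s) * cos (ang s) = 1"
      using sin_cos_squared_add[of "ang s"] by (simp add: power2_eq_square)
    then show ?thesis using curve_shoulder[OF 2] by simp
  next
    case 3
    have "\<tau> * \<tau> + cos \<theta>2 * cos \<theta>2 = 1"
      using sin_cos_squared_add[of \<theta>2] by (simp add: power2_eq_square sin2)
    then show ?thesis unfolding curve_ray[OF 3] ang_values(4)[OF 3] sin2 by (simp add: algebra_simps)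
  qed
qed

end

section \<open>Distances along the curve\<close>

context clasp_curve begin

text \<open>The centre \<open>c s + R N s\<close> of the ball rolling on the inside keeps distance at least \<open>R\<close> from every
  tangent line; \<open>R = \<sigma>\<close> is the smallest radius of curvature.\<close>

lemma rolling_ball:
  assumes "0 \<le> R" "R \<le> \<sigma>"
  shows "- (X s - X t) * sin (ang t) + (Y s - Y t) * cos (ang t) \<ge> R * (1 - cos (ang s - ang t))"
proof -
  let ?H = "\<lambda>s. - (X s - X t) * sin (ang t) + (Y s - Y t) * cos (ang t) - R * (1 - cos (ang s - ang t))"
  have cont: "continuous_on A ?H" for A
    by (intro continuous_intros X_continuous Y_continuous ang_continuous)
  let ?K = "{-s3, -s2, -s1, s1, s2, s3}"
  \<comment> \<open>The factor \<open>1 - R * k\<close> is nonnegative since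
    \<open>R \<le> \<sigma>\<close> and \<open>k \<le> 1 / \<sigma>\<close>; the sine keeps its sign
    on either side of \<open>t\<close> because the curve turns by at most pi in total.\<close>
  have d: "\<exists>k\<ge>0. k * \<sigma> \<le> 1 \<and> (?H has_real_derivative (1 - R * k) * sin (ang u - ang t)) (at u)" if "u \<notin> ?K" for u
  proof -
    obtain k where k: "k \<ge> 0" "k * \<sigma> \<le> 1" "(ang has_real_derivative k) (at u)" using ang_DERIV[OF \<open>u \<notin> ?K\<close>] by blast
    have "(?H has_real_derivative (1 - R * k) * sin (ang u - ang t)) (at u)"
      using k(3) X_DERIV[of u] Y_DERIV[of u]
      by (auto intro!: derivative_eq_intros simp: sin_diff algebra_simps)
    then show ?thesis using k by blast
  qed
  have fac: "0 \<le> 1 - R * k" if "k \<ge> 0" "k * \<sigma> \<le> 1" for k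
  proof -
    have "R * k \<le> \<sigma> * k" using assms that by (intro mult_right_mono) auto
    then show ?thesis using that by (simp add: mult.commute)
  qed
  have "0 \<le> ?H s"
  proof (cases "t \<le> s")
    case True
    have "?H t \<le> ?H s"
    proof (rule mono_except_finite[OF True _ cont, of ?K])
      fix u assume u: "u \<in> {t<..<s} - ?K"
      then obtain k where k: "k \<ge> 0" "k * \<sigma> \<le> 1" "(?H has_real_derivative (1 - R * k) * sin (ang u - ang t)) (at u)"
        using d[of u] by auto
      have "0 \<le> ang u - ang t" "ang u - ang t \<le> pi"
        using ang_mono[of t u] u ang_range(4)[of u] ang_range(3)[of t] by auto
      then have "0 \<le> (1 - R * k) * sin (ang u - ang t)"
        using fac[OF k(1,2)] sin_ge_zero by simp
      then show "\<exists>d\<ge>0. (?H has_real_derivative d) (at u)" using k(3) by blast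
    qed simp
    then show ?thesis by simp
  next
    case False
    then have st: "s \<le> t" by simp
    have "- ?H s \<le> - ?H t"
    proof (rule mono_except_finite[OF st _ continuous_on_minus[OF cont], of ?K])
      fix u assume u: "u \<in> {s<..<t} - ?K"
      then obtain k where k: "k \<ge> 0" "k * \<sigma> \<le> 1" "(?H has_real_derivative (1 - R * k) * sin (ang u - ang t)) (at u)"
        using d[of u] by auto
      have "0 \<le> ang t - ang u" "ang t - ang u \<le> pi"
        using ang_mono[of u t] u ang_range(4)[of t] ang_range(3)[of u] by auto
      then have "0 \<le> (1 - R * k) * sin (ang t - ang u)"
        using fac[OF k(1,2)] sin_ge_zero by simp
      then have "0 \<le> - ((1 - R * k) * sin (ang u - ang t))"
        using sin_minus[of "ang t - ang u"] by simp
      then show "\<exists>d\<ge>0. ((\<lambda>u. - ?H u) has_real_derivative d) (at u)" using DERIV_minus[OF k(3)] by blast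
    qed simp
    then show ?thesis by simp
  qed
  then show ?thesis by simp
qed

lemma convex_tangent: "- (X t - X s) * sin (ang s) + (Y t - Y s) * cos (ang s) \<ge> 0"
  using rolling_ball[of 0 t s] sigma_pos by simp

text \<open>By \<open>rolling_ball\<close> with \<open>R = \<sigma>\<close>, the centre of the disc
  of radius \<open>\<sigma>\<close> touching at \<open>s\<close> is at least \<open>\<sigma>\<close>
  away from the tangent line at \<open>t\<close>, hence from the point at \<open>t\<close>.
  Expanding the square of this distance gives the inequality.\<close>

lemma inner_ball:
  "2 * \<sigma> * (- (X t - X s) * sin (ang s) + (Y t - Y s) * cos (ang s)) \<le> (X t - X s)\<^sup>2 + (Y t - Y s)\<^sup>2"
proof -
  let ?a = "X s - \<sigma> * sin (ang s) - X t" and ?b = "Y s + \<sigma> * cos (ang s) - Y t"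
  have "\<sigma> \<le> - ?a * sin (ang t) + ?b * cos (ang t)"
    using rolling_ball[of \<sigma> s t] sigma_pos by (simp add: cos_diff algebra_simps)
  then have "\<sigma>\<^sup>2 \<le> (- ?a * sin (ang t) + ?b * cos (ang t))\<^sup>2"
    using sigma_pos by (intro power_mono) auto
  also have "\<dots> \<le> (?a\<^sup>2 + ?b\<^sup>2) * ((sin (ang t))\<^sup>2 + (cos (ang t))\<^sup>2)"
  proof -
    have "(a\<^sup>2 + b\<^sup>2) * (S\<^sup>2 + c\<^sup>2) - (- a * S + b * c)\<^sup>2 = (a * c + b * S)\<^sup>2" for a b S c :: real
      by (simp add: power2_eq_square algebra_simps)
    from this[of ?a ?b "sin (ang t)" "cos (ang t)"] show ?thesis
      using zero_le_power2[of "?a * cos (ang t) + ?b * sin (ang t)"] by linarith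
  qed
  finally have "\<sigma>\<^sup>2 \<le> ?a\<^sup>2 + ?b\<^sup>2" by simp
  moreover have "(X s - \<sigma> * S - X t)\<^sup>2 + (Y s + \<sigma> * c - Y t)\<^sup>2 = (X t - X s)\<^sup>2 + (Y t - Y s)\<^sup>2
     + \<sigma>\<^sup>2 * (S\<^sup>2 + c\<^sup>2) - 2 * \<sigma> * (- (X t - X s) * S + (Y t - Y s) * c)" for S c
    by (simp add: power2_eq_square algebra_simps)
  note this[of "sin (ang s)" "cos (ang s)"]
  ultimately show ?thesis by simp
qed

section \<open>Distances from the tips and between the two components\<close>

lemma above_tip: "z0 \<le> Y s"
  using convex_tangent[of s 0] by (simp add: ang_0 Y0)

lemma tip_ball: "2 * \<sigma> * (Y s - z0) - (Y s - z0)\<^sup>2 \<le> (X s)\<^sup>2"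
  using inner_ball[of s 0] by (simp add: ang_0 X0 Y0)

lemma X_nonneg: "0 \<le> s \<Longrightarrow> 0 \<le> X s" using X_mono[of 0 s] X0 by simp

text \<open>At height \<open>\<sigma>\<close> above the tip the inner disc has its full half-width
  \<open>\<sigma>\<close>, and \<open>X\<close> does not decrease afterwards.\<close>

lemma X_large:
  assumes "0 \<le> s" "\<sigma> \<le> Y s - z0"
  shows "\<sigma> \<le> X s"
proof -
  have "\<exists>u\<ge>0. u \<le> s \<and> Y u = z0 + \<sigma>"
    using assms sigma_pos Y0 by (intro IVT' Y_continuous) auto
  then obtain u where u: "0 \<le> u" "u \<le> s" "Y u = z0 + \<sigma>" by blast
  have "\<sigma>\<^sup>2 \<le> (X u)\<^sup>2" using tip_ball[of u] u by (simp add: power2_eq_square)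
  then have "\<sigma> \<le> X u" using X_nonneg[OF u(1)] by (rule power2_le_imp_le)
  then show ?thesis using X_mono[OF u(2)] by simp
qed

text \<open>Past the tip arc already the tangent line is at distance 1 from the opposite tip. On the
  arc, \<open>q\<close> is the distance from the centre of the arc to that tip, and the law of
  cosines with \<open>q * C = 1 - \<sigma>\<close> gives at least
  \<open>(\<sigma> + (1 - \<sigma>))\<^sup>2\<close>.\<close>

lemma dist_tip_nonneg:
  assumes "0 \<le> s"
  shows "1 \<le> (X s)\<^sup>2 + (Y s + z0)\<^sup>2"
proof (cases "s \<le> s1")
  case True
  then have s: "s \<in> {-s1..s1}" using assms s123 by simp
  define c where "c = cos (s / \<sigma>)"
  define q where "q = (1 - \<sigma>) / C"
  have "s / \<sigma> \<le> \<theta>1" "0 \<le> s / \<sigma>" using True sigma_pos assms by (auto simp: s1_def pos_divide_le_eq mult.commute)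
  then have "C \<le> c" unfolding c_def cos1[symmetric] using theta by (intro cos_monotone_0_pi_le) auto
  have q: "q \<ge> 1 - \<sigma>" "q * C = 1 - \<sigma>" using C_pos C_less sigma1 by (auto simp: q_def pos_le_divide_eq mult_left_le)
  have "X s = \<sigma> * sin (s / \<sigma>)" "Y s + z0 = - (q + \<sigma> * c)"
  proof -
    have "Y s + z0 = 2 * z0 + \<sigma> - \<sigma> * c" using curve_arc(2)[OF s] by (simp add: c_def)
    also have "2 * z0 = - \<sigma> - q" by (simp only: z0_def q_def) simp
    finally show "Y s + z0 = - (q + \<sigma> * c)" by simp
  qed (rule curve_arc(1)[OF s])
  moreover have "(\<sigma> * S)\<^sup>2 + (- (q + \<sigma> * c))\<^sup>2 = \<sigma>\<^sup>2 * (S\<^sup>2 + c\<^sup>2) + q\<^sup>2 + 2 * \<sigma> * (q * c)" for S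
    by (simp add: power2_eq_square algebra_simps)
  ultimately have "(X s)\<^sup>2 + (Y s + z0)\<^sup>2 = \<sigma>\<^sup>2 * ((sin (s/\<sigma>))\<^sup>2 + c\<^sup>2) + q\<^sup>2 + 2 * \<sigma> * (q * c)"
    by (simp only:)
  also have "(sin (s/\<sigma>))\<^sup>2 + c\<^sup>2 = 1" by (simp add: c_def)
  also have "\<sigma>\<^sup>2 * 1 + q\<^sup>2 + 2 * \<sigma> * (q * c) \<ge> \<sigma>\<^sup>2 * 1 + (1 - \<sigma>)\<^sup>2 + 2 * \<sigma> * (1 - \<sigma>)"
  proof -
    have "(1 - \<sigma>)\<^sup>2 \<le> q\<^sup>2" using q sigma1 by (intro power_mono) auto
    moreover have "1 - \<sigma> \<le> q * c" using q \<open>C \<le> c\<close> sigma1 mult_left_mono[of C c q] by auto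
    then have "2 * \<sigma> * (1 - \<sigma>) \<le> 2 * \<sigma> * (q * c)" using sigma_pos by (intro mult_left_mono) auto
    ultimately show ?thesis by linarith
  qed
  finally show ?thesis by (simp add: power2_eq_square algebra_simps)
next
  case False
  let ?S = "sin (ang s)" and ?C = "cos (ang s)"
  have sup: "X s * ?S - (Y s + z0) * ?C = 1" using False by (intro support) simp
  have "((X s)\<^sup>2 + (Y s + z0)\<^sup>2) * (S\<^sup>2 + c\<^sup>2) - (X s * S - (Y s + z0) * c)\<^sup>2 = (X s * c + (Y s + z0) * S)\<^sup>2" for S c
    by (simp add: power2_eq_square algebra_simps)
  from this[of ?S ?C, unfolded sup sin_cos_squared_add power_one mult_1_right]
  show ?thesis using zero_le_power2[of "X s * ?C + (Y s + z0) * ?S"] by linarith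
qed

lemma dist_tip: "1 \<le> (X s)\<^sup>2 + (Y s + z0)\<^sup>2"
  using dist_tip_nonneg[of s] dist_tip_nonneg[of "-s"] X_minus[of s] Y_minus[of s] by (cases "0 \<le> s") auto

text \<open>Squared distance between the point at \<open>s\<close> on one component and the point at
  \<open>t\<close> on the other: their planes are perpendicular, and the second component has its
  height negated.\<close>

definition dist2 :: "real \<Rightarrow> real \<Rightarrow> real" where "dist2 s t = (X s)\<^sup>2 + (X t)\<^sup>2 + (Y s + Y t)\<^sup>2"

lemma dist2_commute: "dist2 s t = dist2 t s" by (simp add: dist2_def add.commute)

text \<open>Expansion about the tip of the first component. The first difference is nonnegative by
  \<open>tip_ball\<close> and the next sum at least 1 by \<open>dist_tip\<close>, so only the sign
  of the last product is in question.\<close>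

lemma dist2_tip_expand:
  "dist2 s t = (X s)\<^sup>2 - (2 * \<sigma> * (Y s - z0) - (Y s - z0)\<^sup>2) + ((X t)\<^sup>2 + (Y t + z0)\<^sup>2) + 2 * (Y s - z0) * (\<sigma> + (Y t + z0))"
  by (simp add: dist2_def power2_eq_square algebra_simps)

text \<open>When the last product in \<open>dist2_tip_expand\<close> may be negative,
  \<open>X t\<close> is large instead, and the point at \<open>s\<close> supplies the missing
  \<open>\<sigma>\<^sup>2\<close>: by its abscissa if it is high, otherwise by
  \<open>tip_ball\<close> together with the difference in height.\<close>

lemma dist2_far:
  assumes "0 \<le> s" "- \<sigma> \<le> Y t + z0 \<or> 1 - \<sigma>\<^sup>2 \<le> (X t)\<^sup>2"
  shows "1 \<le> dist2 s t"
proof (cases "- \<sigma> \<le> Y t + z0")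
  case True
  then have "0 \<le> 2 * (Y s - z0) * (\<sigma> + (Y t + z0))" using above_tip[of s] by simp
  then show ?thesis using tip_ball[of s] dist_tip[of t] dist2_tip_expand[of s t] by linarith
next
  case False
  then have Xt: "1 - \<sigma>\<^sup>2 \<le> (X t)\<^sup>2" using assms by simp
  show ?thesis
  proof (cases "\<sigma> \<le> Y s - z0")
    case True
    have "\<sigma>\<^sup>2 \<le> (X s)\<^sup>2" using X_large[OF assms(1) True] sigma_pos by (intro power_mono) auto
    then show ?thesis using Xt zero_le_power2[of "Y s + Y t"] unfolding dist2_def by linarith
  next
    case small: False
    have "(\<sigma> - (Y s - z0))\<^sup>2 \<le> (- (Y t + z0) - (Y s - z0))\<^sup>2" using False small by (intro power_mono) auto
    moreover have "(- (Y t + z0) - (Y s - z0))\<^sup>2 = (Y s + Y t)\<^sup>2" by (simp add: power2_eq_square algebra_simps)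
    moreover have "(\<sigma> - (Y s - z0))\<^sup>2 = \<sigma>\<^sup>2 - (2 * \<sigma> * (Y s - z0) - (Y s - z0)\<^sup>2)" by (simp add: power2_eq_square algebra_simps)
    ultimately show ?thesis using tip_ball[of s] Xt unfolding dist2_def by linarith
  qed
qed

text \<open>The two segments lie in parallel planes with normal
  \<open>(\<tau>/2, - \<tau>/2, - C)\<close> of squared length \<open>2 - C\<^sup>2\<close>, and
  \<open>?v\<close> is the difference of the values of this normal on them. By Cauchy-Schwarz, in
  the form of a sum of squares, \<open>sigma_bound\<close> is exactly what puts the planes at
  distance at least 1.\<close>

lemma dist2_segments:
  assumes "s \<in> {s1..s2}" "t \<in> {s1..s2}"
  shows "1 \<le> dist2 s t"
proof -
  have z: "2 * z0 * C = - (\<sigma> * C) - (1 - \<sigma>)" using C_pos by (simp add: z0_def field_simps)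
  have l: "X u * (\<tau>/2) - Y u * C = 1 + z0 * C" if "u \<in> {s1..s2}" for u
    using support[of u] that by (simp add: ang_values(2) sin1 cos1 algebra_simps)
  let ?v = "(X s + X t) * (\<tau>/2) - (Y s + Y t) * C"
  have v: "?v = 1 + \<sigma> * (1 - C)"
    using l[OF assms(1)] l[OF assms(2)] z by (simp only: distrib_right right_diff_distrib mult_1_right)
  have "(2 * (\<tau>/2)\<^sup>2 + C\<^sup>2) * dist2 s t - ?v\<^sup>2
     = (\<tau>/2)\<^sup>2 * (X s - X t)\<^sup>2 + (C * X s + (\<tau>/2) * (Y s + Y t))\<^sup>2 + (C * X t + (\<tau>/2) * (Y s + Y t))\<^sup>2"
    by (simp add: dist2_def power2_eq_square algebra_simps)
  then have "?v\<^sup>2 \<le> (2 * (\<tau>/2)\<^sup>2 + C\<^sup>2) * dist2 s t"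
    by (smt (verit) zero_le_power2 mult_nonneg_nonneg)
  moreover have "2 * (\<tau>/2)\<^sup>2 + C\<^sup>2 = 2 - C\<^sup>2" using C_sq by linarith
  ultimately have "2 - C\<^sup>2 \<le> (2 - C\<^sup>2) * dist2 s t" using sigma_bound v by simp
  moreover have "0 < 2 - C\<^sup>2" using C_sq zero_le_power2[of "\<tau>/2"] by linarith
  ultimately show ?thesis by (simp add: mult_le_cancel_left1)
qed

text \<open>On the tip arc \<open>tip_ball\<close> is an equality, so by
  \<open>dist2_tip_expand\<close> the squared distance to a fixed point is affine in the height of
  the moving point, and nonincreasing if the fixed point is low. The least value is at the end
  \<open>s1\<close> of the arc.\<close>

lemma dist2_arc_le:
  assumes "s \<in> {0..s1}" "Y t + z0 \<le> - \<sigma>"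
  shows "dist2 s1 t \<le> dist2 s t"
proof -
  have arc: "(X u)\<^sup>2 - (2 * \<sigma> * (Y u - z0) - (Y u - z0)\<^sup>2) = 0" if "u \<in> {0..s1}" for u
  proof -
    have "u \<in> {-s1..s1}" using that s123 by auto
    note c = curve_arc[OF this]
    have "(\<sigma> * S)\<^sup>2 - (2 * \<sigma> * (z0 + \<sigma> - \<sigma> * c - z0) - (z0 + \<sigma> - \<sigma> * c - z0)\<^sup>2) = \<sigma>\<^sup>2 * (S\<^sup>2 + c\<^sup>2) - \<sigma>\<^sup>2"
      for S c by (simp add: power2_eq_square algebra_simps)
    then show ?thesis unfolding c by simp
  qed
  have "Y s \<le> Y s1" using assms by (intro Y_mono) auto
  then have "(Y s1 - z0) * (\<sigma> + (Y t + z0)) \<le> (Y s - z0) * (\<sigma> + (Y t + z0))"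
    using assms by (intro mult_right_mono_neg) auto
  then have "2 * (Y s1 - z0) * (\<sigma> + (Y t + z0)) \<le> 2 * (Y s - z0) * (\<sigma> + (Y t + z0))"
    by (simp only: mult.assoc)
  moreover have "s1 \<in> {0..s1}" using s123 by simp
  ultimately show ?thesis
    using dist2_tip_expand[of s t] dist2_tip_expand[of s1 t] arc[OF assms(1)] arc[of s1] by linarith
qed

text \<open>Points that are not far lie before \<open>s2\<close>, because
  \<open>X s2 = \<tau>/2\<close> and \<open>C < \<sigma>\<close>. Both parameters can then be pushed
  from the tip arcs to the segments without increasing the distance. After the first push the moved
  point may have become far, whence the second case split.\<close>

lemma dist2_ge_1_nonneg:
  assumes s: "0 \<le> s" and t: "0 \<le> t"
  shows "1 \<le> dist2 s t"
proof -
  let ?far = "\<lambda>t. - \<sigma> \<le> Y t + z0 \<or> 1 - \<sigma>\<^sup>2 \<le> (X t)\<^sup>2"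
  have near: "u \<le> s2" if "\<not> ?far u" for u
  proof (rule ccontr)
    assume "\<not> u \<le> s2"
    then have "(\<tau>/2)\<^sup>2 \<le> (X u)\<^sup>2" using X_mono[of s2 u] curve_s2(1) tau by (intro power_mono) auto
    moreover have "C\<^sup>2 \<le> \<sigma>\<^sup>2" using sigma_gt_C C_pos by (intro power_mono) auto
    ultimately show False using that C_sq by auto
  qed
  show ?thesis
  proof (cases "?far t \<or> ?far s")
    case True
    then show ?thesis using dist2_far[OF s, of t] dist2_far[OF t, of s] by (metis dist2_commute)
  next
    case False
    then have st: "s \<le> s2" "t \<le> s2" "Y t + z0 \<le> - \<sigma>" using near by auto
    let ?s = "max s s1" and ?t = "max t s1"
    have mx: "?s \<in> {s1..s2}" "?t \<in> {s1..s2}" "0 \<le> ?s" using st s123 by auto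
    have 1: "dist2 ?s t \<le> dist2 s t"
      using dist2_arc_le[of s t] s st by (cases "s \<le> s1") (auto simp: max_def)
    have "1 \<le> dist2 ?s t"
    proof (cases "?far ?s")
      case True
      then show ?thesis using dist2_far[OF t, of ?s] by (metis dist2_commute)
    next
      case False
      then have "dist2 ?t ?s \<le> dist2 t ?s"
        using dist2_arc_le[of t ?s] t by (cases "t \<le> s1") (auto simp: max_def)
      then show ?thesis using dist2_segments[OF mx(2,1)] by (simp add: dist2_commute)
    qed
    then show ?thesis using 1 by simp
  qed
qed

lemma dist2_ge_1: "1 \<le> dist2 s t"
proof -
  have "dist2 s t = dist2 \<bar>s\<bar> \<bar>t\<bar>"
    using X_minus[of s] X_minus[of t] Y_minus[of s] Y_minus[of t] by (auto simp: dist2_def abs_real_def)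
  then show ?thesis using dist2_ge_1_nonneg[of "\<bar>s\<bar>" "\<bar>t\<bar>"] by simp
qed

lemma dist2_strut:
  assumes "s \<in> {s2..s3}"
  shows "dist2 s 0 = 1"
  using curve_shoulder[OF assms] by (simp add: dist2_def X0 Y0)

text \<open>On the right half \<open>X + Y\<close> is strictly increasing, since the tangent angle
  lies between 0 and a right angle; the two halves are told apart by the sign of
  \<open>X\<close>.\<close>

lemma curve_inj:
  assumes "X s = X t" "Y s = Y t"
  shows "s = t"
proof -
  have XY: "u = v" if "0 \<le> u" "0 \<le> v" "X u = X v" "Y u = Y v" for u v
  proof -
    have "X u + Y u < X v + Y v" if "0 \<le> u" "u < v" for u v
    proof (rule DERIV_pos_imp_increasing_open[OF \<open>u < v\<close>])
      fix x assume "u < x" 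
      have r: "0 \<le> ang x" "ang x \<le> pi/2" using ang_nonneg[of x] ang_range(4) \<open>0 \<le> u\<close> \<open>u < x\<close> by auto
      have "0 < cos (ang x) + sin (ang x)"
      proof (cases "ang x = 0")
        case False
        then have "0 < sin (ang x)" using r pi_gt_zero by (intro sin_gt_zero) auto
        then show ?thesis using cos_ang[of x] by simp
      qed simp
      moreover have "((\<lambda>x. X x + Y x) has_real_derivative cos (ang x) + sin (ang x)) (at x)"
        by (intro derivative_intros X_DERIV Y_DERIV)
      ultimately show "\<exists>y. ((\<lambda>x. X x + Y x) has_real_derivative y) (at x) \<and> 0 < y" by blast
    qed (intro continuous_intros X_continuous Y_continuous)
    then show ?thesis using that by (metis less_irrefl linorder_neqE_linordered_idom)
  qed
  have pos: "0 < X u" if "0 < u" for u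
  proof -
    have "0 < X (min u s1)"
    proof -
      have "min u s1 / \<sigma> \<le> \<theta>1" "0 < min u s1 / \<sigma>" using that s123 sigma_pos by (auto simp: s1_def pos_divide_le_eq mult.commute min_le_iff_disj)
      then have "0 < sin (min u s1 / \<sigma>)" using theta pi_gt_zero by (intro sin_gt_zero) auto
      then show ?thesis using curve_arc(1)[of "min u s1"] that s123 sigma_pos by simp
    qed
    then show ?thesis using X_mono[of "min u s1" u] by simp
  qed
  show ?thesis
  proof (cases "0 \<le> s \<and> 0 \<le> t \<or> s \<le> 0 \<and> t \<le> 0")
    case True
    then show ?thesis using XY[of s t] XY[of "-s" "-t"] assms by (auto simp: X_minus Y_minus)
  next
    case False
    then show ?thesis using pos[of s] pos[of t] pos[of "-s"] pos[of "-t"] assms by (auto simp: X_minus not_le)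
  qed
qed

lemma X_pos: "0 < s \<Longrightarrow> 0 < X s"
  using X_nonneg[of s] curve_inj[of s "-s"] X_minus[of s] Y_minus[of s] by fastforce

end

section \<open>The two components in space\<close>

context clasp_curve begin

text \<open>The components are indexed by the real numbers 0 and 1, so that the data below depend
  continuously on the index and the kinks form a compact subset of a metric space.\<close>

definition fa :: "real \<Rightarrow> real^3" where "fa j = (1 - j) *\<^sub>R axis 1 1 + j *\<^sub>R axis 2 1"
definition fb :: "real \<Rightarrow> real^3" where "fb j = (1 - 2 * j) *\<^sub>R axis 3 1"
definition curve where "curve j s = X s *\<^sub>R fa j + Y s *\<^sub>R fb j"
definition tangent where "tangent j s = cos (ang s) *\<^sub>R fa j + sin (ang s) *\<^sub>R fb j"
definition normal where "normal j s = - sin (ang s) *\<^sub>R fa j + cos (ang s) *\<^sub>R fb j"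

lemma frame_inner:
  assumes "j \<in> {0, 1}"
  shows "fa j \<bullet> fa j = 1" "fb j \<bullet> fb j = 1" "fa j \<bullet> fb j = 0" "fb j \<bullet> fa j = 0"
  using assms by (auto simp: fa_def fb_def inner_axis_axis)

lemma frame_combination_inner:
  assumes "j \<in> {0, 1}"
  shows "(x *\<^sub>R fa j + y *\<^sub>R fb j) \<bullet> (x' *\<^sub>R fa j + y' *\<^sub>R fb j) = x * x' + y * y'"
  using frame_inner[OF assms] by (simp add: inner_add_left inner_add_right)

lemma curve_derivative: "(curve j has_vector_derivative tangent j s) (at s)"
proof -
  have "((\<lambda>s. X s *\<^sub>R fa j) has_vector_derivative cos (ang s) *\<^sub>R fa j) (at s)"
    using has_vector_derivative_scaleR[OF X_DERIV has_vector_derivative_const] by simp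
  moreover have "((\<lambda>s. Y s *\<^sub>R fb j) has_vector_derivative sin (ang s) *\<^sub>R fb j) (at s)"
    using has_vector_derivative_scaleR[OF Y_DERIV has_vector_derivative_const] by simp
  ultimately show ?thesis unfolding curve_def[abs_def] tangent_def by (rule has_vector_derivative_add)
qed

lemma tangent_unit: "j \<in> {0, 1} \<Longrightarrow> norm (tangent j s) = 1"
  and normal_unit: "j \<in> {0, 1} \<Longrightarrow> norm (normal j s) = 1"
  and tangent_normal: "j \<in> {0, 1} \<Longrightarrow> tangent j s \<bullet> normal j s = 0"
proof -
  assume j: "j \<in> {0, 1}"
  have 1: "cos (ang s) * cos (ang s) + sin (ang s) * sin (ang s) = 1"
    using sin_cos_squared_add2[of "ang s"] by (simp add: power2_eq_square)
  show "norm (tangent j s) = 1" unfolding tangent_def norm_eq_sqrt_inner frame_combination_inner[OF j] 1 by simp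
  show "norm (normal j s) = 1" unfolding normal_def norm_eq_sqrt_inner frame_combination_inner[OF j] using 1 by (simp add: add.commute)
  show "tangent j s \<bullet> normal j s = 0" unfolding normal_def tangent_def frame_combination_inner[OF j] by simp
qed

lemma curve_diff: "curve j s - curve j u = (X s - X u) *\<^sub>R fa j + (Y s - Y u) *\<^sub>R fb j"
  by (simp add: curve_def algebra_simps)

lemma dist_curve_same:
  assumes "j \<in> {0, 1}"
  shows "(norm (curve j s - curve j u))\<^sup>2 = (X s - X u)\<^sup>2 + (Y s - Y u)\<^sup>2"
  unfolding curve_diff power2_norm_eq_inner frame_combination_inner[OF assms] by (simp add: power2_eq_square)

lemma dist_curves: "(norm (curve 0 s - curve 1 t))\<^sup>2 = dist2 s t"
proof -
  have "curve 0 s - curve 1 t = X s *\<^sub>R axis 1 1 - X t *\<^sub>R axis 2 1 + (Y s + Y t) *\<^sub>R axis 3 1"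
    by (simp add: curve_def fa_def fb_def algebra_simps)
  then show ?thesis unfolding power2_norm_eq_inner
    by (simp add: inner_add_left inner_add_right inner_diff_left inner_diff_right inner_axis_axis dist2_def power2_eq_square)
qed

text \<open>The chord of an angle is at most the angle, \<open>ang\<close> has Lipschitz constant
  \<open>1 / \<sigma>\<close>, and \<open>1 / 0.86 < 117/100\<close>.\<close>

lemma tangent_lipschitz:
  assumes j: "j \<in> {0, 1}"
  shows "norm (tangent j u - tangent j s) \<le> (117/100) * \<bar>u - s\<bar>"
proof -
  have "tangent j u - tangent j s = (cos (ang u) - cos (ang s)) *\<^sub>R fa j + (sin (ang u) - sin (ang s)) *\<^sub>R fb j"
    by (simp add: tangent_def algebra_simps)
  then have "(norm (tangent j u - tangent j s))\<^sup>2 = (cos (ang u) - cos (ang s))\<^sup>2 + (sin (ang u) - sin (ang s))\<^sup>2"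
    by (simp only: power2_norm_eq_inner frame_combination_inner[OF j]) (simp only: power2_eq_square)
  also have "\<dots> = ((cos (ang u))\<^sup>2 + (sin (ang u))\<^sup>2) + ((cos (ang s))\<^sup>2 + (sin (ang s))\<^sup>2) - 2 * cos (ang u - ang s)"
    unfolding cos_diff by (simp add: power2_eq_square algebra_simps)
  also have "\<dots> = 2 - 2 * cos (2 * ((ang u - ang s) / 2))"
    by (simp only: sin_cos_squared_add2 nonzero_mult_div_cancel_left times_divide_eq_right)
  also have "\<dots> = (2 * \<bar>sin ((ang u - ang s) / 2)\<bar>)\<^sup>2"
    unfolding cos_double_sin by (simp add: power2_eq_square)
  finally have "norm (tangent j u - tangent j s) = 2 * \<bar>sin ((ang u - ang s) / 2)\<bar>"
    by (rule power2_eq_imp_eq) auto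
  also have "\<dots> \<le> \<bar>ang u - ang s\<bar>" using abs_sin_x_le_abs_x[of "(ang u - ang s) / 2"] by simp
  also have "\<dots> \<le> \<bar>u - s\<bar> / \<sigma>"
    using ang_lipschitz[of u s] ang_lipschitz[of s u] by (cases "u \<le> s") auto
  also have "\<dots> \<le> \<bar>u - s\<bar> * (117/100)"
  proof -
    have "1 / \<sigma> \<le> 117/100" using sigma_lower by (simp add: pos_divide_le_eq)
    then have "\<bar>u - s\<bar> * (1 / \<sigma>) \<le> \<bar>u - s\<bar> * (117/100)" by (rule mult_left_mono) simp
    then show ?thesis by simp
  qed
  finally show ?thesis by simp
qed

lemma ang_piece_DERIV:
  assumes P: "(p, q, k) \<in> pieces l" and s: "s \<in> {p..q}"
  shows "(ang has_real_derivative k) (at s within {p..q})"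
proof -
  have "((\<lambda>s. ang p + k * (s - p)) has_real_derivative k) (at s within {p..q})"
    by (auto intro!: derivative_eq_intros)
  then show ?thesis
  proof (rule has_field_derivative_transform_within[OF _ zero_less_one s])
    show "ang p + k * (x - p) = ang x" if "x \<in> {p..q}" for x by (rule ang_piece[OF P that, symmetric])
  qed
qed

lemma frame_derivatives:
  assumes "(ang has_real_derivative k) (at s within S)"
  shows "(tangent j has_vector_derivative k *\<^sub>R normal j s) (at s within S)"
    and "(normal j has_vector_derivative - k *\<^sub>R tangent j s) (at s within S)"
proof -
  have c: "((\<lambda>s. cos (ang s)) has_real_derivative - sin (ang s) * k) (at s within S)"
    and i: "((\<lambda>s. sin (ang s)) has_real_derivative cos (ang s) * k) (at s within S)"
    and i': "((\<lambda>s. - sin (ang s)) has_real_derivative - (cos (ang s) * k)) (at s within S)"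
    using assms by (auto intro!: derivative_eq_intros)
  show "(tangent j has_vector_derivative k *\<^sub>R normal j s) (at s within S)"
    using has_vector_derivative_add[OF has_vector_derivative_scaleR[OF c has_vector_derivative_const[of "fa j"]]
        has_vector_derivative_scaleR[OF i has_vector_derivative_const[of "fb j"]]]
    by (simp add: tangent_def[abs_def] normal_def algebra_simps)
  show "(normal j has_vector_derivative - k *\<^sub>R tangent j s) (at s within S)"
    using has_vector_derivative_add[OF has_vector_derivative_scaleR[OF i' has_vector_derivative_const[of "fa j"]]
        has_vector_derivative_scaleR[OF c has_vector_derivative_const[of "fb j"]]]
    by (simp add: tangent_def normal_def[abs_def] algebra_simps)
qed

lemma pieces_cover:
  assumes "s3 < l"
  shows "(\<Union>(p, q, k)\<in>pieces l. {p..q}) = {-l..l}" "(p, q, k) \<in> pieces l \<Longrightarrow> p < q"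
  using assms s123 by (auto simp: pieces_def)

lemma curve_inj_on: "j \<in> {0, 1} \<Longrightarrow> inj_on (curve j) A"
proof (rule inj_onI)
  fix s u assume j: "j \<in> {0, 1}" and "curve j s = curve j u"
  then have "(X s - X u)\<^sup>2 + (Y s - Y u)\<^sup>2 = 0" using dist_curve_same[OF j, of s u] by simp
  then show "s = u" using curve_inj[of s u] by (simp add: sum_power2_eq_zero_iff)
qed

text \<open>Let \<open>P\<close> lead to \<open>p\<close> and \<open>w\<close> to the second nearest
  point. As \<open>P\<close> is orthogonal to the tangent, \<open>w \<bullet> w = 2 * (P \<bullet>
  w) \<le> w \<bullet> normal j s\<close>, whereas \<open>inner_ball\<close> says
  \<open>2 * \<sigma> * (w \<bullet> normal j s) \<le> w \<bullet> w\<close>. With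
  \<open>\<sigma> > 1/2\<close> this forces \<open>w = 0\<close>. The point \<open>p\<close> may lie
  off the plane of the curve; only the normal component of \<open>P\<close> matters.\<close>

lemma nearest_interior_unique:
  assumes j: "j \<in> {0, 1}" and s: "s \<in> {-l<..<l}" and u: "u \<in> {-l..l}"
    and d: "dist p (curve j s) \<le> 1/2"
    and min: "\<And>v. v \<in> {-l..l} \<Longrightarrow> dist p (curve j s) \<le> dist p (curve j v)"
    and eq: "dist p (curve j u) = dist p (curve j s)"
  shows "s = u"
proof (rule ccontr)
  assume "s \<noteq> u"
  define P where "P = p - curve j s"
  define w where "w = curve j u - curve j s"
  have w0: "w \<noteq> 0" using curve_inj_on[OF j, of UNIV] \<open>s \<noteq> u\<close> by (auto simp: w_def inj_on_def)
  have "norm (P - w) = norm P" using eq by (simp add: P_def w_def dist_norm)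
  then have "(P - w) \<bullet> (P - w) = P \<bullet> P" by (simp add: dot_square_norm)
  then have Pw: "2 * (P \<bullet> w) = w \<bullet> w" by (simp add: inner_diff_left inner_diff_right inner_commute)
  have "(curve j s - p) \<bullet> tangent j s = 0"
  proof (rule antisym)
    let ?f = "\<lambda>v. (curve j v - p) \<bullet> (curve j v - p)"
    have f: "?f v = (dist p (curve j v))\<^sup>2" for v by (simp add: dist_norm norm_minus_commute dot_square_norm)
    have "((\<lambda>v. curve j v - p) has_vector_derivative tangent j s - 0) (at s)" by (intro derivative_intros curve_derivative)
    from bounded_bilinear.has_vector_derivative[OF bounded_bilinear_inner this this]
    have "(?f has_real_derivative 2 * ((curve j s - p) \<bullet> tangent j s)) (at s)"
      by (simp add: has_real_derivative_iff_has_vector_derivative inner_commute)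
    then have "2 * ((curve j s - p) \<bullet> tangent j s) = 0"
    proof (rule DERIV_local_min)
      show "0 < min (s + l) (l - s)" using s by auto
      show "\<forall>v. \<bar>s - v\<bar> < min (s + l) (l - s) \<longrightarrow> ?f s \<le> ?f v"
        unfolding f by (intro allI impI power_mono min) auto
    qed
    then show "(curve j s - p) \<bullet> tangent j s \<le> 0" "0 \<le> (curve j s - p) \<bullet> tangent j s" by auto
  qed
  then have PT: "P \<bullet> tangent j s = 0" unfolding P_def by (simp add: inner_diff_left)
  have wN: "w \<bullet> normal j s = - (X u - X s) * sin (ang s) + (Y u - Y s) * cos (ang s)"
    unfolding w_def curve_diff normal_def frame_combination_inner[OF j] by (simp add: algebra_simps)
  have "w = (w \<bullet> tangent j s) *\<^sub>R tangent j s + (w \<bullet> normal j s) *\<^sub>R normal j s"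
  proof -
    have id: "x = (x * c + y * S) * c + (- x * S + y * c) * - S \<and> y = (x * c + y * S) * S + (- x * S + y * c) * c"
      if "S\<^sup>2 + c\<^sup>2 = 1" for x y S c :: real
    proof -
      have "(x * c + y * S) * c + (- x * S + y * c) * - S = x * (S\<^sup>2 + c\<^sup>2)" 
           "(x * c + y * S) * S + (- x * S + y * c) * c = y * (S\<^sup>2 + c\<^sup>2)"
        by (simp_all add: power2_eq_square algebra_simps)
      then show ?thesis using that by simp
    qed
    have gen: "a *\<^sub>R (c *\<^sub>R p + S *\<^sub>R q) + b *\<^sub>R (- S *\<^sub>R p + c *\<^sub>R q) = (a * c + b * - S) *\<^sub>R p + (a * S + b * c) *\<^sub>R q"
      for a b c S :: real and p q :: "real^3" by (simp add: algebra_simps)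
    have wT: "w \<bullet> tangent j s = (X u - X s) * cos (ang s) + (Y u - Y s) * sin (ang s)"
      unfolding w_def curve_diff tangent_def frame_combination_inner[OF j] by simp
    have "(w \<bullet> tangent j s) *\<^sub>R tangent j s + (w \<bullet> normal j s) *\<^sub>R normal j s =
      (((X u - X s) * cos (ang s) + (Y u - Y s) * sin (ang s)) * cos (ang s) + (- (X u - X s) * sin (ang s) + (Y u - Y s) * cos (ang s)) * - sin (ang s)) *\<^sub>R fa j
      + (((X u - X s) * cos (ang s) + (Y u - Y s) * sin (ang s)) * sin (ang s) + (- (X u - X s) * sin (ang s) + (Y u - Y s) * cos (ang s)) * cos (ang s)) *\<^sub>R fb j"
      unfolding wT wN unfolding tangent_def normal_def by (rule gen)
    also have "\<dots> = w"
      unfolding w_def curve_diff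
      using id[OF sin_cos_squared_add, of "X u - X s" "ang s" "Y u - Y s"] by simp
    finally show ?thesis by simp
  qed
  then have "P \<bullet> w = P \<bullet> ((w \<bullet> tangent j s) *\<^sub>R tangent j s + (w \<bullet> normal j s) *\<^sub>R normal j s)" by simp
  also have "\<dots> = (w \<bullet> normal j s) * (P \<bullet> normal j s)" using PT by (simp add: inner_add_right)
  also have "\<dots> \<le> (w \<bullet> normal j s) * (1/2)"
  proof (rule mult_left_mono)
    show "P \<bullet> normal j s \<le> 1/2"
      using norm_cauchy_schwarz[of P "normal j s"] normal_unit[OF j, of s] d by (simp add: P_def dist_norm)
    show "0 \<le> w \<bullet> normal j s" unfolding wN by (rule convex_tangent)
  qed
  finally have "2 * \<sigma> * (w \<bullet> w) \<le> 2 * \<sigma> * (w \<bullet> normal j s)" using Pw sigma_pos by simp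
  also have "\<dots> \<le> w \<bullet> w"
    using inner_ball[of u s] dist_curve_same[OF j, of u s] unfolding wN[symmetric] w_def[symmetric]
    by (simp add: dot_square_norm)
  finally have "(2 * \<sigma> - 1) * (w \<bullet> w) \<le> 0" by (simp add: algebra_simps)
  moreover have "0 < w \<bullet> w" using w0 by simp
  ultimately show False using sigma_lower by (simp add: mult_le_0_iff)
qed

text \<open>Unless one of the two points is interior, they are the two ends, which are
  \<open>2 * X l > 1\<close> apart, although both would lie within 1/2 of \<open>p\<close>.\<close>

lemma nearest_unique:
  assumes j: "j \<in> {0, 1}" and l: "1/2 < X l" and s: "s \<in> {-l..l}" and u: "u \<in> {-l..l}"
    and d: "dist p (curve j s) \<le> 1/2"
    and min: "\<And>v. v \<in> {-l..l} \<Longrightarrow> dist p (curve j s) \<le> dist p (curve j v)"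
    and eq: "dist p (curve j u) = dist p (curve j s)"
  shows "s = u"
proof -
  have "(norm (curve j l - curve j (- l)))\<^sup>2 = (2 * X l)\<^sup>2"
    unfolding dist_curve_same[OF j] X_minus Y_minus by simp
  then have ends: "norm (curve j l - curve j (- l)) = 2 * X l" by (rule power2_eq_imp_eq) (use l in auto)
  have le1: "dist (curve j s) (curve j u) \<le> 1"
    using dist_triangle[of "curve j s" "curve j u" p] d eq by (simp add: dist_commute)
  consider "s \<in> {-l<..<l}" | "u \<in> {-l<..<l}" | "s = u" | "s = l" "u = -l" | "s = -l" "u = l"
    using s u by fastforce
  then show ?thesis
  proof cases
    case 1 show ?thesis by (rule nearest_interior_unique[OF j 1 u d min eq])
  next
    case 2
    have "dist p (curve j u) \<le> 1/2" using d eq by linarith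
    moreover have "dist p (curve j u) \<le> dist p (curve j v)" if "v \<in> {-l..l}" for v
      using min[OF that] eq by linarith
    ultimately show ?thesis using nearest_interior_unique[OF j 2 s _ _ eq[symmetric]] by blast
  next
    case 3 then show ?thesis .
  next
    case 4
    then show ?thesis using ends le1 l by (simp add: dist_norm)
  next
    case 5
    then show ?thesis using ends le1 l by (simp add: dist_norm norm_minus_commute)
  qed
qed

end

section \<open>Variation of the thickness\<close>

lemma C1_param_inverse:
  fixes F :: "real \<Rightarrow> 'k::topological_space \<Rightarrow> real"
  assumes F: "C1_param \<epsilon> K F V" and nz: "\<And>t k. \<bar>t\<bar> < \<epsilon> \<Longrightarrow> k \<in> K \<Longrightarrow> F t k \<noteq> 0"
  shows "C1_param \<epsilon> K (\<lambda>t k. inverse (F t k)) (\<lambda>p. - V p / (F (fst p) (snd p))\<^sup>2)"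
  unfolding C1_param_def
proof (intro conjI ballI)
  fix t k assume tk: "t \<in> {-\<epsilon><..<\<epsilon>}" "k \<in> K"
  then have t: "\<bar>t\<bar> < \<epsilon>" by auto
  have "((\<lambda>u. F u k) has_real_derivative V (t, k)) (at t)"
    using C1_paramD(2)[OF F t tk(2)] by (simp add: has_real_derivative_iff_has_vector_derivative)
  from DERIV_inverse_fun[OF this nz[OF t tk(2)]]
  show "((\<lambda>u. inverse (F u k)) has_vector_derivative - V (t, k) / (F (fst (t, k)) (snd (t, k)))\<^sup>2) (at t)"
    by (simp add: has_real_derivative_iff_has_vector_derivative divide_inverse power2_eq_square mult.assoc)
next
  have nz': "F (fst p) (snd p) \<noteq> 0" if "p \<in> {-\<epsilon><..<\<epsilon>} \<times> K" for p
    using that by (intro nz) (auto simp: abs_less_iff)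
  show "continuous_on ({-\<epsilon><..<\<epsilon>} \<times> K) (\<lambda>p. - V p / (F (fst p) (snd p))\<^sup>2)"
    by (intro continuous_intros C1_paramD(3)[OF F] C1_paramD(4)[OF F]) (use nz' in auto)
  show "continuous_on ({-\<epsilon><..<\<epsilon>} \<times> K) (\<lambda>p. inverse (F (fst p) (snd p)))"
    by (intro continuous_intros C1_paramD(4)[OF F]) (use nz' in auto)
qed (rule C1_paramD(1)[OF F])

text \<open>The square of the curvature is a rational function of velocity and acceleration, hence
  differentiable also where the curvature vanishes.\<close>

lemma norm_curvature_of_sq:
  assumes "u \<noteq> 0"
  shows "(norm (curvature_of u v))\<^sup>2 = ((v \<bullet> v) * (u \<bullet> u) - (u \<bullet> v) * (u \<bullet> v)) * inverse ((u \<bullet> u) * ((u \<bullet> u) * (u \<bullet> u)))"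
proof -
  have n: "norm u \<noteq> 0" using assms by simp
  have uu: "u \<bullet> u = (norm u)\<^sup>2" by (simp add: dot_square_norm)
  let ?n = "norm u"
  have "(norm (curvature_of u v))\<^sup>2 = (1/?n\<^sup>2)\<^sup>2 * (v \<bullet> v) - 2 * (1/?n\<^sup>2) * ((u \<bullet> v)/?n^4) * (u \<bullet> v) + ((u \<bullet> v)/?n^4)\<^sup>2 * (u \<bullet> u)"
    unfolding curvature_of_def power2_norm_eq_inner
    by (simp add: inner_diff_left inner_diff_right inner_commute power2_eq_square)
  also have "\<dots> = ((v \<bullet> v) * ?n\<^sup>2 - (u \<bullet> v) * (u \<bullet> v)) * inverse (?n\<^sup>2 * (?n\<^sup>2 * ?n\<^sup>2))"
    unfolding uu using n by (simp add: field_simps power2_eq_square power4_eq_xxxx)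
  finally show ?thesis by (simp only: uu)
qed

text \<open>Leaves it to unification to compute the velocity \<open>V\<close> from the product and
  quotient rules.\<close>

lemma C1_param_exI: "C1_param \<epsilon> K G V \<Longrightarrow> R V \<Longrightarrow> \<exists>V. C1_param \<epsilon> K G V \<and> R V"
  by blast

text \<open>\<open>A\<close>, \<open>B\<close>, \<open>D\<close> stand for
  \<open>u \<bullet> u\<close>, \<open>u \<bullet> v\<close>, \<open>v \<bullet> v\<close> with
  velocity \<open>u\<close> and acceleration \<open>v\<close>. The minus sign turns the greatest
  curvature into a minimum, as Danskin's theorem expects. At time 0 arclength gives
  \<open>A = 1\<close> and \<open>B = 0\<close>.\<close>

lemma C1_param_squared_curvature:
  fixes A B D :: "real \<Rightarrow> 'k::topological_space \<Rightarrow> real"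
  assumes A: "C1_param \<epsilon> K A VA" and B: "C1_param \<epsilon> K B VB" and D: "C1_param \<epsilon> K D VD"
    and nz: "\<And>t k. \<bar>t\<bar> < \<epsilon> \<Longrightarrow> k \<in> K \<Longrightarrow> A t k \<noteq> 0"
  shows "\<exists>V. C1_param \<epsilon> K (\<lambda>t k. - ((D t k * A t k - B t k * B t k) * inverse (A t k * (A t k * A t k)))) V \<and>
    (\<forall>k. A 0 k = 1 \<longrightarrow> B 0 k = 0 \<longrightarrow> V (0, k) = - (VD (0, k) - 2 * D 0 k * VA (0, k)))"
proof -
  note m = bounded_bilinear.C1_param[OF bounded_bilinear_mult]
  note den = m[OF A m[OF A A]]
  have nz': "A t k * (A t k * A t k) \<noteq> 0" if "\<bar>t\<bar> < \<epsilon>" "k \<in> K" for t k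
    using nz[OF that] by simp
  note q = m[OF C1_param_diff[OF m[OF D A] m[OF B B]] C1_param_inverse[OF den nz']]
  note mq = C1_param_linear[OF q bounded_linear_minus[OF bounded_linear_ident]]
  show ?thesis by (rule C1_param_exI[OF mq]) simp_all
qed

text \<open>As both functions start from the same value, for positive t the difference quotient of
  the minimum is the minimum of the difference quotients.\<close>

lemma min_right_derivative:
  fixes f g :: "real \<Rightarrow> real"
  assumes f: "(f has_real_derivative a) (at_right 0)" and g: "(g has_real_derivative b) (at_right 0)" and eq: "f 0 = g 0"
  shows "((\<lambda>t. min (f t) (g t)) has_real_derivative min a b) (at_right 0)"
proof -
  have "((\<lambda>t. min ((f t - f 0) / (t - 0)) ((g t - g 0) / (t - 0))) \<longlongrightarrow> min a b) (at_right 0)"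
    using f g by (intro tendsto_min) (simp_all add: has_field_derivative_iff)
  moreover have "\<forall>\<^sub>F t in at_right 0. min ((f t - f 0) / (t - 0)) ((g t - g 0) / (t - 0)) = (min (f t) (g t) - min (f 0) (g 0)) / (t - 0)"
    unfolding eventually_at_filter
  proof (intro always_eventually allI impI)
    fix t :: real assume "t \<noteq> 0" "t \<in> {0<..}"
    then have t: "0 < t" by simp
    show "min ((f t - f 0) / (t - 0)) ((g t - g 0) / (t - 0)) = (min (f t) (g t) - min (f 0) (g 0)) / (t - 0)"
    proof (cases "f t \<le> g t")
      case True
      then have "(f t - f 0) / t \<le> (g t - g 0) / t" using t eq by (intro divide_right_mono) auto
      then show ?thesis using True eq by (simp add: min_def)
    next
      case False
      then have "(g t - g 0) / t < (f t - f 0) / t" using t eq by (intro divide_strict_right_mono) auto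
      then show ?thesis using False eq by (simp add: min_def)
    qed
  qed
  ultimately have "((\<lambda>t. (min (f t) (g t) - min (f 0) (g 0)) / (t - 0)) \<longlongrightarrow> min a b) (at_right 0)"
    by (rule Lim_transform_eventually)
  then show ?thesis by (simp add: has_field_derivative_iff)
qed

text \<open>The component, the piece in the sense of \<open>pieces\<close>, and the parameter.\<close>

type_synonym kink = "real \<times> (real \<times> real \<times> real) \<times> real"

section \<open>Struts, kinks and their first variations\<close>

context clasp_curve begin

text \<open>The piece belongs to the index because curvature jumps at the junctions: a junction
  occurs once with each of its one-sided curvatures, which makes the curvature a continuous function
  on a compact set.\<close>

definition kinks :: "real \<Rightarrow> kink set" where
  "kinks l = (\<Union>j\<in>{0, 1}. \<Union>i\<in>pieces l. {j} \<times> {i} \<times> {fst i..fst (snd i)})"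

lemma kinks_iff: "(j, (p, q, k), s) \<in> kinks l \<longleftrightarrow> j \<in> {0, 1} \<and> (p, q, k) \<in> pieces l \<and> s \<in> {p..q}"
  by (auto simp: kinks_def)

lemma kinks_compact: "compact (kinks l)"
  unfolding kinks_def by (intro compact_UN compact_Times) (auto simp: pieces_def)

definition L :: "real \<Rightarrow> (real^3) set" where "L l = curve 0 ` {-l..l} \<union> curve 1 ` {-l..l}"

definition curv :: "kink \<Rightarrow> real" where "curv x = snd (snd (fst (snd x)))"
definition par :: "kink \<Rightarrow> real" where "par x = snd (snd x)"

lemma curv_par: "curv (j, (p, q, k), s) = k" "par (j, (p, q, k), s) = s"
  by (simp_all add: curv_def par_def)

lemma continuous_frame:
  "continuous_on A (\<lambda>x::kink. curve (fst x) (par x))" "continuous_on A (\<lambda>x::kink. tangent (fst x) (par x))"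
  "continuous_on A (\<lambda>x::kink. normal (fst x) (par x))" "continuous_on A curv" "continuous_on A par"
proof -
  show p: "continuous_on A par" unfolding par_def[abs_def] by (intro continuous_intros)
  show "continuous_on A curv" unfolding curv_def[abs_def] by (intro continuous_intros)
  have X: "continuous_on A (\<lambda>x. X (par x))" by (rule continuous_on_compose2[OF X_continuous[of UNIV] p]) simp
  have Y: "continuous_on A (\<lambda>x. Y (par x))" by (rule continuous_on_compose2[OF Y_continuous[of UNIV] p]) simp
  have a: "continuous_on A (\<lambda>x. ang (par x))" by (rule continuous_on_compose2[OF ang_continuous[of UNIV] p]) simp
  show "continuous_on A (\<lambda>x::kink. curve (fst x) (par x))" "continuous_on A (\<lambda>x::kink. tangent (fst x) (par x))"
    "continuous_on A (\<lambda>x::kink. normal (fst x) (par x))"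
    unfolding curve_def tangent_def normal_def fa_def fb_def by (intro continuous_intros X Y a)+
qed

text \<open>First variation of the squared distance, hence twice that of the length of a strut of
  length 1.\<close>

definition strut_dot :: "(real^3 \<Rightarrow> real^3) \<Rightarrow> real \<times> real \<Rightarrow> real" where
  "strut_dot \<xi> k = 2 * ((curve 0 (fst k) - curve 1 (snd k)) \<bullet> (\<xi> (curve 0 (fst k)) - \<xi> (curve 1 (snd k))))"

text \<open>First variation of the squared curvature at a point of curvature \<open>k\<close> with
  unit tangent \<open>T\<close> and unit normal \<open>N\<close>; the last term accounts for the
  stretching of arclength.\<close>

definition kink_dot where
  "kink_dot \<xi>' \<xi>'' x = (let c = curve (fst x) (par x); T = tangent (fst x) (par x); N = normal (fst x) (par x); k = curv x
     in 2 * k * (N \<bullet> (blinfun_apply (blinfun_apply (\<xi>'' c) T) T + k *\<^sub>R blinfun_apply (\<xi>' c) N) - 2 * k * (T \<bullet> blinfun_apply (\<xi>' c) T)))"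

end

locale clasp_flow = clasp_curve \<tau> \<sigma> + flow \<epsilon> \<phi> D1 D2 V0 V1 V2
  for \<tau> \<sigma> \<epsilon> \<phi> D1 D2 V0 V1 V2 +
  fixes l :: real
  assumes l: "s3 < l" "1/2 < X l"
begin

text \<open>Velocity and, on a piece of curvature \<open>k\<close>, acceleration of the transported
  component. From them come the squared curvatures \<open>Q\<close>, with maximum \<open>M2\<close>;
  \<open>F\<close> are the squared distances between the components, with minimum
  \<open>M1\<close>.\<close>

definition g1 where "g1 t j s = D1 t (curve j s) (tangent j s)"
definition g2 where "g2 t k j s = D2 t (curve j s) (tangent j s) (tangent j s) + D1 t (curve j s) (k *\<^sub>R normal j s)"
definition F where "F t k = (\<phi> t (curve 0 (fst k)) - \<phi> t (curve 1 (snd k))) \<bullet> (\<phi> t (curve 0 (fst k)) - \<phi> t (curve 1 (snd k)))"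
definition Q where "Q t x = (let u = g1 t (fst x) (par x); v = g2 t (curv x) (fst x) (par x) in
   ((v \<bullet> v) * (u \<bullet> u) - (u \<bullet> v) * (u \<bullet> v)) * inverse ((u \<bullet> u) * ((u \<bullet> u) * (u \<bullet> u))))"
abbreviation "rect \<equiv> {-l..l} \<times> {-l..l}"
definition M1 where "M1 t = (INF k\<in>rect. F t k)"
definition M2 where "M2 t = - (INF x\<in>kinks l. - Q t x)"

lemma l_pos: "0 < l" using l s123 by linarith

lemma g1_nonzero: "\<bar>t\<bar> < \<epsilon> \<Longrightarrow> j \<in> {0, 1} \<Longrightarrow> g1 t j s \<noteq> 0"
  unfolding g1_def using tangent_unit[of j s] by (intro D1_nonzero) auto

lemma F_param: "\<exists>V. C1_param \<epsilon> rect F V \<and> (\<forall>k\<in>rect. V (0, k) = strut_dot (\<lambda>x. V0 (0, x)) k)"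
proof -
  have c: "continuous_on A (curve j)" for j A
    by (intro continuous_at_imp_continuous_on ballI has_vector_derivative_continuous[OF curve_derivative])
  have c0: "continuous_on rect (\<lambda>k. curve 0 (fst k))" by (rule continuous_on_compose2[OF c[of UNIV] continuous_on_fst[OF continuous_on_id]]) simp
  have c1: "continuous_on rect (\<lambda>k. curve 1 (snd k))" by (rule continuous_on_compose2[OF c[of UNIV] continuous_on_snd[OF continuous_on_id]]) simp
  note d = C1_param_diff[OF C1_param_subst[OF C1_param_phi c0] C1_param_subst[OF C1_param_phi c1], simplified]
  show ?thesis unfolding F_def[abs_def]
    by (rule C1_param_exI[OF bounded_bilinear.C1_param[OF bounded_bilinear_inner d d]]) (simp add: strut_dot_def phi0 inner_commute[of "V0 p - V0 q" for p q])
qed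

lemma g1_param: "C1_param \<epsilon> (kinks l) (\<lambda>t x. g1 t (fst x) (par x)) (\<lambda>p. V1 (fst p, curve (fst (snd p)) (par (snd p))) (tangent (fst (snd p)) (par (snd p))))"
proof -
  note D = C1_param_subst[OF C1_param_D1 continuous_frame(1), simplified]
  from bounded_bilinear.C1_param[OF bounded_bilinear_blinfun_apply D C1_param_const[OF eps continuous_frame(2)]]
  show ?thesis by (simp add: g1_def blinfun.zero_right)
qed

lemma g2_param: "C1_param \<epsilon> (kinks l) (\<lambda>t x. g2 t (curv x) (fst x) (par x))
   (\<lambda>p. V2 (fst p, curve (fst (snd p)) (par (snd p))) (tangent (fst (snd p)) (par (snd p))) (tangent (fst (snd p)) (par (snd p)))
      + V1 (fst p, curve (fst (snd p)) (par (snd p))) (curv (snd p) *\<^sub>R normal (fst (snd p)) (par (snd p))))"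
proof -
  note D = C1_param_subst[OF C1_param_D1 continuous_frame(1), simplified]
  note D2 = C1_param_subst[OF C1_param_D2 continuous_frame(1), simplified]
  note T = C1_param_const[OF eps continuous_frame(2)[of "kinks l"]]
  have N: "continuous_on (kinks l) (\<lambda>x. curv x *\<^sub>R normal (fst x) (par x))"
    by (intro continuous_intros continuous_frame)
  note b = bounded_bilinear.C1_param[OF bounded_bilinear_blinfun_apply]
  from C1_param_add[OF b[OF b[OF D2 T] T] b[OF D C1_param_const[OF eps N]]]
  show ?thesis by (simp add: g2_def blinfun.zero_right)
qed

lemma Q_param: "\<exists>V. C1_param \<epsilon> (kinks l) (\<lambda>t x. - Q t x) V \<and> 
   (\<forall>x\<in>kinks l. V (0, x) = - kink_dot (\<lambda>x. V1 (0, x)) (\<lambda>x. V2 (0, x)) x)"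
proof -
  let ?u = "\<lambda>t x. g1 t (fst x) (par x)" and ?v = "\<lambda>t x. g2 t (curv x) (fst x) (par x)"
  have nz: "?u t x \<noteq> 0" if "\<bar>t\<bar> < \<epsilon>" "x \<in> kinks l" for t x
    using g1_nonzero[OF that(1), of "fst x" "par x"] that(2) by (auto simp: kinks_def)
  note inn = bounded_bilinear.C1_param[OF bounded_bilinear_inner]
  have nz': "?u t x \<bullet> ?u t x \<noteq> 0" if "\<bar>t\<bar> < \<epsilon>" "x \<in> kinks l" for t x
    using nz[OF that] by simp
  let ?Vu = "\<lambda>x. V1 (0, curve (fst x) (par x)) (tangent (fst x) (par x))"
  let ?Vv = "\<lambda>x. V2 (0, curve (fst x) (par x)) (tangent (fst x) (par x)) (tangent (fst x) (par x))
         + V1 (0, curve (fst x) (par x)) (curv x *\<^sub>R normal (fst x) (par x))"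
  obtain V where V: "C1_param \<epsilon> (kinks l) (\<lambda>t x. - Q t x) V" and
    V0: "\<And>x. ?u 0 x \<bullet> ?u 0 x = 1 \<Longrightarrow> ?u 0 x \<bullet> ?v 0 x = 0 \<Longrightarrow>
      V (0, x) = - ((?v 0 x \<bullet> ?Vv x + ?Vv x \<bullet> ?v 0 x) - 2 * (?v 0 x \<bullet> ?v 0 x) * (?u 0 x \<bullet> ?Vu x + ?Vu x \<bullet> ?u 0 x))"
    using C1_param_squared_curvature[OF inn[OF g1_param g1_param] inn[OF g1_param g2_param] inn[OF g2_param g2_param] nz']
    unfolding Q_def[abs_def] Let_def fst_conv snd_conv by blast
  have at0: "?u 0 x = tangent (fst x) (par x)" "?v 0 x = curv x *\<^sub>R normal (fst x) (par x)" for x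
    by (simp_all add: g1_def g2_def D1_0 D2_0)
  have TT: "tangent j s \<bullet> tangent j s = 1" and NN: "normal j s \<bullet> normal j s = 1"
    and TN: "tangent j s \<bullet> normal j s = 0" "normal j s \<bullet> tangent j s = 0" if "j \<in> {0, 1}" for j s
    using tangent_unit[OF that, of s] normal_unit[OF that, of s] tangent_normal[OF that, of s] by (auto simp: dot_square_norm inner_commute)
  have j: "fst x \<in> {0, 1}" if "x \<in> kinks l" for x using that by (auto simp: kinks_def)
  have "V (0, x) = - kink_dot (\<lambda>x. V1 (0, x)) (\<lambda>x. V2 (0, x)) x" if x: "x \<in> kinks l" for x
  proof -
    have "?u 0 x \<bullet> ?u 0 x = 1" "?u 0 x \<bullet> ?v 0 x = 0" "?v 0 x \<bullet> ?v 0 x = curv x * curv x"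
      unfolding at0 by (simp_all add: TT[OF j[OF x]] NN[OF j[OF x]] TN[OF j[OF x]])
    from V0[OF this(1,2), unfolded this(3)]
    have "V (0, x) = - (2 * (?v 0 x \<bullet> ?Vv x) - 4 * (curv x * curv x) * (?u 0 x \<bullet> ?Vu x))"
      by (simp add: inner_commute[of "?Vv x"] inner_commute[of "?Vu x"])
    then show ?thesis unfolding at0 kink_dot_def Let_def by (simp add: algebra_simps blinfun.scaleR_right)
  qed
  then show ?thesis using V by blast
qed

end

context clasp_flow begin

lemma F_0: "F 0 k = dist2 (fst k) (snd k)"
  by (simp add: F_def phi0 dot_square_norm dist_curves)

lemma Q_0:
  assumes "x \<in> kinks l"
  shows "Q 0 x = (curv x)\<^sup>2"
proof -
  have j: "fst x \<in> {0, 1}" using assms by (auto simp: kinks_def)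
  have "g1 0 (fst x) (par x) = tangent (fst x) (par x)" "g2 0 (curv x) (fst x) (par x) = curv x *\<^sub>R normal (fst x) (par x)"
    by (simp_all add: g1_def g2_def D1_0 D2_0)
  then show ?thesis
    using tangent_unit[OF j, of "par x"] normal_unit[OF j, of "par x"] tangent_normal[OF j, of "par x"]
    by (simp add: Q_def Let_def dot_square_norm power2_eq_square)
qed

lemma M1_0: "M1 0 = 1"
  unfolding M1_def
proof (rule cInf_eq_minimum)
  have "(s2, 0) \<in> rect" using l s123 by auto
  moreover have "F 0 (s2, 0) = 1" using dist2_strut[of s2] s123 by (simp add: F_0)
  ultimately show "1 \<in> F 0 ` rect" by (metis imageI)
qed (auto simp: F_0 dist2_ge_1)

lemma curv_range: "x \<in> kinks l \<Longrightarrow> 0 \<le> curv x \<and> curv x \<le> 1 / \<sigma>"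
  using sigma_pos sigma1 by (auto simp: kinks_def pieces_def curv_def)

lemma M2_0: "M2 0 = (1 / \<sigma>)\<^sup>2"
proof -
  have "(INF x\<in>kinks l. - Q 0 x) = - ((1 / \<sigma>)\<^sup>2)"
  proof (rule cInf_eq_minimum)
    have x: "(0, (- s1, s1, 1 / \<sigma>), 0) \<in> kinks l" using s123 by (simp add: kinks_iff pieces_def)
    then have "- Q 0 (0, (- s1, s1, 1 / \<sigma>), 0) = - ((1 / \<sigma>)\<^sup>2)" by (simp only: Q_0 curv_par)
    then show "- ((1 / \<sigma>)\<^sup>2) \<in> (\<lambda>x. - Q 0 x) ` kinks l" using x by (metis imageI)
    fix y assume "y \<in> (\<lambda>x. - Q 0 x) ` kinks l"
    then obtain x where x: "x \<in> kinks l" "y = - Q 0 x" by blast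
    have "(curv x)\<^sup>2 \<le> (1 / \<sigma>)\<^sup>2" using curv_range[OF x(1)] by (intro power_mono) auto
    then show "- ((1 / \<sigma>)\<^sup>2) \<le> y" using x Q_0 by simp
  qed
  then show ?thesis by (simp add: M2_def)
qed

lemma C1_param_attains_INF:
  assumes "C1_param \<epsilon> K G V" "compact K" "K \<noteq> {}" "\<bar>t\<bar> < \<epsilon>"
  shows "\<exists>k\<in>K. G t k = (INF k\<in>K. G t k :: real) \<and> (\<forall>k'\<in>K. G t k \<le> G t k')"
proof -
  have "continuous_on K (\<lambda>k. (t, k))" by (rule continuous_on_Pair[OF continuous_on_const continuous_on_id])
  from continuous_on_compose2[OF C1_paramD(4)[OF assms(1)] this] have "continuous_on K (G t)"
    using assms(4) by (auto simp: abs_less_iff image_subset_iff)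
  from continuous_attains_inf[OF assms(2,3) this] obtain k where k: "k \<in> K" "\<And>k'. k' \<in> K \<Longrightarrow> G t k \<le> G t k'" by blast
  have "(INF k\<in>K. G t k) = G t k" by (rule cInf_eq_minimum) (use k in auto)
  then show ?thesis using k by metis
qed

lemma kinks_nonempty: "kinks l \<noteq> {}"
proof -
  have "(0, (- s1, s1, 1 / \<sigma>), 0) \<in> kinks l" using s123 by (simp add: kinks_iff pieces_def)
  then show ?thesis by blast
qed

lemma rect_compact: "compact rect" "rect \<noteq> {}"
  using l_pos by (auto intro!: compact_Times)

section \<open>Thickness of the transported link and its right derivative\<close>

lemma regular_arc_transported:
  assumes "0 < l"
  shows "\<exists>\<delta>>0. \<delta> < \<epsilon> \<and> (\<forall>t j. \<bar>t\<bar> \<le> \<delta> \<longrightarrow> j \<in> {0, 1} \<longrightarrow> regular_arc (\<lambda>s. \<phi> t (curve j s)) (g1 t j) (- l) l)"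
proof -
  have cc: "continuous_on A (curve j)" for A j
    by (intro continuous_at_imp_continuous_on ballI has_vector_derivative_continuous[OF curve_derivative])
  have "compact (curve 0 ` {-l..l} \<union> curve 1 ` {-l..l})"
    by (intro compact_Un compact_continuous_image cc compact_Icc)
  then obtain R where R: "\<And>x. x \<in> curve 0 ` {-l..l} \<union> curve 1 ` {-l..l} \<Longrightarrow> norm x \<le> R"
    using compact_imp_bounded bounded_iff by metis
  obtain \<delta> where \<delta>: "0 < \<delta>" "\<delta> < \<epsilon>"
    "\<And>t x. \<bar>t\<bar> \<le> \<delta> \<Longrightarrow> norm x \<le> R \<Longrightarrow> norm (\<phi> t x - x) < 1 \<and> norm (D1 t x - id_blinfun) < 1 \<and> norm (D2 t x) < 1"
    by (rule near_identity[OF zero_less_one, where R=R], rule that)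
  have "regular_arc (\<lambda>s. \<phi> t (curve j s)) (g1 t j) (- l) l" if t: "\<bar>t\<bar> \<le> \<delta>" and j: "j \<in> {0, 1}" for t j
    unfolding regular_arc_def
  proof (intro conjI allI)
    have t': "\<bar>t\<bar> < \<epsilon>" using t \<delta> by simp
    show "- l < l" using assms by simp
    show "((\<lambda>s. \<phi> t (curve j s)) has_vector_derivative g1 t j s) (at s)" for s
      unfolding g1_def by (rule transported_derivative[OF t' curve_derivative])
    have "continuous_on UNIV (D1 t)"
      using D1_derivative[OF t'] by (intro continuous_at_imp_continuous_on ballI has_derivative_continuous)
    then have "continuous_on UNIV (\<lambda>s. D1 t (curve j s))" by (rule continuous_on_compose2[OF _ cc]) simp
    moreover have "continuous_on UNIV (tangent j)"
      unfolding tangent_def[abs_def] by (intro continuous_intros ang_continuous)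
    ultimately show "continuous_on UNIV (g1 t j)" unfolding g1_def[abs_def] by (rule blinfun.continuous_on)
    show "g1 t j s \<noteq> 0" for s by (rule g1_nonzero[OF t' j])
    show "\<exists>K. K-lipschitz_on {-l..l} (g1 t j)"
    proof (intro exI lipschitz_onI)
      fix u s assume "u \<in> {-l..l}" "s \<in> {-l..l}"
      then have "norm (curve j s) \<le> R" "norm (curve j u) \<le> R" using R j by auto
      from transported_lipschitz[OF t' curve_derivative tangent_unit[OF j] tangent_lipschitz[OF j] _ zero_le_one _ this]
      show "dist (g1 t j u) (g1 t j s) \<le> (117/100 * (1 + 1) + 1) * dist u s"
        using \<delta>(3)[OF t] by (simp add: g1_def dist_norm less_imp_le)
    qed simp
    show "inj_on (\<lambda>s. \<phi> t (curve j s)) {-l..l}"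
    proof (rule inj_onI)
      fix s u assume "\<phi> t (curve j s) = \<phi> t (curve j u)"
      then have "curve j s = curve j u" using diffeo[OF t'] by (meson bij_is_inj injD)
      then show "s = u" by (rule inj_onD[OF curve_inj_on[OF j, of UNIV]]) auto
    qed
  qed
  then show ?thesis using \<delta>(1,2) by blast
qed

text \<open>The reach is half the distance \<open>sqrt (M1 t)\<close> of the components as long as
  nearest points within that half are unique on each component. The bound
  \<open>1 + 2 * \<delta>\<close> places such points within \<open>1/2 + \<delta>\<close>, the range
  of \<open>nearest_unique_stable\<close>; it allows the distance to grow slightly. The curvature
  term is \<open>INF_rho\<close> over the kinks.\<close>

lemma Thi_formula:
  obtains \<delta> where "0 < \<delta>" "\<delta> < \<epsilon>" "\<And>t. \<bar>t\<bar> \<le> \<delta> \<Longrightarrow> 0 < M1 t \<Longrightarrow> sqrt (M1 t) \<le> 1 + 2 * \<delta> \<Longrightarrow> 0 < M2 t \<Longrightarrow>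
    Thi \<sigma> (\<phi> t ` L l) = ereal (min (sqrt (M1 t)) (1 / (\<sigma> * sqrt (M2 t))))"
proof -
  have uniq: "\<exists>\<delta>>0. \<delta> < \<epsilon> \<and> (\<forall>t p s u. \<bar>t\<bar> \<le> \<delta> \<longrightarrow> s \<in> {-l..l} \<longrightarrow> u \<in> {-l..l} \<longrightarrow> dist p (\<phi> t (curve j s)) \<le> 1/2 + \<delta> \<longrightarrow>
      (\<forall>v\<in>{-l..l}. dist p (\<phi> t (curve j s)) \<le> dist p (\<phi> t (curve j v))) \<longrightarrow> dist p (\<phi> t (curve j u)) = dist p (\<phi> t (curve j s)) \<longrightarrow> s = u)"
    if j: "j \<in> {0, 1}" for j
  proof -
    show ?thesis
    proof (rule nearest_unique_stable[where c="curve j" and a="-l" and b=l, OF curve_derivative tangent_unit[OF j] tangent_lipschitz[OF j]])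
      show "s = u" if "s \<in> {-l..l}" "u \<in> {-l..l}" "dist p (curve j s) \<le> 1/2"
        "\<And>v. v \<in> {-l..l} \<Longrightarrow> dist p (curve j s) \<le> dist p (curve j v)" "dist p (curve j u) = dist p (curve j s)" for p s u
        by (rule nearest_unique[OF j l(2) that])
    next
      fix \<delta> assume *: "0 < \<delta>" "\<delta> < \<epsilon>" "\<And>t p s u. \<bar>t\<bar> \<le> \<delta> \<Longrightarrow> s \<in> {-l..l} \<Longrightarrow> u \<in> {-l..l} \<Longrightarrow> dist p (\<phi> t (curve j s)) \<le> 1/2 + \<delta> \<Longrightarrow>
        (\<And>v. v \<in> {-l..l} \<Longrightarrow> dist p (\<phi> t (curve j s)) \<le> dist p (\<phi> t (curve j v))) \<Longrightarrow> dist p (\<phi> t (curve j u)) = dist p (\<phi> t (curve j s)) \<Longrightarrow> s = u"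
      show ?thesis by (intro exI[of _ \<delta>] conjI *(1,2) allI impI) (rule *(3), blast+)
    qed
  qed
  obtain d0 where d0: "0 < d0" "d0 < \<epsilon>" and u0: "\<And>t p s u. \<bar>t\<bar> \<le> d0 \<Longrightarrow> s \<in> {-l..l} \<Longrightarrow> u \<in> {-l..l} \<Longrightarrow> dist p (\<phi> t (curve 0 s)) \<le> 1/2 + d0 \<Longrightarrow>
      (\<forall>v\<in>{-l..l}. dist p (\<phi> t (curve 0 s)) \<le> dist p (\<phi> t (curve 0 v))) \<Longrightarrow> dist p (\<phi> t (curve 0 u)) = dist p (\<phi> t (curve 0 s)) \<Longrightarrow> s = u"
    using uniq[of 0] by (metis insertI1)
  obtain d1 where d1: "0 < d1" "d1 < \<epsilon>" and u1: "\<And>t p s u. \<bar>t\<bar> \<le> d1 \<Longrightarrow> s \<in> {-l..l} \<Longrightarrow> u \<in> {-l..l} \<Longrightarrow> dist p (\<phi> t (curve 1 s)) \<le> 1/2 + d1 \<Longrightarrow>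
      (\<forall>v\<in>{-l..l}. dist p (\<phi> t (curve 1 s)) \<le> dist p (\<phi> t (curve 1 v))) \<Longrightarrow> dist p (\<phi> t (curve 1 u)) = dist p (\<phi> t (curve 1 s)) \<Longrightarrow> s = u"
    using uniq[of 1] by (metis insertI1 insertI2)
  obtain d2 where d2: "0 < d2" "d2 < \<epsilon>" and reg: "\<And>t j. \<bar>t\<bar> \<le> d2 \<Longrightarrow> j \<in> {0, 1} \<Longrightarrow> regular_arc (\<lambda>s. \<phi> t (curve j s)) (g1 t j) (- l) l"
    using regular_arc_transported[OF l_pos] by blast
  define \<delta> where "\<delta> = min d0 (min d1 d2)"
  show thesis
  proof (rule that[of \<delta>])
    show "0 < \<delta>" "\<delta> < \<epsilon>" using d0 d1 d2 by (auto simp: \<delta>_def)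
    fix t assume t: "\<bar>t\<bar> \<le> \<delta>" and M1: "0 < M1 t" "sqrt (M1 t) \<le> 1 + 2 * \<delta>" and M2: "0 < M2 t"
    have td: "\<bar>t\<bar> \<le> d0" "\<bar>t\<bar> \<le> d1" "\<bar>t\<bar> \<le> d2" "\<bar>t\<bar> < \<epsilon>" and \<delta>d: "\<delta> \<le> d0" "\<delta> \<le> d1" using t d0 by (auto simp: \<delta>_def)
    define \<gamma> where "\<gamma> = (\<lambda>j s. \<phi> t (curve j s))"
    have regj: "regular_arc (\<gamma> j) (g1 t j) (- l) l" if "j \<in> {0, 1}" for j unfolding \<gamma>_def by (rule reg[OF td(3) that])
    have cont: "continuous_on A (\<gamma> j)" if "j \<in> {0, 1}" for j A
      using regj[OF that] unfolding regular_arc_def by (intro continuous_at_imp_continuous_on ballI) (blast intro: has_vector_derivative_continuous)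
    have comp: "compact (\<gamma> j ` {-l..l})" if "j \<in> {0, 1}" for j by (intro compact_continuous_image cont that compact_Icc)
    have image: "\<phi> t ` L l = \<gamma> 0 ` {-l..l} \<union> \<gamma> 1 ` {-l..l}" by (simp add: L_def \<gamma>_def image_Un image_image)
    obtain VF where VF: "C1_param \<epsilon> rect F VF" using F_param by blast
    obtain k1 where k1: "k1 \<in> rect" "F t k1 = M1 t" "\<And>k. k \<in> rect \<Longrightarrow> M1 t \<le> F t k"
      using C1_param_attains_INF[OF VF rect_compact td(4)] unfolding M1_def[symmetric] by metis
    have distF: "dist (\<gamma> 0 s) (\<gamma> 1 u) = sqrt (F t (s, u))" for s u
      by (simp add: \<gamma>_def F_def dist_norm norm_eq_sqrt_inner)
    let ?D = "sqrt (M1 t)"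
    have D: "0 < ?D" using M1 by simp
    have D_le: "?D \<le> dist (\<gamma> 0 s) (\<gamma> 1 u)" if "s \<in> {-l..l}" "u \<in> {-l..l}" for s u
      unfolding distF using k1(3)[of "(s, u)"] that by simp
    have disj: "\<gamma> 0 ` {-l..l} \<inter> \<gamma> 1 ` {-l..l} = {}" 
    proof -
      have "\<gamma> 0 s \<noteq> \<gamma> 1 u" if "s \<in> {-l..l}" "u \<in> {-l..l}" for s u
        using D_le[OF that] D by (metis dist_self not_le)
      then show ?thesis by blast
    qed
    have reach: "reach (\<phi> t ` L l) = ereal (?D / 2)"
      unfolding image
    proof (rule reach_two_components[OF comp comp D])
      show "(0::real) \<in> {0, 1}" "(1::real) \<in> {0, 1}" by auto
      show "?D \<le> dist a b" if "a \<in> \<gamma> 0 ` {-l..l}" "b \<in> \<gamma> 1 ` {-l..l}" for a b using D_le that by blast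
      show "\<gamma> 0 (fst k1) \<in> \<gamma> 0 ` {-l..l}" "\<gamma> 1 (snd k1) \<in> \<gamma> 1 ` {-l..l}" using k1(1) by auto
      show "dist (\<gamma> 0 (fst k1)) (\<gamma> 1 (snd k1)) = ?D" unfolding distF using k1(2) by simp
      fix S p q q'
      assume S: "S = \<gamma> 0 ` {-l..l} \<or> S = \<gamma> 1 ` {-l..l}" and q: "q \<in> S" "q' \<in> S" "dist p q < ?D / 2"
        and min: "\<And>v. v \<in> S \<Longrightarrow> dist p q \<le> dist p v" and eq: "dist p q' = dist p q"
      have half: "dist p q \<le> 1/2 + \<delta>" using q(3) M1(2) by linarith
      show "q = q'"
        using S
      proof
        assume S0: "S = \<gamma> 0 ` {-l..l}"
        obtain s u where su: "s \<in> {-l..l}" "q = \<gamma> 0 s" "u \<in> {-l..l}" "q' = \<gamma> 0 u" using q S0 by blast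
        have "s = u"
          by (rule u0[OF td(1) su(1,3), where p=p])
            (use min half eq \<delta>d su S0 in \<open>auto simp: \<gamma>_def\<close>)
        then show ?thesis using su by simp
      next
        assume S1: "S = \<gamma> 1 ` {-l..l}"
        obtain s u where su: "s \<in> {-l..l}" "q = \<gamma> 1 s" "u \<in> {-l..l}" "q' = \<gamma> 1 u" using q S1 by blast
        have "s = u"
          by (rule u1[OF td(2) su(1,3), where p=p])
            (use min half eq \<delta>d su S1 in \<open>auto simp: \<gamma>_def\<close>)
        then show ?thesis using su by simp
      qed
    qed
    obtain VQ where VQ: "C1_param \<epsilon> (kinks l) (\<lambda>t x. - Q t x) VQ" using Q_param by blast
    obtain x1 where x1: "x1 \<in> kinks l" "Q t x1 = M2 t" "\<And>x. x \<in> kinks l \<Longrightarrow> Q t x \<le> M2 t"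
      using C1_param_attains_INF[OF VQ kinks_compact kinks_nonempty td(4)] unfolding M2_def by (metis minus_minus neg_le_iff_le)
    obtain j1 p1 q1 c1 s1' where x1': "x1 = (j1, (p1, q1, c1), s1')" by (metis prod.collapse)
    have Qn: "norm (curvature_of (g1 t j s) (g2 t (snd (snd i)) j s)) = sqrt (Q t (j, i, s))" if "j \<in> {0, 1}" for i j s
    proof -
      have "Q t (j, i, s) = (norm (curvature_of (g1 t j s) (g2 t (snd (snd i)) j s)))\<^sup>2"
        unfolding norm_curvature_of_sq[OF g1_nonzero[OF td(4) that]] by (simp add: Q_def Let_def curv_def par_def)
      then show ?thesis by simp
    qed
    have rho: "(INF x\<in>\<phi> t ` L l. rho (\<phi> t ` L l) x) = ereal (1 / sqrt (M2 t))"
    proof (rule INF_rho[where A="{0, 1}" and P="pieces l" and p=fst and q="\<lambda>i. fst (snd i)" and \<gamma>=\<gamma> and \<gamma>'="g1 t"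
          and \<gamma>''="\<lambda>i j s. g2 t (snd (snd i)) j s" and ?i0.0="(p1, q1, c1)" and ?j0.0=j1 and ?s0.0=s1'])
      show "regular_arc (\<gamma> j) (g1 t j) (- l) l" if "j \<in> {0, 1}" for j by (rule regj[OF that])
      \<comment> \<open>A component is relatively open because the other one is compact and disjoint
        from it.\<close>
      show "openin (top_of_set (\<phi> t ` L l)) (\<gamma> j ` {-l..l})" if j: "j \<in> {0, 1}" for j
      proof -
        have "\<gamma> j ` {-l..l} = (\<phi> t ` L l) \<inter> - (\<gamma> (1 - j) ` {-l..l})" 
        proof -
          have "j = 0 \<or> j = 1" using j by simp
          then show ?thesis using disj unfolding image by (elim disjE) (simp, blast)+
        qed
        moreover have "open (- (\<gamma> (1 - j) ` {-l..l}))" using comp[of "1 - j"] j by (auto intro: compact_imp_closed)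
        ultimately show ?thesis unfolding openin_open by blast
      qed
      show "\<phi> t ` L l = (\<Union>j\<in>{0, 1}. \<gamma> j ` {-l..l})" unfolding image by simp
      show "fst i < fst (snd i)" if "i \<in> pieces l" for i
        using pieces_cover(2)[OF l(1), of "fst i" "fst (snd i)" "snd (snd i)"] that by simp
      show "(\<Union>i\<in>pieces l. {fst i..fst (snd i)}) = {-l..l}"
        using pieces_cover(1)[OF l(1)] by (simp add: case_prod_beta)
      show "(g1 t j has_vector_derivative g2 t (snd (snd i)) j s) (at s within {fst i..fst (snd i)})"
        if "i \<in> pieces l" "j \<in> {0, 1}" "s \<in> {fst i..fst (snd i)}" for i j s
      proof -
        have "(fst i, fst (snd i), snd (snd i)) \<in> pieces l" using that by simp
        from frame_derivatives(1)[OF ang_piece_DERIV[OF this that(3)]]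
        show ?thesis unfolding g1_def[abs_def] g2_def
          by (intro transported_derivative2[OF td(4)] has_vector_derivative_at_within[OF curve_derivative])
      qed
      show "continuous_on {fst i..fst (snd i)} (\<lambda>s. g2 t (snd (snd i)) j s)" if "i \<in> pieces l" "j \<in> {0, 1}" for i j
      proof -
        have cc: "continuous_on A (curve j)" for A
          by (intro continuous_at_imp_continuous_on ballI has_vector_derivative_continuous[OF curve_derivative])
        have 1: "continuous_on A (\<lambda>s. D1 t (curve j s))" for A
          using D1_derivative[OF td(4)] 
          by (intro continuous_on_compose2[OF _ cc, of UNIV] continuous_at_imp_continuous_on ballI has_derivative_continuous) auto
        have 2: "continuous_on A (\<lambda>s. D2 t (curve j s))" for A
          by (rule continuous_on_compose2[OF D2_continuous[OF td(4)] cc]) simp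
        have 3: "continuous_on A (tangent j)" "continuous_on A (normal j)" for A
          unfolding tangent_def[abs_def] normal_def[abs_def] by (intro continuous_intros ang_continuous)+
        show ?thesis unfolding g2_def
          by (intro continuous_on_add blinfun.continuous_on 1 2 3 continuous_on_scaleR continuous_on_const)
      qed
      show "norm (curvature_of (g1 t j s) (g2 t (snd (snd i)) j s)) \<le> sqrt (M2 t)"
        if "i \<in> pieces l" "j \<in> {0, 1}" "s \<in> {fst i..fst (snd i)}" for i j s
      proof -
        have "(j, i, s) \<in> kinks l" using that by (auto simp: kinks_def)
        then show ?thesis unfolding Qn[OF that(2)] using x1(3) by simp
      qed
      have "(j1, (p1, q1, c1), s1') \<in> kinks l" using x1(1) x1' by simp
      then show "(p1, q1, c1) \<in> pieces l" and j1: "j1 \<in> {0, 1}" and "s1' \<in> {fst (p1, q1, c1)..fst (snd (p1, q1, c1))}"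
        unfolding kinks_iff by auto
      show "norm (curvature_of (g1 t j1 s1') (g2 t (snd (snd (p1, q1, c1))) j1 s1')) = sqrt (M2 t)"
        unfolding Qn[OF j1] using x1(2) x1' by simp
      show "0 < sqrt (M2 t)" using M2 by simp
    qed
    have "2 * ereal (?D / 2) = ereal ?D" by simp
    moreover have "ereal (1 / sqrt (M2 t)) / ereal \<sigma> = ereal (1 / (\<sigma> * sqrt (M2 t)))"
      using sigma_pos by (simp add: mult.commute)
    ultimately show "Thi \<sigma> (\<phi> t ` L l) = ereal (min ?D (1 / (\<sigma> * sqrt (M2 t))))"
      unfolding Thi_def reach rho by simp
  qed
qed

lemma Thi_0: "Thi \<sigma> (L l) = 1"
proof -
  obtain \<delta> where \<delta>: "0 < \<delta>" "\<delta> < \<epsilon>" "\<And>t. \<bar>t\<bar> \<le> \<delta> \<Longrightarrow> 0 < M1 t \<Longrightarrow> sqrt (M1 t) \<le> 1 + 2 * \<delta> \<Longrightarrow> 0 < M2 t \<Longrightarrow>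
    Thi \<sigma> (\<phi> t ` L l) = ereal (min (sqrt (M1 t)) (1 / (\<sigma> * sqrt (M2 t))))"
    by (rule Thi_formula, rule that)
  have "\<phi> 0 ` L l = L l" by (simp add: phi0)
  moreover have "sqrt ((1 / \<sigma>)\<^sup>2) = 1 / \<sigma>" using sigma_pos by (intro real_sqrt_unique) auto
  ultimately show ?thesis using \<delta>(3)[of 0] \<delta>(1) sigma_pos by (simp add: M1_0 M2_0 one_ereal_def)
qed

text \<open>Danskin's theorem for \<open>M1\<close> and for \<open>M2\<close>, then the minimum of
  the two terms, which are both 1 at time 0. The active kinks are those of curvature
  \<open>1 / \<sigma>\<close>, that is, the tip arcs, because the shoulders have the smaller
  curvature 1. The factor \<open>- (\<sigma>\<^sup>2 / 2)\<close> is the derivative of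
  \<open>1 / (\<sigma> * sqrt x)\<close> at \<open>x = (1 / \<sigma>)\<^sup>2\<close>.\<close>

lemma Thi_derivative:
  assumes V: "\<And>x. V0 (0, x) = \<xi> x" "\<And>x. V1 (0, x) = \<xi>' x" "\<And>x. V2 (0, x) = \<xi>'' x"
  obtains k x where "k \<in> rect" "dist2 (fst k) (snd k) = 1" "x \<in> kinks l" "curv x = 1 / \<sigma>"
    "\<And>k'. k' \<in> rect \<Longrightarrow> dist2 (fst k') (snd k') = 1 \<Longrightarrow> strut_dot \<xi> k \<le> strut_dot \<xi> k'"
    "\<And>x'. x' \<in> kinks l \<Longrightarrow> curv x' = 1 / \<sigma> \<Longrightarrow> kink_dot \<xi>' \<xi>'' x' \<le> kink_dot \<xi>' \<xi>'' x"
    "((\<lambda>t. real_of_ereal (Thi \<sigma> (\<phi> t ` L l))) has_real_derivative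
        min (strut_dot \<xi> k / 2) (- (\<sigma>\<^sup>2 / 2) * kink_dot \<xi>' \<xi>'' x)) (at_right 0)"
proof -
  obtain VF where VF: "C1_param \<epsilon> rect F VF" "\<And>k. k \<in> rect \<Longrightarrow> VF (0, k) = strut_dot \<xi> k"
    using F_param V by auto
  obtain k where k: "k \<in> rect" "F 0 k = M1 0" "\<And>k'. k' \<in> rect \<Longrightarrow> F 0 k' = M1 0 \<Longrightarrow> VF (0, k) \<le> VF (0, k')"
    and dM1: "(M1 has_real_derivative VF (0, k)) (at_right 0)"
    using C1_param_INF_derivative[OF VF(1) rect_compact] unfolding M1_def[symmetric] by blast
  obtain VQ where VQ: "C1_param \<epsilon> (kinks l) (\<lambda>t x. - Q t x) VQ" "\<And>x. x \<in> kinks l \<Longrightarrow> VQ (0, x) = - kink_dot \<xi>' \<xi>'' x"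
    using Q_param V by auto
  obtain x where x: "x \<in> kinks l" "- Q 0 x = (INF x\<in>kinks l. - Q 0 x)"
    "\<And>x'. x' \<in> kinks l \<Longrightarrow> - Q 0 x' = (INF x\<in>kinks l. - Q 0 x) \<Longrightarrow> VQ (0, x) \<le> VQ (0, x')"
    and dM2: "((\<lambda>t. INF x\<in>kinks l. - Q t x) has_real_derivative VQ (0, x)) (at_right 0)"
    using C1_param_INF_derivative[OF VQ(1) kinks_compact kinks_nonempty] by blast
  have INF0: "(INF x\<in>kinks l. - Q 0 x) = - ((1 / \<sigma>)\<^sup>2)" using M2_0 unfolding M2_def by simp
  have act: "- Q 0 x' = (INF x\<in>kinks l. - Q 0 x) \<longleftrightarrow> curv x' = 1 / \<sigma>" if "x' \<in> kinks l" for x'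
    unfolding INF0 Q_0[OF that] using curv_range[OF that] sigma_pos power2_eq_iff_nonneg[of "curv x'" "1/\<sigma>"] by auto
  have dM2': "(M2 has_real_derivative kink_dot \<xi>' \<xi>'' x) (at_right 0)"
    using DERIV_minus[OF dM2] VQ(2)[OF x(1)] by (simp add: M2_def[abs_def])
  have sM1: "((\<lambda>t. sqrt (M1 t)) has_real_derivative strut_dot \<xi> k / 2) (at_right 0)"
    using dM1 VF(2)[OF k(1)] by (auto intro!: derivative_eq_intros simp: M1_0)
  have sq: "sqrt ((1 / \<sigma>)\<^sup>2) = 1 / \<sigma>" using sigma_pos by (intro real_sqrt_unique) auto
  have s1: "((\<lambda>t. sqrt (M2 t)) has_real_derivative inverse (1 / \<sigma>) / 2 * kink_dot \<xi>' \<xi>'' x) (at_right 0)"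
  proof -
    have "(sqrt has_real_derivative inverse (sqrt (M2 0)) / 2) (at (M2 0))"
      using sigma_pos by (intro DERIV_real_sqrt) (simp add: M2_0)
    from DERIV_chain2[OF this dM2'] show ?thesis by (simp only: M2_0 sq)
  qed
  have sM2: "((\<lambda>t. 1 / (\<sigma> * sqrt (M2 t))) has_real_derivative - (\<sigma>\<^sup>2 / 2) * kink_dot \<xi>' \<xi>'' x) (at_right 0)"
  proof -
    have "((\<lambda>t. 1 / (\<sigma> * sqrt (M2 t))) has_real_derivative
        (0 * (\<sigma> * sqrt (M2 0)) - 1 * (\<sigma> * (inverse (1 / \<sigma>) / 2 * kink_dot \<xi>' \<xi>'' x))) / ((\<sigma> * sqrt (M2 0)) * (\<sigma> * sqrt (M2 0)))) (at_right 0)"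
      by (intro DERIV_divide DERIV_const DERIV_cmult s1) (use sigma_pos in \<open>simp add: M2_0 sq\<close>)
    moreover have "(0 * (\<sigma> * sqrt (M2 0)) - 1 * (\<sigma> * (inverse (1 / \<sigma>) / 2 * kink_dot \<xi>' \<xi>'' x))) / ((\<sigma> * sqrt (M2 0)) * (\<sigma> * sqrt (M2 0)))
      = - (\<sigma>\<^sup>2 / 2) * kink_dot \<xi>' \<xi>'' x"
      unfolding M2_0 sq using sigma_pos by (simp add: power2_eq_square)
    ultimately show ?thesis by (rule DERIV_cong)
  qed
  let ?f = "\<lambda>t. min (sqrt (M1 t)) (1 / (\<sigma> * sqrt (M2 t)))"
  have df: "(?f has_real_derivative min (strut_dot \<xi> k / 2) (- (\<sigma>\<^sup>2 / 2) * kink_dot \<xi>' \<xi>'' x)) (at_right 0)"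
    by (rule min_right_derivative[OF sM1 sM2]) (use sigma_pos in \<open>simp add: M1_0 M2_0 sq\<close>)
  obtain \<delta> where \<delta>: "0 < \<delta>" "\<delta> < \<epsilon>" "\<And>t. \<bar>t\<bar> \<le> \<delta> \<Longrightarrow> 0 < M1 t \<Longrightarrow> sqrt (M1 t) \<le> 1 + 2 * \<delta> \<Longrightarrow> 0 < M2 t \<Longrightarrow>
    Thi \<sigma> (\<phi> t ` L l) = ereal (?f t)"
    by (rule Thi_formula, rule that)
  have lim: "(M1 \<longlongrightarrow> 1) (at_right 0)" "((\<lambda>t. sqrt (M1 t)) \<longlongrightarrow> 1) (at_right 0)" "(M2 \<longlongrightarrow> (1/\<sigma>)\<^sup>2) (at_right 0)"
    using DERIV_continuous[OF dM1] DERIV_continuous[OF sM1] DERIV_continuous[OF dM2']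
    by (simp_all add: continuous_within M1_0 M2_0)
  have "\<forall>\<^sub>F t in at_right 0. 0 < M1 t" by (rule order_tendstoD(1)[OF lim(1)]) simp
  moreover have "\<forall>\<^sub>F t in at_right 0. sqrt (M1 t) < 1 + 2 * \<delta>" by (rule order_tendstoD(2)[OF lim(2)]) (use \<delta> in simp)
  moreover have "\<forall>\<^sub>F t in at_right 0. 0 < M2 t" by (rule order_tendstoD(1)[OF lim(3)]) (use sigma_pos in simp)
  moreover have "\<forall>\<^sub>F t in at_right 0. t < \<delta>" unfolding eventually_at_right_field using \<delta>(1) by blast
  moreover have "\<forall>\<^sub>F t in at_right (0::real). 0 < t" by (simp add: eventually_at_filter)
  ultimately have ev: "\<forall>\<^sub>F t in at_right 0. real_of_ereal (Thi \<sigma> (\<phi> t ` L l)) = ?f t"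
  proof eventually_elim
    case (elim t)
    then have "Thi \<sigma> (\<phi> t ` L l) = ereal (?f t)" by (intro \<delta>(3)) auto
    then show ?case by (simp only: real_of_ereal.simps)
  qed
  \<comment> \<open>The difference quotient also involves the value at 0, which the filter
    \<open>at_right 0\<close> does not see.\<close>
  have "real_of_ereal (Thi \<sigma> (\<phi> 0 ` L l)) = ?f 0"
    using Thi_0 sigma_pos by (simp add: phi0 M1_0 M2_0 sq)
  then have der: "((\<lambda>t. real_of_ereal (Thi \<sigma> (\<phi> t ` L l))) has_real_derivative
        min (strut_dot \<xi> k / 2) (- (\<sigma>\<^sup>2 / 2) * kink_dot \<xi>' \<xi>'' x)) (at_right 0)"
  proof -
    let ?g = "\<lambda>t. real_of_ereal (Thi \<sigma> (\<phi> t ` L l))"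
    assume g0: "?g 0 = ?f 0"
    have "\<forall>\<^sub>F t in at_right 0. (?f t - ?f 0) / (t - 0) = (?g t - ?g 0) / (t - 0)"
      using ev by eventually_elim (simp only: g0)
    with df show ?thesis unfolding has_field_derivative_iff by (rule Lim_transform_eventually)
  qed
  have kact: "dist2 (fst k) (snd k) = 1" using k(2) by (simp add: F_0 M1_0)
  have xact: "curv x = 1 / \<sigma>" using x(2) act[OF x(1)] by simp
  show thesis
  proof (rule that[OF k(1) kact x(1) xact _ _ der])
    show "strut_dot \<xi> k \<le> strut_dot \<xi> k'" if "k' \<in> rect" "dist2 (fst k') (snd k') = 1" for k'
      using k(3)[OF that(1)] VF(2)[OF that(1)] VF(2)[OF k(1)] that(2) by (simp add: F_0 M1_0)
    show "kink_dot \<xi>' \<xi>'' x' \<le> kink_dot \<xi>' \<xi>'' x" if "x' \<in> kinks l" "curv x' = 1 / \<sigma>" for x'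
      using x(3)[OF that(1)] act[OF that(1)] VQ(2)[OF that(1)] VQ(2)[OF x(1)] that(2) by simp
  qed
qed

end

section \<open>Balance\<close>

text \<open>\<open>B\<close> is differentiable within a closed piece only, since its derivative
  jumps with the curvature; \<open>H\<close> is a global antiderivative, so increments over
  consecutive pieces telescope.\<close>

lemma increment_le:
  fixes B H :: "real \<Rightarrow> real"
  assumes pq: "p \<le> q" and B: "\<And>s. s \<in> {p..q} \<Longrightarrow> (B has_real_derivative b s) (at s within {p..q})"
    and H: "\<And>s. (H has_real_derivative h s) (at s)" and le: "\<And>s. s \<in> {p..q} \<Longrightarrow> b s \<le> h s"
  shows "B q - B p \<le> H q - H p"
proof -
  have d: "((\<lambda>s. H s - B s) has_real_derivative h s - b s) (at s within {p..q})" if "s \<in> {p..q}" for s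
    by (intro DERIV_diff B that has_field_derivative_at_within[OF H])
  have "H p - B p \<le> H q - B q"
  proof (rule mono_except_finite[OF pq finite.emptyI])
    show "continuous_on {p..q} (\<lambda>s. H s - B s)"
      unfolding continuous_on_eq_continuous_within using DERIV_continuous[OF d] by blast
    fix s assume s: "s \<in> {p<..<q} - {}"
    then have "at s within {p..q} = at s" by (intro at_within_interior) simp
    then show "\<exists>d\<ge>0. ((\<lambda>s. H s - B s) has_real_derivative d) (at s)"
      using d[of s] le[of s] s by (intro exI[of _ "h s - b s"]) auto
  qed
  then show ?thesis by simp
qed

context clasp_curve begin

text \<open>The shoulder is a unit arc around the opposite tip, so the struts ending on it run along
  its normals; the left shoulder follows by reflection.\<close>

lemma shoulder_normal:
  assumes "s \<in> {s2..s3} \<or> s \<in> {-s3..-s2}"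
  shows "curve j s - curve (1 - j) 0 = - normal j s" "dist2 s 0 = 1"
proof -
  have *: "X s = sin (ang s) \<and> Y s = - z0 - cos (ang s)"
  proof (cases "s \<in> {s2..s3}")
    case True
    then show ?thesis using curve_shoulder by simp
  next
    case False
    then have "- s \<in> {s2..s3}" using assms by auto
    from curve_shoulder[OF this] show ?thesis by (simp add: X_minus Y_minus ang_minus)
  qed
  have "fb (1 - j) = - fb j" by (simp add: fb_def algebra_simps flip: scaleR_minus_left)
  then have tip: "curve (1 - j) 0 = - z0 *\<^sub>R fb j" by (simp add: curve_def X0 Y0)
  show "curve j s - curve (1 - j) 0 = - normal j s"
    unfolding tip unfolding curve_def normal_def conjunct1[OF *] conjunct2[OF *] by (simp add: algebra_simps)
  show "dist2 s 0 = 1" using * by (simp add: dist2_def X0 Y0)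
qed

lemma frame_at_0: "curve j 0 = z0 *\<^sub>R fb j" "normal j 0 = fb j" "tangent j 0 = fa j"
  by (simp_all add: curve_def normal_def tangent_def X0 Y0 ang_0)

lemma ray_tangent:
  assumes "s3 \<le> s"
  shows "tangent j s = cos \<theta>2 *\<^sub>R fa j + \<tau> *\<^sub>R fb j" "tangent j (- s) = cos \<theta>2 *\<^sub>R fa j - \<tau> *\<^sub>R fb j"
  using assms by (simp_all add: tangent_def ang_values(4) ang_minus sin2)

lemma shoulder_tangent: "tangent j s2 = C *\<^sub>R fa j + (\<tau>/2) *\<^sub>R fb j" "tangent j (- s2) = C *\<^sub>R fa j - (\<tau>/2) *\<^sub>R fb j"
proof -
  have "ang s2 = \<theta>1" using ang_values(2)[of s2] s123 by simp
  then show "tangent j s2 = C *\<^sub>R fa j + (\<tau>/2) *\<^sub>R fb j" "tangent j (- s2) = C *\<^sub>R fa j - (\<tau>/2) *\<^sub>R fb j"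
    by (simp_all add: tangent_def ang_minus sin1 cos1)
qed

context
  fixes \<xi> :: "real^3 \<Rightarrow> real^3" and \<xi>' \<xi>'' and l :: real
  assumes C2: "C2_with \<xi> \<xi>' \<xi>''" and l: "s3 < l"
begin

text \<open>First and second derivative of \<open>\<xi>\<close> along the curve, the latter on a
  piece of curvature \<open>k\<close>. The length density of the variation is
  \<open>eta j s \<bullet> tangent j s\<close>.\<close>

definition eta where "eta j s = blinfun_apply (\<xi>' (curve j s)) (tangent j s)"
definition eta2 where "eta2 k j s = blinfun_apply (blinfun_apply (\<xi>'' (curve j s)) (tangent j s)) (tangent j s)
   + k *\<^sub>R blinfun_apply (\<xi>' (curve j s)) (normal j s)"

lemma xi_curve_derivative: "((\<lambda>s. \<xi> (curve j s)) has_vector_derivative eta j s) (at s within S)"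
proof -
  have "(\<xi> has_derivative \<xi>' (curve j s)) (at (curve j s))" using C2 by (simp add: C2_with_def)
  from has_derivative_compose[OF has_vector_derivative_at_within[OF curve_derivative, unfolded has_vector_derivative_def] this]
  show ?thesis by (simp add: has_vector_derivative_def eta_def blinfun.scaleR_right)
qed

lemma eta_derivative:
  assumes "(ang has_real_derivative k) (at s within S)"
  shows "(eta j has_vector_derivative eta2 k j s) (at s within S)"
proof -
  have "(\<xi>' has_derivative \<xi>'' (curve j s)) (at (curve j s))" using C2 by (simp add: C2_with_def)
  from has_derivative_compose[OF has_vector_derivative_at_within[OF curve_derivative, unfolded has_vector_derivative_def] this]
  have "((\<lambda>s. \<xi>' (curve j s)) has_vector_derivative \<xi>'' (curve j s) (tangent j s)) (at s within S)"
    by (simp add: has_vector_derivative_def blinfun.scaleR_right)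
  from bounded_bilinear.has_vector_derivative[OF bounded_bilinear_blinfun_apply this frame_derivatives(1)[OF assms]]
  show ?thesis by (simp add: eta_def[abs_def] eta2_def add.commute blinfun.scaleR_right)
qed

lemma eta_continuous: "continuous_on A (eta j)"
proof -
  have c: "continuous_on A (curve j)"
    by (intro continuous_at_imp_continuous_on ballI has_vector_derivative_continuous[OF curve_derivative])
  have "continuous_on UNIV \<xi>'"
    using C2 unfolding C2_with_def by (intro continuous_at_imp_continuous_on ballI has_derivative_continuous) blast
  then have "continuous_on A (\<lambda>s. \<xi>' (curve j s))" by (rule continuous_on_compose2[OF _ c]) simp
  moreover have "continuous_on A (tangent j)"
    unfolding tangent_def[abs_def] by (intro continuous_intros ang_continuous)
  ultimately show ?thesis unfolding eta_def[abs_def] by (rule blinfun.continuous_on)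
qed

lemma inner_DERIV:
  assumes "(f has_vector_derivative f') (at s within S)" "(g has_vector_derivative g') (at s within S)"
  shows "((\<lambda>s. f s \<bullet> (g s :: real^3)) has_real_derivative (f s \<bullet> g' + f' \<bullet> g s)) (at s within S)"
  using bounded_bilinear.has_vector_derivative[OF bounded_bilinear_inner assms]
  by (simp add: has_real_derivative_iff_has_vector_derivative)

lemma xi_tangent_DERIV:
  assumes "(ang has_real_derivative k) (at s within S)"
  shows "((\<lambda>s. \<xi> (curve j s) \<bullet> tangent j s) has_real_derivative
     (k * (\<xi> (curve j s) \<bullet> normal j s) + eta j s \<bullet> tangent j s)) (at s within S)"
  using inner_DERIV[OF xi_curve_derivative frame_derivatives(1)[OF assms]] by simp

text \<open>The weight \<open>w\<close> with which the curvature of the tip arc is loaded solves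
  \<open>w'' + w / \<sigma>\<^sup>2 = 1 / \<sigma>\<close> off the tip and vanishes to first order at the ends of the arc; the jump \<open>-\<tau>\<close> of \<open>w'\<close> at
  the tip balances the force that the struts exert there.\<close>

lemma tip_arc_DERIV:
  fixes \<iota> :: real
  assumes \<iota>: "\<iota> * \<iota> = 1" and a: "(ang has_real_derivative 1 / \<sigma>) (at s within S)"
  defines "w \<equiv> \<lambda>s. \<sigma> * (1 - cos (\<theta>1 - \<iota> * s / \<sigma>))" and "w' \<equiv> \<lambda>s. - \<iota> * sin (\<theta>1 - \<iota> * s / \<sigma>)"
  shows "((\<lambda>s. w s * (eta j s \<bullet> normal j s) - w' s * (\<xi> (curve j s) \<bullet> normal j s) - (w s / \<sigma>) * (\<xi> (curve j s) \<bullet> tangent j s))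
    has_real_derivative w s * (eta2 (1/\<sigma>) j s \<bullet> normal j s - 2 * (1/\<sigma>) * (eta j s \<bullet> tangent j s)) - (1/\<sigma>) * (\<xi> (curve j s) \<bullet> normal j s))
    (at s within S)"
proof -
  have s0: "\<sigma> \<noteq> 0" using sigma_pos by simp
  have w: "(w has_real_derivative w' s) (at s within S)"
    unfolding w_def w'_def using s0 by (auto intro!: derivative_eq_intros)
  have w': "(w' has_real_derivative cos (\<theta>1 - \<iota> * s / \<sigma>) / \<sigma>) (at s within S)"
  proof -
    have "(w' has_real_derivative (\<iota> * \<iota>) * cos (\<theta>1 - \<iota> * s / \<sigma>) / \<sigma>) (at s within S)"
      unfolding w'_def using s0 by (auto intro!: derivative_eq_intros)
    then show ?thesis using \<iota> by simp
  qed
  have ws: "((\<lambda>s. w s / \<sigma>) has_real_derivative w' s / \<sigma>) (at s within S)" by (rule DERIV_cdivide[OF w])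
  have eN: "((\<lambda>s. eta j s \<bullet> normal j s) has_real_derivative (- (1/\<sigma>) * (eta j s \<bullet> tangent j s) + eta2 (1/\<sigma>) j s \<bullet> normal j s)) (at s within S)"
    using inner_DERIV[OF eta_derivative[OF a] frame_derivatives(2)[OF a]] by simp
  have xN: "((\<lambda>s. \<xi> (curve j s) \<bullet> normal j s) has_real_derivative (- (1/\<sigma>) * (\<xi> (curve j s) \<bullet> tangent j s) + eta j s \<bullet> normal j s)) (at s within S)"
    using inner_DERIV[OF xi_curve_derivative frame_derivatives(2)[OF a]] by simp
  \<comment> \<open>The differential equation of the weight enters here, as
    \<open>w'' = (1 - w / \<sigma>) / \<sigma>\<close>.\<close>
  have cw: "cos (\<theta>1 - \<iota> * s / \<sigma>) = 1 - w s / \<sigma>" using s0 by (simp add: w_def)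
  show ?thesis
    by (rule DERIV_cong[OF DERIV_diff[OF DERIV_diff[OF DERIV_mult[OF w eN] DERIV_mult[OF w' xN]] DERIV_mult[OF ws xi_tangent_DERIV[OF a]]]])
      (simp add: cw algebra_simps add_divide_distrib diff_divide_distrib)
qed

text \<open>Every piece bounds an increment of the antiderivative \<open>H\<close> of the length
  density from below, and the bounds add up. On the shoulders
  \<open>?e \<bullet> tangent j s\<close> is subtracted, so that the strut condition controls the
  sign; on the tip arc \<open>G\<close> is added, so that the kink condition does. What survives are
  the end terms, the force of the struts on the opposite tip, and the jump of \<open>G\<close> at
  the tip itself.\<close>

lemma component_length_bound:
  assumes j: "j \<in> {0, 1}"
    and strut: "\<And>s. s \<in> {s2..s3} \<or> s \<in> {-s3..-s2} \<Longrightarrow> 0 \<le> (\<xi> (curve (1 - j) 0) - \<xi> (curve j s)) \<bullet> normal j s"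
    and kink: "\<And>s. s \<in> {-s1..s1} \<Longrightarrow> eta2 (1/\<sigma>) j s \<bullet> normal j s - 2 * (1/\<sigma>) * (eta j s \<bullet> tangent j s) \<le> 0"
    and H: "\<And>s. (H has_real_derivative eta j s \<bullet> tangent j s) (at s)"
  shows "\<xi> (curve j l) \<bullet> tangent j l - \<xi> (curve j (- l)) \<bullet> tangent j (- l)
      - \<tau> * (\<xi> (curve j 0) \<bullet> fb j) - \<tau> * (\<xi> (curve (1 - j) 0) \<bullet> fb j) \<le> H l - H (- l)"
proof -
  let ?A = "\<lambda>s. \<xi> (curve j s) \<bullet> tangent j s" and ?e = "\<xi> (curve (1 - j) 0)"
  have straight: "?A q - ?A p \<le> H q - H p" if P: "(p, q, 0) \<in> pieces l" for p q
  proof (rule increment_le[OF _ _ H])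
    show "p \<le> q" using pieces_cover(2)[OF l P] by simp
    show "(?A has_real_derivative eta j s \<bullet> tangent j s) (at s within {p..q})" if "s \<in> {p..q}" for s
      using xi_tangent_DERIV[OF ang_piece_DERIV[OF P that]] by simp
  qed simp
  have shoulder: "(?A q - ?e \<bullet> tangent j q) - (?A p - ?e \<bullet> tangent j p) \<le> H q - H p"
    if P: "(p, q, 1) \<in> pieces l" and pq: "{p..q} = {s2..s3} \<or> {p..q} = {-s3..-s2}" for p q
  proof (rule increment_le[OF _ _ H])
    show "p \<le> q" using pieces_cover(2)[OF l P] by simp
    fix s assume s: "s \<in> {p..q}"
    note a = ang_piece_DERIV[OF P s]
    have "((\<lambda>s. ?e \<bullet> tangent j s) has_real_derivative ?e \<bullet> normal j s) (at s within {p..q})"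
      using inner_DERIV[OF has_vector_derivative_const frame_derivatives(1)[OF a]] by simp
    from DERIV_diff[OF xi_tangent_DERIV[OF a] this]
    show "((\<lambda>s. ?A s - ?e \<bullet> tangent j s) has_real_derivative
       1 * (\<xi> (curve j s) \<bullet> normal j s) + eta j s \<bullet> tangent j s - ?e \<bullet> normal j s) (at s within {p..q})" .
    show "1 * (\<xi> (curve j s) \<bullet> normal j s) + eta j s \<bullet> tangent j s - ?e \<bullet> normal j s \<le> eta j s \<bullet> tangent j s"
      using strut[of s] s pq by (auto simp: inner_diff_left)
  qed
  \<comment> \<open>\<open>\<iota> = 1\<close> serves the right half of the tip arc, and
    \<open>\<iota> = -1\<close> the left half with the mirrored weight.\<close>
  define w where "w \<iota> s = \<sigma> * (1 - cos (\<theta>1 - \<iota> * s / \<sigma>))" for \<iota> s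
  define G where "G \<iota> s = w \<iota> s * (eta j s \<bullet> normal j s) - (- \<iota> * sin (\<theta>1 - \<iota> * s / \<sigma>)) * (\<xi> (curve j s) \<bullet> normal j s) - (w \<iota> s / \<sigma>) * ?A s" for \<iota> s
  have arc: "(?A q + G \<iota> q) - (?A p + G \<iota> p) \<le> H q - H p" if pq: "p \<le> q" "{p..q} \<subseteq> {-s1..s1}" and \<iota>: "\<iota> * \<iota> = 1" for p q \<iota>
  proof (rule increment_le[OF pq(1) _ H])
    fix s assume s: "s \<in> {p..q}"
    have P: "(- s1, s1, 1/\<sigma>) \<in> pieces l" by (simp add: pieces_def)
    have a: "(ang has_real_derivative 1/\<sigma>) (at s within {p..q})"
      by (rule DERIV_subset[OF ang_piece_DERIV[OF P] pq(2)]) (use s pq in blast)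
    from DERIV_add[OF xi_tangent_DERIV[OF a] tip_arc_DERIV[OF \<iota> a]]
    have "((\<lambda>s. ?A s + G \<iota> s) has_real_derivative
       ((1/\<sigma>) * (\<xi> (curve j s) \<bullet> normal j s) + eta j s \<bullet> tangent j s) +
       (w \<iota> s * (eta2 (1/\<sigma>) j s \<bullet> normal j s - 2 * (1/\<sigma>) * (eta j s \<bullet> tangent j s)) - (1/\<sigma>) * (\<xi> (curve j s) \<bullet> normal j s))) (at s within {p..q})"
      unfolding G_def w_def .
    then show "((\<lambda>s. ?A s + G \<iota> s) has_real_derivative
       eta j s \<bullet> tangent j s + w \<iota> s * (eta2 (1/\<sigma>) j s \<bullet> normal j s - 2 * (1/\<sigma>) * (eta j s \<bullet> tangent j s))) (at s within {p..q})"
      by (rule DERIV_cong) simp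
    have "0 \<le> w \<iota> s" using sigma_pos by (simp add: w_def)
    then have "w \<iota> s * (eta2 (1/\<sigma>) j s \<bullet> normal j s - 2 * (1/\<sigma>) * (eta j s \<bullet> tangent j s)) \<le> 0"
      using kink[of s] s pq by (intro mult_nonneg_nonpos) auto
    then show "eta j s \<bullet> tangent j s + w \<iota> s * (eta2 (1/\<sigma>) j s \<bullet> normal j s - 2 * (1/\<sigma>) * (eta j s \<bullet> tangent j s)) \<le> eta j s \<bullet> tangent j s" by simp
  qed
  have s1\<sigma>: "s1 / \<sigma> = \<theta>1" using sigma_pos by (simp add: s1_def)
  \<comment> \<open>\<open>w\<close> and \<open>w'\<close> vanish at the outer ends of the arc. At
    the tip the two values of \<open>w\<close> agree, while those of \<open>w'\<close> differ by
    \<open>2 * sin \<theta>1 = \<tau>\<close>.\<close>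
  have G: "G 1 s1 = 0" "G (-1) (- s1) = 0" "G (-1) 0 - G 1 0 = - \<tau> * (\<xi> (curve j 0) \<bullet> fb j)"
    using s1\<sigma> by (auto simp: G_def w_def frame_at_0 sin1)
  have 1: "?A (- s3) - ?A (- l) \<le> H (- s3) - H (- l)" by (rule straight) (simp add: pieces_def)
  have 2: "(?A (- s2) - ?e \<bullet> tangent j (- s2)) - (?A (- s3) - ?e \<bullet> tangent j (- s3)) \<le> H (- s2) - H (- s3)"
    by (rule shoulder) (auto simp: pieces_def)
  have 3: "?A (- s1) - ?A (- s2) \<le> H (- s1) - H (- s2)" by (rule straight) (simp add: pieces_def)
  have 4: "(?A 0 + G (-1) 0) - (?A (- s1) + G (-1) (- s1)) \<le> H 0 - H (- s1)" by (rule arc) (use s123 in auto)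
  have 5: "(?A s1 + G 1 s1) - (?A 0 + G 1 0) \<le> H s1 - H 0" by (rule arc) (use s123 in auto)
  have 6: "?A s2 - ?A s1 \<le> H s2 - H s1" by (rule straight) (simp add: pieces_def)
  have 7: "(?A s3 - ?e \<bullet> tangent j s3) - (?A s2 - ?e \<bullet> tangent j s2) \<le> H s3 - H s2"
    by (rule shoulder) (auto simp: pieces_def)
  have 8: "?A l - ?A s3 \<le> H l - H s3" by (rule straight) (simp add: pieces_def)
  \<comment> \<open>Along each shoulder the vertical component of the tangent changes by
    \<open>\<tau>/2\<close>; the horizontal changes of the two shoulders cancel. This is the total
    force \<open>\<tau>\<close>.\<close>
  have "tangent j s3 - tangent j (- s3) - (tangent j s2 - tangent j (- s2)) = \<tau> *\<^sub>R fb j"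
    using ray_tangent[of s3 j] by (simp add: shoulder_tangent algebra_simps flip: scaleR_add_left)
  then have "?e \<bullet> tangent j s3 - ?e \<bullet> tangent j (- s3) - (?e \<bullet> tangent j s2 - ?e \<bullet> tangent j (- s2)) = \<tau> * (?e \<bullet> fb j)"
    by (simp only: inner_diff_right[symmetric] inner_scaleR_right)
  then show ?thesis using 1 2 3 4 5 6 7 8 G by linarith
qed

lemma len_variation_eq:
  assumes H: "\<And>s. (H has_real_derivative eta j s \<bullet> tangent j s) (at s)"
  shows "len_variation (\<lambda>s. curve j (s - l)) (2 * l) \<xi> = H l - H (- l)"
proof -
  have l0: "0 < 2 * l" using l s123 by linarith
  have shift: "((\<lambda>s. f (s - l)) has_vector_derivative v) (at s within S)" if "(f has_vector_derivative v) (at (s - l))"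
    for f :: "real \<Rightarrow> 'b::real_normed_vector" and v s S
  proof -
    have "((\<lambda>s. s - l) has_vector_derivative 1) (at s within S)" by (auto intro!: derivative_eq_intros)
    from vector_diff_chain_within[OF this has_vector_derivative_at_within[OF that]] show ?thesis by (simp add: o_def)
  qed
  have "integral {0..2*l} (\<lambda>s. vector_derivative (\<xi> \<circ> (\<lambda>s. curve j (s - l))) (at s within {0..2*l}) \<bullet>
       vector_derivative (\<lambda>s. curve j (s - l)) (at s within {0..2*l})) = integral {0..2*l} (\<lambda>s. eta j (s - l) \<bullet> tangent j (s - l))"
  proof (rule integral_cong)
    fix s assume s: "s \<in> {0..2*l}"
    have "vector_derivative (\<xi> \<circ> (\<lambda>s. curve j (s - l))) (at s within {0..2*l}) = eta j (s - l)"
      using vector_derivative_within_cbox[of 0 "2*l" s "\<xi> \<circ> (\<lambda>s. curve j (s - l))"] l0 s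
        shift[OF xi_curve_derivative[of j "s - l" UNIV]] by (simp add: o_def)
    moreover have "vector_derivative (\<lambda>s. curve j (s - l)) (at s within {0..2*l}) = tangent j (s - l)"
      using vector_derivative_within_cbox[of 0 "2*l" s "\<lambda>s. curve j (s - l)"] l0 s
        shift[OF curve_derivative] by simp
    ultimately show "vector_derivative (\<xi> \<circ> (\<lambda>s. curve j (s - l))) (at s within {0..2*l}) \<bullet>
       vector_derivative (\<lambda>s. curve j (s - l)) (at s within {0..2*l}) = eta j (s - l) \<bullet> tangent j (s - l)" by simp
  qed
  also have "\<dots> = H l - H (- l)"
  proof (rule integral_unique)
    have "((\<lambda>s. eta j (s - l) \<bullet> tangent j (s - l)) has_integral (H (2*l - l) - H (0 - l))) {0..2*l}"
    proof (rule fundamental_theorem_of_calculus)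
      show "((\<lambda>s. H (s - l)) has_vector_derivative eta j (s - l) \<bullet> tangent j (s - l)) (at s within {0..2*l})" for s
        by (rule shift) (use H in \<open>simp add: has_real_derivative_iff_has_vector_derivative\<close>)
    qed (use l0 in simp)
    then show "((\<lambda>s. eta j (s - l) \<bullet> tangent j (s - l)) has_integral (H l - H (- l))) {0..2*l}" by simp
  qed
  finally show ?thesis unfolding len_variation_def .
qed

text \<open>Action equals reaction: since \<open>fb 1 = - fb 0\<close>, the force of one component
  on the opposite tip cancels the jump term of that tip when both bounds are added, and the end
  terms vanish by \<open>bdry\<close>.\<close>

lemma len_variation_nonneg:
  assumes strut: "\<And>j s. j \<in> {0, 1} \<Longrightarrow> s \<in> {s2..s3} \<or> s \<in> {-s3..-s2} \<Longrightarrow> 0 \<le> (\<xi> (curve (1 - j) 0) - \<xi> (curve j s)) \<bullet> normal j s"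
    and kink: "\<And>j s. j \<in> {0, 1} \<Longrightarrow> s \<in> {-s1..s1} \<Longrightarrow> eta2 (1/\<sigma>) j s \<bullet> normal j s - 2 * (1/\<sigma>) * (eta j s \<bullet> tangent j s) \<le> 0"
    and bdry: "\<And>j. j \<in> {0, 1} \<Longrightarrow> \<xi> (curve j l) \<bullet> tangent j l = 0" "\<And>j. j \<in> {0, 1} \<Longrightarrow> \<xi> (curve j (- l)) \<bullet> tangent j (- l) = 0"
  shows "0 \<le> len_variation (\<lambda>s. curve 0 (s - l)) (2 * l) \<xi> + len_variation (\<lambda>s. curve 1 (s - l)) (2 * l) \<xi>"
proof -
  have bound: "- \<tau> * (\<xi> (curve j 0) \<bullet> fb j) - \<tau> * (\<xi> (curve (1 - j) 0) \<bullet> fb j) \<le> len_variation (\<lambda>s. curve j (s - l)) (2 * l) \<xi>"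
    if j: "j \<in> {0, 1}" for j
  proof -
    have "continuous_on UNIV (\<lambda>s. eta j s \<bullet> tangent j s)"
      unfolding tangent_def[abs_def] by (intro continuous_intros ang_continuous eta_continuous)
    from real_antiderivative_exists[OF this, of 0] obtain H where H: "\<And>s. (H has_real_derivative eta j s \<bullet> tangent j s) (at s)" by blast
    show ?thesis
      using component_length_bound[OF j strut[OF j] kink[OF j] H] bdry[OF j] unfolding len_variation_eq[OF H] by simp
  qed
  have "fb 1 = - fb 0" by (simp add: fb_def)
  then show ?thesis using bound[of 0] bound[of 1] by simp
qed

end

end

section \<open>The Hopf link\<close>

definition radial_scale :: "('a::real_normed_vector \<Rightarrow> real) \<Rightarrow> 'a \<Rightarrow> 'a" where
  "radial_scale m v = m (sgn v) *\<^sub>R v"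

text \<open>Away from 0 \<open>sgn\<close> is continuous; at 0 the boundedness of \<open>m\<close>
  on the compact sphere suffices.\<close>

lemma radial_scale_continuous:
  fixes m :: "'a::euclidean_space \<Rightarrow> real"
  assumes m: "continuous_on (sphere 0 1) m"
  shows "continuous_on UNIV (radial_scale m)"
  unfolding continuous_on_eq_continuous_within
proof
  fix v :: 'a
  show "continuous (at v within UNIV) (radial_scale m)"
  proof (cases "v = 0")
    case False
    have "continuous_on (- {0}) (\<lambda>v::'a. m (sgn v) *\<^sub>R v)"
      by (intro continuous_on_scaleR continuous_on_compose2[OF m] continuous_on_id continuous_on_sgn) (auto simp: norm_sgn split: if_splits)
    then have "isCont (\<lambda>v::'a. m (sgn v) *\<^sub>R v) v"
      using False by (simp add: continuous_on_eq_continuous_at open_Compl)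
    then show ?thesis by (simp add: radial_scale_def[abs_def])
  next
    case True
    have "compact (m ` sphere 0 1)" by (intro compact_continuous_image m compact_sphere)
    then obtain B where B: "\<And>u. u \<in> sphere 0 1 \<Longrightarrow> \<bar>m u\<bar> \<le> B"
      using compact_imp_bounded bounded_iff by (metis imageI real_norm_def)
    have "(radial_scale m \<longlongrightarrow> 0) (at 0)"
    proof (rule Lim_null_comparison)
      show "\<forall>\<^sub>F v in at 0. norm (radial_scale m v) \<le> B * norm v"
        unfolding eventually_at_filter
      proof (intro always_eventually allI impI)
        fix v :: 'a assume "v \<noteq> 0"
        then show "norm (radial_scale m v) \<le> B * norm v"
          using B[of "sgn v"] by (simp add: radial_scale_def norm_sgn mult_right_mono)
      qed
      show "((\<lambda>v::'a. B * norm v) \<longlongrightarrow> 0) (at 0)" by (rule tendsto_eq_intros refl | simp)+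
    qed
    then show ?thesis using True by (simp add: continuous_within radial_scale_def)
  qed
qed

text \<open>Each ray from 0 meets \<open>J\<close> exactly once, so \<open>J\<close> is given by a
  positive radius function on the sphere, continuous because a continuous bijection from a compact
  set is a homeomorphism. Every ray is scaled by \<open>R\<close> over this radius; rays where
  \<open>J\<close> already has norm \<open>R\<close> stay fixed.\<close>

lemma radial_homeomorphism:
  fixes J :: "'a::euclidean_space set"
  assumes J: "compact J" "0 \<notin> J" "bij_betw sgn J (sphere 0 1)" and R: "0 < R"
  obtains f g where "homeomorphism UNIV UNIV f g" "f ` J = sphere 0 R"
    "\<And>v t. v \<in> J \<Longrightarrow> norm v = R \<Longrightarrow> 0 \<le> t \<Longrightarrow> f (t *\<^sub>R v) = t *\<^sub>R v"
proof -
  have "continuous_on J sgn" using J(2) by (intro continuous_on_sgn continuous_on_id) auto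
  then obtain q where q: "homeomorphism J (sphere 0 1) sgn q"
    using homeomorphism_compact[OF J(1)] J(3) unfolding bij_betw_def by metis
  have q_cont: "continuous_on (sphere 0 1) q" and qJ: "\<And>u. u \<in> sphere 0 1 \<Longrightarrow> q u \<in> J \<and> sgn (q u) = u"
    and qsgn: "\<And>v. v \<in> J \<Longrightarrow> q (sgn v) = v"
    using q by (auto simp: homeomorphism_def)
  define m where "m u = R / norm (q u)" for u
  have nz: "norm (q u) > 0" if "u \<in> sphere 0 1" for u using qJ[OF that] J(2) by auto
  have m_pos: "m u > 0" if "u \<in> sphere 0 1" for u using nz[OF that] R by (simp add: m_def)
  have m_cont: "continuous_on (sphere 0 1) m" "continuous_on (sphere 0 1) (\<lambda>u. 1 / m u)"
    unfolding m_def using nz R by (auto intro!: continuous_intros q_cont simp: less_imp_neq)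
  have unit: "sgn v \<in> sphere 0 1" if "v \<noteq> 0" for v :: 'a using that by (simp add: norm_sgn)
  have inv: "radial_scale (\<lambda>u. 1 / k u) (radial_scale k v) = v" if "\<And>u. u \<in> sphere 0 1 \<Longrightarrow> k u > 0" for k and v :: 'a
  proof (cases "v = 0")
    case False
    then have "k (sgn v) > 0" using that unit by blast
    then show ?thesis by (simp add: radial_scale_def sgn_scaleR)
  qed (simp add: radial_scale_def)
  show thesis
  proof (rule that)
    have "homeomorphism UNIV UNIV (radial_scale m) (radial_scale (\<lambda>u. 1 / m u))"
    proof (rule homeomorphismI)
      show "radial_scale (\<lambda>u. 1 / m u) (radial_scale m v) = v" for v :: 'a using inv m_pos by blast
      have "1 / (1 / m u) = m u" for u by simp
      then show "radial_scale m (radial_scale (\<lambda>u. 1 / m u) v) = v" for v :: 'a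
        using inv[of "\<lambda>u. 1 / m u" v] m_pos by simp
    qed (auto intro!: radial_scale_continuous m_cont)
    then show "homeomorphism UNIV UNIV (radial_scale m) (radial_scale (\<lambda>u. 1 / m u))" .
    have on_J: "radial_scale m v = R *\<^sub>R sgn v" if "v \<in> J" for v
      using qsgn[OF that] by (simp add: radial_scale_def m_def sgn_div_norm divide_inverse)
    show "radial_scale m ` J = sphere 0 R"
    proof
      show "radial_scale m ` J \<subseteq> sphere 0 R"
        using on_J J(2) R by (auto simp: norm_sgn)
      show "sphere 0 R \<subseteq> radial_scale m ` J"
      proof
        fix w :: 'a assume "w \<in> sphere 0 R"
        then have w: "norm w = R" "w \<noteq> 0" using R by auto
        have "radial_scale m (q (sgn w)) = R *\<^sub>R sgn w"
          using on_J[of "q (sgn w)"] qJ[OF unit[OF w(2)]] by simp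
        also have "\<dots> = w" using w R by (simp add: sgn_div_norm)
        finally have "radial_scale m (q (sgn w)) = w" .
        then show "w \<in> radial_scale m ` J" using qJ[OF unit[OF w(2)]] by (metis imageI)
      qed
    qed
    show "radial_scale m (t *\<^sub>R v) = t *\<^sub>R v" if "v \<in> J" "norm v = R" "0 \<le> t" for v t
    proof (cases "t = 0")
      case False
      then have "sgn (t *\<^sub>R v) = sgn v" using that by (simp add: sgn_scaleR)
      then show ?thesis using qsgn[OF that(1)] that R by (simp add: radial_scale_def m_def)
    qed (simp add: radial_scale_def)
  qed
qed

text \<open>\<open>rot\<close> is the symmetry carrying the first component to the second.
  \<open>emb r\<close> places a coordinate plane into the xz-plane with its origin at height
  \<open>r\<close>.\<close>

definition rot :: "real^3 \<Rightarrow> real^3" where "rot p = vector [- p $ 2, p $ 1, - p $ 3]"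
definition rot_inv :: "real^3 \<Rightarrow> real^3" where "rot_inv p = vector [p $ 2, - p $ 1, - p $ 3]"
definition emb :: "real \<Rightarrow> real \<times> real \<Rightarrow> real^3" where "emb r v = vector [fst v, 0, snd v + r]"

lemma vector3_eq: "(vector [x, y, z] :: real^3) = x *\<^sub>R axis 1 1 + y *\<^sub>R axis 2 1 + z *\<^sub>R axis 3 1"
  by (simp add: vec_eq_iff forall_3 axis_def)

lemma vec3_eqI: "p $ 1 = q $ 1 \<Longrightarrow> p $ 2 = q $ 2 \<Longrightarrow> p $ 3 = q $ 3 \<Longrightarrow> p = (q :: real^3)"
  by (simp add: vec_eq_iff forall_3)

lemma norm3_sq: "(norm (p :: real^3))\<^sup>2 = (p $ 1)\<^sup>2 + (p $ 2)\<^sup>2 + (p $ 3)\<^sup>2"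
  unfolding power2_norm_eq_inner by (simp add: inner_vec_def sum_3 power2_eq_square)

lemma norm3_eq: "0 \<le> c \<Longrightarrow> norm (p :: real^3) = c \<longleftrightarrow> (p $ 1)\<^sup>2 + (p $ 2)\<^sup>2 + (p $ 3)\<^sup>2 = c\<^sup>2"
  using norm3_sq[of p] by (metis norm_ge_zero power2_eq_imp_eq)

lemma continuous_on_vector3:
  assumes "continuous_on A f" "continuous_on A g" "continuous_on A h"
  shows "continuous_on A (\<lambda>p. vector [f p, g p, h p] :: real^3)"
  unfolding vector3_eq by (intro continuous_intros assms)

lemma norm_real_Pair_sq: "(norm (x :: real, w :: real))\<^sup>2 = x\<^sup>2 + w\<^sup>2"
  unfolding norm_Pair real_norm_def power2_abs by (rule real_sqrt_pow2) simp

lemma rot_rot_inv: "rot (rot_inv p) = p" "rot_inv (rot p) = p"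
  by (auto simp: rot_def rot_inv_def intro!: vec3_eqI)

lemma homeomorphism_rot: "homeomorphism UNIV UNIV rot rot_inv"
  by (rule homeomorphismI)
    (auto simp: rot_def[abs_def] rot_inv_def[abs_def] intro!: continuous_on_vector3 continuous_intros vec3_eqI)

lemma homeomorphism_planar:
  assumes f: "homeomorphism (UNIV :: (real \<times> real) set) UNIV f g"
  shows "homeomorphism UNIV UNIV (\<lambda>p::real^3. vector [fst (f (p $ 1, p $ 3 - r)), p $ 2, snd (f (p $ 1, p $ 3 - r)) + r] :: real^3)
     (\<lambda>p::real^3. vector [fst (g (p $ 1, p $ 3 - r)), p $ 2, snd (g (p $ 1, p $ 3 - r)) + r] :: real^3)"
proof -
  have c: "continuous_on UNIV f" "continuous_on UNIV g" and i: "\<And>v. g (f v) = v" "\<And>v. f (g v) = v"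
    using f by (auto simp: homeomorphism_def)
  have cont: "continuous_on UNIV (\<lambda>p::real^3. vector [fst (k (p $ 1, p $ 3 - r)), p $ 2, snd (k (p $ 1, p $ 3 - r)) + r] :: real^3)"
    if k: "continuous_on UNIV k" for k :: "real \<times> real \<Rightarrow> real \<times> real"
  proof -
    have "continuous_on UNIV (\<lambda>p::real^3. k (p $ 1, p $ 3 - r))"
      by (rule continuous_on_compose2[OF k]) (auto intro!: continuous_intros)
    then show ?thesis by (intro continuous_on_vector3 continuous_intros) auto
  qed
  show ?thesis
    by (rule homeomorphismI) (use cont c i in \<open>auto intro!: vec3_eqI\<close>)
qed

text \<open>The radial map taking the first curve to a circle of radius \<open>2 r\<close> centred at \<open>(0, 0, r)\<close> fixes the
  half-line of the \<open>z\<close>-axis below that centre.  The second curve lies over this half-line in the perpendicular plane, so the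
  two curves can be made round one after the other.\<close>

lemma Hopf_link_from_planar_curve:
  assumes J: "compact J" "0 \<notin> J" "bij_betw sgn J (sphere (0 :: real \<times> real) 1)" and r: "0 < r"
    and low: "(0, - 2 * r) \<in> J" "\<And>v. v \<in> J \<Longrightarrow> - 2 * r \<le> snd v"
  shows "is_Hopf_link (emb r ` J) (rot ` emb r ` J)"
proof -
  let ?R = "2 * r"
  have R: "0 < ?R" using r by simp
  obtain f g where f: "homeomorphism UNIV UNIV f g" "f ` J = sphere 0 ?R"
    and fixed: "\<And>v t. v \<in> J \<Longrightarrow> norm v = ?R \<Longrightarrow> 0 \<le> t \<Longrightarrow> f (t *\<^sub>R v) = t *\<^sub>R v"
    by (rule radial_homeomorphism[OF J R], rule that)
  have axis: "f (0, y) = (0, y)" if "y \<le> 0" for y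
  proof -
    have "norm (0::real, - 2 * r) = ?R" using r by (simp add: norm_Pair real_sqrt_mult)
    from fixed[OF low(1) this, of "- y / ?R"] show ?thesis using that r by (simp add: field_simps)
  qed
  define F where "F p = (vector [fst (f (p $ 1, p $ 3 - r)), p $ 2, snd (f (p $ 1, p $ 3 - r)) + r] :: real^3)" for p :: "real^3"
  have hF: "homeomorphism UNIV UNIV F (\<lambda>p. vector [fst (g (p $ 1, p $ 3 - r)), p $ 2, snd (g (p $ 1, p $ 3 - r)) + r])"
    unfolding F_def[abs_def] by (rule homeomorphism_planar[OF f(1)])
  have F_emb: "F (emb r v) = emb r (f v)" for v by (simp add: F_def emb_def)
  \<comment> \<open>A point of the second curve has first coordinate 0 and height
    \<open>- snd v - 2 * r \<le> 0\<close> relative to the centre, so \<open>F\<close> acts on it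
    through the half-line fixed by \<open>f\<close>.\<close>
  have F_fix: "F (rot (emb r v)) = rot (emb r v)" if "- 2 * r \<le> snd v" for v
    using axis[of "- snd v - 2 * r"] that by (intro vec3_eqI) (auto simp: F_def rot_def emb_def algebra_simps)
  have F_fix': "F (rot_inv (emb r v)) = rot_inv (emb r v)" if "- 2 * r \<le> snd v" for v
    using axis[of "- snd v - 2 * r"] that by (intro vec3_eqI) (auto simp: F_def rot_inv_def emb_def algebra_simps)
  \<comment> \<open>Similarity from the rounded pair, two circles of radius \<open>2 * r\<close>
    with centres at heights \<open>r\<close> and \<open>- r\<close>, to the standard Hopf
    link.\<close>
  define Aff where "Aff p = (vector [(r - p $ 3) / ?R, p $ 1 / ?R, p $ 2 / ?R] :: real^3)" for p :: "real^3"
  define Ainv where "Ainv p = (vector [?R * p $ 2, ?R * p $ 3, r - ?R * p $ 1] :: real^3)" for p :: "real^3"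
  have hA: "homeomorphism UNIV UNIV Aff Ainv"
    by (rule homeomorphismI)
      (use r in \<open>auto simp: Aff_def[abs_def] Ainv_def[abs_def] intro!: continuous_on_vector3 continuous_intros vec3_eqI\<close>)
  have hR': "homeomorphism UNIV UNIV rot_inv rot" using homeomorphism_rot homeomorphism_symD by blast
  \<comment> \<open>\<open>F\<close> rounds the first curve and fixes the second. Its conjugate by
    \<open>rot\<close> rounds the second and fixes the first, which by then is a circle reaching no
    lower than \<open>2 * r\<close> below its centre.\<close>
  define H where "H = Aff \<circ> (rot \<circ> (F \<circ> (rot_inv \<circ> F)))"
  obtain K where K: "homeomorphism UNIV UNIV H K"
    using homeomorphism_compose[OF homeomorphism_compose[OF homeomorphism_compose[OF homeomorphism_compose[OF hF hR'] hF] homeomorphism_rot] hA]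
    unfolding H_def by blast
  have HA: "H (emb r v) = Aff (emb r (f v))" if "v \<in> J" for v
  proof -
    have "f v \<in> sphere 0 ?R" using f(2) that by blast
    then have "norm (f v) = ?R" by simp
    then have "- ?R \<le> snd (f v)" using norm_snd_le[of "snd (f v)" "fst (f v)"] by (simp add: abs_le_iff)
    then have "F (rot_inv (emb r (f v))) = rot_inv (emb r (f v))" by (intro F_fix') simp
    then show ?thesis by (simp add: H_def F_emb rot_rot_inv)
  qed
  have HB: "H (rot (emb r v)) = Aff (rot (emb r (f v)))" if "v \<in> J" for v
    using F_fix[OF low(2)[OF that]] by (simp add: H_def F_emb rot_rot_inv)
  have HJ: "H ` emb r ` J = (\<lambda>w. Aff (emb r w)) ` sphere 0 ?R"
    unfolding f(2)[symmetric] image_image using HA by simp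
  also have "(\<lambda>w. Aff (emb r w)) ` sphere 0 ?R = {p. p $ 3 = 0 \<and> norm p = 1}"
  proof (intro antisym subsetI)
    fix p assume "p \<in> (\<lambda>w. Aff (emb r w)) ` sphere 0 ?R"
    then obtain x w where xw: "norm (x, w) = ?R" "p = Aff (emb r (x, w))" by auto
    have "x\<^sup>2 + w\<^sup>2 = ?R\<^sup>2" using norm_real_Pair_sq[of x w] unfolding xw(1) by (rule sym)
    then have "(w / ?R)\<^sup>2 + (x / ?R)\<^sup>2 = 1" using r by (simp add: power_divide field_simps)
    then show "p \<in> {p. p $ 3 = 0 \<and> norm p = 1}" using xw(2) by (simp add: norm3_eq Aff_def emb_def)
  next
    fix p :: "real^3" assume "p \<in> {p. p $ 3 = 0 \<and> norm p = 1}"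
    then have p: "p $ 3 = 0" "(p $ 1)\<^sup>2 + (p $ 2)\<^sup>2 = 1" by (auto simp: norm3_eq)
    have "norm (?R * p $ 2, - ?R * p $ 1) = sqrt (?R\<^sup>2 * ((p $ 1)\<^sup>2 + (p $ 2)\<^sup>2))"
      by (simp add: norm_Pair power_mult_distrib algebra_simps)
    also have "\<dots> = ?R" using p(2) r by (simp add: real_sqrt_mult)
    finally have "(?R * p $ 2, - ?R * p $ 1) \<in> sphere 0 ?R" by simp
    moreover have "Aff (emb r (?R * p $ 2, - ?R * p $ 1)) = p" using p(1) r by (intro vec3_eqI) (auto simp: Aff_def emb_def)
    ultimately show "p \<in> (\<lambda>w. Aff (emb r w)) ` sphere 0 ?R" by (metis imageI)
  qed
  finally have 1: "H ` emb r ` J = {p. p $ 3 = 0 \<and> norm p = 1}" .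
  have "H ` rot ` emb r ` J = (\<lambda>w. Aff (rot (emb r w))) ` sphere 0 ?R"
    unfolding f(2)[symmetric] image_image using HB by simp
  also have "(\<lambda>w. Aff (rot (emb r w))) ` sphere 0 ?R = {p. p $ 2 = 0 \<and> norm (p - vector [1, 0, 0]) = 1}"
  proof (intro antisym subsetI)
    fix p assume "p \<in> (\<lambda>w. Aff (rot (emb r w))) ` sphere 0 ?R"
    then obtain x w where xw: "norm (x, w) = ?R" "p = Aff (rot (emb r (x, w)))" by auto
    have "x\<^sup>2 + w\<^sup>2 = ?R\<^sup>2" using norm_real_Pair_sq[of x w] unfolding xw(1) by (rule sym)
    then have "(w / ?R)\<^sup>2 + (x / ?R)\<^sup>2 = 1" using r by (simp add: power_divide field_simps)
    moreover have "p $ 1 - 1 = w / ?R" "p $ 2 = 0" "p $ 3 = x / ?R"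
      using xw(2) r by (simp_all add: Aff_def rot_def emb_def field_simps)
    ultimately show "p \<in> {p. p $ 2 = 0 \<and> norm (p - vector [1, 0, 0]) = 1}" by (simp add: norm3_eq)
  next
    fix p :: "real^3" assume "p \<in> {p. p $ 2 = 0 \<and> norm (p - vector [1, 0, 0]) = 1}"
    then have p: "p $ 2 = 0" "(p $ 1 - 1)\<^sup>2 + (p $ 3)\<^sup>2 = 1" by (auto simp: norm3_eq)
    have "norm (?R * p $ 3, ?R * (p $ 1 - 1)) = sqrt (?R\<^sup>2 * ((p $ 1 - 1)\<^sup>2 + (p $ 3)\<^sup>2))"
      by (simp only: norm_Pair real_norm_def power2_abs power_mult_distrib distrib_left add.commute)
    also have "\<dots> = ?R" using p(2) r by (simp add: real_sqrt_mult)
    finally have "(?R * p $ 3, ?R * (p $ 1 - 1)) \<in> sphere 0 ?R" by simp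
    moreover have "Aff (rot (emb r (?R * p $ 3, ?R * (p $ 1 - 1)))) = p"
      using p(1) r by (intro vec3_eqI) (auto simp: Aff_def rot_def emb_def field_simps)
    ultimately show "p \<in> (\<lambda>w. Aff (rot (emb r w))) ` sphere 0 ?R" by (metis imageI)
  qed
  finally show ?thesis unfolding is_Hopf_link_def using K 1 by (intro exI[of _ H] exI[of _ K] conjI)
qed

lemma closed_segment_image_eq:
  assumes "\<And>u. u \<in> {0..1} \<Longrightarrow> f ((1 - u) *\<^sub>R a + u *\<^sub>R b) = (1 - u) *\<^sub>R f a + u *\<^sub>R f b"
  shows "f ` closed_segment a b = closed_segment (f a) (f b)"
  using assms unfolding closed_segment_image_interval image_image by (intro image_cong) auto

section \<open>The closed-up component is star-shaped about the opposite tip\<close>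

context clasp_curve begin

text \<open>Right half of the first component with its closing segment, in coordinates of the
  xz-plane centred at the opposite tip.\<close>

definition upper :: "real \<Rightarrow> real \<times> real \<Rightarrow> (real \<times> real) set" where
  "upper l c = {v. \<exists>s\<in>{0..l}. v = (X s, Y s + z0)} \<union> closed_segment (X l, Y l + z0) c"

definition mirror :: "real \<times> real \<Rightarrow> real \<times> real" where "mirror v = (- fst v, snd v)"

lemma z0_neg: "z0 < 0"
proof -
  have "0 < (1 - \<sigma>) / C" using sigma1 C_pos by simp
  moreover have "2 * z0 = - \<sigma> - (1 - \<sigma>) / C" by (simp only: z0_def) simp
  ultimately show ?thesis using sigma_pos by linarith
qed

text \<open>On the tip arc the signed distance of the tangent line from the opposite tip is
  \<open>\<sigma> + ((1 - \<sigma>) / C) * cos (ang s)\<close>; from there on it is 1. Positivity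
  means that the curve is never tangent to a ray from that tip.\<close>

lemma support_pos: "0 \<le> s \<Longrightarrow> 0 < X s * sin (ang s) - (Y s + z0) * cos (ang s)"
proof (cases "s \<le> s1")
  case True
  assume "0 \<le> s"
  then have s: "s \<in> {-s1..s1}" using True s123 by simp
  have q: "0 \<le> (1 - \<sigma>) / C" using sigma1 C_pos by simp
  have "2 * z0 = - \<sigma> - (1 - \<sigma>) / C" by (simp only: z0_def) simp
  then have z: "2 * z0 + \<sigma> = - ((1 - \<sigma>) / C)" by linarith
  have "\<sigma> * S * S - (z0 + \<sigma> - \<sigma> * c + z0) * c = \<sigma> * (S\<^sup>2 + c\<^sup>2) - (2 * z0 + \<sigma>) * c" for S c
    by (simp add: power2_eq_square algebra_simps)
  from this[of "sin (s/\<sigma>)" "cos (s/\<sigma>)"]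
  have "X s * sin (ang s) - (Y s + z0) * cos (ang s) = \<sigma> + ((1 - \<sigma>) / C) * cos (ang s)"
    unfolding z curve_arc[OF s] ang_values(1)[OF s] by simp
  moreover have "0 \<le> ((1 - \<sigma>) / C) * cos (ang s)" using q cos_ang by (rule mult_nonneg_nonneg)
  ultimately show ?thesis using sigma_pos by linarith
qed (simp add: support)

text \<open>The numerator of the derivative is the quantity of \<open>support_pos\<close>, so the
  polar angle seen from the opposite tip increases strictly.\<close>

lemma slope_strict_mono:
  assumes "0 < s" "s < t"
  shows "(Y s + z0) / X s < (Y t + z0) / X t"
proof (rule DERIV_pos_imp_increasing[OF assms(2)])
  fix u assume u: "s \<le> u" "u \<le> t"
  then have p: "0 < X u" "0 < X u * sin (ang u) - (Y u + z0) * cos (ang u)" using X_pos[of u] support_pos[of u] assms by auto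
  have "((\<lambda>u. (Y u + z0) / X u) has_real_derivative ((sin (ang u) + 0) * X u - (Y u + z0) * cos (ang u)) / (X u * X u)) (at u)"
    by (intro DERIV_divide DERIV_add Y_DERIV X_DERIV DERIV_const) (use p in simp)
  moreover have "0 < ((sin (ang u) + 0) * X u - (Y u + z0) * cos (ang u)) / (X u * X u)"
    using p by (simp add: mult.commute)
  ultimately show "\<exists>y. ((\<lambda>u. (Y u + z0) / X u) has_real_derivative y) (at u) \<and> 0 < y" by blast
qed

context
  fixes l W :: real
  assumes l0: "0 < l" and W: "0 < W"
begin

lemma upper_cases:
  assumes "v \<in> upper l (0, W)"
  obtains s where "s \<in> {0..l}" "v = (X s, Y s + z0)"
    | u where "u \<in> {0..1}" "v = ((1 - u) * X l, (1 - u) * (Y l + z0) + u * W)"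
  using assms unfolding upper_def closed_segment_def by auto

lemma upper_nonneg: "v \<in> upper l (0, W) \<Longrightarrow> 0 \<le> fst v"
  by (erule upper_cases) (auto simp: X_nonneg l0 less_imp_le)

lemma upper_axis:
  assumes "v \<in> upper l (0, W)" "fst v = 0"
  shows "v = (0, 2 * z0) \<or> v = (0, W)"
  using assms(1)
proof (rule upper_cases)
  fix s assume "s \<in> {0..l}" "v = (X s, Y s + z0)"
  then show ?thesis using assms(2) X_pos[of s] by (cases "s = 0") (auto simp: X0 Y0)
next
  fix u assume "u \<in> {0..1}" "v = ((1 - u) * X l, (1 - u) * (Y l + z0) + u * W)"
  then show ?thesis using assms(2) X_pos[OF l0] by auto
qed

text \<open>Points are labelled by \<open>s\<close> along the curve and by
  \<open>\<mu> = u / (1 - u)\<close> along the closing segment, where \<open>\<mu>\<close> can be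
  positive for \<open>s = l\<close> only. The slope increases strictly along these labels.\<close>

lemma upper_slope_inj:
  assumes v: "v \<in> upper l (0, W)" "0 < fst v" and w: "w \<in> upper l (0, W)" "0 < fst w"
    and eq: "snd v / fst v = snd w / fst w"
  shows "v = w"
proof -
  define k where "k s = (Y s + z0) / X s" for s
  have param: "\<exists>s \<mu>. 0 < s \<and> s \<le> l \<and> 0 \<le> \<mu> \<and> (\<mu> = 0 \<or> s = l) \<and> snd v / fst v = k s + \<mu> * (W / X l)
      \<and> v = (1 / (1 + \<mu>)) *\<^sub>R (X s, Y s + z0) + (\<mu> / (1 + \<mu>)) *\<^sub>R (0, W)"
    if v: "v \<in> upper l (0, W)" "0 < fst v" for v
    using v(1)
  proof (rule upper_cases)
    fix s assume s: "s \<in> {0..l}" "v = (X s, Y s + z0)"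
    then have "s \<noteq> 0" using v(2) X0 by auto
    then show ?thesis using s by (intro exI[of _ s] exI[of _ 0]) (auto simp: k_def)
  next
    fix u assume u: "u \<in> {0..1}" "v = ((1 - u) * X l, (1 - u) * (Y l + z0) + u * W)"
    then have u1: "u < 1" using v(2) X_pos[OF l0] by (cases "u = 1") auto
    have "1 + u / (1 - u) = 1 / (1 - u)" using u1 by (simp add: field_simps)
    then have e: "1 / (1 + u / (1 - u)) = 1 - u" "(u / (1 - u)) / (1 + u / (1 - u)) = u" using u1 by auto
    have "snd v / fst v = k l + (u / (1 - u)) * (W / X l)"
      using u(2) u1 X_pos[OF l0] by (simp add: k_def field_simps)
    moreover have "v = (1 / (1 + u / (1 - u))) *\<^sub>R (X l, Y l + z0) + ((u / (1 - u)) / (1 + u / (1 - u))) *\<^sub>R (0, W)"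
      unfolding e using u(2) by simp
    moreover have "0 \<le> u / (1 - u)" using u u1 by simp
    ultimately show ?thesis using l0 by blast
  qed
  obtain s \<mu> where s: "0 < s" "s \<le> l" "0 \<le> \<mu>" "\<mu> = 0 \<or> s = l" "snd v / fst v = k s + \<mu> * (W / X l)"
    "v = (1 / (1 + \<mu>)) *\<^sub>R (X s, Y s + z0) + (\<mu> / (1 + \<mu>)) *\<^sub>R (0, W)" using param[OF v] by blast
  obtain t \<nu> where t: "0 < t" "t \<le> l" "0 \<le> \<nu>" "\<nu> = 0 \<or> t = l" "snd w / fst w = k t + \<nu> * (W / X l)"
    "w = (1 / (1 + \<nu>)) *\<^sub>R (X t, Y t + z0) + (\<nu> / (1 + \<nu>)) *\<^sub>R (0, W)" using param[OF w] by blast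
  have pos: "0 < W / X l" using W X_pos[OF l0] by simp
  have e: "k s + \<mu> * (W / X l) = k t + \<nu> * (W / X l)" using eq s(5) t(5) by simp
  have mono: "a < b \<Longrightarrow> 0 < a \<Longrightarrow> k a < k b" for a b using slope_strict_mono[of a b] by (simp add: k_def)
  have "s = t"
  proof (rule ccontr)
    assume "s \<noteq> t"
    then consider "s < t" | "t < s" by linarith
    then show False
    proof cases
      case 1
      then have "\<mu> = 0" using s(4) t(2) by auto
      then show False using e mono[OF 1 s(1)] t(3) pos mult_nonneg_nonneg[of \<nu> "W / X l"] by simp
    next
      case 2
      then have "\<nu> = 0" using t(4) s(2) by auto
      then show False using e mono[OF 2 t(1)] s(3) pos mult_nonneg_nonneg[of \<mu> "W / X l"] by simp
    qed
  qed
  then have "\<mu> * (W / X l) = \<nu> * (W / X l)" using e by (metis add_left_imp_eq)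
  then have "\<mu> = \<nu>" using pos by (metis mult_right_cancel order_less_irrefl)
  then show ?thesis using s(6) t(6) \<open>s = t\<close> by simp
qed

text \<open>Slopes below that of the end point occur on the curve by the intermediate value theorem,
  starting from the tip, which lies below the centre. Steeper ones occur on the closing segment, for
  which the position is solved explicitly.\<close>

lemma upper_slope_exists: "\<exists>v\<in>upper l (0, W). 0 < fst v \<and> snd v / fst v = M"
proof -
  define k where "k = (Y l + z0) / X l"
  have Xl: "0 < X l" by (rule X_pos[OF l0])
  show ?thesis
  proof (cases "k \<le> M")
    case True
    define \<mu> where "\<mu> = (M - k) * X l / W"
    have \<mu>: "0 \<le> \<mu>" using True Xl W by (simp add: \<mu>_def)
    define u where "u = \<mu> / (1 + \<mu>)"
    have u: "0 \<le> u" "u < 1" "1 - u = 1 / (1 + \<mu>)" using \<mu> by (auto simp: u_def field_simps)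
    define v where "v = (1 - u) *\<^sub>R (X l, Y l + z0) + u *\<^sub>R (0, W)"
    have "v \<in> closed_segment (X l, Y l + z0) (0, W)"
      unfolding in_segment v_def by (intro exI[of _ u] conjI refl) (use u in linarith)+
    then have "v \<in> upper l (0, W)" by (simp add: upper_def)
    moreover have "0 < fst v" using u(2) Xl by (simp add: v_def)
    moreover have "snd v = M * fst v"
    proof -
      have "u * W = (1 - u) * (\<mu> * W)" unfolding u(3) by (simp add: u_def)
      also have "\<mu> * W = (M - k) * X l" using W by (simp add: \<mu>_def)
      finally have "snd v = (1 - u) * (Y l + z0 + (M - k) * X l)" by (simp add: v_def algebra_simps)
      also have "Y l + z0 = k * X l" using Xl by (simp add: k_def)
      finally show ?thesis by (simp add: v_def algebra_simps)
    qed
    ultimately show ?thesis by (intro bexI[of _ v]) auto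
  next
    case False
    have "\<exists>s\<ge>0. s \<le> l \<and> (Y s + z0) - M * X s = 0"
    proof (rule IVT')
      show "Y 0 + z0 - M * X 0 \<le> 0" using z0_neg by (simp add: X0 Y0)
      show "0 \<le> Y l + z0 - M * X l" using False Xl by (simp add: k_def field_simps)
    qed (use l0 in \<open>auto intro!: continuous_intros X_continuous Y_continuous\<close>)
    then obtain s where s: "0 \<le> s" "s \<le> l" "Y s + z0 = M * X s" by auto
    have "s \<noteq> 0" using z0_neg s(3) by (auto simp: X0 Y0)
    then have "0 < X s" using X_pos s(1) by simp
    then show ?thesis using s by (intro bexI[of _ "(X s, Y s + z0)"]) (auto simp: upper_def)
  qed
qed

lemma upper_ends: "(0, 2 * z0) \<in> upper l (0, W)" "(0, W) \<in> upper l (0, W)"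
  using l0 by (auto simp: upper_def X0 Y0 intro!: bexI[of _ 0])

lemma sgn_eq_iff_slope:
  fixes v w :: "real \<times> real"
  assumes "0 < fst v" "0 < fst w"
  shows "sgn v = sgn w \<Longrightarrow> snd v / fst v = snd w / fst w" "snd v / fst v = snd w / fst w \<Longrightarrow> sgn v = sgn w"
proof -
  have n: "norm v > 0" "norm w > 0" using assms by auto
  show "snd v / fst v = snd w / fst w" if "sgn v = sgn w"
  proof -
    have "fst v / norm v = fst w / norm w" "snd v / norm v = snd w / norm w"
      using that by (auto simp: sgn_div_norm prod_eq_iff divide_inverse mult.commute)
    then have "(snd v / norm v) / (fst v / norm v) = (snd w / norm w) / (fst w / norm w)" by simp
    then show ?thesis using n by simp
  qed
  show "sgn v = sgn w" if eq: "snd v / fst v = snd w / fst w"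
  proof -
    have "w = (fst w / fst v) *\<^sub>R v" using assms eq by (simp add: prod_eq_iff field_simps)
    then show ?thesis using assms sgn_scaleR[of "fst w / fst v" v] by simp
  qed
qed

definition planar_curve :: "(real \<times> real) set" where
  "planar_curve = upper l (0, W) \<union> mirror ` upper l (0, W)"

lemma sgn_mirror: "sgn (mirror v) = mirror (sgn v)"
proof -
  have "norm (mirror v) = norm v" by (simp add: mirror_def norm_prod_def)
  then show ?thesis by (simp add: sgn_div_norm mirror_def)
qed

lemma mirror_mirror: "mirror (mirror v) = v" by (simp add: mirror_def)

lemma planar_curve_mirror: "v \<in> planar_curve \<Longrightarrow> mirror v \<in> planar_curve"
  by (auto simp: planar_curve_def mirror_mirror)

lemma planar_curve_nonneg: "v \<in> planar_curve \<Longrightarrow> 0 \<le> fst v \<Longrightarrow> v \<in> upper l (0, W)"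
proof -
  assume v: "v \<in> planar_curve" "0 \<le> fst v"
  show ?thesis
  proof (cases "v \<in> upper l (0, W)")
    case False
    then obtain w where w: "w \<in> upper l (0, W)" "v = mirror w" using v by (auto simp: planar_curve_def)
    then have "fst w = 0" using upper_nonneg[OF w(1)] v(2) by (simp add: mirror_def)
    then have "v = w" using w(2) by (simp add: mirror_def prod_eq_iff)
    then show ?thesis using w by simp
  qed
qed

text \<open>In the right half-plane directions correspond to slopes. On the axis only the tip below
  and the apex \<open>(0, W)\<close> above the centre are left, and the left half-plane is the
  mirror image.\<close>

lemma planar_curve_bij: "bij_betw sgn planar_curve (sphere 0 1)"
  unfolding bij_betw_def
proof
  have half: "v = w" if v: "v \<in> planar_curve" "0 \<le> fst v" and w: "w \<in> planar_curve" and eq: "sgn v = sgn w" for v w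
  proof -
    have "v \<noteq> 0" using upper_axis[OF planar_curve_nonneg[OF v]] z0_neg W by (auto simp: zero_prod_def)
    then have "w \<noteq> 0" using eq by (metis sgn_zero_iff)
    have fsgn: "fst (sgn x) = fst x / norm x" for x :: "real \<times> real" by (simp add: sgn_div_norm divide_inverse mult.commute)
    have f: "fst v / norm v = fst w / norm w" using eq fsgn[of v] fsgn[of w] by simp
    then have "0 \<le> fst w" using v(2) \<open>v \<noteq> 0\<close> \<open>w \<noteq> 0\<close> by (metis divide_nonneg_pos zero_le_divide_iff norm_ge_zero norm_eq_zero order_antisym)
    then have w': "w \<in> upper l (0, W)" and v': "v \<in> upper l (0, W)" using planar_curve_nonneg v w by auto
    show "v = w"
    proof (cases "fst v = 0")
      case True
      then have "fst w = 0" using f \<open>w \<noteq> 0\<close> by simp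
      have "snd v / norm v = snd w / norm w"
        using arg_cong[OF eq, of snd] by (simp add: sgn_div_norm divide_inverse mult.commute)
      then have "(0 < snd v) = (0 < snd w)" using \<open>v \<noteq> 0\<close> \<open>w \<noteq> 0\<close> by (metis zero_less_divide_iff norm_ge_zero not_less zero_less_norm_iff)
      then show ?thesis using upper_axis[OF v' True] upper_axis[OF w' \<open>fst w = 0\<close>] z0_neg W by auto
    next
      case False
      then have "0 < fst v" using v(2) by simp
      moreover have "0 < fst w" using f False \<open>v \<noteq> 0\<close> \<open>0 \<le> fst w\<close> by (cases "fst w = 0") auto
      ultimately show ?thesis using upper_slope_inj[OF v' _ w'] sgn_eq_iff_slope(1)[OF _ _ eq] by blast
    qed
  qed
  show "inj_on sgn planar_curve"
  proof (rule inj_onI)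
    fix v w assume v: "v \<in> planar_curve" and w: "w \<in> planar_curve" and eq: "sgn v = sgn w"
    show "v = w"
    proof (cases "0 \<le> fst v")
      case True
      then show ?thesis using half v w eq by blast
    next
      case False
      have "mirror v = mirror w"
        by (rule half) (use False v w eq planar_curve_mirror in \<open>auto simp: sgn_mirror\<close>, auto simp: mirror_def)
      then show ?thesis by (metis mirror_mirror)
    qed
  qed
  have pos: "u \<in> sgn ` planar_curve" if u: "norm u = 1" "0 \<le> fst u" for u
  proof (cases "fst u = 0")
    case True
    have "u = (0, snd u)" using True by (simp add: prod_eq_iff)
    moreover have "\<bar>snd u\<bar> = 1" using u(1) True by (simp add: norm_prod_def)
    ultimately consider "u = (0, 1)" | "u = (0, - 1)" by (metis abs_eq_iff' abs_of_nonneg zero_le_one)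
    then show ?thesis
    proof cases
      case 1
      have "sgn (0, W) = u" using W 1 by (simp add: sgn_div_norm norm_prod_def)
      then show ?thesis using upper_ends(2) unfolding planar_curve_def by (metis UnI1 imageI)
    next
      case 2
      have "sgn (0, 2 * z0) = u" using z0_neg 2 by (simp add: sgn_div_norm norm_prod_def real_sqrt_mult)
      then show ?thesis using upper_ends(1) unfolding planar_curve_def by (metis UnI1 imageI)
    qed
  next
    case False
    then have fu: "0 < fst u" using u by simp
    obtain v where v: "v \<in> upper l (0, W)" "0 < fst v" "snd v / fst v = snd u / fst u"
      using upper_slope_exists[of "snd u / fst u"] by blast
    have "sgn v = sgn u" by (rule sgn_eq_iff_slope(2)[OF v(2) fu v(3)])
    also have "\<dots> = u" using u(1) by (simp add: sgn_div_norm)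
    finally show ?thesis using v(1) unfolding planar_curve_def by (metis UnI1 imageI)
  qed
  show "sgn ` planar_curve = sphere 0 1"
  proof
    have "0 \<notin> planar_curve"
    proof
      assume "0 \<in> planar_curve"
      then show False using upper_axis[OF planar_curve_nonneg[of 0]] z0_neg W by (auto simp: zero_prod_def)
    qed
    then show "sgn ` planar_curve \<subseteq> sphere 0 1" by (auto simp: norm_sgn)
    show "sphere 0 1 \<subseteq> sgn ` planar_curve"
    proof
      fix u :: "real \<times> real" assume "u \<in> sphere 0 1"
      then have u: "norm u = 1" by simp
      show "u \<in> sgn ` planar_curve"
      proof (cases "0 \<le> fst u")
        case True
        then show ?thesis using pos u by blast
      next
        case False
        have "mirror u \<in> sgn ` planar_curve"
          by (rule pos) (use False u in \<open>auto simp: mirror_def norm_prod_def\<close>)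
        then obtain v where "v \<in> planar_curve" "mirror u = sgn v" by blast
        then have "mirror v \<in> planar_curve" "u = sgn (mirror v)"
          by (blast intro: planar_curve_mirror, metis mirror_mirror sgn_mirror)
        then show ?thesis by blast
      qed
    qed
  qed
qed

lemma planar_curve_compact: "compact planar_curve"
proof -
  have "{v. \<exists>s\<in>{0..l}. v = (X s, Y s + z0)} = (\<lambda>s. (X s, Y s + z0)) ` {0..l}" by auto
  then have "compact (upper l (0, W))"
    unfolding upper_def by (auto intro!: compact_Un compact_continuous_image continuous_intros X_continuous Y_continuous)
  moreover have "continuous_on A mirror" for A unfolding mirror_def[abs_def] by (intro continuous_intros)
  ultimately show ?thesis unfolding planar_curve_def by (intro compact_Un compact_continuous_image)
qed

text \<open>With \<open>r = - z0\<close> the tip is the lowest point and lies \<open>2 * r\<close>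
  below the centre, as the rounding construction demands.\<close>

lemma planar_curve_Hopf: "is_Hopf_link (emb (- z0) ` planar_curve) (rot ` emb (- z0) ` planar_curve)"
proof (rule Hopf_link_from_planar_curve[OF planar_curve_compact _ planar_curve_bij])
  show "0 < - z0" using z0_neg by simp
  show "0 \<notin> planar_curve"
  proof
    assume "0 \<in> planar_curve"
    then show False using upper_axis[OF planar_curve_nonneg[of 0]] z0_neg W by (auto simp: zero_prod_def)
  qed
  show "(0, - 2 * - z0) \<in> planar_curve" using upper_ends(1) by (simp add: planar_curve_def)
  have "2 * z0 \<le> snd v" if "v \<in> upper l (0, W)" for v
    using that
  proof (rule upper_cases)
    fix u assume u: "u \<in> {0..1}" "v = ((1 - u) * X l, (1 - u) * (Y l + z0) + u * W)"
    have "(1 - u) * (2 * z0) + u * (2 * z0) \<le> (1 - u) * (Y l + z0) + u * W"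
      using u above_tip[of l] z0_neg W by (intro add_mono mult_left_mono) auto
    then show ?thesis using u by (simp add: algebra_simps)
  qed (use above_tip in auto)
  note low = this
  fix v assume "v \<in> planar_curve"
  then consider "v \<in> upper l (0, W)" | w where "w \<in> upper l (0, W)" "v = mirror w"
    unfolding planar_curve_def by blast
  then show "- 2 * - z0 \<le> snd v" by cases (use low in \<open>simp_all add: mirror_def\<close>)
qed

end

end

section \<open>The clasp\<close>

lemma C1_family_flow:
  assumes "C1_family_of_C2_diffeos \<epsilon> \<phi> \<xi>"
  obtains D1 D2 V0 V1 V2 where "flow \<epsilon> \<phi> D1 D2 V0 V1 V2" "\<And>x. V0 (0, x) = \<xi> x"
proof -
  obtain D1 D2 V0 V1 V2 where *: "0 < \<epsilon>"
    "\<forall>t\<in>{-\<epsilon><..<\<epsilon>}. bij (\<phi> t) \<and> C2_with (\<phi> t) (D1 t) (D2 t) \<and> C2 (inv (\<phi> t))"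
    "\<forall>t\<in>{-\<epsilon><..<\<epsilon>}. \<forall>x. ((\<lambda>u. \<phi> u x) has_vector_derivative V0 (t, x)) (at t) \<and>
       ((\<lambda>u. D1 u x) has_vector_derivative V1 (t, x)) (at t) \<and> ((\<lambda>u. D2 u x) has_vector_derivative V2 (t, x)) (at t)"
    "continuous_on ({-\<epsilon><..<\<epsilon>} \<times> UNIV) V0" "continuous_on ({-\<epsilon><..<\<epsilon>} \<times> UNIV) V1" "continuous_on ({-\<epsilon><..<\<epsilon>} \<times> UNIV) V2"
    "\<forall>x. \<phi> 0 x = x \<and> V0 (0, x) = \<xi> x"
    using assms unfolding C1_family_of_C2_diffeos_def by (elim conjE exE)
  have t: "t \<in> {-\<epsilon><..<\<epsilon>}" if "\<bar>t\<bar> < \<epsilon>" for t using that by auto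
  have "flow \<epsilon> \<phi> D1 D2 V0 V1 V2"
    by unfold_locales (use * t in blast)+
  then show thesis using that *(7) by blast
qed

text \<open>The constant family, through which the formula for transported links yields the
  thickness of the link itself.\<close>

lemma flow_trivial: "flow 1 (\<lambda>t x. x) (\<lambda>t x. id_blinfun) (\<lambda>t x. 0) (\<lambda>p. 0) (\<lambda>p. 0) (\<lambda>p. 0)"
proof -
  have "C2_with (\<lambda>x. x) (\<lambda>x. id_blinfun) (\<lambda>x. 0)"
    unfolding C2_with_def by (auto intro!: derivative_eq_intros)
  moreover have "inv (\<lambda>x::real^3. x) = (\<lambda>x. x)" using inv_id by (simp add: id_def)
  ultimately show ?thesis
    by unfold_locales (auto simp: C2_def bij_def inj_def)
qed

lemma rot_linear: "rot ((1 - u) *\<^sub>R a + u *\<^sub>R b) = (1 - u) *\<^sub>R rot a + u *\<^sub>R rot b"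
  by (rule vec3_eqI) (simp_all add: rot_def algebra_simps)

lemma emb_affine: "emb r ((1 - u) *\<^sub>R a + u *\<^sub>R b) = (1 - u) *\<^sub>R emb r a + u *\<^sub>R emb r b"
  by (rule vec3_eqI) (simp_all add: emb_def algebra_simps)

lemma convex_clasp_face: "convex (clasp_face \<tau> h n)"
proof -
  have "clasp_face \<tau> h n = {p. n \<bullet> p = h} \<inter> (\<Inter>i\<in>{1, -1}. {p. conormal1 \<tau> i \<bullet> p \<le> h} \<inter> {p. conormal2 \<tau> i \<bullet> p \<le> h})"
    by (auto simp: clasp_face_def clasp_body_def)
  then show ?thesis by (auto intro!: convex_Int convex_INT convex_hyperplane convex_halfspace_le)
qed

lemma inner3: "(p :: real^3) \<bullet> q = p $ 1 * q $ 1 + p $ 2 * q $ 2 + p $ 3 * q $ 3"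
  by (simp add: inner_vec_def sum_3)

context clasp_curve begin

lemma curve_components: "curve 0 s = vector [X s, 0, Y s]" "curve 1 s = vector [0, X s, - Y s]"
  and tangent_components: "tangent 0 s = vector [cos (ang s), 0, sin (ang s)]" "tangent 1 s = vector [0, cos (ang s), - sin (ang s)]"
  by (rule vec3_eqI; simp add: curve_def tangent_def fa_def fb_def axis_def)+

lemma curve_rot: "curve 1 s = rot (curve 0 s)"
  by (rule vec3_eqI) (simp_all add: curve_components rot_def)

lemma curve_emb: "emb (- z0) (X s, Y s + z0) = curve 0 s"
  by (rule vec3_eqI) (simp_all add: curve_components emb_def)

lemma z0_gt: "- 1 < z0"
proof -
  have "(1 - \<sigma>) / C \<le> 1" using C_lower sigma_lower C_pos by (simp add: pos_divide_le_eq)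
  moreover have "2 * z0 = - \<sigma> - (1 - \<sigma>) / C" by (simp only: z0_def) simp
  ultimately show ?thesis using sigma1 by linarith
qed

text \<open>Every generator preserves \<open>L l\<close>. Conversely, the first reflection reaches
  the left half of the first component, and a quarter turn carries this component onto the
  second.\<close>

lemma sym_2star2_curve:
  assumes "0 < l"
  shows "sym_2star2 (curve 0 ` {0..l}) = L l"
proof
  let ?r1 = "\<lambda>p. vector [- p $ 1, p $ 2, p $ 3] :: real^3"
  let ?r2 = "\<lambda>p. vector [p $ 1, - p $ 2, p $ 3] :: real^3"
  let ?r3 = "\<lambda>p. vector [- p $ 2, p $ 1, - p $ 3] :: real^3"
  have refl0: "curve 0 (- s) = ?r1 (curve 0 s)" "curve 0 s = ?r2 (curve 0 s)" "curve 1 s = ?r3 (curve 0 s)" for s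
    by (rule vec3_eqI; simp add: curve_components X_minus Y_minus)+
  have refl1: "curve 1 s = ?r1 (curve 1 s)" "curve 1 (- s) = ?r2 (curve 1 s)" "curve 0 (- s) = ?r3 (curve 1 s)" for s
    by (rule vec3_eqI; simp add: curve_components X_minus Y_minus)+
  have mem: "curve 0 s \<in> L l" "curve 1 s \<in> L l" if "s \<in> {-l..l}" for s using that by (auto simp: L_def)
  have inv: "?r1 p \<in> L l" "?r2 p \<in> L l" "?r3 p \<in> L l" if p: "p \<in> L l" for p
  proof -
    obtain s where s: "s \<in> {-l..l}" "p = curve 0 s \<or> p = curve 1 s" using p by (auto simp: L_def)
    have ms: "- s \<in> {-l..l}" using s by auto
    show "?r1 p \<in> L l" using s(2) refl0(1)[of s] refl1(1)[of s] mem(1)[OF ms] mem(2)[OF s(1)] by metis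
    show "?r2 p \<in> L l" using s(2) refl0(2)[of s] refl1(2)[of s] mem(1)[OF s(1)] mem(2)[OF ms] by metis
    show "?r3 p \<in> L l" using s(2) refl0(3)[of s] refl1(3)[of s] mem(2)[OF s(1)] mem(1)[OF ms] by metis
  qed
  have "g p \<in> L l" if "g \<in> group_2star2" "p \<in> L l" for g p
    using that by (induction rule: group_2star2.induct) (simp_all add: inv)
  then show "sym_2star2 (curve 0 ` {0..l}) \<subseteq> L l"
    unfolding sym_2star2_def using mem(1) assms by auto
  show "L l \<subseteq> sym_2star2 (curve 0 ` {0..l})"
  proof
    fix p assume "p \<in> L l"
    then obtain s where s: "s \<in> {-l..l}" "p = curve 0 s \<or> p = curve 1 s" by (auto simp: L_def)
    note G = group_2star2.intros
    have half: "\<exists>g\<in>group_2star2. \<exists>u\<in>{0..l}. curve 0 s = g (curve 0 u)"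
    proof (cases "0 \<le> s")
      case True
      then show ?thesis using s G(1) by (intro bexI[of _ id] bexI[of _ s]) auto
    next
      case False
      then show ?thesis using s refl0(1)[of "- s"] G(2)[OF G(1)]
        by (intro bexI[of _ "?r1 \<circ> id"] bexI[of _ "- s"]) auto
    qed
    then obtain g u where g: "g \<in> group_2star2" "u \<in> {0..l}" "curve 0 s = g (curve 0 u)" by blast
    show "p \<in> sym_2star2 (curve 0 ` {0..l})"
      using s(2)
    proof
      assume "p = curve 0 s"
      then show ?thesis using g unfolding sym_2star2_def by blast
    next
      assume "p = curve 1 s"
      then have "p = (?r3 \<circ> g) (curve 0 u)" using refl0(3)[of s] g(3) by simp
      then show ?thesis using G(4)[OF g(1)] g(2) unfolding sym_2star2_def by blast
    qed
  qed
qed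

lemma transition_curve_curve:
  assumes l: "s3 < l" and h: "conormal1 \<tau> 1 \<bullet> curve 0 l = h"
  shows "transition_curve \<tau> \<sigma> h (curve 0) l z0 (vector [0, 0, - z0])"
  unfolding transition_curve_def
proof (intro conjI)
  have t: "continuous_on A (tangent 0)" for A
    unfolding tangent_def[abs_def] by (intro continuous_intros ang_continuous)
  have "C1_arclength (curve 0) {0..l} (tangent 0)"
    unfolding C1_arclength_def using tangent_unit[of 0] t
    by (auto intro: has_vector_derivative_at_within[OF curve_derivative])
  moreover have "convex_curve_xz (curve 0) {0..l} (tangent 0)"
    unfolding convex_curve_xz_def
  proof (intro ballI disjI1)
    fix s u
    show "0 \<le> vector [- tangent 0 s $ 3, 0, tangent 0 s $ 1] \<bullet> (curve 0 u - curve 0 s)"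
      using convex_tangent[of u s] by (simp add: inner3 tangent_components curve_components algebra_simps)
  qed
  moreover have "tangent 0 0 $ 3 = 0" by (simp add: tangent_components ang_0)
  ultimately show "\<exists>T. C1_arclength (curve 0) {0..l} T \<and> convex_curve_xz (curve 0) {0..l} T \<and> T 0 $ 3 = 0" by blast
  show "curve 0 0 = vector [0, 0, z0]" by (simp add: curve_components X0 Y0)
  show "\<forall>s\<in>{0..l}. curve 0 s $ 2 = 0 \<and> 0 \<le> curve 0 s $ 1 \<and> z0 \<le> curve 0 s $ 3"
    using X_nonneg above_tip by (simp add: curve_components)
  have arc1: "circular_arc (curve 0) 0 s1 (vector [0, 0, z0 + \<sigma>]) \<sigma> (arcsin (\<tau>/2))"
    unfolding circular_arc_def
  proof (intro conjI exI ballI)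
    show "s1 - 0 = \<sigma> * arcsin (\<tau>/2)" by (simp add: s1_def \<theta>1_def)
    show "norm (vector [0, 0, - 1] :: real^3) = 1" "norm (vector [1, 0, 0] :: real^3) = 1"
      "(vector [0, 0, - 1] :: real^3) \<bullet> vector [1, 0, 0] = 0" by (simp_all add: norm3_eq inner3)
    fix s assume "s \<in> {0..s1}"
    then have s: "s \<in> {-s1..s1}" using s123 by simp
    show "curve 0 s = vector [0, 0, z0 + \<sigma>] + \<sigma> *\<^sub>R (cos ((s - 0) / \<sigma>) *\<^sub>R vector [0, 0, - 1] + sin ((s - 0) / \<sigma>) *\<^sub>R vector [1, 0, 0])"
      by (rule vec3_eqI) (simp_all add: curve_components curve_arc[OF s])
  qed
  have unit1: "norm (vector [C, 0, \<tau>/2] :: real^3) = 1" using C_sq by (simp add: norm3_eq)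
  have seg: "straight_piece (curve 0) s1 s2"
    unfolding straight_piece_def
  proof (intro exI conjI ballI)
    show "norm (vector [C, 0, \<tau>/2] :: real^3) = 1" by (rule unit1)
    fix s assume s: "s \<in> {s1..s2}"
    have s1: "s1 \<in> {s1..s2}" using s123 by simp
    show "curve 0 s = curve 0 s1 + (s - s1) *\<^sub>R vector [C, 0, \<tau>/2]"
      unfolding curve_components curve_segment[OF s] curve_segment[OF s1] by (rule vec3_eqI) simp_all
  qed
  have arc2: "circular_arc (curve 0) s2 s3 (vector [0, 0, - z0]) 1 (arcsin \<tau> - arcsin (\<tau>/2))"
    unfolding circular_arc_def
  proof (intro conjI exI ballI)
    show "s3 - s2 = 1 * (arcsin \<tau> - arcsin (\<tau>/2))" by (simp add: s3_def \<theta>1_def \<theta>2_def)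
    have "(\<tau>/2)\<^sup>2 + C\<^sup>2 = 1" using C_sq by simp
    then show "norm (vector [\<tau>/2, 0, - C] :: real^3) = 1" by (simp add: norm3_eq)
    show "norm (vector [C, 0, \<tau>/2] :: real^3) = 1" by (rule unit1)
    show "(vector [\<tau>/2, 0, - C] :: real^3) \<bullet> vector [C, 0, \<tau>/2] = 0" by (simp add: inner3)
    fix s assume s: "s \<in> {s2..s3}"
    show "curve 0 s = vector [0, 0, - z0] + 1 *\<^sub>R (cos ((s - s2) / 1) *\<^sub>R vector [\<tau>/2, 0, - C] + sin ((s - s2) / 1) *\<^sub>R vector [C, 0, \<tau>/2])"
      unfolding curve_components curve_shoulder[OF s] ang_values(3)[OF s] sin_add cos_add sin1 cos1
      by (rule vec3_eqI) (simp_all add: algebra_simps)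
  qed
  have ray: "straight_piece (curve 0) s3 l"
    unfolding straight_piece_def
  proof (intro exI conjI ballI)
    show "norm (vector [cos \<theta>2, 0, \<tau>] :: real^3) = 1"
      using sin_cos_squared_add2[of \<theta>2] by (simp add: norm3_eq sin2)
    fix s assume "s \<in> {s3..l}"
    then have s: "s3 \<le> s" by simp
    show "curve 0 s = curve 0 s3 + (s - s3) *\<^sub>R vector [cos \<theta>2, 0, \<tau>]"
      unfolding curve_components curve_ray[OF s] curve_ray[OF order_refl] by (rule vec3_eqI) simp_all
  qed
  have "s2 - s1 = \<tau> * (1 - \<sigma>) / sqrt (4 - \<tau>\<^sup>2)" by (simp add: s2_def)
  then show "\<exists>s1 s2 s3 m1. circular_arc (curve 0) 0 s1 m1 \<sigma> (arcsin (\<tau> / 2)) \<and> straight_piece (curve 0) s1 s2 \<and>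
      s2 - s1 = \<tau> * (1 - \<sigma>) / sqrt (4 - \<tau>\<^sup>2) \<and> circular_arc (curve 0) s2 s3 (vector [0, 0, - z0]) 1 (arcsin \<tau> - arcsin (\<tau> / 2)) \<and>
      straight_piece (curve 0) s3 l \<and> s3 < l \<and> conormal1 \<tau> 1 \<bullet> curve 0 l = h"
    using arc1 seg arc2 ray l h by blast
qed

lemma planar_curve_link:
  assumes "0 < l" "0 < W"
  shows "emb (- z0) ` planar_curve l W = curve 0 ` {-l..l} \<union> closed_segment (curve 0 l) (vector [0, 0, W - z0]) \<union> closed_segment (vector [0, 0, W - z0]) (curve 0 (- l))"
proof -
  let ?p = "vector [0, 0, W - z0] :: real^3"
  have p: "emb (- z0) (0, W) = ?p" by (simp add: emb_def)
  have up: "upper l (0, W) = (\<lambda>s. (X s, Y s + z0)) ` {0..l} \<union> closed_segment (X l, Y l + z0) (0, W)"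
    by (auto simp: upper_def)
  have 1: "emb (- z0) ` upper l (0, W) = curve 0 ` {0..l} \<union> closed_segment (curve 0 l) ?p"
    unfolding up image_Un image_image curve_emb closed_segment_image_eq[OF emb_affine] p by simp
  have m: "emb (- z0) (mirror (X s, Y s + z0)) = curve 0 (- s)" for s
    by (rule vec3_eqI) (simp_all add: curve_components emb_def mirror_def X_minus Y_minus)
  have mp: "emb (- z0) (mirror (0, W)) = ?p" by (simp add: emb_def mirror_def)
  have ma: "emb (- z0) (mirror ((1 - u) *\<^sub>R a + u *\<^sub>R b)) = (1 - u) *\<^sub>R emb (- z0) (mirror a) + u *\<^sub>R emb (- z0) (mirror b)" for u a b
    by (rule vec3_eqI) (simp_all add: emb_def mirror_def algebra_simps)
  have 2: "emb (- z0) ` mirror ` upper l (0, W) = (\<lambda>s. curve 0 (- s)) ` {0..l} \<union> closed_segment (curve 0 (- l)) ?p"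
    unfolding up image_Un image_image m closed_segment_image_eq[where f="\<lambda>v. emb (- z0) (mirror v)", OF ma] mp by simp
  have "(\<lambda>s. curve 0 (- s)) ` {0..l} = curve 0 ` {-l..0}"
  proof -
    have "uminus ` {0..l} = {-l..0}" by simp
    then show ?thesis by (metis (no_types, lifting) image_cong image_image)
  qed
  moreover have "{-l..l} = {0..l} \<union> {-l..0}" using assms by auto
  ultimately show ?thesis
    unfolding planar_curve_def[OF assms] image_Un 1 2 by (simp add: image_Un closed_segment_commute Un_ac)
qed

end

section \<open>End conditions, linking and criticality\<close>

context clasp_curve begin

text \<open>The direction of the ray is the unit normal of its plane, so the distance to the plane
  shrinks at unit speed and \<open>l\<close> solves a linear equation. From
  \<open>h \<ge> 10\<close> and \<open>z0 > -1\<close> the ray has length at least 9, whence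
  \<open>X l \<ge> \<tau> + 9 * (1 - \<tau>) \<ge> 1\<close>.\<close>

lemma link_exists:
  assumes h: "10 \<le> h"
  defines "l \<equiv> s3 + h + \<tau> * z0"
  shows "s3 + 9 \<le> l" "1/2 < X l" "sqrt (1 - \<tau>\<^sup>2) * X l + \<tau> * Y l = h"
proof -
  have "\<tau> * z0 \<ge> 1 * z0" using tau z0_neg by (intro mult_right_mono_neg) auto
  then show l: "s3 + 9 \<le> l" using z0_gt h by (simp add: l_def)
  then have ls: "s3 \<le> l" by simp
  have "(1 - \<tau>)\<^sup>2 \<le> 1 - \<tau>\<^sup>2" using tau mult_left_le[of \<tau> \<tau>] by (simp add: power2_eq_square algebra_simps)
  then have "1 - \<tau> \<le> cos \<theta>2" unfolding cos2 by (rule real_le_rsqrt)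
  then have "9 * (1 - \<tau>) \<le> (l - s3) * cos \<theta>2" using l tau by (intro mult_mono) auto
  then show "1/2 < X l" unfolding curve_ray[OF ls] using tau by simp
  have "sqrt (1 - \<tau>\<^sup>2) * X l + \<tau> * Y l = (l - s3) * (\<tau>\<^sup>2 + (cos \<theta>2)\<^sup>2) - \<tau> * z0"
    unfolding curve_ray[OF ls] cos2[symmetric] by (simp add: power2_eq_square algebra_simps)
  also have "\<tau>\<^sup>2 + (cos \<theta>2)\<^sup>2 = 1" using sin_cos_squared_add[of \<theta>2] by (simp add: sin2)
  finally show "sqrt (1 - \<tau>\<^sup>2) * X l + \<tau> * Y l = h" by (simp add: l_def)
qed

context
  fixes h l :: real
  assumes h: "10 \<le> h" and l: "s3 + 9 \<le> l" and Xl: "1/2 < X l" and end_plane: "sqrt (1 - \<tau>\<^sup>2) * X l + \<tau> * Y l = h"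
begin

lemma conormal_ends:
  "conormal1 \<tau> 1 \<bullet> curve 0 l = h" "conormal1 \<tau> (-1) \<bullet> curve 0 (- l) = h"
  "conormal2 \<tau> 1 \<bullet> curve 1 l = h" "conormal2 \<tau> (-1) \<bullet> curve 1 (- l) = h"
  using end_plane by (simp_all add: inner3 conormal1_def conormal2_def curve_components X_minus Y_minus)

text \<open>The rays meet their planes orthogonally; this makes the boundary terms of the length
  variation vanish for every \<open>\<xi>\<close> tangent to the planes at the end points.\<close>

lemma tangent_ends:
  "tangent 0 l = conormal1 \<tau> 1" "tangent 0 (- l) = - conormal1 \<tau> (-1)"
  "tangent 1 l = conormal2 \<tau> 1" "tangent 1 (- l) = - conormal2 \<tau> (-1)"
  using l by (auto intro!: vec3_eqI simp: tangent_components conormal1_def conormal2_def ang_minus ang_values(4) sin2 cos2)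

lemma body_ends: "curve j l \<in> clasp_body \<tau> h" "curve j (- l) \<in> clasp_body \<tau> h" if "j \<in> {0, 1}" for j
proof -
  have "0 \<le> sqrt (1 - \<tau>\<^sup>2) * X l" using Xl tau2 by (intro mult_nonneg_nonneg) auto
  moreover have "- (\<tau> * Y l) \<le> h"
  proof -
    have "\<tau> * Y l \<ge> \<tau> * z0" using above_tip[of l] tau by (intro mult_left_mono) auto
    moreover have "\<tau> * z0 \<ge> 1 * z0" using tau z0_neg by (intro mult_right_mono_neg) auto
    ultimately show ?thesis using z0_gt h by simp
  qed
  ultimately have e: "sqrt (1 - \<tau>\<^sup>2) * X l + \<tau> * Y l \<le> h" "- (sqrt (1 - \<tau>\<^sup>2) * X l) + \<tau> * Y l \<le> h" "- (\<tau> * Y l) \<le> h"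
    using end_plane by auto
  show "curve j l \<in> clasp_body \<tau> h" "curve j (- l) \<in> clasp_body \<tau> h"
    using that e by (auto simp: clasp_body_def inner3 conormal1_def conormal2_def curve_components X_minus Y_minus)
qed

text \<open>The closing segments of the first arc meet at the point
  \<open>(0, 0, h / \<tau>)\<close> on the common edge of its faces, which has height
  \<open>W = h / \<tau> + z0\<close> over the opposite tip. Faces are convex, so only the ends of
  the segments have to be checked.\<close>

lemma hooked_link: "hooked \<tau> h (\<lambda>s. curve 0 (s - l)) (2 * l) (\<lambda>s. curve 1 (s - l)) (2 * l)"
proof -
  have l0: "0 < l" using l s123 by linarith
  let ?p = "vector [0, 0, h / \<tau>] :: real^3" and ?q = "vector [0, 0, - (h / \<tau>)] :: real^3"
  have face: "closed_segment a b \<subseteq> clasp_face \<tau> h n" if "a \<in> clasp_face \<tau> h n" "b \<in> clasp_face \<tau> h n" for a b n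
    using that convex_clasp_face by (simp add: closed_segment_subset)
  have pq: "?p \<in> clasp_face \<tau> h (conormal1 \<tau> i)" "?q \<in> clasp_face \<tau> h (conormal2 \<tau> i)" for i
    using tau h by (auto simp: clasp_face_def clasp_body_def inner3 conormal1_def conormal2_def)
  have ends: "curve 0 l \<in> clasp_face \<tau> h (conormal1 \<tau> 1)" "curve 0 (- l) \<in> clasp_face \<tau> h (conormal1 \<tau> (-1))"
    "curve 1 l \<in> clasp_face \<tau> h (conormal2 \<tau> 1)" "curve 1 (- l) \<in> clasp_face \<tau> h (conormal2 \<tau> (-1))"
    using conormal_ends body_ends by (simp_all add: clasp_face_def)
  define W where "W = h / \<tau> + z0"
  have "h * \<tau> \<le> h * 1" using tau h by (intro mult_left_mono) auto
  then have "h \<le> h / \<tau>" using tau by (simp add: pos_le_divide_eq)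
  then have W: "0 < W" using z0_gt h by (simp add: W_def)
  have im: "(\<lambda>s. curve j (s - l)) ` {0..2 * l} = curve j ` {-l..l}" for j
  proof -
    have "(\<lambda>s. s - l) ` {0..2*l} = {-l..l}" by (simp add: image_minus_const_atLeastAtMost')
    then show ?thesis by (metis image_image)
  qed
  have A: "emb (- z0) ` planar_curve l W = curve 0 ` {-l..l} \<union> closed_segment (curve 0 l) ?p \<union> closed_segment ?p (curve 0 (- l))"
    using planar_curve_link[OF l0 W] by (simp add: W_def)
  have "rot ?p = ?q" by (rule vec3_eqI) (simp_all add: rot_def)
  then have B: "rot ` emb (- z0) ` planar_curve l W = curve 1 ` {-l..l} \<union> closed_segment (curve 1 l) ?q \<union> closed_segment ?q (curve 1 (- l))"
    unfolding A image_Un closed_segment_image_eq[OF rot_linear] image_image curve_rot[symmetric] by simp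
  show ?thesis
    unfolding hooked_def
  proof (intro exI conjI)
    show "is_Hopf_link ((\<lambda>s. curve 0 (s - l)) ` {0..2 * l} \<union> closed_segment (curve 0 (2 * l - l)) ?p \<union> closed_segment ?p (curve 0 (0 - l)))
      ((\<lambda>s. curve 1 (s - l)) ` {0..2 * l} \<union> closed_segment (curve 1 (2 * l - l)) ?q \<union> closed_segment ?q (curve 1 (0 - l)))"
      using planar_curve_Hopf[OF l0 W] unfolding B unfolding A im by simp
  qed (simp_all add: face pq ends)
qed

lemma clasp_link_curves: "clasp_link \<tau> h (\<lambda>s. curve 0 (s - l)) (2 * l) (\<lambda>s. curve 1 (s - l)) (2 * l)"
  unfolding clasp_link_def
proof (intro conjI)
  have l0: "0 < l" using l s123 by linarith
  have arc: "C11_arc (\<lambda>s. curve j (s - l)) (2 * l)" if j: "j \<in> {0, 1}" for j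
    unfolding C11_arc_def
  proof (intro conjI exI)
    show "0 < 2 * l" using l0 by simp
    show "inj_on (\<lambda>s. curve j (s - l)) {0..2 * l}"
    proof (rule inj_onI)
      fix x y assume "curve j (x - l) = curve j (y - l)"
      then have "x - l = y - l" by (rule inj_onD[OF curve_inj_on[OF j, of UNIV]]) auto
      then show "x = y" by simp
    qed
    show "C11_arclength (\<lambda>s. curve j (s - l)) {0..2 * l} (\<lambda>s. tangent j (s - l))"
      unfolding C11_arclength_def C1_arclength_def
    proof (intro conjI ballI exI)
      fix s
      have "((\<lambda>s. s - l) has_vector_derivative 1) (at s within {0..2*l})" by (auto intro!: derivative_eq_intros)
      from vector_diff_chain_within[OF this has_vector_derivative_at_within[OF curve_derivative]]
      show "((\<lambda>s. curve j (s - l)) has_vector_derivative tangent j (s - l)) (at s within {0..2 * l})" by (simp add: o_def)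
      show "norm (tangent j (s - l)) = 1" by (rule tangent_unit[OF j])
    next
      have "continuous_on UNIV (tangent j)" unfolding tangent_def[abs_def] by (intro continuous_intros ang_continuous)
      then show "continuous_on {0..2 * l} (\<lambda>s. tangent j (s - l))"
        by (rule continuous_on_compose2) (auto intro!: continuous_intros)
      show "(117/100)-lipschitz_on {0..2 * l} (\<lambda>s. tangent j (s - l))"
      proof (rule lipschitz_onI)
        show "dist (tangent j (x - l)) (tangent j (y - l)) \<le> (117/100) * dist x y" for x y
          using tangent_lipschitz[OF j, of "x - l" "y - l"] by (simp add: dist_norm)
      qed simp
    qed
  qed
  show "C11_arc (\<lambda>s. curve 0 (s - l)) (2 * l)" "C11_arc (\<lambda>s. curve 1 (s - l)) (2 * l)" by (simp_all add: arc)
  have "curve 0 s \<noteq> curve 1 u" for s u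
    using dist_curves[of s u] dist2_ge_1[of s u] by auto
  then show "(\<lambda>s. curve 0 (s - l)) ` {0..2 * l} \<inter> (\<lambda>s. curve 1 (s - l)) ` {0..2 * l} = {}" by blast
qed (use conormal_ends hooked_link in simp_all)

text \<open>Otherwise no strut shortens and no kink tightens to first order, and
  \<open>len_variation_nonneg\<close> contradicts \<open>len\<close>. \<open>opt k x\<close>
  describes a decisive strut and a decisive kink; \<open>?d k x\<close> has the same value for all
  such pairs, so it does not depend on the family.\<close>

lemma thickness_decreases:
  assumes C2: "C2_with \<xi> \<xi>' \<xi>''"
    and bdry: "conormal1 \<tau> (-1) \<bullet> \<xi> (curve 0 (- l)) = 0" "conormal1 \<tau> 1 \<bullet> \<xi> (curve 0 l) = 0"
      "conormal2 \<tau> (-1) \<bullet> \<xi> (curve 1 (- l)) = 0" "conormal2 \<tau> 1 \<bullet> \<xi> (curve 1 l) = 0"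
    and len: "len_variation (\<lambda>s. curve 0 (s - l)) (2 * l) \<xi> + len_variation (\<lambda>s. curve 1 (s - l)) (2 * l) \<xi> < 0"
  shows "\<exists>d<0. has_Thi_variation \<sigma> (L l) \<xi> d"
proof -
  have sl: "s3 < l" using l by simp
  let ?rect = "{-l..l} \<times> {-l..l}"
  define opt where "opt k x \<longleftrightarrow> k \<in> ?rect \<and> dist2 (fst k) (snd k) = 1 \<and> x \<in> kinks l \<and> curv x = 1 / \<sigma> \<and>
    (\<forall>k'\<in>?rect. dist2 (fst k') (snd k') = 1 \<longrightarrow> strut_dot \<xi> k \<le> strut_dot \<xi> k') \<and>
    (\<forall>x'\<in>kinks l. curv x' = 1 / \<sigma> \<longrightarrow> kink_dot \<xi>' \<xi>'' x' \<le> kink_dot \<xi>' \<xi>'' x)" for k x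
  let ?d = "\<lambda>k x. min (strut_dot \<xi> k / 2) (- (\<sigma>\<^sup>2 / 2) * kink_dot \<xi>' \<xi>'' x)"
  have deriv: "\<exists>k x. opt k x \<and> ((\<lambda>t. real_of_ereal (Thi \<sigma> (\<phi> t ` L l))) has_real_derivative ?d k x) (at_right 0)"
    if fam: "C1_family_of_C2_diffeos \<epsilon> \<phi> \<xi>" for \<epsilon> \<phi>
  proof -
    obtain D1 D2 V0 V1 V2 where fl: "flow \<epsilon> \<phi> D1 D2 V0 V1 V2" and V0: "\<And>x. V0 (0, x) = \<xi> x"
      by (rule C1_family_flow[OF fam], rule that)
    interpret cf: clasp_flow \<tau> \<sigma> \<epsilon> \<phi> D1 D2 V0 V1 V2 l
      by (intro clasp_flow.intro clasp_flow_axioms.intro clasp_curve_axioms fl sl Xl)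
    show ?thesis
      using cf.Thi_derivative[OF V0 cf.velocity_derivatives[OF C2 V0]] unfolding opt_def by metis
  qed
  have same: "?d k x = ?d k' x'" if "opt k x" "opt k' x'" for k x k' x'
  proof -
    have "strut_dot \<xi> k = strut_dot \<xi> k'" "kink_dot \<xi>' \<xi>'' x = kink_dot \<xi>' \<xi>'' x'"
      using that unfolding opt_def by (auto intro!: antisym)
    then show ?thesis by simp
  qed
  have neg: "?d k x < 0" if opt: "opt k x" for k x
  proof (rule ccontr)
    assume "\<not> ?d k x < 0"
    then have ge: "0 \<le> strut_dot \<xi> k" "0 \<le> - (\<sigma>\<^sup>2 / 2) * kink_dot \<xi>' \<xi>'' x" by auto
    have st: "0 \<le> strut_dot \<xi> k'" if "k' \<in> ?rect" "dist2 (fst k') (snd k') = 1" for k'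
      using opt ge(1) that unfolding opt_def by force
    have "kink_dot \<xi>' \<xi>'' x \<le> 0" using ge(2) sigma_pos by (simp add: mult_le_0_iff)
    then have kk: "kink_dot \<xi>' \<xi>'' x' \<le> 0" if "x' \<in> kinks l" "curv x' = 1 / \<sigma>" for x'
      using opt that unfolding opt_def by force
    have "0 \<le> len_variation (\<lambda>s. curve 0 (s - l)) (2 * l) \<xi> + len_variation (\<lambda>s. curve 1 (s - l)) (2 * l) \<xi>"
    proof (rule len_variation_nonneg[OF C2 sl])
      fix j s :: real assume j: "j \<in> {0, 1}" and s: "s \<in> {s2..s3} \<or> s \<in> {-s3..-s2}"
      note sh = shoulder_normal[OF s]
      have sr: "s \<in> {-l..l}" "0 \<in> {-l..l}" using s sl s123 by auto
      have "0 \<le> (curve j s - curve (1 - j) 0) \<bullet> (\<xi> (curve j s) - \<xi> (curve (1 - j) 0))"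
      proof (cases "j = 0")
        case True
        then show ?thesis using st[of "(s, 0)"] sh(2) sr by (simp add: strut_dot_def)
      next
        case False
        then have "j = 1" using j by simp
        moreover have "dist2 0 s = 1" using sh(2) dist2_commute by simp
        ultimately show ?thesis using st[of "(0, s)"] sr
          by (simp add: strut_dot_def) (metis inner_minus_left inner_minus_right minus_diff_eq minus_minus)
      qed
      then have "0 \<le> - (normal j s \<bullet> (\<xi> (curve j s) - \<xi> (curve (1 - j) 0)))" unfolding sh(1) by simp
      also have "\<dots> = (\<xi> (curve (1 - j) 0) - \<xi> (curve j s)) \<bullet> normal j s"
        by (simp add: inner_diff_left inner_diff_right inner_commute)
      finally show "0 \<le> (\<xi> (curve (1 - j) 0) - \<xi> (curve j s)) \<bullet> normal j s" .
    next
      fix j s :: real assume j: "j \<in> {0, 1}" and s: "s \<in> {-s1..s1}"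
      have "(j, (- s1, s1, 1/\<sigma>), s) \<in> kinks l" using j s by (auto simp: kinks_iff pieces_def)
      from kk[OF this] have "kink_dot \<xi>' \<xi>'' (j, (- s1, s1, 1/\<sigma>), s) \<le> 0" by (simp add: curv_par)
      moreover have "kink_dot \<xi>' \<xi>'' (j, (- s1, s1, 1/\<sigma>), s) =
          2 * (1/\<sigma>) * (eta2 \<xi>' \<xi>'' (1/\<sigma>) j s \<bullet> normal j s - 2 * (1/\<sigma>) * (eta \<xi>' j s \<bullet> tangent j s))"
        unfolding kink_dot_def Let_def eta_def[OF C2 sl] eta2_def[OF C2 sl] fst_conv curv_par
        by (simp only: inner_commute[of "normal j s"] inner_commute[of "tangent j s"])
      ultimately show "eta2 \<xi>' \<xi>'' (1/\<sigma>) j s \<bullet> normal j s - 2 * (1/\<sigma>) * (eta \<xi>' j s \<bullet> tangent j s) \<le> 0"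
        using sigma_pos by (simp add: divide_le_0_iff mult_le_0_iff)
    next
      fix j :: real assume "j \<in> {0, 1}"
      then show "\<xi> (curve j l) \<bullet> tangent j l = 0" "\<xi> (curve j (- l)) \<bullet> tangent j (- l) = 0"
        using bdry tangent_ends by (auto simp: inner_commute)
    qed
    then show False using len by simp
  qed
  show ?thesis
  proof (cases "\<exists>\<epsilon> \<phi>. C1_family_of_C2_diffeos \<epsilon> \<phi> \<xi>")
    case True
    then obtain k x where opt: "opt k x" using deriv by blast
    have "has_Thi_variation \<sigma> (L l) \<xi> (?d k x)"
      unfolding has_Thi_variation_def
    proof (intro allI impI)
      fix \<epsilon> \<phi> assume "C1_family_of_C2_diffeos \<epsilon> \<phi> \<xi>"
      from deriv[OF this] obtain k' x' where "opt k' x'"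
        and d: "((\<lambda>t. real_of_ereal (Thi \<sigma> (\<phi> t ` L l))) has_real_derivative ?d k' x') (at_right 0)" by blast
      then show "((\<lambda>t. real_of_ereal (Thi \<sigma> (\<phi> t ` L l))) has_real_derivative ?d k x) (at_right 0)"
        using same[OF opt, of k' x'] by simp
    qed
    then show ?thesis using neg[OF opt] by blast
  next
    case False
    \<comment> \<open>If no family has velocity \<open>\<xi>\<close>, every number satisfies
      \<open>has_Thi_variation\<close> vacuously.\<close>
    then have "has_Thi_variation \<sigma> (L l) \<xi> (- 1)" unfolding has_Thi_variation_def by blast
    then show ?thesis by (intro exI[of _ "- 1"]) simp
  qed
qed

lemma clasp_critical_link: "clasp_critical \<tau> \<sigma> h (L l)"
  unfolding clasp_critical_def
proof (rule exI[of _ "\<lambda>s. curve 0 (s - l)"], rule exI[of _ "2 * l"], rule exI[of _ "\<lambda>s. curve 1 (s - l)"], rule exI[of _ "2 * l"], intro conjI allI impI)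
  have l0: "0 < l" using l s123 by linarith
  have im: "(\<lambda>s. curve j (s - l)) ` {0..2 * l} = curve j ` {-l..l}" for j
  proof -
    have "(\<lambda>s. s - l) ` {0..2*l} = {-l..l}" by (simp add: image_minus_const_atLeastAtMost')
    then show ?thesis by (metis image_image)
  qed
  show "L l = (\<lambda>s. curve 0 (s - l)) ` {0..2 * l} \<union> (\<lambda>s. curve 1 (s - l)) ` {0..2 * l}"
    unfolding im L_def ..
  show "clasp_link \<tau> h (\<lambda>s. curve 0 (s - l)) (2 * l) (\<lambda>s. curve 1 (s - l)) (2 * l)" by (rule clasp_link_curves)
  show "Thi \<sigma> (L l) = 1"
  proof -
    interpret cf: clasp_flow \<tau> \<sigma> 1 "\<lambda>t x. x" "\<lambda>t x. id_blinfun" "\<lambda>t x. 0" "\<lambda>p. 0" "\<lambda>p. 0" "\<lambda>p. 0" l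
      using l by (intro clasp_flow.intro clasp_flow_axioms.intro clasp_curve_axioms flow_trivial Xl) simp
    show ?thesis by (rule cf.Thi_0)
  qed
  fix \<xi> :: "real^3 \<Rightarrow> real^3"
  assume A: "C2 \<xi> \<and> conormal1 \<tau> (- 1) \<bullet> \<xi> (curve 0 (0 - l)) = 0 \<and> conormal1 \<tau> 1 \<bullet> \<xi> (curve 0 (2 * l - l)) = 0 \<and>
       conormal2 \<tau> (- 1) \<bullet> \<xi> (curve 1 (0 - l)) = 0 \<and> conormal2 \<tau> 1 \<bullet> \<xi> (curve 1 (2 * l - l)) = 0 \<and>
       len_variation (\<lambda>s. curve 0 (s - l)) (2 * l) \<xi> + len_variation (\<lambda>s. curve 1 (s - l)) (2 * l) \<xi> < 0"
  then obtain \<xi>' \<xi>'' where "C2_with \<xi> \<xi>' \<xi>''" unfolding C2_def by blast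
  then show "\<exists>d<0. has_Thi_variation \<sigma> (L l) \<xi> d"
    by (rule thickness_decreases) (use A in simp_all)
qed

end

end

theorem proposition7p6:
  shows "\<exists>h0::real. \<forall>\<tau> \<sigma> h :: real.
           0 < \<tau> \<and> \<tau> \<le> 1 \<and> 1 > \<sigma> \<and>
           \<sigma> \<ge> (sqrt (4 + \<tau>\<^sup>2) - 2) / (2 - sqrt (4 - \<tau>\<^sup>2)) \<and> h \<ge> h0 \<longrightarrow>
           (\<exists>c l z0. transition_curve \<tau> \<sigma> h c l z0 (vector [0, 0, - z0]) \<and>
                     clasp_critical \<tau> \<sigma> h (sym_2star2 (c ` {0..l})))"
\<comment> \<open>The threshold 10 comes from \<open>link_exists\<close> and is uniform in \<tau>
  and \<sigma>.\<close>
proof (intro exI[of _ 10] allI impI)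
  fix \<tau> \<sigma> h :: real
  assume A: "0 < \<tau> \<and> \<tau> \<le> 1 \<and> 1 > \<sigma> \<and> \<sigma> \<ge> (sqrt (4 + \<tau>\<^sup>2) - 2) / (2 - sqrt (4 - \<tau>\<^sup>2)) \<and> h \<ge> 10"
  interpret clasp_curve \<tau> \<sigma> by unfold_locales (use A in auto)
  define l where "l = s3 + h + \<tau> * z0"
  have h: "10 \<le> h" using A by simp
  note le = link_exists[OF h, folded l_def]
  have l0: "0 < l" "s3 < l" using le(1) s123 by linarith+
  have "transition_curve \<tau> \<sigma> h (curve 0) l z0 (vector [0, 0, - z0])"
    by (rule transition_curve_curve[OF l0(2) conormal_ends(1)[OF h le]])
  moreover have "clasp_critical \<tau> \<sigma> h (sym_2star2 (curve 0 ` {0..l}))"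
    unfolding sym_2star2_curve[OF l0(1)] by (rule clasp_critical_link[OF h le])
  ultimately show "\<exists>c l z0. transition_curve \<tau> \<sigma> h c l z0 (vector [0, 0, - z0]) \<and>
      clasp_critical \<tau> \<sigma> h (sym_2star2 (c ` {0..l}))" by blast
qed

end
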